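(* Let $B$ be a pointed Poisson Hopf algebra over $k$. Then the $\mathcal H(B)$-extension $B\subset B^e$ is (right) Galois; that is, the map $$\beta:B^e\otimes_BB^e\to B^e\otimes\mathcal H(B),\qquad x\otimes y\mapsto(x\otimes1)\lambda(y),$$ is bijective, where $\lambda:B^e\to B^e\otimes\mathcal H(B)$ is the right $\mathcal H(B)$-comodule structure map of $B^e$.
   Context: $k$ is a field. A Poisson algebra is a commutative $k$-algebra with a Lie bracket $\{\cdot,\cdot\}$ such that $\{a,bc\}=\{a,b\}c+b\{a,c\}$; the tensor square $A\otimes A$ of a Poisson algebra is Poisson with $\{a\otimes b,c\otimes d\}=ac\otimes\{b,d\}+\{a,c\}\otimes bd$. A Poisson Hopf algebra is a commutative Hopf algebra $B$ with a Poisson bracket such that $\Delta(\{a,b\})=\{\Delta(a),\Delta(b)\}$; it is pointed if it is pointed as a coalgebra (its coradical is spanned by group-like elements). Universal enveloping algebra: $B^e$ is the associative unital $k$-algebra generated by two copies $\{m_a:a\in B\}$ and $\{h_a:a\in B\}$ of the vector space $B$ (linear in $a$) subject to, for all $x,y\in B$, $$m_{xy}=m_xm_y,\quad h_{\{x,y\}}=h_xh_y-h_yh_x,\quad h_{xy}=m_yh_x+m_xh_y,\quad m_{\{x,y\}}=h_xm_y-m_yh_x,\quad m_1=1.$$ $B^e$ is a Hopf algebra with $\Delta(m_b)=m_{b_1}\otimes m_{b_2}$, $\epsilon(m_b)=\epsilon(b)$, $\Delta(h_b)=m_{b_1}\otimes h_{b_2}+h_{b_1}\otimes m_{b_2}$,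 $\epsilon(h_b)=0$ (Sweedler notation). The map $b\mapsto m_b$ is injective and identifies $B$ with a Hopf subalgebra of $B^e$. With $B^+=\ker\epsilon|_B$, one has $B^eB^+=B^+B^e$, a Hopf ideal of $B^e$, and $\mathcal H(B):=B^e/B^eB^+$, with projection $\pi:B^e\to\mathcal H(B)$. The comodule structure map is $\lambda=(\mathrm{id}\otimes\pi)\Delta$, and the coinvariants of $B^e$ are $B$, so $B\subset B^e$ is an $\mathcal H(B)$-extension. *)

theory Defs
  imports "HOL-Algebra.Module" "HOL-Algebra.QuotRing" "HOL-Algebra.Free_Abelian_Groups"
begin

section \<open>Tensor products\<close>

text \<open>Elements of a tensor product of \<open>M\<close> and \<open>N\<close> are cosets in the free abelian group
  on \<open>carrier M \<times> carrier N\<close>.\<close>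

type_synonym ('m, 'n) tensor = "(('m \<times> 'n) \<Rightarrow>\<^sub>0 int) set"

text \<open>A right action \<open>ra\<close> on \<open>M\<close> and a left action \<open>la\<close> on \<open>N\<close> of the set of scalars \<open>S\<close>
  are given; the balancing relation is \<open>(x s) \<otimes> y = x \<otimes> (s y)\<close>.\<close>

definition tensor_relators ::
  "'r set \<Rightarrow> ('m \<Rightarrow> 'r \<Rightarrow> 'm) \<Rightarrow> ('r \<Rightarrow> 'n \<Rightarrow> 'n) \<Rightarrow> ('m, 'x) ring_scheme \<Rightarrow> ('n, 'y) ring_scheme
    \<Rightarrow> (('m \<times> 'n) \<Rightarrow>\<^sub>0 int) set"
  where "tensor_relators S ra la M N =
    {frag_of (x \<oplus>\<^bsub>M\<^esub> x', y) - frag_of (x, y) - frag_of (x', y) | x x' y.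
       x \<in> carrier M \<and> x' \<in> carrier M \<and> y \<in> carrier N} \<union>
    {frag_of (x, y \<oplus>\<^bsub>N\<^esub> y') - frag_of (x, y) - frag_of (x, y') | x y y'.
       x \<in> carrier M \<and> y \<in> carrier N \<and> y' \<in> carrier N} \<union>
    {frag_of (ra x s, y) - frag_of (x, la s y) | x s y.
       x \<in> carrier M \<and> s \<in> S \<and> y \<in> carrier N}"

definition tensor_kernel ::
  "'r set \<Rightarrow> ('m \<Rightarrow> 'r \<Rightarrow> 'm) \<Rightarrow> ('r \<Rightarrow> 'n \<Rightarrow> 'n) \<Rightarrow> ('m, 'x) ring_scheme \<Rightarrow> ('n, 'y) ring_scheme
    \<Rightarrow> (('m \<times> 'n) \<Rightarrow>\<^sub>0 int) set"
  where "tensor_kernel S ra la M N =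
    generate (free_Abelian_group (carrier M \<times> carrier N)) (tensor_relators S ra la M N)"

definition tensor_group ::
  "'r set \<Rightarrow> ('m \<Rightarrow> 'r \<Rightarrow> 'm) \<Rightarrow> ('r \<Rightarrow> 'n \<Rightarrow> 'n) \<Rightarrow> ('m, 'x) ring_scheme \<Rightarrow> ('n, 'y) ring_scheme
    \<Rightarrow> ('m, 'n) tensor monoid"
  where "tensor_group S ra la M N =
    free_Abelian_group (carrier M \<times> carrier N) Mod tensor_kernel S ra la M N"

definition pure_tensor ::
  "'r set \<Rightarrow> ('m \<Rightarrow> 'r \<Rightarrow> 'm) \<Rightarrow> ('r \<Rightarrow> 'n \<Rightarrow> 'n) \<Rightarrow> ('m, 'x) ring_scheme \<Rightarrow> ('n, 'y) ring_scheme
    \<Rightarrow> 'm \<Rightarrow> 'n \<Rightarrow> ('m, 'n) tensor"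
  where "pure_tensor S ra la M N x y =
    tensor_kernel S ra la M N #>\<^bsub>free_Abelian_group (carrier M \<times> carrier N)\<^esub> frag_of (x, y)"

text \<open>The group homomorphism induced by a balanced map \<open>f\<close>; it is meaningful only for such \<open>f\<close>
  (see \<open>tensor_lift_ex1\<close> below).\<close>

definition tensor_lift ::
  "'r set \<Rightarrow> ('m \<Rightarrow> 'r \<Rightarrow> 'm) \<Rightarrow> ('r \<Rightarrow> 'n \<Rightarrow> 'n) \<Rightarrow> ('m, 'x) ring_scheme \<Rightarrow> ('n, 'y) ring_scheme
    \<Rightarrow> ('g, 'z) monoid_scheme \<Rightarrow> ('m \<Rightarrow> 'n \<Rightarrow> 'g) \<Rightarrow> ('m, 'n) tensor \<Rightarrow> 'g"
  where "tensor_lift S ra la M N G f =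
    (THE g. g \<in> extensional (carrier (tensor_group S ra la M N)) \<and>
            g \<in> hom (tensor_group S ra la M N) G \<and>
            (\<forall>x\<in>carrier M. \<forall>y\<in>carrier N. g (pure_tensor S ra la M N x y) = f x y))"

lemma tensor_lift_ex1:
  assumes "comm_group G" and M: "abelian_monoid M" and N: "abelian_monoid N"
    and ra: "\<And>x s. \<lbrakk>x \<in> carrier M; s \<in> S\<rbrakk> \<Longrightarrow> ra x s \<in> carrier M"
    and la: "\<And>s y. \<lbrakk>s \<in> S; y \<in> carrier N\<rbrakk> \<Longrightarrow> la s y \<in> carrier N"
    and f: "\<And>x y. \<lbrakk>x \<in> carrier M; y \<in> carrier N\<rbrakk> \<Longrightarrow> f x y \<in> carrier G"
    and f_left: "\<And>x x' y. \<lbrakk>x \<in> carrier M; x' \<in> carrier M; y \<in> carrier N\<rbrakk> \<Longrightarrow>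
      f (x \<oplus>\<^bsub>M\<^esub> x') y = f x y \<otimes>\<^bsub>G\<^esub> f x' y"
    and f_right: "\<And>x y y'. \<lbrakk>x \<in> carrier M; y \<in> carrier N; y' \<in> carrier N\<rbrakk> \<Longrightarrow>
      f x (y \<oplus>\<^bsub>N\<^esub> y') = f x y \<otimes>\<^bsub>G\<^esub> f x y'"
    and f_bal: "\<And>x s y. \<lbrakk>x \<in> carrier M; s \<in> S; y \<in> carrier N\<rbrakk> \<Longrightarrow> f (ra x s) y = f x (la s y)"
  shows "\<exists>!g. g \<in> extensional (carrier (tensor_group S ra la M N)) \<and>
            g \<in> hom (tensor_group S ra la M N) G \<and>
            (\<forall>x\<in>carrier M. \<forall>y\<in>carrier N. g (pure_tensor S ra la M N x y) = f x y)"
proof -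
  interpret G: comm_group G by fact
  interpret M: abelian_monoid M by fact
  interpret N: abelian_monoid N by fact
  define F where "F = free_Abelian_group (carrier M \<times> carrier N)"
  define K where "K = tensor_kernel S ra la M N"
  interpret F: comm_group F
    unfolding F_def by (rule abelian_free_Abelian_group)
  have FP: "frag_of (x, y) \<in> carrier F" if "x \<in> carrier M" "y \<in> carrier N" for x y
    using that by (simp add: F_def)
  have Fd: "a - b \<in> carrier F" "a - b = a \<otimes>\<^bsub>F\<^esub> inv\<^bsub>F\<^esub> b"
    if "a \<in> carrier F" "b \<in> carrier F" for a b
    using that keys_diff[of a b] by (auto simp: F_def)
  have rels: "tensor_relators S ra la M N \<subseteq> carrier F"
    unfolding tensor_relators_def using ra la by (auto intro!: Fd(1) FP)
  have KF: "K \<lhd> F"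
    unfolding K_def tensor_kernel_def F_def[symmetric]
    by (rule F.subgroup_imp_normal[OF F.generate_is_subgroup[OF rels]])
  have T: "tensor_group S ra la M N = F Mod K"
    by (simp add: tensor_group_def F_def K_def)
  have P: "pure_tensor S ra la M N x y = K #>\<^bsub>F\<^esub> frag_of (x, y)" for x y
    by (simp add: pure_tensor_def F_def K_def)
  have "case_prod f ` (carrier M \<times> carrier N) \<subseteq> carrier G"
    using f by auto
  then obtain h where "h \<in> hom (free_Abelian_group (carrier M \<times> carrier N)) G"
    and hf: "\<And>p. p \<in> carrier M \<times> carrier N \<Longrightarrow> h (frag_of p) = case_prod f p"
    by (rule G.free_Abelian_group_universal) (rule that)
  then have h: "h \<in> hom F G"
    by (simp add: F_def)
  interpret h: group_hom F G h
    by unfold_locales (rule h)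
  have hd: "h (a - b) = h a \<otimes>\<^bsub>G\<^esub> inv\<^bsub>G\<^esub> h b" if "a \<in> carrier F" "b \<in> carrier F" for a b
    using that by (simp add: Fd(2))
  have abc: "a \<otimes>\<^bsub>G\<^esub> b \<otimes>\<^bsub>G\<^esub> inv\<^bsub>G\<^esub> a \<otimes>\<^bsub>G\<^esub> inv\<^bsub>G\<^esub> b = \<one>\<^bsub>G\<^esub>"
    if "a \<in> carrier G" "b \<in> carrier G" for a b
    using that by (simp add: G.m_assoc G.m_lcomm[of b])
  have "h u = \<one>\<^bsub>G\<^esub>" if "u \<in> tensor_relators S ra la M N" for u
    using that unfolding tensor_relators_def
  proof (elim UnE CollectE exE conjE)
    fix x x' y assume "x \<in> carrier M" "x' \<in> carrier M" "y \<in> carrier N"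
      and "u = frag_of (x \<oplus>\<^bsub>M\<^esub> x', y) - frag_of (x, y) - frag_of (x', y)"
    then show ?thesis by (simp add: hd Fd(1) FP hf f_left f abc)
  next
    fix x y y' assume "x \<in> carrier M" "y \<in> carrier N" "y' \<in> carrier N"
      and "u = frag_of (x, y \<oplus>\<^bsub>N\<^esub> y') - frag_of (x, y) - frag_of (x, y')"
    then show ?thesis by (simp add: hd Fd(1) FP hf f_right f abc)
  next
    fix x s y assume "x \<in> carrier M" "s \<in> S" "y \<in> carrier N"
      and "u = frag_of (ra x s, y) - frag_of (x, la s y)"
    then show ?thesis by (simp add: hd FP hf ra la f_bal f)
  qed
  then have "tensor_relators S ra la M N \<subseteq> kernel F G h"
    using rels by (auto simp: kernel_def)
  then have "K \<subseteq> kernel F G h"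
    unfolding K_def tensor_kernel_def F_def[symmetric]
    by (rule F.generate_subgroup_incl[OF _ h.subgroup_kernel])
  then obtain g where g: "g \<in> hom (F Mod K) G" and gh: "\<And>c. c \<in> carrier F \<Longrightarrow> g (K #>\<^bsub>F\<^esub> c) = h c"
    using h.FactGroup_universal_kernel[OF KF] by blast
  show ?thesis
    unfolding T P
  proof (rule ex1I)
    interpret Q: group "F Mod K" using KF by (rule normal.factorgroup_is_group)
    let ?g = "restrict g (carrier (F Mod K))"
    have in_Q: "K #>\<^bsub>F\<^esub> c \<in> carrier (F Mod K)" if "c \<in> carrier F" for c
      using that by (auto simp: carrier_FactGroup)
    show "?g \<in> extensional (carrier (F Mod K)) \<and> ?g \<in> hom (F Mod K) G \<and>
        (\<forall>x\<in>carrier M. \<forall>y\<in>carrier N. ?g (K #>\<^bsub>F\<^esub> frag_of (x, y)) = f x y)"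
      using g Q.m_closed by (auto simp: hom_def in_Q FP gh hf Pi_iff)
    fix g' assume g': "g' \<in> extensional (carrier (F Mod K)) \<and> g' \<in> hom (F Mod K) G \<and>
        (\<forall>x\<in>carrier M. \<forall>y\<in>carrier N. g' (K #>\<^bsub>F\<^esub> frag_of (x, y)) = f x y)"
    interpret g': group_hom "F Mod K" G g'
      by unfold_locales (use g' in blast)
    have q: "group_hom F (F Mod K) (\<lambda>c. K #>\<^bsub>F\<^esub> c)"
      by unfold_locales (rule normal.r_coset_hom_Mod[OF KF])
    interpret q: group_hom F "F Mod K" "\<lambda>c. K #>\<^bsub>F\<^esub> c" by (rule q)
    have eq: "g' (K #>\<^bsub>F\<^esub> c) = h c" if "c \<in> carrier F" for c
    proof -
      have "Poly_Mapping.keys c \<subseteq> carrier M \<times> carrier N"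
        using that by (simp add: F_def)
      then have "c \<in> carrier F \<and> g' (K #>\<^bsub>F\<^esub> c) = h c"
      proof (rule free_Abelian_group_induct)
        have "(0 :: _ \<Rightarrow>\<^sub>0 int) = \<one>\<^bsub>F\<^esub>" by (simp add: F_def)
        then show "0 \<in> carrier F \<and> g' (K #>\<^bsub>F\<^esub> 0) = h 0"
          by (metis F.one_closed g'.hom_one q.hom_one h.hom_one)
      next
        fix a b assume "a \<in> carrier F \<and> g' (K #>\<^bsub>F\<^esub> a) = h a"
          "b \<in> carrier F \<and> g' (K #>\<^bsub>F\<^esub> b) = h b"
        then show "a - b \<in> carrier F \<and> g' (K #>\<^bsub>F\<^esub> (a - b)) = h (a - b)"
          by (simp add: Fd(2) del: mult_FactGroup)
      next
        fix p assume "p \<in> carrier M \<times> carrier N"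
        then show "frag_of p \<in> carrier F \<and> g' (K #>\<^bsub>F\<^esub> frag_of p) = h (frag_of p)"
          using g' by (auto simp: FP hf)
      qed
      then show ?thesis ..
    qed
    show "g' = ?g"
    proof (rule extensionalityI[of _ "carrier (F Mod K)"])
      fix X assume "X \<in> carrier (F Mod K)"
      then show "g' X = ?g X"
        by (auto simp: carrier_FactGroup eq gh)
    qed (use g' in auto)
  qed
qed


subsection \<open>Tensor products over the ground field\<close>

definition ktensor_group ::
  "('k, 'w) ring_scheme \<Rightarrow> ('k, 'm, 'x) module_scheme \<Rightarrow> ('k, 'n, 'y) module_scheme
    \<Rightarrow> ('m, 'n) tensor monoid"
  where "ktensor_group k M N =
    tensor_group (carrier k) (\<lambda>x r. r \<odot>\<^bsub>M\<^esub> x) (\<lambda>r y. r \<odot>\<^bsub>N\<^esub> y) M N"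

definition kpure ::
  "('k, 'w) ring_scheme \<Rightarrow> ('k, 'm, 'x) module_scheme \<Rightarrow> ('k, 'n, 'y) module_scheme
    \<Rightarrow> 'm \<Rightarrow> 'n \<Rightarrow> ('m, 'n) tensor"
  where "kpure k M N =
    pure_tensor (carrier k) (\<lambda>x r. r \<odot>\<^bsub>M\<^esub> x) (\<lambda>r y. r \<odot>\<^bsub>N\<^esub> y) M N"

definition klift ::
  "('k, 'w) ring_scheme \<Rightarrow> ('k, 'm, 'x) module_scheme \<Rightarrow> ('k, 'n, 'y) module_scheme
    \<Rightarrow> ('g, 'z) monoid_scheme \<Rightarrow> ('m \<Rightarrow> 'n \<Rightarrow> 'g) \<Rightarrow> ('m, 'n) tensor \<Rightarrow> 'g"
  where "klift k M N =
    tensor_lift (carrier k) (\<lambda>x r. r \<odot>\<^bsub>M\<^esub> x) (\<lambda>r y. r \<odot>\<^bsub>N\<^esub> y) M N"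

text \<open>For plain modules \<open>M\<close>, \<open>N\<close> only the additive structure and scalar multiplication matter.
  For algebras, the product is \<open>(a \<otimes> b)(c \<otimes> d) = ac \<otimes> bd\<close>.\<close>

definition tensor_algebra ::
  "('k, 'w) ring_scheme \<Rightarrow> ('k, 'm, 'x) module_scheme \<Rightarrow> ('k, 'n, 'y) module_scheme
    \<Rightarrow> ('k, ('m, 'n) tensor) module"
  where "tensor_algebra k M N =
    \<lparr>carrier = carrier (ktensor_group k M N),
     monoid.mult = (\<lambda>s t. klift k M N (ktensor_group k M N)
               (\<lambda>a b. klift k M N (ktensor_group k M N)
                  (\<lambda>c d. kpure k M N (a \<otimes>\<^bsub>M\<^esub> c) (b \<otimes>\<^bsub>N\<^esub> d)) t) s),
     one = kpure k M N \<one>\<^bsub>M\<^esub> \<one>\<^bsub>N\<^esub>,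
     ring.zero = \<one>\<^bsub>ktensor_group k M N\<^esub>,
     ring.add = monoid.mult (ktensor_group k M N),
     smult = (\<lambda>r. klift k M N (ktensor_group k M N) (\<lambda>x y. kpure k M N (r \<odot>\<^bsub>M\<^esub> x) y))\<rparr>"

definition tensor_map ::
  "('k, 'w) ring_scheme \<Rightarrow> ('k, 'm, 'x) module_scheme \<Rightarrow> ('k, 'n, 'y) module_scheme
    \<Rightarrow> ('k, 'p, 'u) module_scheme \<Rightarrow> ('k, 'q, 'v) module_scheme
    \<Rightarrow> ('m \<Rightarrow> 'p) \<Rightarrow> ('n \<Rightarrow> 'q) \<Rightarrow> ('m, 'n) tensor \<Rightarrow> ('p, 'q) tensor"
  where "tensor_map k M N P Q f g = klift k M N (ktensor_group k P Q) (\<lambda>x y. kpure k P Q (f x) (g y))"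

text \<open>The associativity isomorphism \<open>(M \<otimes> N) \<otimes> P \<rightarrow> M \<otimes> (N \<otimes> P)\<close>.\<close>

definition tensor_assoc ::
  "('k, 'w) ring_scheme \<Rightarrow> ('k, 'm, 'x) module_scheme \<Rightarrow> ('k, 'n, 'y) module_scheme
    \<Rightarrow> ('k, 'p, 'z) module_scheme \<Rightarrow> (('m, 'n) tensor, 'p) tensor \<Rightarrow> ('m, ('n, 'p) tensor) tensor"
  where "tensor_assoc k M N P =
    klift k (tensor_algebra k M N) P (ktensor_group k M (tensor_algebra k N P))
      (\<lambda>t z. klift k M N (ktensor_group k M (tensor_algebra k N P))
               (\<lambda>x y. kpure k M (tensor_algebra k N P) x (kpure k N P y z)) t)"


section \<open>Pointed Poisson Hopf algebras\<close>

definition alg_hom ::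
  "('k, 'w) ring_scheme \<Rightarrow> ('k, 'a, 'x) module_scheme \<Rightarrow> ('k, 'b, 'y) module_scheme \<Rightarrow> ('a \<Rightarrow> 'b) set"
  where "alg_hom k A B =
    {f \<in> ring_hom A B. \<forall>r\<in>carrier k. \<forall>x\<in>carrier A. f (r \<odot>\<^bsub>A\<^esub> x) = r \<odot>\<^bsub>B\<^esub> f x}"

definition lin_map ::
  "('k, 'w) ring_scheme \<Rightarrow> ('k, 'a, 'x) module_scheme \<Rightarrow> ('k, 'b, 'y) module_scheme \<Rightarrow> ('a \<Rightarrow> 'b) set"
  where "lin_map k A B =
    {f \<in> hom (add_monoid A) (add_monoid B).
       \<forall>r\<in>carrier k. \<forall>x\<in>carrier A. f (r \<odot>\<^bsub>A\<^esub> x) = r \<odot>\<^bsub>B\<^esub> f x}"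

record ('k, 'a) poisson_hopf = "('k, 'a) module" +
  comult :: "'a \<Rightarrow> ('a, 'a) tensor"
  counit :: "'a \<Rightarrow> 'k"
  antipode :: "'a \<Rightarrow> 'a"
  bracket :: "'a \<Rightarrow> 'a \<Rightarrow> 'a"

locale commutative_hopf_algebra = field k + algebra k B
  for k (structure) and B :: "('a, 'b, 'c) poisson_hopf_scheme" (structure) +
  assumes comult_alg_hom: "comult B \<in> alg_hom k B (tensor_algebra k B B)"
    and counit_ring_hom: "counit B \<in> ring_hom B k"
    and counit_smult: "\<lbrakk>r \<in> carrier k; x \<in> carrier B\<rbrakk> \<Longrightarrow> counit B (r \<odot>\<^bsub>B\<^esub> x) = r \<otimes>\<^bsub>k\<^esub> counit B x"
    and antipode_lin: "antipode B \<in> lin_map k B B"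
    and coassoc: "x \<in> carrier B \<Longrightarrow>
      tensor_assoc k B B B
        (tensor_map k B B (tensor_algebra k B B) B (comult B) (\<lambda>y. y) (comult B x)) =
      tensor_map k B B B (tensor_algebra k B B) (\<lambda>y. y) (comult B) (comult B x)"
    and counit_left: "x \<in> carrier B \<Longrightarrow>
      klift k B B (add_monoid B) (\<lambda>y z. counit B y \<odot>\<^bsub>B\<^esub> z) (comult B x) = x"
    and counit_right: "x \<in> carrier B \<Longrightarrow>
      klift k B B (add_monoid B) (\<lambda>y z. counit B z \<odot>\<^bsub>B\<^esub> y) (comult B x) = x"
    and antipode_left: "x \<in> carrier B \<Longrightarrow>
      klift k B B (add_monoid B) (\<lambda>y z. antipode B y \<otimes>\<^bsub>B\<^esub> z) (comult B x) =
        counit B x \<odot>\<^bsub>B\<^esub> \<one>\<^bsub>B\<^esub>"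
    and antipode_right: "x \<in> carrier B \<Longrightarrow>
      klift k B B (add_monoid B) (\<lambda>y z. y \<otimes>\<^bsub>B\<^esub> antipode B z) (comult B x) =
        counit B x \<odot>\<^bsub>B\<^esub> \<one>\<^bsub>B\<^esub>"

locale poisson_algebra = field k + algebra k B
  for k (structure) and B :: "('a, 'b, 'c) poisson_hopf_scheme" (structure) +
  assumes bracket_closed: "\<lbrakk>x \<in> carrier B; y \<in> carrier B\<rbrakk> \<Longrightarrow> bracket B x y \<in> carrier B"
    and bracket_add_left: "\<lbrakk>x \<in> carrier B; y \<in> carrier B; z \<in> carrier B\<rbrakk> \<Longrightarrow>
      bracket B (x \<oplus>\<^bsub>B\<^esub> y) z = bracket B x z \<oplus>\<^bsub>B\<^esub> bracket B y z"
    and bracket_add_right: "\<lbrakk>x \<in> carrier B; y \<in> carrier B; z \<in> carrier B\<rbrakk> \<Longrightarrow>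
      bracket B x (y \<oplus>\<^bsub>B\<^esub> z) = bracket B x y \<oplus>\<^bsub>B\<^esub> bracket B x z"
    and bracket_smult_left: "\<lbrakk>r \<in> carrier k; x \<in> carrier B; y \<in> carrier B\<rbrakk> \<Longrightarrow>
      bracket B (r \<odot>\<^bsub>B\<^esub> x) y = r \<odot>\<^bsub>B\<^esub> bracket B x y"
    and bracket_smult_right: "\<lbrakk>r \<in> carrier k; x \<in> carrier B; y \<in> carrier B\<rbrakk> \<Longrightarrow>
      bracket B x (r \<odot>\<^bsub>B\<^esub> y) = r \<odot>\<^bsub>B\<^esub> bracket B x y"
    and bracket_alternating: "x \<in> carrier B \<Longrightarrow> bracket B x x = \<zero>\<^bsub>B\<^esub>"
    and jacobi: "\<lbrakk>x \<in> carrier B; y \<in> carrier B; z \<in> carrier B\<rbrakk> \<Longrightarrow>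
      bracket B x (bracket B y z) \<oplus>\<^bsub>B\<^esub> bracket B y (bracket B z x) \<oplus>\<^bsub>B\<^esub>
        bracket B z (bracket B x y) = \<zero>\<^bsub>B\<^esub>"
    and leibniz: "\<lbrakk>x \<in> carrier B; y \<in> carrier B; z \<in> carrier B\<rbrakk> \<Longrightarrow>
      bracket B x (y \<otimes>\<^bsub>B\<^esub> z) = bracket B x y \<otimes>\<^bsub>B\<^esub> z \<oplus>\<^bsub>B\<^esub> y \<otimes>\<^bsub>B\<^esub> bracket B x z"

text \<open>The bracket \<open>{a \<otimes> b, c \<otimes> d} = ac \<otimes> {b, d} + {a, c} \<otimes> bd\<close> on the tensor square.\<close>

definition tensor_bracket ::
  "('k, 'w) ring_scheme \<Rightarrow> ('k, 'b, 'x) poisson_hopf_scheme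
    \<Rightarrow> ('b, 'b) tensor \<Rightarrow> ('b, 'b) tensor \<Rightarrow> ('b, 'b) tensor"
  where "tensor_bracket k B s t =
    klift k B B (ktensor_group k B B)
      (\<lambda>a b. klift k B B (ktensor_group k B B)
         (\<lambda>c d. kpure k B B (a \<otimes>\<^bsub>B\<^esub> c) (bracket B b d) \<oplus>\<^bsub>tensor_algebra k B B\<^esub>
                kpure k B B (bracket B a c) (b \<otimes>\<^bsub>B\<^esub> d)) t) s"

locale poisson_hopf_algebra = commutative_hopf_algebra k B + poisson_algebra k B
  for k (structure) and B :: "('a, 'b, 'c) poisson_hopf_scheme" (structure) +
  assumes comult_bracket: "\<lbrakk>x \<in> carrier B; y \<in> carrier B\<rbrakk> \<Longrightarrow>
      comult B (bracket B x y) = tensor_bracket k B (comult B x) (comult B y)"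

definition linear_span ::
  "('k, 'w) ring_scheme \<Rightarrow> ('k, 'm, 'x) module_scheme \<Rightarrow> 'm set \<Rightarrow> 'm set"
  where "linear_span k M S = \<Inter>{N. submodule N k M \<and> S \<subseteq> N}"

text \<open>\<open>C \<otimes> C\<close> is identified with its image in \<open>B \<otimes> B\<close>.\<close>

definition subcoalgebra ::
  "('k, 'w) ring_scheme \<Rightarrow> ('k, 'b, 'x) poisson_hopf_scheme \<Rightarrow> 'b set \<Rightarrow> bool"
  where "subcoalgebra k B C \<longleftrightarrow> submodule C k B \<and>
    comult B ` C \<subseteq> linear_span k (tensor_algebra k B B) {kpure k B B c d | c d. c \<in> C \<and> d \<in> C}"

definition simple_subcoalgebra ::
  "('k, 'w) ring_scheme \<Rightarrow> ('k, 'b, 'x) poisson_hopf_scheme \<Rightarrow> 'b set \<Rightarrow> bool"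
  where "simple_subcoalgebra k B C \<longleftrightarrow> subcoalgebra k B C \<and> C \<noteq> {\<zero>\<^bsub>B\<^esub>} \<and>
    (\<forall>D. subcoalgebra k B D \<and> D \<subseteq> C \<longrightarrow> D = {\<zero>\<^bsub>B\<^esub>} \<or> D = C)"

definition coradical ::
  "('k, 'w) ring_scheme \<Rightarrow> ('k, 'b, 'x) poisson_hopf_scheme \<Rightarrow> 'b set"
  where "coradical k B = linear_span k B (\<Union>{C. simple_subcoalgebra k B C})"

definition group_likes ::
  "('k, 'w) ring_scheme \<Rightarrow> ('k, 'b, 'x) poisson_hopf_scheme \<Rightarrow> 'b set"
  where "group_likes k B =
    {g \<in> carrier B. comult B g = kpure k B B g g \<and> counit B g = \<one>\<^bsub>k\<^esub>}"

definition pointed ::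
  "('k, 'w) ring_scheme \<Rightarrow> ('k, 'b, 'x) poisson_hopf_scheme \<Rightarrow> bool"
  where "pointed k B \<longleftrightarrow> coradical k B = linear_span k B (group_likes k B)"


section \<open>The universal enveloping algebra of a Poisson algebra\<close>

text \<open>The free associative unital algebra on \<open>G\<close>: finitely supported functions on words over
  \<open>G\<close>, with the convolution product along concatenation.\<close>

definition free_algebra ::
  "('k, 'w) ring_scheme \<Rightarrow> 'g set \<Rightarrow> ('k, 'g list \<Rightarrow> 'k) module"
  where "free_algebra k G =
    \<lparr>carrier = {f. range f \<subseteq> carrier k \<and> finite {u. f u \<noteq> \<zero>\<^bsub>k\<^esub>} \<and> {u. f u \<noteq> \<zero>\<^bsub>k\<^esub>} \<subseteq> lists G},
     monoid.mult = (\<lambda>f g u. \<Oplus>\<^bsub>k\<^esub>i\<in>{..length u}. f (take i u) \<otimes>\<^bsub>k\<^esub> g (drop i u)),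
     one = (\<lambda>u. if u = [] then \<one>\<^bsub>k\<^esub> else \<zero>\<^bsub>k\<^esub>),
     ring.zero = (\<lambda>u. \<zero>\<^bsub>k\<^esub>),
     ring.add = (\<lambda>f g u. f u \<oplus>\<^bsub>k\<^esub> g u),
     smult = (\<lambda>r f u. r \<otimes>\<^bsub>k\<^esub> f u)\<rparr>"

definition free_gen :: "('k, 'w) ring_scheme \<Rightarrow> 'g \<Rightarrow> 'g list \<Rightarrow> 'k"
  where "free_gen k g = (\<lambda>u. if u = [g] then \<one>\<^bsub>k\<^esub> else \<zero>\<^bsub>k\<^esub>)"

definition quot_algebra ::
  "('k, 'a, 'x) module_scheme \<Rightarrow> 'a set \<Rightarrow> ('k, 'a set) module"
  where "quot_algebra A I =
    \<lparr>carrier = carrier (A Quot I), monoid.mult = monoid.mult (A Quot I), one = monoid.one (A Quot I),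
     ring.zero = ring.zero (A Quot I), ring.add = ring.add (A Quot I),
     smult = (\<lambda>r c. \<Union>x\<in>c. I +>\<^bsub>A\<^esub> (r \<odot>\<^bsub>A\<^esub> x))\<rparr>"

text \<open>The two copies of \<open>B\<close> are the summands of \<open>B + B\<close>: \<open>m\<^sub>a\<close> comes from \<open>Inl a\<close> and
  \<open>h\<^sub>a\<close> from \<open>Inr a\<close>.\<close>

definition env_relators ::
  "('k, 'w) ring_scheme \<Rightarrow> ('k, 'b, 'x) poisson_hopf_scheme \<Rightarrow> (('b + 'b) list \<Rightarrow> 'k) set"
  where "env_relators k B =
    (let F = free_algebra k (carrier B <+> carrier B);
         m = (\<lambda>a. free_gen k (Inl a)); h = (\<lambda>a. free_gen k (Inr a))
     in {m (x \<oplus>\<^bsub>B\<^esub> y) \<ominus>\<^bsub>F\<^esub> (m x \<oplus>\<^bsub>F\<^esub> m y) | x y. x \<in> carrier B \<and> y \<in> carrier B} \<union>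
        {h (x \<oplus>\<^bsub>B\<^esub> y) \<ominus>\<^bsub>F\<^esub> (h x \<oplus>\<^bsub>F\<^esub> h y) | x y. x \<in> carrier B \<and> y \<in> carrier B} \<union>
        {m (r \<odot>\<^bsub>B\<^esub> x) \<ominus>\<^bsub>F\<^esub> r \<odot>\<^bsub>F\<^esub> m x | r x. r \<in> carrier k \<and> x \<in> carrier B} \<union>
        {h (r \<odot>\<^bsub>B\<^esub> x) \<ominus>\<^bsub>F\<^esub> r \<odot>\<^bsub>F\<^esub> h x | r x. r \<in> carrier k \<and> x \<in> carrier B} \<union>
        {m (x \<otimes>\<^bsub>B\<^esub> y) \<ominus>\<^bsub>F\<^esub> m x \<otimes>\<^bsub>F\<^esub> m y | x y. x \<in> carrier B \<and> y \<in> carrier B} \<union>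
        {h (bracket B x y) \<ominus>\<^bsub>F\<^esub> (h x \<otimes>\<^bsub>F\<^esub> h y \<ominus>\<^bsub>F\<^esub> h y \<otimes>\<^bsub>F\<^esub> h x) | x y.
           x \<in> carrier B \<and> y \<in> carrier B} \<union>
        {h (x \<otimes>\<^bsub>B\<^esub> y) \<ominus>\<^bsub>F\<^esub> (m y \<otimes>\<^bsub>F\<^esub> h x \<oplus>\<^bsub>F\<^esub> m x \<otimes>\<^bsub>F\<^esub> h y) | x y.
           x \<in> carrier B \<and> y \<in> carrier B} \<union>
        {m (bracket B x y) \<ominus>\<^bsub>F\<^esub> (h x \<otimes>\<^bsub>F\<^esub> m y \<ominus>\<^bsub>F\<^esub> m y \<otimes>\<^bsub>F\<^esub> h x) | x y.
           x \<in> carrier B \<and> y \<in> carrier B} \<union>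
        {m \<one>\<^bsub>B\<^esub> \<ominus>\<^bsub>F\<^esub> \<one>\<^bsub>F\<^esub>})"

type_synonym ('k, 'b) env = "(('b + 'b) list \<Rightarrow> 'k) set"

definition env_ideal ::
  "('k, 'w) ring_scheme \<Rightarrow> ('k, 'b, 'x) poisson_hopf_scheme \<Rightarrow> (('b + 'b) list \<Rightarrow> 'k) set"
  where "env_ideal k B = Idl\<^bsub>free_algebra k (carrier B <+> carrier B)\<^esub> (env_relators k B)"

definition env_algebra ::
  "('k, 'w) ring_scheme \<Rightarrow> ('k, 'b, 'x) poisson_hopf_scheme \<Rightarrow> ('k, ('k, 'b) env) module"
  where "env_algebra k B =
    quot_algebra (free_algebra k (carrier B <+> carrier B)) (env_ideal k B)"

definition env_m ::
  "('k, 'w) ring_scheme \<Rightarrow> ('k, 'b, 'x) poisson_hopf_scheme \<Rightarrow> 'b \<Rightarrow> ('k, 'b) env"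
  where "env_m k B a =
    env_ideal k B +>\<^bsub>free_algebra k (carrier B <+> carrier B)\<^esub> free_gen k (Inl a)"

definition env_h ::
  "('k, 'w) ring_scheme \<Rightarrow> ('k, 'b, 'x) poisson_hopf_scheme \<Rightarrow> 'b \<Rightarrow> ('k, 'b) env"
  where "env_h k B a =
    env_ideal k B +>\<^bsub>free_algebra k (carrier B <+> carrier B)\<^esub> free_gen k (Inr a)"

text \<open>\<open>\<Delta>(m\<^sub>b) = m\<^bsub>b1\<^esub> \<otimes> m\<^bsub>b2\<^esub>\<close> and
  \<open>\<Delta>(h\<^sub>b) = m\<^bsub>b1\<^esub> \<otimes> h\<^bsub>b2\<^esub> + h\<^bsub>b1\<^esub> \<otimes> m\<^bsub>b2\<^esub>\<close>; these determine the algebra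
  homomorphism \<open>\<Delta>\<close>.\<close>

definition env_comult ::
  "('k, 'w) ring_scheme \<Rightarrow> ('k, 'b, 'x) poisson_hopf_scheme
    \<Rightarrow> ('k, 'b) env \<Rightarrow> (('k, 'b) env, ('k, 'b) env) tensor"
  where "env_comult k B =
    (let U = env_algebra k B; m = env_m k B; h = env_h k B in
     THE D. D \<in> extensional (carrier U) \<and> D \<in> alg_hom k U (tensor_algebra k U U) \<and>
       (\<forall>b\<in>carrier B.
          D (m b) = tensor_map k B B U U m m (comult B b) \<and>
          D (h b) = tensor_map k B B U U m h (comult B b) \<oplus>\<^bsub>tensor_algebra k U U\<^esub>
                    tensor_map k B B U U h m (comult B b)))"


section \<open>The extension of \<open>B\<close> by the quotient Hopf algebra\<close>

definition augmentation_ideal ::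
  "('k, 'w) ring_scheme \<Rightarrow> ('k, 'b, 'x) poisson_hopf_scheme \<Rightarrow> 'b set"
  where "augmentation_ideal k B = {b \<in> carrier B. counit B b = \<zero>\<^bsub>k\<^esub>}"

text \<open>The left ideal \<open>B\<^sup>eB\<^sup>+\<close>, i.e. all finite sums of products; it turns out to be two-sided.\<close>

definition env_aug ::
  "('k, 'w) ring_scheme \<Rightarrow> ('k, 'b, 'x) poisson_hopf_scheme \<Rightarrow> ('k, 'b) env set"
  where "env_aug k B = generate (add_monoid (env_algebra k B))
    {x \<otimes>\<^bsub>env_algebra k B\<^esub> env_m k B b | x b.
       x \<in> carrier (env_algebra k B) \<and> b \<in> augmentation_ideal k B}"

definition env_quot ::
  "('k, 'w) ring_scheme \<Rightarrow> ('k, 'b, 'x) poisson_hopf_scheme \<Rightarrow> ('k, ('k, 'b) env set) module"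
  where "env_quot k B = quot_algebra (env_algebra k B) (env_aug k B)"

definition env_proj ::
  "('k, 'w) ring_scheme \<Rightarrow> ('k, 'b, 'x) poisson_hopf_scheme \<Rightarrow> ('k, 'b) env \<Rightarrow> ('k, 'b) env set"
  where "env_proj k B x = env_aug k B +>\<^bsub>env_algebra k B\<^esub> x"

definition env_coaction ::
  "('k, 'w) ring_scheme \<Rightarrow> ('k, 'b, 'x) poisson_hopf_scheme
    \<Rightarrow> ('k, 'b) env \<Rightarrow> (('k, 'b) env, ('k, 'b) env set) tensor"
  where "env_coaction k B x =
    tensor_map k (env_algebra k B) (env_algebra k B) (env_algebra k B) (env_quot k B)
      (\<lambda>y. y) (env_proj k B) (env_comult k B x)"

text \<open>\<open>B\<^sup>e \<otimes>\<^sub>B B\<^sup>e\<close>, where \<open>B\<close> acts on \<open>B\<^sup>e\<close> by multiplication with \<open>m\<^sub>b\<close>.\<close>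

definition env_tensor_B ::
  "('k, 'w) ring_scheme \<Rightarrow> ('k, 'b, 'x) poisson_hopf_scheme
    \<Rightarrow> (('k, 'b) env, ('k, 'b) env) tensor monoid"
  where "env_tensor_B k B =
    tensor_group (carrier B) (\<lambda>x b. x \<otimes>\<^bsub>env_algebra k B\<^esub> env_m k B b)
      (\<lambda>b y. env_m k B b \<otimes>\<^bsub>env_algebra k B\<^esub> y) (env_algebra k B) (env_algebra k B)"

definition env_pure_B ::
  "('k, 'w) ring_scheme \<Rightarrow> ('k, 'b, 'x) poisson_hopf_scheme
    \<Rightarrow> ('k, 'b) env \<Rightarrow> ('k, 'b) env \<Rightarrow> (('k, 'b) env, ('k, 'b) env) tensor"
  where "env_pure_B k B =
    pure_tensor (carrier B) (\<lambda>x b. x \<otimes>\<^bsub>env_algebra k B\<^esub> env_m k B b)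
      (\<lambda>b y. env_m k B b \<otimes>\<^bsub>env_algebra k B\<^esub> y) (env_algebra k B) (env_algebra k B)"

definition galois_map ::
  "('k, 'w) ring_scheme \<Rightarrow> ('k, 'b, 'x) poisson_hopf_scheme
    \<Rightarrow> (('k, 'b) env, ('k, 'b) env) tensor \<Rightarrow> (('k, 'b) env, ('k, 'b) env set) tensor"
  where "galois_map k B =
    (let U = env_algebra k B; H = env_quot k B in
     tensor_lift (carrier B) (\<lambda>x b. x \<otimes>\<^bsub>U\<^esub> env_m k B b) (\<lambda>b y. env_m k B b \<otimes>\<^bsub>U\<^esub> y) U U
       (add_monoid (tensor_algebra k U H))
       (\<lambda>x y. kpure k U H x \<one>\<^bsub>H\<^esub> \<otimes>\<^bsub>tensor_algebra k U H\<^esub> env_coaction k B y))"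

end

theory Submission
  imports Defs
begin

text \<open>Write \<open>U = B\<^sup>e\<close>, \<open>H = U/UB\<^sup>+\<close> and \<open>W = U \<otimes>\<^sub>B U\<close>, and put \<open>p\<^sub>b = m\<^bsub>S(b1)\<^esub> h\<^bsub>b2\<^esub>\<close>. Since
  \<open>m\<^bsub>b1\<^esub> p\<^bsub>b2\<^esub> = h\<^sub>b\<close>, convolution with \<open>m\<close> can be cancelled, which gives
  \<open>p\<^bsub>xy\<^esub> = \<epsilon>(x)p\<^sub>y + \<epsilon>(y)p\<^sub>x\<close> and \<open>p\<^bsub>{x,y}\<^esub> = [p\<^sub>x, p\<^sub>y]\<close>; moreover \<open>[p\<^sub>b, m\<^sub>c]\<close> lies in \<open>B\<close>, so that
  \<open>T\<^sub>b(x \<otimes> y) = x \<otimes> p\<^sub>b y - x p\<^sub>b \<otimes> y\<close> is well defined on \<open>W\<close>. Hence \<open>m\<^sub>b \<mapsto> \<epsilon>(b)\<close>, \<open>h\<^sub>b \<mapsto> T\<^sub>b\<close>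
  extends to a ring homomorphism \<open>\<Theta>\<close> from \<open>U\<close> to the endomorphisms of \<open>W\<close>, which factors through
  \<open>H\<close> and plays the role of \<open>u \<mapsto> S(u1) \<otimes> u2\<close> without an antipode of \<open>U\<close> being constructed. The
  inverse of the Galois map is \<open>x \<otimes> \<pi>(u) \<mapsto> x \<Theta>\<^sub>u(1 \<otimes> 1)\<close>.\<close>

text \<open>Inside \<open>W\<close> the candidates for S(u1) \<otimes> u2 cannot be multiplied,
  because \<open>B\<close> need not be central in \<open>U\<close> and \<open>W\<close> inherits no
  product. Among the additive endomorphisms of \<open>W\<close> they can: \<open>u\<close> acts,
  formally, by x \<otimes> y \<mapsto> x S(u1) \<otimes> u2 y, composition follows the product of
  \<open>U\<close>, and left multiplications by \<open>U\<close> commute with the action. The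
  endomorphisms form only a ring, so scalars are carried by a separate ring homomorphism from
  \<open>k\<close>. The form of \<open>p b\<close> is dictated by the coaction:
  \<open>lam (p b)\<close> is the sum of 1 \<otimes> \<pi>(h_b) and p_b \<otimes> 1, so p_b is
  primitive relative to the coaction, and for u = p_b the element S(u1) \<otimes> u2 has to be 1
  \<otimes> p_b - p_b \<otimes> 1, which is what \<open>T b\<close> inserts between x and y. Each
  composite with the inverse then rests on one identity that is stable under products and is checked
  on m_b and h_b alone: the Galois map turns the operator of \<open>u\<close> into left
  multiplication by 1 \<otimes> \<pi>(u) (\<open>gal_\<Theta>\<close>), and the operator attached to
  \<lambda>(y) sends 1 \<otimes> z to 1 \<otimes> yz (\<open>\<Psi>_lam\<close>).\<close>

section \<open>Finite sums over lists of pairs\<close>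

definition psum :: "('g, 'z) monoid_scheme \<Rightarrow> ('a \<Rightarrow> 'b \<Rightarrow> 'g) \<Rightarrow> ('a \<times> 'b) list \<Rightarrow> 'g"
  where "psum G f xs = foldr (\<lambda>(x, y) s. f x y \<otimes>\<^bsub>G\<^esub> s) xs \<one>\<^bsub>G\<^esub>"

lemma psum_Nil [simp]: "psum G f [] = \<one>\<^bsub>G\<^esub>"
  and psum_Cons [simp]: "psum G f ((x, y) # xs) = f x y \<otimes>\<^bsub>G\<^esub> psum G f xs"
  by (simp_all add: psum_def)

lemma psum_cong:
  "(\<And>x y. (x, y) \<in> set xs \<Longrightarrow> f x y = g x y) \<Longrightarrow> psum G f xs = psum G g xs"
  by (induction xs) auto

context comm_monoid
begin

lemma psum_closed [intro]:
  "(\<And>x y. (x, y) \<in> set xs \<Longrightarrow> f x y \<in> carrier G) \<Longrightarrow> psum G f xs \<in> carrier G"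
  by (induction xs) auto

lemma psum_append:
  "(\<And>x y. (x, y) \<in> set xs \<union> set ys \<Longrightarrow> f x y \<in> carrier G) \<Longrightarrow>
    psum G f (xs @ ys) = psum G f xs \<otimes> psum G f ys"
  by (induction xs) (auto simp: m_assoc psum_closed)

lemma psum_one: "psum G (\<lambda>x y. \<one>) xs = \<one>"
  by (induction xs) auto

lemma psum_mult:
  "(\<And>x y. (x, y) \<in> set xs \<Longrightarrow> f x y \<in> carrier G) \<Longrightarrow> (\<And>x y. (x, y) \<in> set xs \<Longrightarrow> g x y \<in> carrier G) \<Longrightarrow>
    psum G (\<lambda>x y. f x y \<otimes> g x y) xs = psum G f xs \<otimes> psum G g xs"
proof (induction xs)
  case (Cons p xs)
  obtain x y where p: "p = (x, y)" by fastforce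
  have c: "psum G f xs \<in> carrier G" "psum G g xs \<in> carrier G" "f x y \<in> carrier G" "g x y \<in> carrier G"
    using Cons.prems by (auto simp: p)
  show ?case
    using Cons c by (simp add: p m_ac)
qed simp

text \<open>Fubini for two finite sums; it serves to exchange the Sweedler sums of two different
  elements.\<close>

lemma psum_swap:
  "(\<And>x y z w. (x, y) \<in> set xs \<Longrightarrow> (z, w) \<in> set ys \<Longrightarrow> f x y z w \<in> carrier G) \<Longrightarrow>
    psum G (\<lambda>x y. psum G (\<lambda>z w. f x y z w) ys) xs = psum G (\<lambda>z w. psum G (\<lambda>x y. f x y z w) xs) ys"
proof (induction xs)
  case Nil
  show ?case by (simp add: psum_one)
next
  case (Cons p xs)
  obtain x y where p: "p = (x, y)" by fastforce
  show ?case
    using Cons by (simp add: p psum_mult psum_closed)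
qed

end

lemma (in group) eq_of_inv:
  "\<lbrakk>a \<otimes> inv b = \<one>; a \<in> carrier G; b \<in> carrier G\<rbrakk> \<Longrightarrow> a = b"
  using inv_equality inv_inv by fastforce

text \<open>A relator of the tensor product has the shape a - b - c. In this form its vanishing in
  the quotient is read back as an additivity law for pure tensors.\<close>

lemma (in comm_group) eq_mult_of_inv:
  "\<lbrakk>a \<otimes> inv b \<otimes> inv c = \<one>; a \<in> carrier G; b \<in> carrier G; c \<in> carrier G\<rbrakk> \<Longrightarrow> a = b \<otimes> c"
  by (rule eq_of_inv) (auto simp: inv_mult m_assoc)

text \<open>Meant for multiplication by a fixed element: an additively generated subgroup is shown
  to be an ideal by looking at its generators only.\<close>

lemma (in group) generate_hom_closed:
  assumes H: "H \<subseteq> carrier G" and f: "f \<in> hom G G" and fH: "\<And>x. x \<in> H \<Longrightarrow> f x \<in> generate G H"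
    and x: "x \<in> generate G H"
  shows "f x \<in> generate G H"
proof -
  interpret f: group_hom G G f
    by (intro group_hom.intro group_hom_axioms.intro is_group f)
  interpret S: subgroup "generate G H" G
    by (rule generate_is_subgroup[OF H])
  show ?thesis
    using x
  proof (induction rule: generate.induct)
    case one
    show ?case by (simp add: generate.one)
  next
    case (incl y)
    then show ?case by (rule fH)
  next
    case (inv y)
    then have "f (inv y) = inv (f y)" using H by (intro f.hom_inv) blast
    then show ?case using fH[OF inv] by (simp add: S.m_inv_closed)
  next
    case (eng y z)
    then have "f (y \<otimes> z) = f y \<otimes> f z"
      using S.subset by (intro f.hom_mult) blast+
    then show ?case using eng by simp
  qed
qed

lemma hom_psum:
  assumes "group_hom G H h" and "\<And>x y. (x, y) \<in> set xs \<Longrightarrow> f x y \<in> carrier G" and "comm_monoid G"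
  shows "h (psum G f xs) = psum H (\<lambda>x y. h (f x y)) xs"
proof -
  interpret group_hom G H h by fact
  interpret c: comm_monoid G by fact
  show ?thesis
    using assms(2) by (induction xs) (auto simp: c.psum_closed)
qed

lemma (in ring) psum_ldistr:
  "a \<in> carrier R \<Longrightarrow> (\<And>x y. (x, y) \<in> set xs \<Longrightarrow> f x y \<in> carrier R) \<Longrightarrow>
    psum (add_monoid R) f xs \<otimes> a = psum (add_monoid R) (\<lambda>x y. f x y \<otimes> a) xs"
proof (induction xs)
  case (Cons p xs)
  obtain x y where p: "p = (x, y)" by fastforce
  have "psum (add_monoid R) f xs \<in> carrier R"
    using add.psum_closed[of xs f] Cons.prems by auto
  then show ?case
    using Cons by (simp add: p l_distr)
qed simp

lemma (in ring) psum_rdistr: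
  "a \<in> carrier R \<Longrightarrow> (\<And>x y. (x, y) \<in> set xs \<Longrightarrow> f x y \<in> carrier R) \<Longrightarrow>
    a \<otimes> psum (add_monoid R) f xs = psum (add_monoid R) (\<lambda>x y. a \<otimes> f x y) xs"
proof (induction xs)
  case (Cons p xs)
  obtain x y where p: "p = (x, y)" by fastforce
  have "psum (add_monoid R) f xs \<in> carrier R"
    using add.psum_closed[of xs f] Cons.prems by auto
  then show ?case
    using Cons by (simp add: p r_distr)
qed simp

section \<open>Balanced maps and the universal property of tensor products\<close>

text \<open>Bundles the hypotheses of \<open>tensor_lift_ex1\<close> on the map into one fact, so
  that they can be proved once and passed around.\<close>

definition balanced ::
  "'r set \<Rightarrow> ('m \<Rightarrow> 'r \<Rightarrow> 'm) \<Rightarrow> ('r \<Rightarrow> 'n \<Rightarrow> 'n) \<Rightarrow> ('m, 'x) ring_scheme \<Rightarrow> ('n, 'y) ring_scheme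
    \<Rightarrow> ('g, 'z) monoid_scheme \<Rightarrow> ('m \<Rightarrow> 'n \<Rightarrow> 'g) \<Rightarrow> bool"
  where "balanced S ra la M N G f \<longleftrightarrow>
    (\<forall>x\<in>carrier M. \<forall>y\<in>carrier N. f x y \<in> carrier G) \<and>
    (\<forall>x\<in>carrier M. \<forall>x'\<in>carrier M. \<forall>y\<in>carrier N. f (x \<oplus>\<^bsub>M\<^esub> x') y = f x y \<otimes>\<^bsub>G\<^esub> f x' y) \<and>
    (\<forall>x\<in>carrier M. \<forall>y\<in>carrier N. \<forall>y'\<in>carrier N. f x (y \<oplus>\<^bsub>N\<^esub> y') = f x y \<otimes>\<^bsub>G\<^esub> f x y') \<and>
    (\<forall>x\<in>carrier M. \<forall>s\<in>S. \<forall>y\<in>carrier N. f (ra x s) y = f x (la s y))"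

lemma balancedI [intro?]:
  assumes "\<And>x y. \<lbrakk>x \<in> carrier M; y \<in> carrier N\<rbrakk> \<Longrightarrow> f x y \<in> carrier G"
    and "\<And>x x' y. \<lbrakk>x \<in> carrier M; x' \<in> carrier M; y \<in> carrier N\<rbrakk> \<Longrightarrow>
      f (x \<oplus>\<^bsub>M\<^esub> x') y = f x y \<otimes>\<^bsub>G\<^esub> f x' y"
    and "\<And>x y y'. \<lbrakk>x \<in> carrier M; y \<in> carrier N; y' \<in> carrier N\<rbrakk> \<Longrightarrow>
      f x (y \<oplus>\<^bsub>N\<^esub> y') = f x y \<otimes>\<^bsub>G\<^esub> f x y'"
    and "\<And>x s y. \<lbrakk>x \<in> carrier M; s \<in> S; y \<in> carrier N\<rbrakk> \<Longrightarrow> f (ra x s) y = f x (la s y)"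
  shows "balanced S ra la M N G f"
  using assms by (simp add: balanced_def)

lemma balancedD:
  assumes "balanced S ra la M N G f"
  shows "\<lbrakk>x \<in> carrier M; y \<in> carrier N\<rbrakk> \<Longrightarrow> f x y \<in> carrier G"
    and "\<lbrakk>x \<in> carrier M; x' \<in> carrier M; y \<in> carrier N\<rbrakk> \<Longrightarrow>
      f (x \<oplus>\<^bsub>M\<^esub> x') y = f x y \<otimes>\<^bsub>G\<^esub> f x' y"
    and "\<lbrakk>x \<in> carrier M; y \<in> carrier N; y' \<in> carrier N\<rbrakk> \<Longrightarrow>
      f x (y \<oplus>\<^bsub>N\<^esub> y') = f x y \<otimes>\<^bsub>G\<^esub> f x y'"
    and "\<lbrakk>x \<in> carrier M; s \<in> S; y \<in> carrier N\<rbrakk> \<Longrightarrow> f (ra x s) y = f x (la s y)"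
  using assms by (auto simp: balanced_def)

text \<open>The scalars are a bare set with two actions. This covers both the tensor products over
  \<open>k\<close> and the tensor product of \<open>B^e\<close> with itself over \<open>B\<close>,
  where \<open>B\<close> acts through \<open>m\<close>.\<close>

locale tensor_product =
  fixes S :: "'r set" and ra :: "'m \<Rightarrow> 'r \<Rightarrow> 'm" and la :: "'r \<Rightarrow> 'n \<Rightarrow> 'n"
    and M :: "('m, 'x) ring_scheme" and N :: "('n, 'y) ring_scheme"
  assumes M: "abelian_group M" and N: "abelian_group N"
    and ra: "\<lbrakk>x \<in> carrier M; s \<in> S\<rbrakk> \<Longrightarrow> ra x s \<in> carrier M"
    and la: "\<lbrakk>s \<in> S; y \<in> carrier N\<rbrakk> \<Longrightarrow> la s y \<in> carrier N"
begin

abbreviation T where "T \<equiv> tensor_group S ra la M N"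
abbreviation P where "P \<equiv> pure_tensor S ra la M N"
abbreviation F where "F \<equiv> free_Abelian_group (carrier M \<times> carrier N)"
abbreviation K where "K \<equiv> tensor_kernel S ra la M N"

interpretation M: abelian_group M by (rule M)
interpretation N: abelian_group N by (rule N)
interpretation F: comm_group F by (rule abelian_free_Abelian_group)

lemma frag_closed: "\<lbrakk>x \<in> carrier M; y \<in> carrier N\<rbrakk> \<Longrightarrow> frag_of (x, y) \<in> carrier F"
  by simp

lemma diff_closed: "a \<in> carrier F \<Longrightarrow> b \<in> carrier F \<Longrightarrow> a - b \<in> carrier F"
  using keys_diff[of a b] by auto

lemma diff_F: "a \<in> carrier F \<Longrightarrow> b \<in> carrier F \<Longrightarrow> a - b = a \<otimes>\<^bsub>F\<^esub> inv\<^bsub>F\<^esub> b"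
  by auto

lemma relators_closed: "tensor_relators S ra la M N \<subseteq> carrier F"
  unfolding tensor_relators_def
  using ra la by (auto intro!: diff_closed frag_closed simp del: carrier_free_Abelian_group_iff)

lemma kernel_normal: "K \<lhd> F"
  unfolding tensor_kernel_def
  by (rule F.subgroup_imp_normal[OF F.generate_is_subgroup[OF relators_closed]])

lemma T_eq: "T = F Mod K"
  by (simp add: tensor_group_def)

lemma comm_group_T: "comm_group T"
  unfolding T_eq by (rule F.abelian_FactGroup[OF normal_imp_subgroup[OF kernel_normal]])

lemma coset_hom: "group_hom F T (\<lambda>c. K #>\<^bsub>F\<^esub> c)"
  unfolding T_eq
  by (intro group_hom.intro group_hom_axioms.intro F.is_group normal.factorgroup_is_group[OF kernel_normal]
      normal.r_coset_hom_Mod[OF kernel_normal])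

interpretation T: comm_group T by (rule comm_group_T)
interpretation q: group_hom F T "\<lambda>c. K #>\<^bsub>F\<^esub> c" by (rule coset_hom)

lemma P_eq: "P x y = K #>\<^bsub>F\<^esub> frag_of (x, y)"
  by (simp add: pure_tensor_def)

lemma pure_closed: "\<lbrakk>x \<in> carrier M; y \<in> carrier N\<rbrakk> \<Longrightarrow> P x y \<in> carrier T"
  unfolding P_eq by (rule q.hom_closed) simp

lemma relator_trivial: "r \<in> tensor_relators S ra la M N \<Longrightarrow> K #>\<^bsub>F\<^esub> r = \<one>\<^bsub>T\<^esub>"
proof -
  assume r: "r \<in> tensor_relators S ra la M N"
  then have "r \<in> K"
    unfolding tensor_kernel_def by (rule generate.incl)
  then have "K #>\<^bsub>F\<^esub> r = K"
    by (intro F.coset_join2 normal_imp_subgroup[OF kernel_normal] subsetD[OF relators_closed r])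
  then show ?thesis
    unfolding T_eq by simp
qed

lemma q_diff: "a \<in> carrier F \<Longrightarrow> b \<in> carrier F \<Longrightarrow>
    K #>\<^bsub>F\<^esub> (a - b) = (K #>\<^bsub>F\<^esub> a) \<otimes>\<^bsub>T\<^esub> inv\<^bsub>T\<^esub> (K #>\<^bsub>F\<^esub> b)"
  by (simp only: diff_F q.hom_mult q.hom_inv F.inv_closed)

lemma q_diff2:
  assumes "a \<in> carrier F" "b \<in> carrier F" "c \<in> carrier F"
  shows "K #>\<^bsub>F\<^esub> (a - b - c) = (K #>\<^bsub>F\<^esub> a) \<otimes>\<^bsub>T\<^esub> inv\<^bsub>T\<^esub> (K #>\<^bsub>F\<^esub> b) \<otimes>\<^bsub>T\<^esub> inv\<^bsub>T\<^esub> (K #>\<^bsub>F\<^esub> c)"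
  unfolding q_diff[OF diff_closed[OF assms(1,2)] assms(3)] q_diff[OF assms(1,2)] ..

lemma pure_add_left:
  assumes "x \<in> carrier M" "x' \<in> carrier M" "y \<in> carrier N"
  shows "P (x \<oplus>\<^bsub>M\<^esub> x') y = P x y \<otimes>\<^bsub>T\<^esub> P x' y"
proof (rule T.eq_mult_of_inv)
  let ?r = "frag_of (x \<oplus>\<^bsub>M\<^esub> x', y) - frag_of (x, y) - frag_of (x', y)"
  have "?r \<in> tensor_relators S ra la M N"
    unfolding tensor_relators_def using assms by (intro UnI1) blast
  from relator_trivial[OF this]
  show "P (x \<oplus>\<^bsub>M\<^esub> x') y \<otimes>\<^bsub>T\<^esub> inv\<^bsub>T\<^esub> P x y \<otimes>\<^bsub>T\<^esub> inv\<^bsub>T\<^esub> P x' y = \<one>\<^bsub>T\<^esub>"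
    by (simp only: q_diff2[OF frag_closed frag_closed frag_closed] assms M.a_closed P_eq)
qed (intro pure_closed assms M.a_closed)+

lemma pure_add_right:
  assumes "x \<in> carrier M" "y \<in> carrier N" "y' \<in> carrier N"
  shows "P x (y \<oplus>\<^bsub>N\<^esub> y') = P x y \<otimes>\<^bsub>T\<^esub> P x y'"
proof (rule T.eq_mult_of_inv)
  let ?r = "frag_of (x, y \<oplus>\<^bsub>N\<^esub> y') - frag_of (x, y) - frag_of (x, y')"
  have "?r \<in> tensor_relators S ra la M N"
    unfolding tensor_relators_def using assms by (intro UnI1 UnI2) blast
  from relator_trivial[OF this]
  show "P x (y \<oplus>\<^bsub>N\<^esub> y') \<otimes>\<^bsub>T\<^esub> inv\<^bsub>T\<^esub> P x y \<otimes>\<^bsub>T\<^esub> inv\<^bsub>T\<^esub> P x y' = \<one>\<^bsub>T\<^esub>"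
    by (simp only: q_diff2[OF frag_closed frag_closed frag_closed] assms N.a_closed P_eq)
qed (intro pure_closed assms N.a_closed)+

lemma pure_middle:
  assumes "x \<in> carrier M" "s \<in> S" "y \<in> carrier N"
  shows "P (ra x s) y = P x (la s y)"
proof (rule T.eq_of_inv)
  let ?r = "frag_of (ra x s, y) - frag_of (x, la s y)"
  have "?r \<in> tensor_relators S ra la M N"
    unfolding tensor_relators_def using assms by (intro UnI2) blast
  from relator_trivial[OF this]
  show "P (ra x s) y \<otimes>\<^bsub>T\<^esub> inv\<^bsub>T\<^esub> P x (la s y) = \<one>\<^bsub>T\<^esub>"
    unfolding P_eq using assms ra la by (subst (asm) q_diff) auto
qed (intro pure_closed assms ra la)+

lemma pure_zero_left: "y \<in> carrier N \<Longrightarrow> P \<zero>\<^bsub>M\<^esub> y = \<one>\<^bsub>T\<^esub>"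
  using pure_add_left[of "\<zero>\<^bsub>M\<^esub>" "\<zero>\<^bsub>M\<^esub>" y] pure_closed[of "\<zero>\<^bsub>M\<^esub>" y] by simp

lemma pure_minus_left: "x \<in> carrier M \<Longrightarrow> y \<in> carrier N \<Longrightarrow> P (\<ominus>\<^bsub>M\<^esub> x) y = inv\<^bsub>T\<^esub> P x y"
  using pure_add_left[of "\<ominus>\<^bsub>M\<^esub> x" x y] pure_zero_left[of y] pure_closed
  by (simp add: M.l_neg T.inv_equality)

text \<open>\<open>tensor_lift\<close> is a definite description, so nothing can be said of it
  before unique existence is known; from here on only these two properties of it are used.\<close>

lemma lift:
  assumes "comm_group G" and "balanced S ra la M N G f"
  shows lift_hom: "tensor_lift S ra la M N G f \<in> hom T G"
    and lift_pure: "\<And>x y. \<lbrakk>x \<in> carrier M; y \<in> carrier N\<rbrakk> \<Longrightarrow> tensor_lift S ra la M N G f (P x y) = f x y"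
proof -
  have "\<exists>!g. g \<in> extensional (carrier T) \<and> g \<in> hom T G \<and>
      (\<forall>x\<in>carrier M. \<forall>y\<in>carrier N. g (P x y) = f x y)"
    using balancedD[OF assms(2)] ra la
    by (intro tensor_lift_ex1 assms(1) M.abelian_monoid_axioms N.abelian_monoid_axioms) auto
  from theI'[OF this]
  show "tensor_lift S ra la M N G f \<in> hom T G"
    and "\<And>x y. \<lbrakk>x \<in> carrier M; y \<in> carrier N\<rbrakk> \<Longrightarrow> tensor_lift S ra la M N G f (P x y) = f x y"
    unfolding tensor_lift_def by auto
qed

text \<open>Integer coefficients disappear because the inverse of a pure tensor is again pure, the
  sign being absorbed by the left factor. This makes plain sums stable under the differences that
  occur in the induction on the free abelian group.\<close>

lemma pure_psum:
  assumes "t \<in> carrier T"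
  shows "\<exists>xs. set xs \<subseteq> carrier M \<times> carrier N \<and> t = psum T P xs"
proof -
  let ?Q = "\<lambda>t. \<exists>xs. set xs \<subseteq> carrier M \<times> carrier N \<and> t = psum T P xs"
  have cl: "psum T P xs \<in> carrier T" if "set xs \<subseteq> carrier M \<times> carrier N" for xs
    using that by (intro T.psum_closed pure_closed) auto
  have mult: "?Q (a \<otimes>\<^bsub>T\<^esub> b)" if ab: "?Q a" "?Q b" for a b
  proof -
    obtain xs ys where xs: "set xs \<subseteq> carrier M \<times> carrier N" "a = psum T P xs"
      and ys: "set ys \<subseteq> carrier M \<times> carrier N" "b = psum T P ys"
      using ab by auto
    have "a \<otimes>\<^bsub>T\<^esub> b = psum T P (xs @ ys)"
      unfolding xs ys
      by (rule T.psum_append[symmetric]) (use xs ys in \<open>auto intro: pure_closed\<close>)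
    then show ?thesis
      using xs(1) ys(1) by (intro exI[of _ "xs @ ys"]) simp
  qed
  have inv: "?Q (inv\<^bsub>T\<^esub> a)" if a: "?Q a" for a
  proof -
    obtain xs where xs: "set xs \<subseteq> carrier M \<times> carrier N" "a = psum T P xs"
      using a by auto
    have "inv\<^bsub>T\<^esub> psum T P xs = psum T P (map (\<lambda>(x, y). (\<ominus>\<^bsub>M\<^esub> x, y)) xs)"
      using xs(1) by (induction xs) (auto simp: T.inv_mult pure_closed cl pure_minus_left)
    then show ?thesis
      using xs by (intro exI[of _ "map (\<lambda>(x, y). (\<ominus>\<^bsub>M\<^esub> x, y)) xs"]) auto
  qed
  obtain c where c: "c \<in> carrier F" "t = K #>\<^bsub>F\<^esub> c"
    using assms by (auto simp: T_eq carrier_FactGroup)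
  then have "Poly_Mapping.keys c \<subseteq> carrier M \<times> carrier N"
    by simp
  then have "?Q (K #>\<^bsub>F\<^esub> c)"
  proof (rule free_Abelian_group_induct)
    show "?Q (K #>\<^bsub>F\<^esub> 0)"
      using q.hom_one by (intro exI[of _ "[]"]) simp
  next
    fix a b :: "('m \<times> 'n) \<Rightarrow>\<^sub>0 int"
    assume ab: "Poly_Mapping.keys a \<subseteq> carrier M \<times> carrier N" "Poly_Mapping.keys b \<subseteq> carrier M \<times> carrier N"
      and Q: "?Q (K #>\<^bsub>F\<^esub> a)" "?Q (K #>\<^bsub>F\<^esub> b)"
    have "K #>\<^bsub>F\<^esub> (a - b) = (K #>\<^bsub>F\<^esub> a) \<otimes>\<^bsub>T\<^esub> inv\<^bsub>T\<^esub> (K #>\<^bsub>F\<^esub> b)"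
      using ab by (intro q_diff) auto
    then show "?Q (K #>\<^bsub>F\<^esub> (a - b))"
      using mult[OF Q(1) inv[OF Q(2)]] by presburger
  next
    fix p assume "p \<in> carrier M \<times> carrier N"
    then show "?Q (K #>\<^bsub>F\<^esub> frag_of p)"
      by (intro exI[of _ "[p]"]) (auto simp: P_eq[symmetric] pure_closed)
  qed
  then show ?thesis
    using c by simp
qed

lemma pure_induct [consumes 1, case_names one pure mult]:
  assumes "t \<in> carrier T"
    and "Q \<one>\<^bsub>T\<^esub>"
    and "\<And>x y. \<lbrakk>x \<in> carrier M; y \<in> carrier N\<rbrakk> \<Longrightarrow> Q (P x y)"
    and "\<And>a b. \<lbrakk>a \<in> carrier T; b \<in> carrier T; Q a; Q b\<rbrakk> \<Longrightarrow> Q (a \<otimes>\<^bsub>T\<^esub> b)"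
  shows "Q t"
proof -
  obtain xs where xs: "set xs \<subseteq> carrier M \<times> carrier N" "t = psum T P xs"
    using pure_psum[OF assms(1)] by auto
  have "psum T P xs \<in> carrier T \<and> Q (psum T P xs)"
    using xs(1) by (induction xs) (auto simp: assms pure_closed)
  then show ?thesis
    using xs by simp
qed

lemma lift_psum:
  assumes "comm_group G" and "balanced S ra la M N G f" and "set xs \<subseteq> carrier M \<times> carrier N"
  shows "tensor_lift S ra la M N G f (psum T P xs) = psum G f xs"
proof -
  interpret G: comm_group G by fact
  have "group_hom T G (tensor_lift S ra la M N G f)"
    by (intro group_hom.intro group_hom_axioms.intro T.is_group G.is_group lift_hom assms)
  from hom_psum[OF this, of xs P] have
    "tensor_lift S ra la M N G f (psum T P xs) = psum G (\<lambda>x y. tensor_lift S ra la M N G f (P x y)) xs"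
    using assms(3) pure_closed T.comm_monoid_axioms by auto
  also have "\<dots> = psum G f xs"
    using assms by (intro psum_cong lift_pure) auto
  finally show ?thesis .
qed

lemma hom_eqI:
  assumes "group G" and "g \<in> hom T G" and "h \<in> hom T G"
    and "\<And>x y. \<lbrakk>x \<in> carrier M; y \<in> carrier N\<rbrakk> \<Longrightarrow> g (P x y) = h (P x y)"
    and "t \<in> carrier T"
  shows "g t = h t"
proof -
  interpret g: group_hom T G g
    by (intro group_hom.intro group_hom_axioms.intro T.is_group assms)
  interpret h: group_hom T G h
    by (intro group_hom.intro group_hom_axioms.intro T.is_group assms)
  show ?thesis
    using assms(5) by (induction t rule: pure_induct) (auto simp: assms(4))
qed

end

section \<open>Noncommutative algebras and tensor products of modules\<close>

text \<open>The locale \<open>algebra\<close> includes commutativity of the product, which fails for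
  \<open>B^e\<close>, its quotient and their tensor products. Here scalars are only asked to pass
  through either factor.\<close>

locale nc_algebra = module + ring M +
  assumes smult_mult_left: "\<lbrakk>a \<in> carrier R; x \<in> carrier M; y \<in> carrier M\<rbrakk> \<Longrightarrow>
      (a \<odot>\<^bsub>M\<^esub> x) \<otimes>\<^bsub>M\<^esub> y = a \<odot>\<^bsub>M\<^esub> (x \<otimes>\<^bsub>M\<^esub> y)"
    and smult_mult_right: "\<lbrakk>a \<in> carrier R; x \<in> carrier M; y \<in> carrier M\<rbrakk> \<Longrightarrow>
      x \<otimes>\<^bsub>M\<^esub> (a \<odot>\<^bsub>M\<^esub> y) = a \<odot>\<^bsub>M\<^esub> (x \<otimes>\<^bsub>M\<^esub> y)"

lemma nc_algebraI:
  assumes "module R M" and "ring M"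
    and "\<And>a x y. \<lbrakk>a \<in> carrier R; x \<in> carrier M; y \<in> carrier M\<rbrakk> \<Longrightarrow>
      (a \<odot>\<^bsub>M\<^esub> x) \<otimes>\<^bsub>M\<^esub> y = a \<odot>\<^bsub>M\<^esub> (x \<otimes>\<^bsub>M\<^esub> y)"
    and "\<And>a x y. \<lbrakk>a \<in> carrier R; x \<in> carrier M; y \<in> carrier M\<rbrakk> \<Longrightarrow>
      x \<otimes>\<^bsub>M\<^esub> (a \<odot>\<^bsub>M\<^esub> y) = a \<odot>\<^bsub>M\<^esub> (x \<otimes>\<^bsub>M\<^esub> y)"
  shows "nc_algebra R M"
  by (intro nc_algebra.intro nc_algebra_axioms.intro assms)

lemma (in algebra) nc_algebra: "nc_algebra R M"
proof (rule nc_algebraI)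
  fix a x y assume h: "a \<in> carrier R" "x \<in> carrier M" "y \<in> carrier M"
  show "x \<otimes>\<^bsub>M\<^esub> (a \<odot>\<^bsub>M\<^esub> y) = a \<odot>\<^bsub>M\<^esub> (x \<otimes>\<^bsub>M\<^esub> y)"
    using h smult_assoc2[of a y x] by (simp add: comm_monoid.m_comm[OF cring.axioms(2)[OF M_cring]])
qed (use M_cring in \<open>auto simp: smult_assoc2 intro: module cring.axioms(1)\<close>)

lemma comm_group_cong:
  assumes "comm_group G" and "carrier H = carrier G" and "monoid.mult H = monoid.mult G" and "\<one>\<^bsub>H\<^esub> = \<one>\<^bsub>G\<^esub>"
  shows "comm_group H"
proof -
  interpret comm_group G by fact
  show ?thesis
    by (rule comm_groupI) (auto simp: assms(2-) m_ac intro: l_inv_ex)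
qed

lemma abelian_group_iff: "abelian_group R \<longleftrightarrow> comm_group (add_monoid R)"
  using abelian_group.a_comm_group
  by (auto simp: abelian_group_def abelian_group_axioms_def abelian_monoid_def comm_group_def)

text \<open>\<open>quot_algebra\<close> copies the operations of the factor ring into a new record
  with scalar multiplication; the ring axioms follow the fields.\<close>

lemma ring_cong:
  assumes "ring R" and "carrier Q = carrier R" and "monoid.mult Q = monoid.mult R" and "\<one>\<^bsub>Q\<^esub> = \<one>\<^bsub>R\<^esub>"
    and "ring.add Q = ring.add R" and "\<zero>\<^bsub>Q\<^esub> = \<zero>\<^bsub>R\<^esub>"
  shows "ring Q"
proof -
  interpret ring R by fact
  have "abelian_group Q"
    unfolding abelian_group_iff by (rule comm_group_cong[OF a_comm_group]) (simp_all add: assms)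
  then show ?thesis
    by (rule ringI) (auto intro!: monoidI simp: assms m_assoc l_distr r_distr)
qed

lemma lin_mapD:
  assumes "f \<in> lin_map k A B"
  shows "x \<in> carrier A \<Longrightarrow> f x \<in> carrier B"
    and "\<lbrakk>x \<in> carrier A; y \<in> carrier A\<rbrakk> \<Longrightarrow> f (x \<oplus>\<^bsub>A\<^esub> y) = f x \<oplus>\<^bsub>B\<^esub> f y"
    and "\<lbrakk>r \<in> carrier k; x \<in> carrier A\<rbrakk> \<Longrightarrow> f (r \<odot>\<^bsub>A\<^esub> x) = r \<odot>\<^bsub>B\<^esub> f x"
  using assms by (auto simp: lin_map_def hom_def)

lemma lin_mapI:
  assumes "\<And>x. x \<in> carrier A \<Longrightarrow> f x \<in> carrier B"
    and "\<And>x y. \<lbrakk>x \<in> carrier A; y \<in> carrier A\<rbrakk> \<Longrightarrow> f (x \<oplus>\<^bsub>A\<^esub> y) = f x \<oplus>\<^bsub>B\<^esub> f y"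
    and "\<And>r x. \<lbrakk>r \<in> carrier k; x \<in> carrier A\<rbrakk> \<Longrightarrow> f (r \<odot>\<^bsub>A\<^esub> x) = r \<odot>\<^bsub>B\<^esub> f x"
  shows "f \<in> lin_map k A B"
  using assms by (auto simp: lin_map_def hom_def)

lemma alg_homD:
  assumes "f \<in> alg_hom k A B"
  shows "f \<in> ring_hom A B" and "f \<in> lin_map k A B"
    and "\<lbrakk>x \<in> carrier A; y \<in> carrier A\<rbrakk> \<Longrightarrow> f (x \<otimes>\<^bsub>A\<^esub> y) = f x \<otimes>\<^bsub>B\<^esub> f y"
    and "f \<one>\<^bsub>A\<^esub> = \<one>\<^bsub>B\<^esub>"
  using assms by (auto simp: alg_hom_def ring_hom_def lin_map_def hom_def)

lemma alg_homI:
  assumes "f \<in> lin_map k A B"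
    and "\<And>x y. \<lbrakk>x \<in> carrier A; y \<in> carrier A\<rbrakk> \<Longrightarrow> f (x \<otimes>\<^bsub>A\<^esub> y) = f x \<otimes>\<^bsub>B\<^esub> f y"
    and "f \<one>\<^bsub>A\<^esub> = \<one>\<^bsub>B\<^esub>"
  shows "f \<in> alg_hom k A B"
  using assms by (auto simp: alg_hom_def ring_hom_def lin_map_def hom_def)

section \<open>Tensor products of modules over the ground ring\<close>

abbreviation kbalanced ::
  "('k, 'w) ring_scheme \<Rightarrow> ('k, 'm, 'x) module_scheme \<Rightarrow> ('k, 'n, 'y) module_scheme
    \<Rightarrow> ('g, 'z) monoid_scheme \<Rightarrow> ('m \<Rightarrow> 'n \<Rightarrow> 'g) \<Rightarrow> bool"
  where "kbalanced k M N \<equiv> balanced (carrier k) (\<lambda>x r. r \<odot>\<^bsub>M\<^esub> x) (\<lambda>r y. r \<odot>\<^bsub>N\<^esub> y) M N"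

locale module_pair = Mm: module k M + Nm: module k N
  for k :: "('k, 'w) ring_scheme" and M :: "('k, 'm, 'x) module_scheme"
    and N :: "('k, 'n, 'y) module_scheme"
begin

abbreviation TA where "TA \<equiv> tensor_algebra k M N"
abbreviation KT where "KT \<equiv> ktensor_group k M N"

sublocale kt: tensor_product "carrier k" "\<lambda>x r. r \<odot>\<^bsub>M\<^esub> x" "\<lambda>r y. r \<odot>\<^bsub>N\<^esub> y" M N
  by unfold_locales auto

lemma TA_simps [simp]:
  "carrier TA = carrier KT" "ring.zero TA = \<one>\<^bsub>KT\<^esub>" "ring.add TA = monoid.mult KT"
  "\<one>\<^bsub>TA\<^esub> = kpure k M N \<one>\<^bsub>M\<^esub> \<one>\<^bsub>N\<^esub>"
  by (simp_all add: tensor_algebra_def)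

lemma comm_group_KT: "comm_group KT"
  unfolding ktensor_group_def by (rule kt.comm_group_T)

lemma TA_abelian_group: "abelian_group TA"
  unfolding abelian_group_iff by (rule comm_group_cong[OF comm_group_KT]) auto

sublocale TA: abelian_group TA
  by (rule TA_abelian_group)

lemma kpure_closed: "\<lbrakk>x \<in> carrier M; y \<in> carrier N\<rbrakk> \<Longrightarrow> kpure k M N x y \<in> carrier TA"
  using kt.pure_closed by (simp add: ktensor_group_def kpure_def)

lemma kpure_add_left:
  "\<lbrakk>x \<in> carrier M; x' \<in> carrier M; y \<in> carrier N\<rbrakk> \<Longrightarrow>
    kpure k M N (x \<oplus>\<^bsub>M\<^esub> x') y = kpure k M N x y \<oplus>\<^bsub>TA\<^esub> kpure k M N x' y"
  using kt.pure_add_left by (simp add: ktensor_group_def kpure_def)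

lemma kpure_add_right:
  "\<lbrakk>x \<in> carrier M; y \<in> carrier N; y' \<in> carrier N\<rbrakk> \<Longrightarrow>
    kpure k M N x (y \<oplus>\<^bsub>N\<^esub> y') = kpure k M N x y \<oplus>\<^bsub>TA\<^esub> kpure k M N x y'"
  using kt.pure_add_right by (simp add: ktensor_group_def kpure_def)

lemma kpure_middle:
  "\<lbrakk>x \<in> carrier M; r \<in> carrier k; y \<in> carrier N\<rbrakk> \<Longrightarrow>
    kpure k M N (r \<odot>\<^bsub>M\<^esub> x) y = kpure k M N x (r \<odot>\<^bsub>N\<^esub> y)"
  using kt.pure_middle by (simp add: kpure_def)

lemma psum_add_monoid: "psum (add_monoid TA) = psum KT"
  by (simp add: psum_def fun_eq_iff)

lemma kpure_psum:
  "t \<in> carrier TA \<Longrightarrow> \<exists>xs. set xs \<subseteq> carrier M \<times> carrier N \<and> t = psum (add_monoid TA) (kpure k M N) xs"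
  using kt.pure_psum unfolding psum_add_monoid by (simp add: kpure_def ktensor_group_def)

lemma kpure_induct [consumes 1, case_names zero pure add]:
  assumes "t \<in> carrier TA"
    and "Q \<zero>\<^bsub>TA\<^esub>"
    and "\<And>x y. \<lbrakk>x \<in> carrier M; y \<in> carrier N\<rbrakk> \<Longrightarrow> Q (kpure k M N x y)"
    and "\<And>a b. \<lbrakk>a \<in> carrier TA; b \<in> carrier TA; Q a; Q b\<rbrakk> \<Longrightarrow> Q (a \<oplus>\<^bsub>TA\<^esub> b)"
  shows "Q t"
  using kt.pure_induct[of t Q] assms by (simp add: kpure_def ktensor_group_def)

lemma hom_add_monoid: "hom (add_monoid TA) G = hom KT G"
  by (simp add: hom_def)

lemma klift_hom:
  "comm_group G \<Longrightarrow> kbalanced k M N G f \<Longrightarrow> klift k M N G f \<in> hom (add_monoid TA) G"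
  using kt.lift_hom unfolding hom_add_monoid by (simp add: klift_def ktensor_group_def)

lemma klift_pure:
  "comm_group G \<Longrightarrow> kbalanced k M N G f \<Longrightarrow> x \<in> carrier M \<Longrightarrow> y \<in> carrier N \<Longrightarrow>
    klift k M N G f (kpure k M N x y) = f x y"
  using kt.lift_pure by (simp add: klift_def kpure_def)

lemma klift_psum:
  "comm_group G \<Longrightarrow> kbalanced k M N G f \<Longrightarrow> set xs \<subseteq> carrier M \<times> carrier N \<Longrightarrow>
    klift k M N G f (psum (add_monoid TA) (kpure k M N) xs) = psum G f xs"
  using kt.lift_psum unfolding psum_add_monoid by (simp add: klift_def kpure_def ktensor_group_def)

lemma tensor_hom_eqI:
  assumes "group G" and "g \<in> hom (add_monoid TA) G" and "h \<in> hom (add_monoid TA) G"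
    and "\<And>x y. \<lbrakk>x \<in> carrier M; y \<in> carrier N\<rbrakk> \<Longrightarrow> g (kpure k M N x y) = h (kpure k M N x y)"
    and "t \<in> carrier TA"
  shows "g t = h t"
  using kt.hom_eqI[of G g h t] assms unfolding hom_add_monoid by (simp add: kpure_def ktensor_group_def)

text \<open>The target of a lift enters only through \<open>hom\<close>, that is through its carrier
  and its product, and these agree for \<open>KT\<close> and \<open>add_monoid TA\<close>. The
  definitions use the first, the ring calculus the second.\<close>

lemma klift_KT: "klift k M N KT f = klift k M N (add_monoid TA) f"
  by (simp add: klift_def tensor_lift_def hom_def)

end

lemma add_hom_zero:
  assumes "abelian_group A" and "abelian_group B" and "f \<in> hom (add_monoid A) (add_monoid B)"
  shows "f \<zero>\<^bsub>A\<^esub> = \<zero>\<^bsub>B\<^esub>"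
proof -
  interpret A: abelian_group A by fact
  interpret B: abelian_group B by fact
  interpret group_hom "add_monoid A" "add_monoid B" f
    by (intro group_hom.intro group_hom_axioms.intro A.a_group B.a_group assms)
  show ?thesis using hom_one by simp
qed

lemma add_homD:
  assumes "f \<in> hom (add_monoid A) G"
  shows "x \<in> carrier A \<Longrightarrow> f x \<in> carrier G"
    and "\<lbrakk>x \<in> carrier A; y \<in> carrier A\<rbrakk> \<Longrightarrow> f (x \<oplus>\<^bsub>A\<^esub> y) = f x \<otimes>\<^bsub>G\<^esub> f y"
  using hom_in_carrier[OF assms, of x] hom_mult[OF assms, of x y] by simp_all

context module_pair
begin

lemmas TA_a_comm_group = TA.a_comm_group

lemma smult_balanced:
  "r \<in> carrier k \<Longrightarrow> kbalanced k M N (add_monoid TA) (\<lambda>x y. kpure k M N (r \<odot>\<^bsub>M\<^esub> x) y)"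
  by (rule balancedI)
    (auto simp: kpure_closed[simplified] kpure_add_left[simplified] kpure_add_right[simplified]
      kpure_middle Mm.smult_r_distr Nm.smult_r_distr
      Mm.smult_assoc1[symmetric] Mm.m_comm simp flip: Nm.smult_assoc1)

lemma TA_smult_eq:
  "r \<odot>\<^bsub>TA\<^esub> t = klift k M N (add_monoid TA) (\<lambda>x y. kpure k M N (r \<odot>\<^bsub>M\<^esub> x) y) t"
  unfolding tensor_algebra_def[of k M N] using klift_KT by (simp add: tensor_algebra_def)

lemma TA_smult_hom: "r \<in> carrier k \<Longrightarrow> (\<lambda>t. r \<odot>\<^bsub>TA\<^esub> t) \<in> hom (add_monoid TA) (add_monoid TA)"
  unfolding TA_smult_eq using klift_hom[OF TA_a_comm_group smult_balanced] by (simp add: eta_contract_eq)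

lemma TA_smult_pure:
  "\<lbrakk>r \<in> carrier k; x \<in> carrier M; y \<in> carrier N\<rbrakk> \<Longrightarrow>
    r \<odot>\<^bsub>TA\<^esub> kpure k M N x y = kpure k M N (r \<odot>\<^bsub>M\<^esub> x) y"
  unfolding TA_smult_eq by (rule klift_pure[OF TA_a_comm_group smult_balanced])

lemma TA_smult_closed: "\<lbrakk>r \<in> carrier k; t \<in> carrier TA\<rbrakk> \<Longrightarrow> r \<odot>\<^bsub>TA\<^esub> t \<in> carrier TA"
  using add_homD(1)[OF TA_smult_hom] by simp

lemma TA_smult_add:
  "\<lbrakk>r \<in> carrier k; s \<in> carrier TA; t \<in> carrier TA\<rbrakk> \<Longrightarrow>
    r \<odot>\<^bsub>TA\<^esub> (s \<oplus>\<^bsub>TA\<^esub> t) = r \<odot>\<^bsub>TA\<^esub> s \<oplus>\<^bsub>TA\<^esub> r \<odot>\<^bsub>TA\<^esub> t"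
  using add_homD(2)[OF TA_smult_hom] by simp

lemma TA_smult_zero: "r \<in> carrier k \<Longrightarrow> r \<odot>\<^bsub>TA\<^esub> \<zero>\<^bsub>TA\<^esub> = \<zero>\<^bsub>TA\<^esub>"
  using add_hom_zero[OF TA_abelian_group TA_abelian_group TA_smult_hom] .

lemma TA_module: "module k TA"
proof (rule moduleI)
  fix a b t assume h: "a \<in> carrier k" "b \<in> carrier k" and t: "t \<in> carrier TA"
  show "(a \<oplus>\<^bsub>k\<^esub> b) \<odot>\<^bsub>TA\<^esub> t = a \<odot>\<^bsub>TA\<^esub> t \<oplus>\<^bsub>TA\<^esub> b \<odot>\<^bsub>TA\<^esub> t"
    using t
  proof (induction rule: kpure_induct)
    case zero
    show ?case using h by (simp only: TA_smult_zero TA.l_zero TA.zero_closed Mm.R.a_closed)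
  next
    case (pure x y)
    then show ?case
      using h by (simp only: TA_smult_pure Mm.R.a_closed Mm.smult_l_distr kpure_add_left Mm.smult_closed)
  next
    case (add s u)
    then show ?case
      using h by (simp only: TA_smult_add Mm.R.a_closed TA.a_ac TA_smult_closed TA.a_closed)
  qed
  show "(a \<otimes>\<^bsub>k\<^esub> b) \<odot>\<^bsub>TA\<^esub> t = a \<odot>\<^bsub>TA\<^esub> (b \<odot>\<^bsub>TA\<^esub> t)"
    using t
  proof (induction rule: kpure_induct)
    case zero
    show ?case using h by (simp only: TA_smult_zero Mm.R.m_closed)
  next
    case (pure x y)
    then show ?case
      using h by (simp only: TA_smult_pure Mm.R.m_closed Mm.smult_assoc1 Mm.smult_closed)
  next
    case (add s u)
    then show ?case
      using h by (simp only: TA_smult_add Mm.R.m_closed TA_smult_closed)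
  qed
next
  fix t assume "t \<in> carrier TA"
  then show "\<one>\<^bsub>k\<^esub> \<odot>\<^bsub>TA\<^esub> t = t"
  proof (induction rule: kpure_induct)
    case zero
    show ?case by (simp only: TA_smult_zero Mm.R.one_closed)
  next
    case (pure x y)
    then show ?case
      by (simp only: TA_smult_pure Mm.R.one_closed Mm.smult_one)
  next
    case (add s u)
    then show ?case
      by (simp only: TA_smult_add Mm.R.one_closed)
  qed
qed (intro Mm.is_cring TA_abelian_group TA_smult_closed TA_smult_add; assumption)+

lemma klift_add:
  "\<lbrakk>comm_group G; kbalanced k M N G f; s \<in> carrier TA; t \<in> carrier TA\<rbrakk> \<Longrightarrow>
    klift k M N G f (s \<oplus>\<^bsub>TA\<^esub> t) = klift k M N G f s \<otimes>\<^bsub>G\<^esub> klift k M N G f t"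
  by (rule add_homD(2)[OF klift_hom])

lemma klift_closed:
  "\<lbrakk>comm_group G; kbalanced k M N G f; t \<in> carrier TA\<rbrakk> \<Longrightarrow> klift k M N G f t \<in> carrier G"
  by (rule add_homD(1)[OF klift_hom])

lemma klift_zero:
  assumes G: "comm_group G" and f: "kbalanced k M N G f"
  shows "klift k M N G f \<zero>\<^bsub>TA\<^esub> = \<one>\<^bsub>G\<^esub>"
  using hom_one[OF klift_hom[OF G f] TA.a_group comm_group.axioms(2)[OF G]] by simp

text \<open>Additivity of a lift in a parameter: \<open>f\<close>, \<open>g\<close> and
  \<open>e\<close> will be one trilinear map with the spare variable at z, z' and their sum.
  \<open>klift_smult\<close> is the companion for scalars.\<close>

lemma klift_dist:
  assumes G: "comm_group G" and f: "kbalanced k M N G f" and g: "kbalanced k M N G g"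
    and e: "kbalanced k M N G e"
    and eq: "\<And>x y. \<lbrakk>x \<in> carrier M; y \<in> carrier N\<rbrakk> \<Longrightarrow> e x y = f x y \<otimes>\<^bsub>G\<^esub> g x y"
    and t: "t \<in> carrier TA"
  shows "klift k M N G e t = klift k M N G f t \<otimes>\<^bsub>G\<^esub> klift k M N G g t"
proof -
  interpret G: comm_group G by (rule G)
  show ?thesis
    using t
  proof (induction rule: kpure_induct)
    case zero
    show ?case by (simp only: klift_zero[OF G] f g e G.l_one G.one_closed)
  next
    case (pure x y)
    then show ?case by (simp only: klift_pure[OF G] f g e eq)
  next
    case (add s t)
    then show ?case
      by (simp only: klift_add[OF G] klift_closed[OF G] f g e G.m_ac G.m_closed)
  qed
qed

lemma klift_smult:
  assumes G: "comm_group G" and f: "kbalanced k M N G f" and e: "kbalanced k M N G e"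
    and r: "r \<in> carrier k"
    and eq: "\<And>x y. \<lbrakk>x \<in> carrier M; y \<in> carrier N\<rbrakk> \<Longrightarrow> e x y = f (r \<odot>\<^bsub>M\<^esub> x) y"
    and t: "t \<in> carrier TA"
  shows "klift k M N G e t = klift k M N G f (r \<odot>\<^bsub>TA\<^esub> t)"
  using t
proof (induction rule: kpure_induct)
  case zero
  show ?case using r by (simp only: klift_zero[OF G] f e TA_smult_zero)
next
  case (pure x y)
  then show ?case using r by (simp only: klift_pure[OF G] f e eq TA_smult_pure Mm.smult_closed)
next
  case (add s t)
  then show ?case using r by (simp only: klift_add[OF G] f e TA_smult_add TA_smult_closed)
qed

text \<open>Currying: a trilinear map lifted in two variables stays bilinear in the tensor and the
  remaining variable. A scalar travels from the third variable to the second by \<open>b2\<close>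
  and to the first by \<open>b1\<close>. Both this and \<open>balanced_klift_right\<close> are
  needed for coassociativity, where lifts are nested.\<close>

lemma balanced_klift_left:
  assumes G: "comm_group G" and L: "module k L"
    and b1: "\<And>z. z \<in> carrier L \<Longrightarrow> kbalanced k M N G (\<lambda>x y. g x y z)"
    and b2: "\<And>x. x \<in> carrier M \<Longrightarrow> kbalanced k N L G (\<lambda>y z. g x y z)"
  shows "kbalanced k TA L G (\<lambda>t z. klift k M N G (\<lambda>x y. g x y z) t)"
proof
  interpret L: module k L by (rule L)
  fix t z z' assume "t \<in> carrier TA" "z \<in> carrier L" "z' \<in> carrier L"
  then show "klift k M N G (\<lambda>x y. g x y (z \<oplus>\<^bsub>L\<^esub> z')) t =
      klift k M N G (\<lambda>x y. g x y z) t \<otimes>\<^bsub>G\<^esub> klift k M N G (\<lambda>x y. g x y z') t"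
    using balancedD(3)[OF b2] by (intro klift_dist G b1) auto
next
  interpret L: module k L by (rule L)
  fix t r z assume h: "t \<in> carrier TA" "r \<in> carrier k" "z \<in> carrier L"
  show "klift k M N G (\<lambda>x y. g x y z) (r \<odot>\<^bsub>TA\<^esub> t) = klift k M N G (\<lambda>x y. g x y (r \<odot>\<^bsub>L\<^esub> z)) t"
    using h balancedD(4)[OF b2] balancedD(4)[OF b1] by (intro klift_smult[symmetric] G b1) auto
qed (intro klift_closed klift_add G b1; assumption)+

lemma balanced_klift_right:
  assumes G: "comm_group G" and L: "module k L"
    and b1: "\<And>z. z \<in> carrier N \<Longrightarrow> kbalanced k L M G (\<lambda>x y. g x y z)"
    and b2: "\<And>x. x \<in> carrier L \<Longrightarrow> kbalanced k M N G (\<lambda>y z. g x y z)"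
  shows "kbalanced k L TA G (\<lambda>x t. klift k M N G (\<lambda>y z. g x y z) t)"
proof
  interpret L: module k L by (rule L)
  fix x x' t assume "x \<in> carrier L" "x' \<in> carrier L" "t \<in> carrier TA"
  then show "klift k M N G (\<lambda>y z. g (x \<oplus>\<^bsub>L\<^esub> x') y z) t =
      klift k M N G (\<lambda>y z. g x y z) t \<otimes>\<^bsub>G\<^esub> klift k M N G (\<lambda>y z. g x' y z) t"
    using balancedD(2)[OF b1] by (intro klift_dist G b2) auto
next
  interpret L: module k L by (rule L)
  fix x r t assume h: "x \<in> carrier L" "r \<in> carrier k" "t \<in> carrier TA"
  show "klift k M N G (\<lambda>y z. g (r \<odot>\<^bsub>L\<^esub> x) y z) t = klift k M N G (\<lambda>y z. g x y z) (r \<odot>\<^bsub>TA\<^esub> t)"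
    using h balancedD(4)[OF b1] by (intro klift_smult G b2) auto
qed (intro klift_closed klift_add G b2; assumption)+

end

section \<open>The algebra structure on the tensor product of two algebras\<close>

locale nc_algebra_pair = Ma: nc_algebra k M + Na: nc_algebra k N
  for k :: "('k, 'w) ring_scheme" and M :: "('k, 'm, 'x) module_scheme"
    and N :: "('k, 'n, 'y) module_scheme"
begin

sublocale module_pair k M N
  by unfold_locales

text \<open>This is left multiplication by the pure tensor of \<open>a\<close> and \<open>b\<close>.
  The product of \<open>TA\<close> is obtained by lifting it once more, in the pair (a, b).\<close>

abbreviation inner where
  "inner a b \<equiv> klift k M N (add_monoid TA) (\<lambda>c d. kpure k M N (a \<otimes>\<^bsub>M\<^esub> c) (b \<otimes>\<^bsub>N\<^esub> d))"

lemma inner_balanced: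
  "\<lbrakk>a \<in> carrier M; b \<in> carrier N\<rbrakk> \<Longrightarrow>
    kbalanced k M N (add_monoid TA) (\<lambda>c d. kpure k M N (a \<otimes>\<^bsub>M\<^esub> c) (b \<otimes>\<^bsub>N\<^esub> d))"
  by (rule balancedI)
    (auto simp: kpure_closed[simplified] kpure_add_left[simplified] kpure_add_right[simplified]
      kpure_middle Ma.r_distr Na.r_distr Ma.smult_mult_right Na.smult_mult_right)

lemmas inner_hom = klift_hom[OF TA_a_comm_group inner_balanced]
  and inner_pure = klift_pure[OF TA_a_comm_group inner_balanced]

lemma inner_closed: "\<lbrakk>a \<in> carrier M; b \<in> carrier N; t \<in> carrier TA\<rbrakk> \<Longrightarrow> inner a b t \<in> carrier TA"
  using add_homD(1)[OF inner_hom] by simp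

lemma inner_add: "\<lbrakk>a \<in> carrier M; b \<in> carrier N; s \<in> carrier TA; t \<in> carrier TA\<rbrakk> \<Longrightarrow>
    inner a b (s \<oplus>\<^bsub>TA\<^esub> t) = inner a b s \<oplus>\<^bsub>TA\<^esub> inner a b t"
  using add_homD(2)[OF inner_hom] by simp

lemma inner_zero: "\<lbrakk>a \<in> carrier M; b \<in> carrier N\<rbrakk> \<Longrightarrow> inner a b \<zero>\<^bsub>TA\<^esub> = \<zero>\<^bsub>TA\<^esub>"
  by (rule add_hom_zero[OF TA_abelian_group TA_abelian_group inner_hom])

lemma outer_balanced:
  assumes t: "t \<in> carrier TA"
  shows "kbalanced k M N (add_monoid TA) (\<lambda>a b. inner a b t)"
proof
  fix a a' b assume h: "a \<in> carrier M" "a' \<in> carrier M" "b \<in> carrier N"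
  have "inner (a \<oplus>\<^bsub>M\<^esub> a') b t = inner a b t \<oplus>\<^bsub>TA\<^esub> inner a' b t"
    using t
  proof (induction rule: kpure_induct)
    case zero
    show ?case using h by (simp only: inner_zero Ma.M.a_closed TA.l_zero TA.zero_closed)
  next
    case (pure x y)
    then show ?case
      using h by (simp only: inner_pure Ma.M.a_closed Ma.l_distr kpure_add_left Ma.m_closed Na.m_closed)
  next
    case (add s u)
    then show ?case
      using h by (simp only: inner_add Ma.M.a_closed TA.a_ac TA.a_closed inner_closed)
  qed
  then show "inner (a \<oplus>\<^bsub>M\<^esub> a') b t = inner a b t \<otimes>\<^bsub>add_monoid TA\<^esub> inner a' b t" by simp
next
  fix a b b' assume h: "a \<in> carrier M" "b \<in> carrier N" "b' \<in> carrier N"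
  have "inner a (b \<oplus>\<^bsub>N\<^esub> b') t = inner a b t \<oplus>\<^bsub>TA\<^esub> inner a b' t"
    using t
  proof (induction rule: kpure_induct)
    case zero
    show ?case using h by (simp only: inner_zero Na.M.a_closed TA.l_zero TA.zero_closed)
  next
    case (pure x y)
    then show ?case
      using h by (simp only: inner_pure Na.M.a_closed Na.l_distr kpure_add_right Ma.m_closed Na.m_closed)
  next
    case (add s u)
    then show ?case
      using h by (simp only: inner_add Na.M.a_closed TA.a_ac TA.a_closed inner_closed)
  qed
  then show "inner a (b \<oplus>\<^bsub>N\<^esub> b') t = inner a b t \<otimes>\<^bsub>add_monoid TA\<^esub> inner a b' t" by simp
next
  fix a r b assume h: "a \<in> carrier M" "r \<in> carrier k" "b \<in> carrier N"
  show "inner (r \<odot>\<^bsub>M\<^esub> a) b t = inner a (r \<odot>\<^bsub>N\<^esub> b) t"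
    using t
  proof (induction rule: kpure_induct)
    case zero
    show ?case using h by (simp only: inner_zero Ma.smult_closed Na.smult_closed)
  next
    case (pure x y)
    then show ?case
      using h by (simp only: inner_pure Ma.smult_closed Na.smult_closed Ma.smult_mult_left
          Na.smult_mult_left kpure_middle Ma.m_closed Na.m_closed)
  next
    case (add s u)
    then show ?case
      using h by (simp only: inner_add Ma.smult_closed Na.smult_closed)
  qed
qed (use inner_closed t in simp)

lemma TA_mult_eq: "s \<otimes>\<^bsub>TA\<^esub> t = klift k M N (add_monoid TA) (\<lambda>a b. inner a b t) s"
proof -
  have "monoid.mult TA = (\<lambda>s t. klift k M N KT (\<lambda>a b. klift k M N KT
      (\<lambda>c d. kpure k M N (a \<otimes>\<^bsub>M\<^esub> c) (b \<otimes>\<^bsub>N\<^esub> d)) t) s)"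
    by (simp add: tensor_algebra_def)
  then show ?thesis
    by (simp only: klift_KT)
qed

lemma TA_mult_hom:
  "t \<in> carrier TA \<Longrightarrow> (\<lambda>s. s \<otimes>\<^bsub>TA\<^esub> t) \<in> hom (add_monoid TA) (add_monoid TA)"
  unfolding TA_mult_eq using klift_hom[OF TA_a_comm_group outer_balanced] by (simp add: eta_contract_eq)

lemma TA_mult_closed: "\<lbrakk>s \<in> carrier TA; t \<in> carrier TA\<rbrakk> \<Longrightarrow> s \<otimes>\<^bsub>TA\<^esub> t \<in> carrier TA"
  using add_homD(1)[OF TA_mult_hom] by simp

lemma TA_l_distr: "\<lbrakk>s \<in> carrier TA; s' \<in> carrier TA; t \<in> carrier TA\<rbrakk> \<Longrightarrow>
    (s \<oplus>\<^bsub>TA\<^esub> s') \<otimes>\<^bsub>TA\<^esub> t = s \<otimes>\<^bsub>TA\<^esub> t \<oplus>\<^bsub>TA\<^esub> s' \<otimes>\<^bsub>TA\<^esub> t"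
  using add_homD(2)[OF TA_mult_hom] by simp

lemma TA_l_null: "t \<in> carrier TA \<Longrightarrow> \<zero>\<^bsub>TA\<^esub> \<otimes>\<^bsub>TA\<^esub> t = \<zero>\<^bsub>TA\<^esub>"
  using add_hom_zero[OF TA_abelian_group TA_abelian_group TA_mult_hom] .

lemma TA_pure_mult: "\<lbrakk>a \<in> carrier M; b \<in> carrier N; t \<in> carrier TA\<rbrakk> \<Longrightarrow>
    kpure k M N a b \<otimes>\<^bsub>TA\<^esub> t = inner a b t"
  unfolding TA_mult_eq by (rule klift_pure[OF TA_a_comm_group outer_balanced])

lemma kpure_mult: "\<lbrakk>a \<in> carrier M; b \<in> carrier N; c \<in> carrier M; d \<in> carrier N\<rbrakk> \<Longrightarrow>
    kpure k M N a b \<otimes>\<^bsub>TA\<^esub> kpure k M N c d = kpure k M N (a \<otimes>\<^bsub>M\<^esub> c) (b \<otimes>\<^bsub>N\<^esub> d)"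
  by (simp only: TA_pure_mult kpure_closed inner_pure)

lemma TA_r_distr:
  assumes "s \<in> carrier TA" "t \<in> carrier TA" "t' \<in> carrier TA"
  shows "s \<otimes>\<^bsub>TA\<^esub> (t \<oplus>\<^bsub>TA\<^esub> t') = s \<otimes>\<^bsub>TA\<^esub> t \<oplus>\<^bsub>TA\<^esub> s \<otimes>\<^bsub>TA\<^esub> t'"
  using assms(1)
proof (induction rule: kpure_induct)
  case zero
  show ?case using assms(2,3) by (simp only: TA_l_null TA.a_closed TA.l_zero TA.zero_closed)
next
  case (pure x y)
  then show ?case using assms(2,3) by (simp only: TA_pure_mult inner_add TA.a_closed)
next
  case (add a b)
  then show ?case
    using assms(2,3) by (simp only: TA_l_distr TA.a_closed TA.a_ac TA_mult_closed)
qed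

lemma TA_r_null:
  assumes "s \<in> carrier TA" shows "s \<otimes>\<^bsub>TA\<^esub> \<zero>\<^bsub>TA\<^esub> = \<zero>\<^bsub>TA\<^esub>"
  using TA_r_distr[OF assms TA.zero_closed TA.zero_closed] TA_mult_closed[OF assms TA.zero_closed]
  by (metis TA.add.l_cancel_one' TA.l_zero TA.zero_closed)

text \<open>Both sides are additive in each of the three arguments, so everything reduces to pure
  tensors, where associativity holds in each leg.\<close>

lemma TA_assoc:
  assumes "s \<in> carrier TA" "t \<in> carrier TA" "u \<in> carrier TA"
  shows "s \<otimes>\<^bsub>TA\<^esub> t \<otimes>\<^bsub>TA\<^esub> u = s \<otimes>\<^bsub>TA\<^esub> (t \<otimes>\<^bsub>TA\<^esub> u)"
  using assms(1)
proof (induction rule: kpure_induct)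
  case zero
  show ?case using assms(2,3) by (simp only: TA_l_null TA_mult_closed)
next
  case (add a b)
  then show ?case
    using assms(2,3) by (simp only: TA_l_distr TA_mult_closed)
next
  case xy: (pure x y)
  note xy' = kpure_closed[OF this]
  show ?case
    using assms(2)
  proof (induction rule: kpure_induct)
    case zero
    show ?case using xy' assms(3) by (simp only: TA_l_null TA_r_null)
  next
    case (add a b)
    then show ?case
      using xy' assms(3) by (simp only: TA_l_distr TA_r_distr TA_mult_closed)
  next
    case zw: (pure z w)
    note zw' = kpure_closed[OF this]
    show ?case
      using assms(3)
    proof (induction rule: kpure_induct)
      case zero
      show ?case using xy' zw' by (simp only: TA_r_null TA_mult_closed)
    next
      case (add a b)
      then show ?case
        using xy' zw' by (simp only: TA_r_distr TA_mult_closed)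
    next
      case (pure a b)
      then show ?case
        using xy zw by (simp only: kpure_mult Ma.m_assoc Na.m_assoc Ma.m_closed Na.m_closed)
    qed
  qed
qed

lemma TA_one_closed: "\<one>\<^bsub>TA\<^esub> \<in> carrier TA"
  using kpure_closed[of "\<one>\<^bsub>M\<^esub>" "\<one>\<^bsub>N\<^esub>"] by simp

lemma TA_l_one: "s \<in> carrier TA \<Longrightarrow> \<one>\<^bsub>TA\<^esub> \<otimes>\<^bsub>TA\<^esub> s = s"
proof (induction rule: kpure_induct)
  case zero
  show ?case by (simp only: TA_r_null TA_one_closed)
next
  case (add a b)
  then show ?case by (simp only: TA_r_distr TA_one_closed)
next
  case (pure x y)
  then show ?case
    by (simp only: TA_simps(4) kpure_mult Ma.one_closed Na.one_closed Ma.l_one Na.l_one)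
qed

lemma TA_r_one: "s \<in> carrier TA \<Longrightarrow> s \<otimes>\<^bsub>TA\<^esub> \<one>\<^bsub>TA\<^esub> = s"
proof (induction rule: kpure_induct)
  case zero
  show ?case by (simp only: TA_l_null TA_one_closed)
next
  case (add a b)
  then show ?case by (simp only: TA_l_distr TA_one_closed)
next
  case (pure x y)
  then show ?case
    by (simp only: TA_simps(4) kpure_mult Ma.one_closed Na.one_closed Ma.r_one Na.r_one)
qed

lemma TA_ring: "ring TA"
  by (intro ringI monoidI TA_abelian_group TA_mult_closed TA_assoc TA_l_one TA_r_one TA_one_closed
      TA_l_distr TA_r_distr; assumption)

lemma TA_nc_algebra: "nc_algebra k TA"
proof (rule nc_algebraI[OF TA_module TA_ring])
  fix a s t assume a: "a \<in> carrier k" and s: "s \<in> carrier TA" and t: "t \<in> carrier TA"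
  show "(a \<odot>\<^bsub>TA\<^esub> s) \<otimes>\<^bsub>TA\<^esub> t = a \<odot>\<^bsub>TA\<^esub> (s \<otimes>\<^bsub>TA\<^esub> t)"
    using s
  proof (induction rule: kpure_induct)
    case zero
    show ?case using a t by (simp only: TA_smult_zero TA_l_null)
  next
    case (add x y)
    then show ?case
      using a t by (simp only: TA_l_distr TA_smult_add TA_smult_closed TA_mult_closed)
  next
    case xy: (pure x y)
    note xy' = kpure_closed[OF this]
    show ?case
      using t
    proof (induction rule: kpure_induct)
      case zero
      show ?case using xy' a by (simp only: TA_smult_zero TA_smult_closed TA_r_null)
    next
      case (add x y)
      then show ?case
        using a xy' by (simp only: TA_r_distr TA_smult_add TA_smult_closed TA_mult_closed)
    next
      case (pure z w)
      then show ?case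
        using xy a by (simp only: TA_smult_pure kpure_mult Ma.smult_closed Ma.m_closed Na.m_closed
            Ma.smult_mult_left)
    qed
  qed
  show "s \<otimes>\<^bsub>TA\<^esub> (a \<odot>\<^bsub>TA\<^esub> t) = a \<odot>\<^bsub>TA\<^esub> (s \<otimes>\<^bsub>TA\<^esub> t)"
    using s
  proof (induction rule: kpure_induct)
    case zero
    show ?case using a t by (simp only: TA_smult_zero TA_l_null TA_smult_closed)
  next
    case (add x y)
    then show ?case
      using a t by (simp only: TA_l_distr TA_smult_add TA_smult_closed TA_mult_closed)
  next
    case xy: (pure x y)
    note xy' = kpure_closed[OF this]
    show ?case
      using t
    proof (induction rule: kpure_induct)
      case zero
      show ?case using xy' a by (simp only: TA_smult_zero TA_smult_closed TA_r_null)
    next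
      case (add x y)
      then show ?case
        using a xy' by (simp only: TA_r_distr TA_smult_add TA_smult_closed TA_mult_closed)
    next
      case (pure z w)
      then show ?case
        using xy a by (simp only: TA_smult_pure kpure_mult Ma.smult_closed Ma.m_closed Na.m_closed
            Ma.smult_mult_right)
    qed
  qed
qed

sublocale TA: nc_algebra k TA
  by (rule TA_nc_algebra)

end

section \<open>Functoriality of the tensor product\<close>

lemma tensor_map_lin:
  assumes "module_pair k M N" and "module_pair k P Q"
    and f: "f \<in> lin_map k M P" and g: "g \<in> lin_map k N Q"
  shows "tensor_map k M N P Q f g \<in> lin_map k (tensor_algebra k M N) (tensor_algebra k P Q)"
    and "\<lbrakk>x \<in> carrier M; y \<in> carrier N\<rbrakk> \<Longrightarrow>
      tensor_map k M N P Q f g (kpure k M N x y) = kpure k P Q (f x) (g y)"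
proof -
  interpret A: module_pair k M N by fact
  interpret B: module_pair k P Q by fact
  note fD = lin_mapD[OF f] and gD = lin_mapD[OF g]
  have bal: "kbalanced k M N (add_monoid B.TA) (\<lambda>x y. kpure k P Q (f x) (g y))"
    by (rule balancedI)
      (auto simp: fD gD B.kpure_closed[simplified] B.kpure_add_left[simplified]
        B.kpure_add_right[simplified] B.kpure_middle)
  have eq: "tensor_map k M N P Q f g = klift k M N (add_monoid B.TA) (\<lambda>x y. kpure k P Q (f x) (g y))"
    by (simp add: tensor_map_def klift_def tensor_lift_def hom_def)
  have hom: "tensor_map k M N P Q f g \<in> hom (add_monoid A.TA) (add_monoid B.TA)"
    unfolding eq by (rule A.klift_hom[OF B.TA_a_comm_group bal])
  note homD = add_homD[OF hom, simplified partial_object.simps monoid.simps]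
  have pure: "tensor_map k M N P Q f g (kpure k M N x y) = kpure k P Q (f x) (g y)"
    if "x \<in> carrier M" "y \<in> carrier N" for x y
    unfolding eq using that by (rule A.klift_pure[OF B.TA_a_comm_group bal])
  show "\<lbrakk>x \<in> carrier M; y \<in> carrier N\<rbrakk> \<Longrightarrow>
      tensor_map k M N P Q f g (kpure k M N x y) = kpure k P Q (f x) (g y)"
    by (rule pure)
  show "tensor_map k M N P Q f g \<in> lin_map k (tensor_algebra k M N) (tensor_algebra k P Q)"
  proof (rule lin_mapI)
    fix r t assume r: "r \<in> carrier k" and "t \<in> carrier A.TA"
    from this(2)
    show "tensor_map k M N P Q f g (r \<odot>\<^bsub>A.TA\<^esub> t) = r \<odot>\<^bsub>B.TA\<^esub> tensor_map k M N P Q f g t"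
    proof (induction rule: A.kpure_induct)
      case zero
      show ?case
        using r by (simp only: A.TA_smult_zero B.TA_smult_zero add_hom_zero[OF A.TA_abelian_group B.TA_abelian_group hom])
    next
      case (pure x y)
      then show ?case
        using r by (simp only: A.TA_smult_pure B.TA_smult_pure \<open>\<And>x y. \<lbrakk>x \<in> carrier M; y \<in> carrier N\<rbrakk> \<Longrightarrow> tensor_map k M N P Q f g (kpure k M N x y) = kpure k P Q (f x) (g y)\<close> fD gD A.Mm.smult_closed)
    next
      case (add s t)
      then show ?case
        using r by (simp only: A.TA_smult_add B.TA_smult_add A.TA_smult_closed homD)
    qed
  qed (use homD in auto)
qed

lemma tensor_map_alg_hom:
  assumes "nc_algebra_pair k M N" and "nc_algebra_pair k P Q"
    and f: "f \<in> alg_hom k M P" and g: "g \<in> alg_hom k N Q"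
  shows "tensor_map k M N P Q f g \<in> alg_hom k (tensor_algebra k M N) (tensor_algebra k P Q)"
proof -
  interpret A: nc_algebra_pair k M N by fact
  interpret B: nc_algebra_pair k P Q by fact
  let ?t = "tensor_map k M N P Q f g"
  note fD = alg_homD[OF f] and gD = alg_homD[OF g]
  note f' = lin_mapD[OF fD(2)] and g' = lin_mapD[OF gD(2)]
  have lin: "?t \<in> lin_map k A.TA B.TA"
    by (rule tensor_map_lin(1)[OF A.module_pair_axioms B.module_pair_axioms fD(2) gD(2)])
  note tD = lin_mapD[OF lin]
  have pure: "?t (kpure k M N x y) = kpure k P Q (f x) (g y)" if "x \<in> carrier M" "y \<in> carrier N" for x y
    by (rule tensor_map_lin(2)[OF A.module_pair_axioms B.module_pair_axioms fD(2) gD(2) that])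
  have zero: "?t \<zero>\<^bsub>A.TA\<^esub> = \<zero>\<^bsub>B.TA\<^esub>"
    by (rule add_hom_zero[OF A.TA_abelian_group B.TA_abelian_group])
      (use lin in \<open>auto simp: lin_map_def\<close>)
  show ?thesis
  proof (rule alg_homI[OF lin])
    show "?t \<one>\<^bsub>A.TA\<^esub> = \<one>\<^bsub>B.TA\<^esub>"
      by (simp add: pure fD gD)
  next
    fix s t assume s: "s \<in> carrier A.TA" and t: "t \<in> carrier A.TA"
    show "?t (s \<otimes>\<^bsub>A.TA\<^esub> t) = ?t s \<otimes>\<^bsub>B.TA\<^esub> ?t t"
      using s
    proof (induction rule: A.kpure_induct)
      case z: zero
      show ?case using t tD by (simp only: zero A.TA_l_null B.TA_l_null)
    next
      case (add a b)
      then show ?case using t tD by (simp only: A.TA_l_distr B.TA_l_distr A.TA_mult_closed)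
    next
      case xy: (pure x y)
      note xy' = A.kpure_closed[OF this] B.kpure_closed[OF f'(1)[OF this(1)] g'(1)[OF this(2)]]
      show ?case
        using t
      proof (induction rule: A.kpure_induct)
        case z: zero
        show ?case using xy xy' tD by (simp only: zero A.TA_r_null B.TA_r_null)
      next
        case (add a b)
        then show ?case using xy' tD by (simp only: A.TA_r_distr B.TA_r_distr A.TA_mult_closed)
      next
        case zw: (pure z w)
        then show ?case
          using xy by (simp only: A.kpure_mult B.kpure_mult pure fD gD f' g' A.Ma.m_closed A.Na.m_closed)
      qed
    qed
  qed
qed

section \<open>Quotients, endomorphism rings and free algebras\<close>

text \<open>Passes between a commutator relation, stated with a difference, and the subtraction-free
  form xy = [x,y] + yx that is convenient for rewriting.\<close>

lemma minus_eq_iff: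
  assumes "ring R" "a \<in> carrier R" "b \<in> carrier R" "c \<in> carrier R"
  shows "a \<ominus>\<^bsub>R\<^esub> b = c \<longleftrightarrow> a = c \<oplus>\<^bsub>R\<^esub> b"
proof -
  interpret ring R by fact
  show ?thesis using assms(2-) by (auto simp: minus_eq a_assoc l_neg r_neg)
qed

context nc_algebra
begin

lemma smult_eq_mult: "\<lbrakk>a \<in> carrier R; x \<in> carrier M\<rbrakk> \<Longrightarrow> a \<odot>\<^bsub>M\<^esub> x = (a \<odot>\<^bsub>M\<^esub> \<one>\<^bsub>M\<^esub>) \<otimes>\<^bsub>M\<^esub> x"
  by (simp add: smult_mult_left)

lemma smult_one_central:
  "\<lbrakk>a \<in> carrier R; x \<in> carrier M\<rbrakk> \<Longrightarrow> (a \<odot>\<^bsub>M\<^esub> \<one>\<^bsub>M\<^esub>) \<otimes>\<^bsub>M\<^esub> x = x \<otimes>\<^bsub>M\<^esub> (a \<odot>\<^bsub>M\<^esub> \<one>\<^bsub>M\<^esub>)"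
  by (simp add: smult_mult_left smult_mult_right)

text \<open>The scalar map handed to the universal property when its target is itself an algebra
  over the ground ring.\<close>

lemma smult_one_ring_hom: "(\<lambda>a. a \<odot>\<^bsub>M\<^esub> \<one>\<^bsub>M\<^esub>) \<in> ring_hom R M"
  by (rule ring_hom_memI) (simp_all add: smult_l_distr smult_assoc1 smult_mult_left)

lemma ideal_smult: "ideal I M \<Longrightarrow> a \<in> carrier R \<Longrightarrow> x \<in> I \<Longrightarrow> a \<odot>\<^bsub>M\<^esub> x \<in> I"
  using ideal.I_l_closed[of I M x "a \<odot>\<^bsub>M\<^esub> \<one>\<^bsub>M\<^esub>"] smult_eq_mult[of a x] ideal.Icarr[of I M x] by simp

end

text \<open>An arbitrary representative is chosen, so the value is meaningful only if
  \<open>f\<close> is constant on the coset; \<open>quot_fun_proj\<close> provides this for additive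
  maps that kill the ideal.\<close>

definition quot_fun :: "('a \<Rightarrow> 'b) \<Rightarrow> 'a set \<Rightarrow> 'b" where "quot_fun f c = f (SOME x. x \<in> c)"

locale algebra_ideal = nc_algebra R M + ideal I M for R M I
begin

abbreviation Q where "Q \<equiv> quot_algebra M I"
abbreviation proj where "proj x \<equiv> I +>\<^bsub>M\<^esub> x"

lemma Q_simps:
  "carrier Q = carrier (M Quot I)" "monoid.mult Q = monoid.mult (M Quot I)" "\<one>\<^bsub>Q\<^esub> = \<one>\<^bsub>M Quot I\<^esub>"
  "ring.zero Q = ring.zero (M Quot I)" "ring.add Q = ring.add (M Quot I)"
  by (simp_all add: quot_algebra_def)

lemma Q_ring: "ring Q"
  by (rule ring_cong[OF quotient_is_ring]) (simp_all add: Q_simps)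

lemma proj_ring_hom: "proj \<in> ring_hom M Q"
  using rcos_ring_hom unfolding ring_hom_def Q_simps .

lemma proj_closed: "x \<in> carrier M \<Longrightarrow> proj x \<in> carrier Q"
  using ring_hom_closed[OF proj_ring_hom] .

lemma Q_carrierE:
  assumes "c \<in> carrier Q"
  obtains x where "x \<in> carrier M" "c = proj x"
  using assms unfolding Q_simps by (auto simp: FactRing_def A_RCOSETS_def')

lemmas proj_add = ring_hom_add[OF proj_ring_hom]
  and proj_mult = ring_hom_mult[OF proj_ring_hom]
  and proj_one = ring_hom_one[OF proj_ring_hom]

lemma proj_eqI:
  assumes "x \<in> carrier M" "y \<in> carrier M" "x \<ominus>\<^bsub>M\<^esub> y \<in> I"
  shows "proj x = proj y"
  using assms quotient_eq_iff_same_a_r_cos[OF ideal_axioms] by blast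

text \<open>The scalar multiple of a coset is defined as a union over its elements. Since the ideal
  is stable under scalars, all members of this union are one and the same coset, and the union is
  not over the empty set.\<close>

lemma proj_smult:
  assumes r: "r \<in> carrier R" and x: "x \<in> carrier M"
  shows "r \<odot>\<^bsub>Q\<^esub> proj x = proj (r \<odot>\<^bsub>M\<^esub> x)"
proof -
  have const: "proj (r \<odot>\<^bsub>M\<^esub> y) = proj (r \<odot>\<^bsub>M\<^esub> x)" if y: "y \<in> proj x" for y
  proof -
    obtain i where i: "i \<in> I" "y = i \<oplus>\<^bsub>M\<^esub> x"
      using y by (auto simp: a_r_coset_def')
    have "r \<odot>\<^bsub>M\<^esub> y \<ominus>\<^bsub>M\<^esub> r \<odot>\<^bsub>M\<^esub> x = r \<odot>\<^bsub>M\<^esub> i"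
      using i r x by (simp add: smult_r_distr Icarr minus_eq a_assoc r_neg)
    then show ?thesis
      using i r x ideal_smult[OF ideal_axioms r i(1)] by (intro proj_eqI) (auto simp: Icarr)
  qed
  have "proj x \<noteq> {}"
    using a_rcos_self[OF x] by blast
  from SUP_eq_const[OF this const]
  show ?thesis
    by (simp add: quot_algebra_def)
qed

lemma Q_nc_algebra: "nc_algebra R Q"
proof (rule nc_algebraI)
  interpret Q: ring Q by (rule Q_ring)
  show "module R Q"
  proof (rule moduleI)
    show "abelian_group Q" by (rule Q.is_abelian_group)
  qed (use is_cring in \<open>auto elim!: Q_carrierE simp: proj_smult proj_closed smult_l_distr smult_r_distr smult_assoc1
      simp flip: proj_add\<close>)
  show "ring Q" by (rule Q_ring)
qed (auto elim!: Q_carrierE simp: proj_smult smult_mult_left smult_mult_right simp flip: proj_mult)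

lemma proj_alg_hom: "proj \<in> alg_hom R M Q"
  using proj_ring_hom by (simp add: alg_hom_def proj_smult)

lemma quot_fun_proj:
  assumes "group G" and f: "f \<in> hom (add_monoid M) G" and null: "\<And>i. i \<in> I \<Longrightarrow> f i = \<one>\<^bsub>G\<^esub>"
    and x: "x \<in> carrier M"
  shows "quot_fun f (proj x) = f x"
proof -
  interpret G: group G by fact
  have "(SOME y. y \<in> proj x) \<in> proj x"
    using a_rcos_self[OF x] by (rule someI)
  then obtain i where i: "i \<in> I" "(SOME y. y \<in> proj x) = i \<oplus>\<^bsub>M\<^esub> x"
    by (auto simp: a_r_coset_def')
  then show ?thesis
    using x add_homD[OF f] by (simp add: quot_fun_def null Icarr)
qed

lemma quot_fun_ring_hom:
  assumes S: "ring S" and f: "f \<in> ring_hom M S" and null: "\<And>i. i \<in> I \<Longrightarrow> f i = \<zero>\<^bsub>S\<^esub>"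
  shows "quot_fun f \<in> ring_hom Q S" and "x \<in> carrier M \<Longrightarrow> quot_fun f (proj x) = f x"
proof -
  interpret S: ring S by (rule S)
  have hom: "f \<in> hom (add_monoid M) (add_monoid S)"
    using f by (auto simp: ring_hom_def hom_def)
  have eval: "quot_fun f (proj x) = f x" if "x \<in> carrier M" for x
    by (rule quot_fun_proj[OF S.a_group hom _ that]) (simp add: null)
  show "x \<in> carrier M \<Longrightarrow> quot_fun f (proj x) = f x" by (rule eval)
  show "quot_fun f \<in> ring_hom Q S"
  proof (rule ring_hom_memI)
    show "quot_fun f \<one>\<^bsub>Q\<^esub> = \<one>\<^bsub>S\<^esub>"
      by (simp add: eval ring_hom_one[OF f] flip: proj_one)
  qed (auto elim!: Q_carrierE simp: eval ring_hom_closed[OF f] ring_hom_mult[OF f] ring_hom_add[OF f]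
      simp flip: proj_add proj_mult)
qed

lemma proj_minus:
  "\<lbrakk>x \<in> carrier M; y \<in> carrier M\<rbrakk> \<Longrightarrow> proj (x \<ominus>\<^bsub>M\<^esub> y) = proj x \<ominus>\<^bsub>Q\<^esub> proj y"
proof -
  interpret Q: ring Q by (rule Q_ring)
  interpret ring_hom_ring M Q proj
    by (rule ring_hom_ringI2[OF ring_axioms Q_ring proj_ring_hom])
  show "\<lbrakk>x \<in> carrier M; y \<in> carrier M\<rbrakk> \<Longrightarrow> proj (x \<ominus>\<^bsub>M\<^esub> y) = proj x \<ominus>\<^bsub>Q\<^esub> proj y"
    by (simp add: a_minus_def)
qed

end

section \<open>The ring of endomorphisms of a commutative group\<close>

text \<open>Endomorphisms are taken extensional and every operation is restricted to the carrier, so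
  that equality of elements is equality of values on the group. The group is written
  multiplicatively, hence the pointwise product as ring addition.\<close>

definition end_ring :: "('w, 'z) monoid_scheme \<Rightarrow> ('w \<Rightarrow> 'w) ring"
  where "end_ring W = \<lparr>carrier = hom W W \<inter> extensional (carrier W), monoid.mult = compose (carrier W),
    one = (\<lambda>x\<in>carrier W. x), ring.zero = (\<lambda>x\<in>carrier W. \<one>\<^bsub>W\<^esub>),
    ring.add = (\<lambda>f g. \<lambda>x\<in>carrier W. f x \<otimes>\<^bsub>W\<^esub> g x)\<rparr>"

context comm_group
begin

lemma end_ring_simps:
  "carrier (end_ring G) = hom G G \<inter> extensional (carrier G)"
  "x \<in> carrier G \<Longrightarrow> (f \<otimes>\<^bsub>end_ring G\<^esub> g) x = f (g x)"
  "x \<in> carrier G \<Longrightarrow> (f \<oplus>\<^bsub>end_ring G\<^esub> g) x = f x \<otimes> g x"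
  "x \<in> carrier G \<Longrightarrow> \<zero>\<^bsub>end_ring G\<^esub> x = \<one>"
  "x \<in> carrier G \<Longrightarrow> \<one>\<^bsub>end_ring G\<^esub> x = x"
  by (simp_all add: end_ring_def compose_eq)

lemma end_ring_hom: "f \<in> carrier (end_ring G) \<Longrightarrow> f \<in> hom G G"
  by (simp add: end_ring_simps)

lemma end_ring_closed: "f \<in> carrier (end_ring G) \<Longrightarrow> x \<in> carrier G \<Longrightarrow> f x \<in> carrier G"
  by (meson end_ring_hom hom_in_carrier)

lemma end_ring_eqI:
  assumes "f \<in> carrier (end_ring G)" "g \<in> carrier (end_ring G)" "\<And>x. x \<in> carrier G \<Longrightarrow> f x = g x"
  shows "f = g"
  by (rule extensionalityI[of _ "carrier G"]) (use assms in \<open>auto simp: end_ring_simps\<close>)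

lemma end_ring_restrict: "f \<in> hom G G \<Longrightarrow> restrict f (carrier G) \<in> carrier (end_ring G)"
  by (auto simp: end_ring_simps hom_def)

lemma end_ring_mult_closed:
  "f \<in> carrier (end_ring G) \<Longrightarrow> g \<in> carrier (end_ring G) \<Longrightarrow> f \<otimes>\<^bsub>end_ring G\<^esub> g \<in> carrier (end_ring G)"
  by (auto simp: end_ring_def hom_def compose_def Pi_iff)

lemma end_ring_add_closed:
  "f \<in> carrier (end_ring G) \<Longrightarrow> g \<in> carrier (end_ring G) \<Longrightarrow> f \<oplus>\<^bsub>end_ring G\<^esub> g \<in> carrier (end_ring G)"
  by (auto simp: end_ring_def hom_def Pi_iff m_ac)

lemma end_ring_one_closed: "\<one>\<^bsub>end_ring G\<^esub> \<in> carrier (end_ring G)"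
  by (auto simp: end_ring_def hom_def)

lemma end_ring_zero_closed: "\<zero>\<^bsub>end_ring G\<^esub> \<in> carrier (end_ring G)"
  by (auto simp: end_ring_def hom_def)

lemma end_ring_inv:
  assumes "f \<in> carrier (end_ring G)"
  shows "(\<lambda>x\<in>carrier G. inv (f x)) \<in> carrier (end_ring G)"
  using assms by (auto simp: end_ring_def hom_def Pi_iff inv_mult)

lemma ring_end_ring: "ring (end_ring G)"
proof (rule ringI)
  note c = end_ring_mult_closed end_ring_add_closed end_ring_one_closed end_ring_zero_closed
  show "abelian_group (end_ring G)"
  proof (rule abelian_groupI)
    fix f g h assume f: "f \<in> carrier (end_ring G)" and g: "g \<in> carrier (end_ring G)"
      and h: "h \<in> carrier (end_ring G)"
    show "f \<oplus>\<^bsub>end_ring G\<^esub> g \<oplus>\<^bsub>end_ring G\<^esub> h = f \<oplus>\<^bsub>end_ring G\<^esub> (g \<oplus>\<^bsub>end_ring G\<^esub> h)"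
      using f g h by (intro end_ring_eqI c) (simp_all add: end_ring_simps(2-) end_ring_closed m_assoc)
  next
    fix f g assume f: "f \<in> carrier (end_ring G)" and g: "g \<in> carrier (end_ring G)"
    show "f \<oplus>\<^bsub>end_ring G\<^esub> g = g \<oplus>\<^bsub>end_ring G\<^esub> f"
      using f g by (intro end_ring_eqI c) (simp_all add: end_ring_simps(2-) end_ring_closed m_comm)
  next
    fix f assume f: "f \<in> carrier (end_ring G)"
    show "\<zero>\<^bsub>end_ring G\<^esub> \<oplus>\<^bsub>end_ring G\<^esub> f = f"
      using f by (intro end_ring_eqI c) (simp_all add: end_ring_simps(2-) end_ring_closed)
    show "\<exists>g\<in>carrier (end_ring G). g \<oplus>\<^bsub>end_ring G\<^esub> f = \<zero>\<^bsub>end_ring G\<^esub>"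
      using f by (intro bexI[OF _ end_ring_inv[OF f]] end_ring_eqI c end_ring_inv)
        (simp_all add: end_ring_simps(2-) end_ring_closed)
  qed (use c in auto)
  show "Group.monoid (end_ring G)"
  proof (rule monoidI)
    fix f g h assume f: "f \<in> carrier (end_ring G)" and g: "g \<in> carrier (end_ring G)"
      and h: "h \<in> carrier (end_ring G)"
    show "f \<otimes>\<^bsub>end_ring G\<^esub> g \<otimes>\<^bsub>end_ring G\<^esub> h = f \<otimes>\<^bsub>end_ring G\<^esub> (g \<otimes>\<^bsub>end_ring G\<^esub> h)"
      using f g h by (intro end_ring_eqI c) (simp_all add: end_ring_simps(2-) end_ring_closed)
  next
    fix f assume f: "f \<in> carrier (end_ring G)"
    show "\<one>\<^bsub>end_ring G\<^esub> \<otimes>\<^bsub>end_ring G\<^esub> f = f" "f \<otimes>\<^bsub>end_ring G\<^esub> \<one>\<^bsub>end_ring G\<^esub> = f"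
      using f by (auto intro!: end_ring_eqI c simp: end_ring_simps(2-) end_ring_closed)
  qed (use c in auto)
  fix f g h assume f: "f \<in> carrier (end_ring G)" and g: "g \<in> carrier (end_ring G)"
    and h: "h \<in> carrier (end_ring G)"
  show "(f \<oplus>\<^bsub>end_ring G\<^esub> g) \<otimes>\<^bsub>end_ring G\<^esub> h = f \<otimes>\<^bsub>end_ring G\<^esub> h \<oplus>\<^bsub>end_ring G\<^esub> g \<otimes>\<^bsub>end_ring G\<^esub> h"
    using f g h by (intro end_ring_eqI c) (simp_all add: end_ring_simps(2-) end_ring_closed)
  show "h \<otimes>\<^bsub>end_ring G\<^esub> (f \<oplus>\<^bsub>end_ring G\<^esub> g) = h \<otimes>\<^bsub>end_ring G\<^esub> f \<oplus>\<^bsub>end_ring G\<^esub> h \<otimes>\<^bsub>end_ring G\<^esub> g"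
    using f g h hom_mult[OF end_ring_hom[OF h]]
    by (intro end_ring_eqI c) (simp_all add: end_ring_simps(2-) end_ring_closed)
qed

end

section \<open>The free algebra and its universal property\<close>

locale free_alg = cring k for k :: "('k, 'w) ring_scheme" (structure) and G :: "'g set"
begin

abbreviation F where "F \<equiv> free_algebra k G"

definition supp :: "('g list \<Rightarrow> 'k) \<Rightarrow> 'g list set" where "supp f = {u. f u \<noteq> \<zero>}"

definition word :: "'k \<Rightarrow> 'g list \<Rightarrow> 'g list \<Rightarrow> 'k" where "word r u = (\<lambda>v. if v = u then r else \<zero>)"

lemma F_carrier: "f \<in> carrier F \<longleftrightarrow> (\<forall>u. f u \<in> carrier k) \<and> finite (supp f) \<and> supp f \<subseteq> lists G"
  by (auto simp: free_algebra_def supp_def)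

lemma F_simps:
  "\<zero>\<^bsub>F\<^esub> = (\<lambda>u. \<zero>)" "f \<oplus>\<^bsub>F\<^esub> g = (\<lambda>u. f u \<oplus> g u)" "\<one>\<^bsub>F\<^esub> = word \<one> []" "r \<odot>\<^bsub>F\<^esub> f = (\<lambda>u. r \<otimes> f u)"
  "f \<otimes>\<^bsub>F\<^esub> g = (\<lambda>u. \<Oplus>i\<in>{..length u}. f (take i u) \<otimes> g (drop i u))"
  by (simp_all add: free_algebra_def word_def)

lemma F_val: "f \<in> carrier F \<Longrightarrow> f u \<in> carrier k"
  by (simp add: F_carrier)

lemma F_zero_closed: "\<zero>\<^bsub>F\<^esub> \<in> carrier F"
  by (simp add: F_carrier F_simps supp_def)

lemma F_add_closed: "\<lbrakk>f \<in> carrier F; g \<in> carrier F\<rbrakk> \<Longrightarrow> f \<oplus>\<^bsub>F\<^esub> g \<in> carrier F"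
proof -
  assume f: "f \<in> carrier F" and g: "g \<in> carrier F"
  have "supp (f \<oplus>\<^bsub>F\<^esub> g) \<subseteq> supp f \<union> supp g"
    by (auto simp: supp_def F_simps)
  moreover have "finite (supp f \<union> supp g)" "supp f \<union> supp g \<subseteq> lists G"
    "\<And>u. (f \<oplus>\<^bsub>F\<^esub> g) u \<in> carrier k"
    using f g by (simp_all add: F_carrier F_simps(2))
  ultimately show ?thesis
    unfolding F_carrier by (meson finite_subset order.trans)
qed

lemma F_smult_closed: "\<lbrakk>r \<in> carrier k; f \<in> carrier F\<rbrakk> \<Longrightarrow> r \<odot>\<^bsub>F\<^esub> f \<in> carrier F"
proof -
  assume r: "r \<in> carrier k" and f: "f \<in> carrier F"
  have "supp (r \<odot>\<^bsub>F\<^esub> f) \<subseteq> supp f"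
    using r by (auto simp: supp_def F_simps)
  moreover have "finite (supp f)" "supp f \<subseteq> lists G" "\<And>u. (r \<odot>\<^bsub>F\<^esub> f) u \<in> carrier k"
    using r f by (simp_all add: F_carrier F_simps(4))
  ultimately show ?thesis
    unfolding F_carrier by (meson finite_subset order.trans)
qed

lemma word_closed: "\<lbrakk>r \<in> carrier k; u \<in> lists G\<rbrakk> \<Longrightarrow> word r u \<in> carrier F"
proof -
  assume r: "r \<in> carrier k" and u: "u \<in> lists G"
  have "supp (word r u) \<subseteq> {u}"
    by (auto simp: supp_def word_def)
  with r u show ?thesis
    by (auto simp: F_carrier word_def intro: finite_subset)
qed

text \<open>A nonzero coefficient of the product at a word forces a nonzero summand, so the word is
  a concatenation of words from the two supports. There are only finitely many of these, with
  letters in \<open>G\<close>.\<close>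

lemma F_mult_closed:
  assumes f: "f \<in> carrier F" and g: "g \<in> carrier F"
  shows "f \<otimes>\<^bsub>F\<^esub> g \<in> carrier F"
proof -
  have img: "supp (f \<otimes>\<^bsub>F\<^esub> g) \<subseteq> (\<lambda>(a, b). a @ b) ` (supp f \<times> supp g)"
  proof
    fix u assume u: "u \<in> supp (f \<otimes>\<^bsub>F\<^esub> g)"
    have "\<exists>i\<in>{..length u}. f (take i u) \<otimes> g (drop i u) \<noteq> \<zero>"
    proof (rule ccontr)
      assume "\<not> ?thesis"
      then have "(\<Oplus>i\<in>{..length u}. f (take i u) \<otimes> g (drop i u)) = (\<Oplus>i\<in>{..length u}. \<zero>)"
        by (intro finsum_cong') auto
      with u show False
        by (simp add: supp_def F_simps(5))
    qed
    then obtain i where "f (take i u) \<otimes> g (drop i u) \<noteq> \<zero>" by auto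
    then have "take i u \<in> supp f" "drop i u \<in> supp g"
      using F_val[OF f, of "take i u"] F_val[OF g, of "drop i u"] by (auto simp: supp_def)
    then show "u \<in> (\<lambda>(a, b). a @ b) ` (supp f \<times> supp g)"
      by (intro image_eqI[of _ _ "(take i u, drop i u)"]) auto
  qed
  have fin: "finite (supp f)" "finite (supp g)" and sub: "supp f \<subseteq> lists G" "supp g \<subseteq> lists G"
    using f g by (simp_all add: F_carrier)
  have "(\<lambda>(a, b). a @ b) ` (supp f \<times> supp g) \<subseteq> lists G"
  proof (rule image_subsetI)
    fix p assume "p \<in> supp f \<times> supp g"
    then have "fst p \<in> lists G" "snd p \<in> lists G"
      using sub by auto
    then show "(\<lambda>(a, b). a @ b) p \<in> lists G"
      by (simp add: case_prod_beta)
  qed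
  with img have "supp (f \<otimes>\<^bsub>F\<^esub> g) \<subseteq> lists G"
    by (rule order.trans)
  moreover have "finite (supp (f \<otimes>\<^bsub>F\<^esub> g))"
    using img by (rule finite_subset) (intro finite_imageI finite_cartesian_product fin)
  moreover have "(f \<otimes>\<^bsub>F\<^esub> g) u \<in> carrier k" for u
    unfolding F_simps(5) using F_val[OF f] F_val[OF g] by (intro finsum_closed) auto
  ultimately show ?thesis
    unfolding F_carrier by blast
qed

lemma F_abelian_group: "abelian_group F"
proof (rule abelian_groupI)
  fix f assume f: "f \<in> carrier F"
  have "(\<lambda>u. \<ominus> f u) \<in> carrier F"
  proof -
    have "(\<lambda>u. \<ominus> f u) = (\<ominus> \<one>) \<odot>\<^bsub>F\<^esub> f"
      using F_val[OF f] by (simp add: F_simps l_minus)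
    then show ?thesis
      using F_smult_closed[OF _ f, of "\<ominus> \<one>"] by simp
  qed
  then show "\<exists>g\<in>carrier F. g \<oplus>\<^bsub>F\<^esub> f = \<zero>\<^bsub>F\<^esub>"
    by (rule bexI[rotated]) (use F_val[OF f] in \<open>simp add: F_simps l_neg\<close>)
qed (auto simp: F_zero_closed F_add_closed, auto simp: F_simps F_val a_ac)

interpretation Fg: abelian_group F by (rule F_abelian_group)

lemma F_module: "module k F"
  by (rule moduleI)
    (auto simp: F_abelian_group F_smult_closed is_cring,
     auto simp: F_simps F_val l_distr r_distr m_assoc)

lemma F_l_distr: "\<lbrakk>f \<in> carrier F; g \<in> carrier F; h \<in> carrier F\<rbrakk> \<Longrightarrow>
    (f \<oplus>\<^bsub>F\<^esub> g) \<otimes>\<^bsub>F\<^esub> h = f \<otimes>\<^bsub>F\<^esub> h \<oplus>\<^bsub>F\<^esub> g \<otimes>\<^bsub>F\<^esub> h"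
  unfolding F_simps
  by (rule ext, subst finsum_addf[symmetric])
    (auto simp: F_val l_distr intro!: finsum_cong')

lemma F_r_distr: "\<lbrakk>f \<in> carrier F; g \<in> carrier F; h \<in> carrier F\<rbrakk> \<Longrightarrow>
    h \<otimes>\<^bsub>F\<^esub> (f \<oplus>\<^bsub>F\<^esub> g) = h \<otimes>\<^bsub>F\<^esub> f \<oplus>\<^bsub>F\<^esub> h \<otimes>\<^bsub>F\<^esub> g"
  unfolding F_simps
  by (rule ext, subst finsum_addf[symmetric])
    (auto simp: F_val r_distr intro!: finsum_cong')

lemma F_smult_mult_left: "\<lbrakk>r \<in> carrier k; f \<in> carrier F; g \<in> carrier F\<rbrakk> \<Longrightarrow>
    (r \<odot>\<^bsub>F\<^esub> f) \<otimes>\<^bsub>F\<^esub> g = r \<odot>\<^bsub>F\<^esub> (f \<otimes>\<^bsub>F\<^esub> g)"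
  unfolding F_simps
  by (rule ext, subst finsum_rdistr)
    (auto simp: F_val m_assoc intro!: finsum_cong')

lemma F_smult_mult_right: "\<lbrakk>r \<in> carrier k; f \<in> carrier F; g \<in> carrier F\<rbrakk> \<Longrightarrow>
    f \<otimes>\<^bsub>F\<^esub> (r \<odot>\<^bsub>F\<^esub> g) = r \<odot>\<^bsub>F\<^esub> (f \<otimes>\<^bsub>F\<^esub> g)"
  unfolding F_simps
  by (rule ext, subst finsum_rdistr)
    (auto simp: F_val m_lcomm intro!: finsum_cong')

lemma word_mult:
  assumes "r \<in> carrier k" "s \<in> carrier k"
  shows "word r u \<otimes>\<^bsub>F\<^esub> word s v = word (r \<otimes> s) (u @ v)"
proof
  fix w
  show "(word r u \<otimes>\<^bsub>F\<^esub> word s v) w = word (r \<otimes> s) (u @ v) w"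
  proof (cases "w = u @ v")
    case True
    \<comment> \<open>The cut at \<open>length u\<close> is the only one whose left half is
      \<open>u\<close>, so a single term of the convolution survives.\<close>
    have "(\<Oplus>i\<in>{..length w}. word r u (take i w) \<otimes> word s v (drop i w)) =
        (\<Oplus>i\<in>{..length w}. if length u = i then (\<lambda>_. r \<otimes> s) i else \<zero>)"
    proof (intro finsum_cong')
      fix i assume i: "i \<in> {..length w}"
      have "take i w = u \<longleftrightarrow> length u = i"
      proof
        assume "take i w = u"
        then show "length u = i" using i by auto
      qed (simp add: True)
      moreover have "length u = i \<Longrightarrow> drop i w = v" by (simp add: True)
      ultimately show "word r u (take i w) \<otimes> word s v (drop i w) = (if length u = i then (\<lambda>_. r \<otimes> s) i else \<zero>)"
        using assms by (simp add: word_def)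
    qed (use assms in auto)
    also have "\<dots> = r \<otimes> s"
      using assms by (subst finsum_singleton) (auto simp: True)
    finally show ?thesis
      by (simp add: F_simps(5)) (simp add: word_def True)
  next
    case False
    have "(\<Oplus>i\<in>{..length w}. word r u (take i w) \<otimes> word s v (drop i w)) = (\<Oplus>i\<in>{..length w}. \<zero>)"
    proof (intro finsum_cong')
      fix i
      have "\<not> (take i w = u \<and> drop i w = v)"
        using False append_take_drop_id[of i w] by auto
      then show "word r u (take i w) \<otimes> word s v (drop i w) = \<zero>"
        using assms by (auto simp: word_def)
    qed auto
    then show ?thesis
      using False by (simp add: F_simps(5)) (simp add: word_def)
  qed
qed

text \<open>Induction on the size of the support, one word being split off at a time. It reduces
  every additive identity to monomials.\<close>

lemma free_induct [consumes 1, case_names zero word add]: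
  assumes f: "f \<in> carrier F"
    and zero: "P \<zero>\<^bsub>F\<^esub>"
    and word: "\<And>r u. \<lbrakk>r \<in> carrier k; u \<in> lists G\<rbrakk> \<Longrightarrow> P (word r u)"
    and add: "\<And>f g. \<lbrakk>f \<in> carrier F; g \<in> carrier F; P f; P g\<rbrakk> \<Longrightarrow> P (f \<oplus>\<^bsub>F\<^esub> g)"
  shows "P f"
proof -
  have "finite (supp f)" using f by (simp add: F_carrier)
  then show ?thesis
    using f
  proof (induction "card (supp f)" arbitrary: f rule: less_induct)
    case less
    show ?case
    proof (cases "supp f = {}")
      case True
      then have "f = \<zero>\<^bsub>F\<^esub>" by (auto simp: supp_def F_simps)
      then show ?thesis using zero by simp
    next
      case False
      then obtain u where u: "u \<in> supp f" by auto
      let ?g = "\<lambda>v. if v = u then \<zero> else f v"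
      have sg: "supp ?g = supp f - {u}" by (auto simp: supp_def)
      have g: "?g \<in> carrier F" using less.prems unfolding F_carrier sg by auto
      have "card (supp ?g) < card (supp f)"
        unfolding sg using u less.prems by (intro card_Diff1_less)
      then have "P ?g"
        using g less.prems unfolding sg by (intro less.hyps) (auto simp: sg)
      moreover have w: "f u \<in> carrier k" "u \<in> lists G"
        using less.prems u by (auto simp: F_carrier)
      moreover have "f = word (f u) u \<oplus>\<^bsub>F\<^esub> ?g"
        using F_val[OF less.prems(2)] by (auto simp: F_simps word_def)
      ultimately show ?thesis
        using add[OF word_closed[OF w] g word[OF w]] by simp
    qed
  qed
qed

lemma F_l_null: "f \<in> carrier F \<Longrightarrow> \<zero>\<^bsub>F\<^esub> \<otimes>\<^bsub>F\<^esub> f = \<zero>\<^bsub>F\<^esub>"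
  unfolding F_simps(1,5) by (simp add: F_val cong: finsum_cong)

lemma F_r_null: "f \<in> carrier F \<Longrightarrow> f \<otimes>\<^bsub>F\<^esub> \<zero>\<^bsub>F\<^esub> = \<zero>\<^bsub>F\<^esub>"
  unfolding F_simps(1,5) by (simp add: F_val cong: finsum_cong)

text \<open>Trilinearity reduces the claim to monomials, where it is associativity of concatenation;
  the double convolution sum never has to be rearranged.\<close>

lemma F_assoc:
  assumes f: "f \<in> carrier F" and g: "g \<in> carrier F" and h: "h \<in> carrier F"
  shows "f \<otimes>\<^bsub>F\<^esub> g \<otimes>\<^bsub>F\<^esub> h = f \<otimes>\<^bsub>F\<^esub> (g \<otimes>\<^bsub>F\<^esub> h)"
  using f
proof (induction rule: free_induct)
  case zero
  show ?case using g h by (simp only: F_l_null F_mult_closed)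
next
  case (add a b)
  then show ?case using g h by (simp only: F_l_distr F_mult_closed)
next
  case w1: (word r u)
  note c1 = word_closed[OF w1]
  show ?case
    using g
  proof (induction rule: free_induct)
    case zero
    show ?case using c1 h by (simp only: F_l_null F_r_null)
  next
    case (add a b)
    then show ?case using c1 h by (simp only: F_l_distr F_r_distr F_mult_closed)
  next
    case w2: (word s v)
    note c2 = word_closed[OF w2]
    show ?case
      using h
    proof (induction rule: free_induct)
      case zero
      show ?case using c1 c2 by (simp only: F_r_null F_mult_closed)
    next
      case (add a b)
      then show ?case using c1 c2 by (simp only: F_r_distr F_mult_closed)
    next
      case w3: (word t w)
      then show ?case
        using w1 w2 by (simp only: word_mult m_closed m_assoc append_assoc)
    qed
  qed
qed

lemma F_one_closed: "\<one>\<^bsub>F\<^esub> \<in> carrier F"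
  unfolding F_simps by (rule word_closed) auto

lemma F_l_one: "f \<in> carrier F \<Longrightarrow> \<one>\<^bsub>F\<^esub> \<otimes>\<^bsub>F\<^esub> f = f"
proof (induction rule: free_induct)
  case zero
  show ?case by (simp only: F_r_null F_one_closed)
next
  case (add a b)
  then show ?case by (simp only: F_r_distr F_one_closed)
next
  case (word r u)
  then show ?case by (simp only: F_simps(3) word_mult one_closed l_one append_Nil)
qed

lemma F_r_one: "f \<in> carrier F \<Longrightarrow> f \<otimes>\<^bsub>F\<^esub> \<one>\<^bsub>F\<^esub> = f"
proof (induction rule: free_induct)
  case zero
  show ?case by (simp only: F_l_null F_one_closed)
next
  case (add a b)
  then show ?case by (simp only: F_l_distr F_one_closed)
next
  case (word r u)
  then show ?case by (simp only: F_simps(3) word_mult one_closed r_one append_Nil2)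
qed

lemma F_nc_algebra: "nc_algebra k F"
  by (intro nc_algebraI F_module ringI monoidI F_abelian_group F_mult_closed F_assoc F_l_one F_r_one
      F_one_closed F_l_distr F_r_distr F_smult_mult_left F_smult_mult_right; assumption)

lemma free_gen_eq: "free_gen k g = word \<one> [g]"
  by (simp add: free_gen_def word_def)

lemma free_gen_closed: "g \<in> G \<Longrightarrow> free_gen k g \<in> carrier F"
  unfolding free_gen_eq by (rule word_closed) auto

lemma word_Cons: "r \<in> carrier k \<Longrightarrow> word r (g # u) = free_gen k g \<otimes>\<^bsub>F\<^esub> word r u"
  by (simp add: free_gen_eq word_mult)

lemma word_Nil: "r \<in> carrier k \<Longrightarrow> word r [] = r \<odot>\<^bsub>F\<^esub> \<one>\<^bsub>F\<^esub>"
  by (auto simp: F_simps word_def)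

text \<open>The scalars of the target enter through \<open>\<iota>\<close>, whose image need only commute with the images of
  the generators.\<close>

theorem free_universal:
  assumes R: "ring R" and \<iota>: "\<iota> \<in> ring_hom k R" and a: "\<And>g. g \<in> G \<Longrightarrow> a g \<in> carrier R"
    and comm: "\<And>r g. \<lbrakk>r \<in> carrier k; g \<in> G\<rbrakk> \<Longrightarrow> \<iota> r \<otimes>\<^bsub>R\<^esub> a g = a g \<otimes>\<^bsub>R\<^esub> \<iota> r"
  shows "\<exists>\<phi>\<in>ring_hom F R. (\<forall>g\<in>G. \<phi> (free_gen k g) = a g) \<and>
    (\<forall>r\<in>carrier k. \<forall>f\<in>carrier F. \<phi> (r \<odot>\<^bsub>F\<^esub> f) = \<iota> r \<otimes>\<^bsub>R\<^esub> \<phi> f)"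
proof -
  interpret R: ring R by fact
  interpret Fr: nc_algebra k F by (rule F_nc_algebra)
  define w where "w u = foldr (\<lambda>g x. a g \<otimes>\<^bsub>R\<^esub> x) u \<one>\<^bsub>R\<^esub>" for u
  have w_simps: "w [] = \<one>\<^bsub>R\<^esub>" "w (g # u) = a g \<otimes>\<^bsub>R\<^esub> w u" for g u
    by (simp_all add: w_def)
  have \<iota>c: "\<iota> r \<in> carrier R" if "r \<in> carrier k" for r
    using ring_hom_closed[OF \<iota> that] .
  have wc: "w u \<in> carrier R" if "u \<in> lists G" for u
    using that by (induction u) (auto simp: w_simps a)
  have w_append: "w (u @ v) = w u \<otimes>\<^bsub>R\<^esub> w v" if "u \<in> lists G" "v \<in> lists G" for u v
    using that by (induction u) (auto simp: w_simps a wc R.m_assoc)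
  have w_comm: "\<iota> r \<otimes>\<^bsub>R\<^esub> w u = w u \<otimes>\<^bsub>R\<^esub> \<iota> r" if "r \<in> carrier k" "u \<in> lists G" for r u
    using that(2)
  proof (induction u)
    case (Cons g u)
    have "\<iota> r \<otimes>\<^bsub>R\<^esub> (a g \<otimes>\<^bsub>R\<^esub> w u) = a g \<otimes>\<^bsub>R\<^esub> (\<iota> r \<otimes>\<^bsub>R\<^esub> w u)"
      using Cons that by (simp add: \<iota>c a wc comm R.m_assoc flip: R.m_assoc[of "\<iota> r"])
    then show ?case using Cons that by (simp add: w_simps \<iota>c a wc R.m_assoc)
  qed (use that in \<open>simp add: w_simps \<iota>c\<close>)
  define \<phi> where "\<phi> f = (\<Oplus>\<^bsub>R\<^esub>u\<in>supp f. \<iota> (f u) \<otimes>\<^bsub>R\<^esub> w u)" for f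
  have \<iota>0: "\<iota> \<zero> = \<zero>\<^bsub>R\<^esub>"
    using ring_hom_zero[OF \<iota> ring_axioms R] .
  \<comment> \<open>The defining sum may run over any finite set of words that contains the support,
    so that two elements and their sum can be compared over a common index set.\<close>
  have \<phi>_sup: "\<phi> f = (\<Oplus>\<^bsub>R\<^esub>u\<in>A. \<iota> (f u) \<otimes>\<^bsub>R\<^esub> w u)"
    if f: "f \<in> carrier F" and A: "supp f \<subseteq> A" "finite A" "A \<subseteq> lists G" for f A
  proof -
    have wA: "w u \<in> carrier R" if "u \<in> A" for u using that A(3) wc by blast
    show ?thesis
      unfolding \<phi>_def
      by (rule R.add.finprod_mono_neutral_cong_left)
        (use A(1,2) F_val[OF f] in \<open>auto simp: supp_def \<iota>0 wA \<iota>c\<close>)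
  qed
  have \<phi>_closed: "\<phi> f \<in> carrier R" if f: "f \<in> carrier F" for f
  proof -
    have "w u \<in> carrier R" if "u \<in> supp f" for u
      using that f wc by (auto simp: F_carrier)
    then show ?thesis
      unfolding \<phi>_def using F_val[OF f] by (intro R.finsum_closed) (simp add: \<iota>c)
  qed
  have \<phi>_add: "\<phi> (f \<oplus>\<^bsub>F\<^esub> g) = \<phi> f \<oplus>\<^bsub>R\<^esub> \<phi> g" if f: "f \<in> carrier F" and g: "g \<in> carrier F" for f g
  proof -
    let ?A = "supp f \<union> supp g"
    have A: "finite ?A" "?A \<subseteq> lists G" using f g by (auto simp: F_carrier)
    have "\<phi> (f \<oplus>\<^bsub>F\<^esub> g) = (\<Oplus>\<^bsub>R\<^esub>u\<in>?A. \<iota> ((f \<oplus>\<^bsub>F\<^esub> g) u) \<otimes>\<^bsub>R\<^esub> w u)"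
      by (rule \<phi>_sup[OF F_add_closed[OF f g] _ A]) (auto simp: supp_def F_simps)
    also have "\<dots> = (\<Oplus>\<^bsub>R\<^esub>u\<in>?A. \<iota> (f u) \<otimes>\<^bsub>R\<^esub> w u \<oplus>\<^bsub>R\<^esub> \<iota> (g u) \<otimes>\<^bsub>R\<^esub> w u)"
      using A F_val[OF f] F_val[OF g]
      by (intro R.finsum_cong')
        (auto simp: F_simps(2) ring_hom_add[OF \<iota>] R.l_distr \<iota>c wc subset_iff)
    also have "\<dots> = \<phi> f \<oplus>\<^bsub>R\<^esub> \<phi> g"
      using A F_val[OF f] F_val[OF g] \<phi>_sup[OF f _ A] \<phi>_sup[OF g _ A]
      by (subst R.finsum_addf) (auto simp: \<iota>c wc subset_iff)
    finally show ?thesis .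
  qed
  have \<phi>_word: "\<phi> (word r u) = \<iota> r \<otimes>\<^bsub>R\<^esub> w u" if r: "r \<in> carrier k" and u: "u \<in> lists G" for r u
  proof -
    have "\<phi> (word r u) = (\<Oplus>\<^bsub>R\<^esub>v\<in>{u}. \<iota> (word r u v) \<otimes>\<^bsub>R\<^esub> w v)"
      by (rule \<phi>_sup[OF word_closed[OF r u]]) (use u in \<open>auto simp: supp_def word_def\<close>)
    then show ?thesis
      using r u by (simp add: word_def \<iota>c wc)
  qed
  have \<phi>0: "\<phi> \<zero>\<^bsub>F\<^esub> = \<zero>\<^bsub>R\<^esub>"
    by (simp add: \<phi>_def supp_def F_simps)
  have \<phi>_mult: "\<phi> (f \<otimes>\<^bsub>F\<^esub> g) = \<phi> f \<otimes>\<^bsub>R\<^esub> \<phi> g" if f: "f \<in> carrier F" and g: "g \<in> carrier F" for f g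
    using f
  proof (induction rule: free_induct)
    case zero
    show ?case using g by (simp only: F_l_null \<phi>0 \<phi>_closed R.l_null)
  next
    case (add x y)
    then show ?case using g by (simp only: F_l_distr \<phi>_add F_mult_closed \<phi>_closed R.l_distr)
  next
    case w1: (word r u)
    note c1 = word_closed[OF w1]
    show ?case
      using g
    proof (induction rule: free_induct)
      case zero
      show ?case using c1 by (simp only: F_r_null \<phi>0 \<phi>_closed R.r_null)
    next
      case (add x y)
      then show ?case using c1 by (simp only: F_r_distr \<phi>_add F_mult_closed \<phi>_closed R.r_distr)
    next
      case w2: (word s v)
      \<comment> \<open>Multiplicativity on monomials is where commutation with the scalars enters:
        \<open>\<iota> s\<close> has to be moved past the image of the word
        \<open>u\<close>.\<close>
      have "\<iota> r \<otimes>\<^bsub>R\<^esub> \<iota> s \<otimes>\<^bsub>R\<^esub> (w u \<otimes>\<^bsub>R\<^esub> w v) = \<iota> r \<otimes>\<^bsub>R\<^esub> (\<iota> s \<otimes>\<^bsub>R\<^esub> w u) \<otimes>\<^bsub>R\<^esub> w v"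
        using w1 w2 by (simp add: R.m_assoc \<iota>c wc)
      also have "\<dots> = \<iota> r \<otimes>\<^bsub>R\<^esub> w u \<otimes>\<^bsub>R\<^esub> (\<iota> s \<otimes>\<^bsub>R\<^esub> w v)"
        using w1 w2 by (subst w_comm[of s u]) (simp_all add: R.m_assoc \<iota>c wc)
      finally show ?case
        using w1 w2 by (simp add: word_mult \<phi>_word w_append ring_hom_mult[OF \<iota>])
    qed
  qed
  have \<phi>_smult: "\<phi> (r \<odot>\<^bsub>F\<^esub> f) = \<iota> r \<otimes>\<^bsub>R\<^esub> \<phi> f" if r: "r \<in> carrier k" and f: "f \<in> carrier F" for r f
  proof -
    have "\<phi> (r \<odot>\<^bsub>F\<^esub> f) = \<phi> (word r [] \<otimes>\<^bsub>F\<^esub> f)"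
      using r f by (simp only: word_Nil F_smult_mult_left F_one_closed F_l_one)
    also have "\<dots> = \<iota> r \<otimes>\<^bsub>R\<^esub> \<phi> f"
      using r f by (simp add: \<phi>_mult word_closed \<phi>_word w_simps \<iota>c)
    finally show ?thesis .
  qed
  have "\<phi> \<in> ring_hom F R"
    by (rule ring_hom_memI)
      (simp_all only: \<phi>_closed \<phi>_mult \<phi>_add, simp add: F_simps(3) \<phi>_word w_simps \<iota>c ring_hom_one[OF \<iota>])
  moreover have "\<phi> (free_gen k g) = a g" if "g \<in> G" for g
    using that by (simp add: free_gen_eq \<phi>_word w_simps a ring_hom_one[OF \<iota>])
  ultimately show ?thesis
    using \<phi>_smult by blast
qed

end

section \<open>The enveloping algebra\<close>

locale poisson_env = kk: field k + BB: algebra k B + poisson_algebra k B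
  for k :: "('k, 'w) ring_scheme" (structure) and B :: "('k, 'b, 'x) poisson_hopf_scheme" (structure)
begin

abbreviation U where "U \<equiv> env_algebra k B"
abbreviation m where "m \<equiv> env_m k B"
abbreviation h where "h \<equiv> env_h k B"
abbreviation times_U (infixl "\<cdot>" 70) where "x \<cdot> y \<equiv> x \<otimes>\<^bsub>U\<^esub> y"
abbreviation FF where "FF \<equiv> free_algebra k (carrier B <+> carrier B)"
abbreviation gm where "gm b \<equiv> free_gen k (Inl b :: 'b + 'b)"
abbreviation gh where "gh b \<equiv> free_gen k (Inr b :: 'b + 'b)"

sublocale free: free_alg k "carrier B <+> carrier B"
  by unfold_locales

sublocale FA: nc_algebra k FF
  by (rule free.F_nc_algebra)

lemma gm_closed: "b \<in> carrier B \<Longrightarrow> gm b \<in> carrier FF"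
  and gh_closed: "b \<in> carrier B \<Longrightarrow> gh b \<in> carrier FF"
  by (auto intro: free.free_gen_closed)

lemma env_relators_closed: "env_relators k B \<subseteq> carrier FF"
  unfolding env_relators_def Let_def
  by (intro Un_least subsetI; (elim CollectE exE conjE)?)
    (auto simp: gm_closed gh_closed bracket_closed)

sublocale UI: algebra_ideal k FF "env_ideal k B"
  by (intro algebra_ideal.intro free.F_nc_algebra)
    (simp add: env_ideal_def FA.genideal_ideal[OF env_relators_closed])

lemma U_eq: "U = UI.Q"
  by (simp add: env_algebra_def)

lemma m_eq: "m b = UI.proj (gm b)" and h_eq: "h b = UI.proj (gh b)"
  by (simp_all add: env_m_def env_h_def)

lemma U_nc_algebra: "nc_algebra k U"
  unfolding U_eq by (rule UI.Q_nc_algebra)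

sublocale U: nc_algebra k U
  by (rule U_nc_algebra)

lemma m_closed: "b \<in> carrier B \<Longrightarrow> m b \<in> carrier U"
  and h_closed: "b \<in> carrier B \<Longrightarrow> h b \<in> carrier U"
  unfolding U_eq m_eq h_eq by (simp_all add: UI.proj_closed gm_closed gh_closed)

text \<open>All nine families of relators are differences, so a membership becomes an equation
  between classes. The lemmas that follow only locate their family in the left-nested union.\<close>

lemma relation:
  assumes "x \<ominus>\<^bsub>FF\<^esub> y \<in> env_relators k B" and "x \<in> carrier FF" and "y \<in> carrier FF"
  shows "UI.proj x = UI.proj y"
  using assms FA.genideal_self[OF env_relators_closed] by (intro UI.proj_eqI) (auto simp: env_ideal_def)

lemmas proj_simps = UI.proj_add UI.proj_mult UI.proj_minus UI.proj_smult UI.proj_one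

lemma m_add:
  assumes "x \<in> carrier B" "y \<in> carrier B"
  shows "m (x \<oplus>\<^bsub>B\<^esub> y) = m x \<oplus>\<^bsub>U\<^esub> m y"
proof -
  have "gm (x \<oplus>\<^bsub>B\<^esub> y) \<ominus>\<^bsub>FF\<^esub> (gm x \<oplus>\<^bsub>FF\<^esub> gm y) \<in> env_relators k B"
    unfolding env_relators_def Let_def
    by (rule UnI1, rule UnI1, rule UnI1, rule UnI1, rule UnI1, rule UnI1, rule UnI1, rule UnI1, use assms in blast)
  from relation[OF this] show ?thesis
    unfolding U_eq m_eq h_eq using assms
    by (simp add: proj_simps gm_closed gh_closed bracket_closed)
qed

lemma h_add:
  assumes "x \<in> carrier B" "y \<in> carrier B"
  shows "h (x \<oplus>\<^bsub>B\<^esub> y) = h x \<oplus>\<^bsub>U\<^esub> h y"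
proof -
  have "gh (x \<oplus>\<^bsub>B\<^esub> y) \<ominus>\<^bsub>FF\<^esub> (gh x \<oplus>\<^bsub>FF\<^esub> gh y) \<in> env_relators k B"
    unfolding env_relators_def Let_def
    by (rule UnI1, rule UnI1, rule UnI1, rule UnI1, rule UnI1, rule UnI1, rule UnI1, rule UnI2, use assms in blast)
  from relation[OF this] show ?thesis
    unfolding U_eq m_eq h_eq using assms
    by (simp add: proj_simps gm_closed gh_closed bracket_closed)
qed

lemma m_smult:
  assumes "r \<in> carrier k" "x \<in> carrier B"
  shows "m (r \<odot>\<^bsub>B\<^esub> x) = r \<odot>\<^bsub>U\<^esub> m x"
proof -
  have "gm (r \<odot>\<^bsub>B\<^esub> x) \<ominus>\<^bsub>FF\<^esub> (r \<odot>\<^bsub>FF\<^esub> gm x) \<in> env_relators k B"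
    unfolding env_relators_def Let_def
    by (rule UnI1, rule UnI1, rule UnI1, rule UnI1, rule UnI1, rule UnI1, rule UnI2, use assms in blast)
  from relation[OF this] show ?thesis
    unfolding U_eq m_eq h_eq using assms
    by (simp add: proj_simps gm_closed gh_closed bracket_closed)
qed

lemma h_smult:
  assumes "r \<in> carrier k" "x \<in> carrier B"
  shows "h (r \<odot>\<^bsub>B\<^esub> x) = r \<odot>\<^bsub>U\<^esub> h x"
proof -
  have "gh (r \<odot>\<^bsub>B\<^esub> x) \<ominus>\<^bsub>FF\<^esub> (r \<odot>\<^bsub>FF\<^esub> gh x) \<in> env_relators k B"
    unfolding env_relators_def Let_def
    by (rule UnI1, rule UnI1, rule UnI1, rule UnI1, rule UnI1, rule UnI2, use assms in blast)
  from relation[OF this] show ?thesis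
    unfolding U_eq m_eq h_eq using assms
    by (simp add: proj_simps gm_closed gh_closed bracket_closed)
qed

lemma m_mult:
  assumes "x \<in> carrier B" "y \<in> carrier B"
  shows "m (x \<otimes>\<^bsub>B\<^esub> y) = m x \<cdot> m y"
proof -
  have "gm (x \<otimes>\<^bsub>B\<^esub> y) \<ominus>\<^bsub>FF\<^esub> (gm x \<otimes>\<^bsub>FF\<^esub> gm y) \<in> env_relators k B"
    unfolding env_relators_def Let_def
    by (rule UnI1, rule UnI1, rule UnI1, rule UnI1, rule UnI2, use assms in blast)
  from relation[OF this] show ?thesis
    unfolding U_eq m_eq h_eq using assms
    by (simp add: proj_simps gm_closed gh_closed bracket_closed)
qed

lemma h_bracket:
  assumes "x \<in> carrier B" "y \<in> carrier B"
  shows "h (bracket B x y) = h x \<cdot> h y \<ominus>\<^bsub>U\<^esub> h y \<cdot> h x"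
proof -
  have "gh (bracket B x y) \<ominus>\<^bsub>FF\<^esub> (gh x \<otimes>\<^bsub>FF\<^esub> gh y \<ominus>\<^bsub>FF\<^esub> gh y \<otimes>\<^bsub>FF\<^esub> gh x) \<in> env_relators k B"
    unfolding env_relators_def Let_def
    by (rule UnI1, rule UnI1, rule UnI1, rule UnI2, use assms in blast)
  from relation[OF this] show ?thesis
    unfolding U_eq m_eq h_eq using assms
    by (simp add: proj_simps gm_closed gh_closed bracket_closed)
qed

lemma h_mult:
  assumes "x \<in> carrier B" "y \<in> carrier B"
  shows "h (x \<otimes>\<^bsub>B\<^esub> y) = m y \<cdot> h x \<oplus>\<^bsub>U\<^esub> m x \<cdot> h y"
proof -
  have "gh (x \<otimes>\<^bsub>B\<^esub> y) \<ominus>\<^bsub>FF\<^esub> (gm y \<otimes>\<^bsub>FF\<^esub> gh x \<oplus>\<^bsub>FF\<^esub> gm x \<otimes>\<^bsub>FF\<^esub> gh y) \<in> env_relators k B"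
    unfolding env_relators_def Let_def
    by (rule UnI1, rule UnI1, rule UnI2, use assms in blast)
  from relation[OF this] show ?thesis
    unfolding U_eq m_eq h_eq using assms
    by (simp add: proj_simps gm_closed gh_closed bracket_closed)
qed

lemma m_bracket:
  assumes "x \<in> carrier B" "y \<in> carrier B"
  shows "m (bracket B x y) = h x \<cdot> m y \<ominus>\<^bsub>U\<^esub> m y \<cdot> h x"
proof -
  have "gm (bracket B x y) \<ominus>\<^bsub>FF\<^esub> (gh x \<otimes>\<^bsub>FF\<^esub> gm y \<ominus>\<^bsub>FF\<^esub> gm y \<otimes>\<^bsub>FF\<^esub> gh x) \<in> env_relators k B"
    unfolding env_relators_def Let_def
    by (rule UnI1, rule UnI2, use assms in blast)
  from relation[OF this] show ?thesis
    unfolding U_eq m_eq h_eq using assms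
    by (simp add: proj_simps gm_closed gh_closed bracket_closed)
qed

lemma m_one:
  shows "m \<one>\<^bsub>B\<^esub> = \<one>\<^bsub>U\<^esub>"
proof -
  have "gm \<one>\<^bsub>B\<^esub> \<ominus>\<^bsub>FF\<^esub> (\<one>\<^bsub>FF\<^esub>) \<in> env_relators k B"
    unfolding env_relators_def Let_def
    by (rule UnI2) simp
  from relation[OF this] show ?thesis
    unfolding U_eq m_eq h_eq
    by (simp add: proj_simps gm_closed gh_closed bracket_closed)
qed

lemma m_lin: "m \<in> lin_map k B U"
  by (intro lin_mapI m_closed m_add m_smult)

lemma h_lin: "h \<in> lin_map k B U"
  by (intro lin_mapI h_closed h_add h_smult)

section \<open>Induction on the enveloping algebra and its universal property\<close>

text \<open>Zero and scalars are covered by the case \<open>m\<close>: the zero of the algebra is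
  \<open>m\<close> of zero, and a monomial with coefficient r is a product of generators ending in
  \<open>m\<close> of r times the unit.\<close>

lemma U_induct [consumes 1, case_names m h add mult]:
  assumes "u \<in> carrier U"
    and m: "\<And>b. b \<in> carrier B \<Longrightarrow> P (m b)"
    and h: "\<And>b. b \<in> carrier B \<Longrightarrow> P (h b)"
    and add: "\<And>u v. \<lbrakk>u \<in> carrier U; v \<in> carrier U; P u; P v\<rbrakk> \<Longrightarrow> P (u \<oplus>\<^bsub>U\<^esub> v)"
    and mult: "\<And>u v. \<lbrakk>u \<in> carrier U; v \<in> carrier U; P u; P v\<rbrakk> \<Longrightarrow> P (u \<cdot> v)"
  shows "P u"
proof -
  obtain f where f: "f \<in> carrier FF" "u = UI.proj f"
    using assms(1) unfolding U_eq by (rule UI.Q_carrierE)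
  have "P (UI.proj f)"
    using f(1)
  proof (induction rule: free.free_induct)
    case zero
    have "UI.proj \<zero>\<^bsub>FF\<^esub> = \<zero>\<^bsub>U\<^esub>"
      unfolding U_eq
      by (rule ring_hom_zero[OF UI.proj_ring_hom nc_algebra.axioms(2)[OF free.F_nc_algebra] UI.Q_ring])
    moreover have "m \<zero>\<^bsub>B\<^esub> = \<zero>\<^bsub>U\<^esub>"
      using m_smult[of "\<zero>\<^bsub>k\<^esub>" "\<one>\<^bsub>B\<^esub>"] m_closed[of "\<one>\<^bsub>B\<^esub>"] by simp
    ultimately show ?case
      using m[of "\<zero>\<^bsub>B\<^esub>"] by simp
  next
    case (word r w)
    from word(2) show ?case
    proof (induction w)
      case Nil
      have "UI.proj (free.word r []) = m (r \<odot>\<^bsub>B\<^esub> \<one>\<^bsub>B\<^esub>)"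
        using word(1) by (simp add: m_smult m_one) (simp add: free.word_Nil U_eq proj_simps[symmetric])
      then show ?case
        using m[of "r \<odot>\<^bsub>B\<^esub> \<one>\<^bsub>B\<^esub>"] word(1) by simp
    next
      case (Cons g w)
      have g: "free_gen k g \<in> carrier FF" and w: "free.word r w \<in> carrier FF"
        using Cons word(1) by (auto intro: free.free_gen_closed free.word_closed)
      have "P (UI.proj (free_gen k g))"
        using Cons.hyps(1) m h by (auto simp: m_eq h_eq)
      moreover have "UI.proj (free.word r (g # w)) = UI.proj (free_gen k g) \<cdot> UI.proj (free.word r w)"
        using g w word(1) by (simp add: free.word_Cons U_eq UI.proj_mult)
      ultimately show ?case
        using mult[of "UI.proj (free_gen k g)" "UI.proj (free.word r w)"] g w Cons
        by (simp add: U_eq UI.proj_closed)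
    qed
  next
    case (add f g)
    then show ?case
      using assms(4)[of "UI.proj f" "UI.proj g"] by (simp add: U_eq UI.proj_closed UI.proj_add)
  qed
  then show ?thesis using f by simp
qed

text \<open>The target is just a ring with a scalar map \<open>\<iota>\<close>, because the decisive
  application is to a ring of additive endomorphisms. The hypotheses on \<open>\<mu>\<close> and
  \<open>\<eta>\<close> mirror the nine families of relators, which are therefore killed by the map
  from the free algebra.\<close>

theorem U_universal:
  assumes S: "ring S" and \<iota>: "\<iota> \<in> ring_hom k S"
    and mc: "\<And>x. x \<in> carrier B \<Longrightarrow> \<mu> x \<in> carrier S" and hc: "\<And>x. x \<in> carrier B \<Longrightarrow> \<eta> x \<in> carrier S"
    and m_comm: "\<And>r x. \<lbrakk>r \<in> carrier k; x \<in> carrier B\<rbrakk> \<Longrightarrow> \<iota> r \<otimes>\<^bsub>S\<^esub> \<mu> x = \<mu> x \<otimes>\<^bsub>S\<^esub> \<iota> r"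
    and h_comm: "\<And>r x. \<lbrakk>r \<in> carrier k; x \<in> carrier B\<rbrakk> \<Longrightarrow> \<iota> r \<otimes>\<^bsub>S\<^esub> \<eta> x = \<eta> x \<otimes>\<^bsub>S\<^esub> \<iota> r"
    and "\<And>x y. \<lbrakk>x \<in> carrier B; y \<in> carrier B\<rbrakk> \<Longrightarrow> \<mu> (x \<oplus>\<^bsub>B\<^esub> y) = \<mu> x \<oplus>\<^bsub>S\<^esub> \<mu> y"
    and "\<And>x y. \<lbrakk>x \<in> carrier B; y \<in> carrier B\<rbrakk> \<Longrightarrow> \<eta> (x \<oplus>\<^bsub>B\<^esub> y) = \<eta> x \<oplus>\<^bsub>S\<^esub> \<eta> y"
    and "\<And>r x. \<lbrakk>r \<in> carrier k; x \<in> carrier B\<rbrakk> \<Longrightarrow> \<mu> (r \<odot>\<^bsub>B\<^esub> x) = \<iota> r \<otimes>\<^bsub>S\<^esub> \<mu> x"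
    and "\<And>r x. \<lbrakk>r \<in> carrier k; x \<in> carrier B\<rbrakk> \<Longrightarrow> \<eta> (r \<odot>\<^bsub>B\<^esub> x) = \<iota> r \<otimes>\<^bsub>S\<^esub> \<eta> x"
    and "\<And>x y. \<lbrakk>x \<in> carrier B; y \<in> carrier B\<rbrakk> \<Longrightarrow> \<mu> (x \<otimes>\<^bsub>B\<^esub> y) = \<mu> x \<otimes>\<^bsub>S\<^esub> \<mu> y"
    and "\<And>x y. \<lbrakk>x \<in> carrier B; y \<in> carrier B\<rbrakk> \<Longrightarrow>
      \<eta> (bracket B x y) = \<eta> x \<otimes>\<^bsub>S\<^esub> \<eta> y \<ominus>\<^bsub>S\<^esub> \<eta> y \<otimes>\<^bsub>S\<^esub> \<eta> x"
    and "\<And>x y. \<lbrakk>x \<in> carrier B; y \<in> carrier B\<rbrakk> \<Longrightarrow>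
      \<eta> (x \<otimes>\<^bsub>B\<^esub> y) = \<mu> y \<otimes>\<^bsub>S\<^esub> \<eta> x \<oplus>\<^bsub>S\<^esub> \<mu> x \<otimes>\<^bsub>S\<^esub> \<eta> y"
    and "\<And>x y. \<lbrakk>x \<in> carrier B; y \<in> carrier B\<rbrakk> \<Longrightarrow>
      \<mu> (bracket B x y) = \<eta> x \<otimes>\<^bsub>S\<^esub> \<mu> y \<ominus>\<^bsub>S\<^esub> \<mu> y \<otimes>\<^bsub>S\<^esub> \<eta> x"
    and "\<mu> \<one>\<^bsub>B\<^esub> = \<one>\<^bsub>S\<^esub>"
  shows "\<exists>\<phi>\<in>ring_hom U S. (\<forall>b\<in>carrier B. \<phi> (m b) = \<mu> b \<and> \<phi> (h b) = \<eta> b) \<and>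
    (\<forall>r\<in>carrier k. \<forall>u\<in>carrier U. \<phi> (r \<odot>\<^bsub>U\<^esub> u) = \<iota> r \<otimes>\<^bsub>S\<^esub> \<phi> u)"
proof -
  interpret S: ring S by (rule S)
  have "\<exists>\<phi>\<in>ring_hom FF S. (\<forall>g\<in>carrier B <+> carrier B. \<phi> (free_gen k g) = case_sum \<mu> \<eta> g) \<and>
      (\<forall>r\<in>carrier k. \<forall>f\<in>carrier FF. \<phi> (r \<odot>\<^bsub>FF\<^esub> f) = \<iota> r \<otimes>\<^bsub>S\<^esub> \<phi> f)"
    by (rule free.free_universal[OF S \<iota>]) (auto simp: mc hc m_comm h_comm)
  then obtain \<phi> where \<phi>: "\<phi> \<in> ring_hom FF S"
    and gen: "\<And>g. g \<in> carrier B <+> carrier B \<Longrightarrow> \<phi> (free_gen k g) = case_sum \<mu> \<eta> g"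
    and sm: "\<And>r f. \<lbrakk>r \<in> carrier k; f \<in> carrier FF\<rbrakk> \<Longrightarrow> \<phi> (r \<odot>\<^bsub>FF\<^esub> f) = \<iota> r \<otimes>\<^bsub>S\<^esub> \<phi> f"
    by auto
  have gen': "\<phi> (gm b) = \<mu> b" "\<phi> (gh b) = \<eta> b" if "b \<in> carrier B" for b
    using gen[of "Inl b"] gen[of "Inr b"] that by auto
  interpret \<phi>: ring_hom_ring FF S \<phi>
    by (rule ring_hom_ringI2[OF nc_algebra.axioms(2)[OF free.F_nc_algebra] S \<phi>])
  have mi: "\<phi> (x \<ominus>\<^bsub>FF\<^esub> y) = \<phi> x \<ominus>\<^bsub>S\<^esub> \<phi> y" if "x \<in> carrier FF" "y \<in> carrier FF" for x y
    using that by (simp add: a_minus_def)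
  have null: "\<phi> (x \<ominus>\<^bsub>FF\<^esub> y) = \<zero>\<^bsub>S\<^esub>"
    if "\<phi> x = \<phi> y" "x \<in> carrier FF" "y \<in> carrier FF" for x y
    using that by (simp only: mi) (simp add: a_minus_def S.r_neg)
  note rules = mi gm_closed gh_closed bracket_closed gen' sm mc hc
    BB.M.a_closed BB.m_closed BB.smult_closed BB.one_closed
    FA.M.a_closed FA.m_closed FA.smult_closed FA.minus_closed
    \<phi>.hom_add \<phi>.hom_mult \<phi>.hom_one
  have "\<phi> u = \<zero>\<^bsub>S\<^esub>" if u: "u \<in> env_relators k B" for u
    using u unfolding env_relators_def Let_def
    by (elim UnE CollectE exE conjE singletonE; hypsubst; intro null)
      (simp_all only: rules assms(7-) FA.one_closed)
  then have "env_relators k B \<subseteq> a_kernel FF S \<phi>"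
    using env_relators_closed unfolding a_kernel_def' by blast
  then have "env_ideal k B \<subseteq> a_kernel FF S \<phi>"
    unfolding env_ideal_def by (rule FA.genideal_minimal[OF \<phi>.kernel_is_ideal])
  then have null: "\<phi> i = \<zero>\<^bsub>S\<^esub>" if "i \<in> env_ideal k B" for i
    using that unfolding a_kernel_def' by blast
  note q = UI.quot_fun_ring_hom[OF S \<phi> null]
  show ?thesis
  proof (intro bexI conjI ballI)
    show "quot_fun \<phi> \<in> ring_hom U S" unfolding U_eq by (rule q(1))
  next
    fix b assume b: "b \<in> carrier B"
    show "quot_fun \<phi> (m b) = \<mu> b" "quot_fun \<phi> (h b) = \<eta> b"
      using b by (simp_all add: m_eq h_eq q(2) gm_closed gh_closed gen')
  next
    fix r u assume r: "r \<in> carrier k" and u: "u \<in> carrier U"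
    obtain f where f: "f \<in> carrier FF" "u = UI.proj f"
      using u unfolding U_eq by (rule UI.Q_carrierE)
    have "r \<odot>\<^bsub>U\<^esub> u = UI.proj (r \<odot>\<^bsub>FF\<^esub> f)"
      using r f by (simp add: U_eq UI.proj_smult)
    then show "quot_fun \<phi> (r \<odot>\<^bsub>U\<^esub> u) = \<iota> r \<otimes>\<^bsub>S\<^esub> quot_fun \<phi> u"
      using r f by (simp add: q(2) sm)
  qed
qed

end

section \<open>Sweedler calculus\<close>

locale hopf_env = poisson_env k B + poisson_hopf_algebra k B
  for k :: "('k, 'w) ring_scheme" (structure) and B :: "('k, 'b, 'x) poisson_hopf_scheme" (structure)
begin

sublocale BP: nc_algebra_pair k B B
  by (intro nc_algebra_pair.intro BB.nc_algebra)

abbreviation BT where "BT \<equiv> tensor_algebra k B B"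
abbreviation S where "S \<equiv> antipode B"
abbreviation eps where "eps \<equiv> counit B"

text \<open>A fixed expression of \<open>\<Delta>(b)\<close> as a finite sum of pure tensors, so that Sweedler sums become
  sums over lists.\<close>

definition cop :: "'b \<Rightarrow> ('b \<times> 'b) list" where
  "cop b = (SOME xs. set xs \<subseteq> carrier B \<times> carrier B \<and> comult B b = psum (add_monoid BT) (kpure k B B) xs)"

text \<open>The Sweedler sum of f(b1, b2) in the group \<open>G\<close>. For balanced
  \<open>f\<close> it does not depend on the expression chosen by \<open>cop\<close>, by
  \<open>klift_comult\<close>; rules such as \<open>sw_cong\<close> and \<open>sw_swap\<close>
  compare sums along the same lists and hold for any \<open>f\<close> with suitable values.\<close>

definition sw :: "('g, 'z) monoid_scheme \<Rightarrow> ('b \<Rightarrow> 'b \<Rightarrow> 'g) \<Rightarrow> 'b \<Rightarrow> 'g" where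
  "sw G f b = psum G f (cop b)"

lemmas comultD = alg_homD[OF comult_alg_hom]
lemmas comult_lin = lin_mapD[OF comultD(2)]
lemmas S_lin = lin_mapD[OF antipode_lin]

lemma eps_closed: "x \<in> carrier B \<Longrightarrow> eps x \<in> carrier k"
  using ring_hom_closed[OF counit_ring_hom] .

lemma cop:
  assumes "b \<in> carrier B"
  shows "set (cop b) \<subseteq> carrier B \<times> carrier B"
    and "comult B b = psum (add_monoid BT) (kpure k B B) (cop b)"
  using someI_ex[OF BP.kpure_psum[OF comult_lin(1)[OF assms]]] by (simp_all add: cop_def)

lemma cop_closed: "b \<in> carrier B \<Longrightarrow> (x, y) \<in> set (cop b) \<Longrightarrow> x \<in> carrier B \<and> y \<in> carrier B"
  using cop(1) by blast

lemma klift_comult: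
  "\<lbrakk>comm_group G; kbalanced k B B G f; b \<in> carrier B\<rbrakk> \<Longrightarrow> klift k B B G f (comult B b) = sw G f b"
  unfolding sw_def using cop by (simp only: BP.klift_psum)

lemma cop_all:
  assumes "b \<in> carrier B" and "\<And>x y. \<lbrakk>x \<in> carrier B; y \<in> carrier B\<rbrakk> \<Longrightarrow> P x y" and "(x, y) \<in> set (cop b)"
  shows "P x y"
  by (rule assms(2)) (use cop_closed[OF assms(1,3)] in simp_all)

lemma sw_cong:
  assumes b: "b \<in> carrier B" and f: "\<And>x y. \<lbrakk>x \<in> carrier B; y \<in> carrier B\<rbrakk> \<Longrightarrow> f x y = g x y"
  shows "sw G f b = sw G g b"
  unfolding sw_def by (rule psum_cong) (rule cop_all[OF b f])

lemma sw_closed: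
  assumes "comm_group G" and b: "b \<in> carrier B"
    and f: "\<And>x y. \<lbrakk>x \<in> carrier B; y \<in> carrier B\<rbrakk> \<Longrightarrow> f x y \<in> carrier G"
  shows "sw G f b \<in> carrier G"
  unfolding sw_def
  by (rule comm_monoid.psum_closed[OF comm_group.axioms(1)[OF assms(1)]]) (rule cop_all[OF b f])

lemma sw_mult_dist:
  assumes "comm_group G" and b: "b \<in> carrier B"
    and f: "\<And>x y. \<lbrakk>x \<in> carrier B; y \<in> carrier B\<rbrakk> \<Longrightarrow> f x y \<in> carrier G"
    and g: "\<And>x y. \<lbrakk>x \<in> carrier B; y \<in> carrier B\<rbrakk> \<Longrightarrow> g x y \<in> carrier G"
  shows "sw G (\<lambda>x y. f x y \<otimes>\<^bsub>G\<^esub> g x y) b = sw G f b \<otimes>\<^bsub>G\<^esub> sw G g b"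
  unfolding sw_def
  by (rule comm_monoid.psum_mult[OF comm_group.axioms(1)[OF assms(1)]])
    (rule cop_all[OF b f] cop_all[OF b g]; assumption)+

lemma sw_swap:
  assumes "comm_group G" and b: "b \<in> carrier B" and c: "c \<in> carrier B"
    and f: "\<And>x y z w. \<lbrakk>x \<in> carrier B; y \<in> carrier B; z \<in> carrier B; w \<in> carrier B\<rbrakk> \<Longrightarrow> f x y z w \<in> carrier G"
  shows "sw G (\<lambda>x y. sw G (\<lambda>z w. f x y z w) c) b = sw G (\<lambda>z w. sw G (\<lambda>x y. f x y z w) b) c"
  unfolding sw_def
proof (rule comm_monoid.psum_swap[OF comm_group.axioms(1)[OF assms(1)]])
  fix x y z w assume "(x, y) \<in> set (cop b)" "(z, w) \<in> set (cop c)"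
  then show "f x y z w \<in> carrier G"
    using cop_closed[OF b, of x y] cop_closed[OF c, of z w] by (simp add: f)
qed

lemma hom_sw:
  assumes "comm_group G" and "group H" and "g \<in> hom G H" and "b \<in> carrier B"
    and "\<And>x y. \<lbrakk>x \<in> carrier B; y \<in> carrier B\<rbrakk> \<Longrightarrow> f x y \<in> carrier G"
  shows "g (sw G f b) = sw H (\<lambda>x y. g (f x y)) b"
proof -
  have "group_hom G H g"
    by (intro group_hom.intro group_hom_axioms.intro comm_group.axioms(2) assms)
  then show ?thesis
    unfolding sw_def
    by (rule hom_psum[OF _ cop_all[OF assms(4,5)] comm_group.axioms(1)[OF assms(1)]])
qed

lemma sw_ldistr:
  assumes "ring R" "a \<in> carrier R" "b \<in> carrier B"
    "\<And>x y. \<lbrakk>x \<in> carrier B; y \<in> carrier B\<rbrakk> \<Longrightarrow> f x y \<in> carrier R"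
  shows "sw (add_monoid R) f b \<otimes>\<^bsub>R\<^esub> a = sw (add_monoid R) (\<lambda>x y. f x y \<otimes>\<^bsub>R\<^esub> a) b"
  unfolding sw_def by (rule ring.psum_ldistr[OF assms(1,2)]) (rule cop_all[OF assms(3,4)])

lemma sw_rdistr:
  assumes "ring R" "a \<in> carrier R" "b \<in> carrier B"
    "\<And>x y. \<lbrakk>x \<in> carrier B; y \<in> carrier B\<rbrakk> \<Longrightarrow> f x y \<in> carrier R"
  shows "a \<otimes>\<^bsub>R\<^esub> sw (add_monoid R) f b = sw (add_monoid R) (\<lambda>x y. a \<otimes>\<^bsub>R\<^esub> f x y) b"
  unfolding sw_def by (rule ring.psum_rdistr[OF assms(1,2)]) (rule cop_all[OF assms(3,4)])

lemma sw_hom: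
  assumes G: "comm_group G" and f: "kbalanced k B B G f"
  shows "sw G f \<in> hom (add_monoid B) G"
proof -
  note l = klift_comult[OF G f]
  show ?thesis
  proof (rule homI)
    fix x assume "x \<in> carrier (add_monoid B)"
    then show "sw G f x \<in> carrier G"
      using sw_closed[OF G _ balancedD(1)[OF f]] by simp
  next
    fix x y assume "x \<in> carrier (add_monoid B)" "y \<in> carrier (add_monoid B)"
    then have "x \<in> carrier B" "y \<in> carrier B" by simp_all
    then show "sw G f (x \<otimes>\<^bsub>add_monoid B\<^esub> y) = sw G f x \<otimes>\<^bsub>G\<^esub> sw G f y"
      using add_homD(2)[OF BP.klift_hom[OF G f]] comult_lin(1)
      by (simp add: l[symmetric] comult_lin(2) del: BP.TA_simps)
  qed
qed

lemma sw_smult: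
  assumes G: "comm_group G" and f: "kbalanced k B B G f" and r: "r \<in> carrier k" and b: "b \<in> carrier B"
  shows "sw G f (r \<odot>\<^bsub>B\<^esub> b) = sw G (\<lambda>x y. f (r \<odot>\<^bsub>B\<^esub> x) y) b"
proof -
  have f': "kbalanced k B B G (\<lambda>x y. f (r \<odot>\<^bsub>B\<^esub> x) y)"
  proof
    fix x s y assume "x \<in> carrier B" "s \<in> carrier k" "y \<in> carrier B"
    then show "f (r \<odot>\<^bsub>B\<^esub> (s \<odot>\<^bsub>B\<^esub> x)) y = f (r \<odot>\<^bsub>B\<^esub> x) (s \<odot>\<^bsub>B\<^esub> y)"
      using r balancedD(4)[OF f] by (simp add: kk.m_comm flip: BB.smult_assoc1)
  qed (use r balancedD[OF f] in \<open>auto simp: BB.smult_r_distr\<close>)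
  have "klift k B B G f (r \<odot>\<^bsub>BT\<^esub> t) = klift k B B G (\<lambda>x y. f (r \<odot>\<^bsub>B\<^esub> x) y) t" if "t \<in> carrier BT" for t
    using that
  proof (induction rule: BP.kpure_induct)
    interpret G: comm_group G by (rule G)
    case zero
    have 0: "g \<zero>\<^bsub>BT\<^esub> = \<one>\<^bsub>G\<^esub>" if "g \<in> hom (add_monoid BT) G" for g
      using hom_one[OF that _ G.is_group] BP.TA.a_group by simp
    show ?case
      using r 0[OF BP.klift_hom[OF G f]] 0[OF BP.klift_hom[OF G f']] by (simp only: BP.TA_smult_zero)
  next
    case (pure x y)
    then show ?case
      using r by (simp only: BP.TA_smult_pure BP.klift_pure[OF G f] BP.klift_pure[OF G f'] BB.smult_closed)
  next
    case (add s t)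
    then show ?case
      using r add_homD(2)[OF BP.klift_hom[OF G f]] add_homD(2)[OF BP.klift_hom[OF G f']]
      by (simp only: BP.TA_smult_add BP.TA_smult_closed)
  qed
  then show ?thesis
    using b r comult_lin by (simp add: klift_comult[OF G f, symmetric] klift_comult[OF G f', symmetric] del: BP.TA_simps)
qed

section \<open>The Hopf and Poisson axioms as rules for Sweedler sums\<close>

text \<open>The axiom is pushed through an arbitrary additive map \<open>f\<close>, so that it can
  be applied in one variable of a larger expression. The other counit rule and the antipode rules
  have the same form.\<close>

lemma sw_counit_left:
  assumes G: "group G" and f: "f \<in> hom (add_monoid B) G" and b: "b \<in> carrier B"
  shows "sw G (\<lambda>x y. f (eps x \<odot>\<^bsub>B\<^esub> y)) b = f b"
proof -
  have bal: "kbalanced k B B (add_monoid B) (\<lambda>y z. eps y \<odot>\<^bsub>B\<^esub> z)"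
    by (rule balancedI) (auto simp: eps_closed ring_hom_add[OF counit_ring_hom] BB.smult_l_distr
        BB.smult_r_distr counit_smult kk.m_comm[of _ "eps _"] BB.smult_assoc1)
  have "f b = f (sw (add_monoid B) (\<lambda>y z. eps y \<odot>\<^bsub>B\<^esub> z) b)"
    using counit_left[OF b] klift_comult[OF BB.M.a_comm_group bal b] by simp
  also have "\<dots> = sw G (\<lambda>x y. f (eps x \<odot>\<^bsub>B\<^esub> y)) b"
    by (rule hom_sw[OF BB.M.a_comm_group G f b]) (simp add: eps_closed)
  finally show ?thesis ..
qed

lemma sw_counit_right:
  assumes G: "group G" and f: "f \<in> hom (add_monoid B) G" and b: "b \<in> carrier B"
  shows "sw G (\<lambda>x y. f (eps y \<odot>\<^bsub>B\<^esub> x)) b = f b"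
proof -
  have bal: "kbalanced k B B (add_monoid B) (\<lambda>y z. eps z \<odot>\<^bsub>B\<^esub> y)"
    by (rule balancedI) (auto simp: eps_closed ring_hom_add[OF counit_ring_hom] BB.smult_l_distr
        BB.smult_r_distr counit_smult kk.m_comm[of _ "eps _"] BB.smult_assoc1)
  have "f b = f (sw (add_monoid B) (\<lambda>y z. eps z \<odot>\<^bsub>B\<^esub> y) b)"
    using counit_right[OF b] klift_comult[OF BB.M.a_comm_group bal b] by simp
  also have "\<dots> = sw G (\<lambda>x y. f (eps y \<odot>\<^bsub>B\<^esub> x)) b"
    by (rule hom_sw[OF BB.M.a_comm_group G f b]) (simp add: eps_closed)
  finally show ?thesis ..
qed

lemma sw_antipode_left:
  assumes G: "group G" and f: "f \<in> hom (add_monoid B) G" and b: "b \<in> carrier B"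
  shows "sw G (\<lambda>x y. f (S x \<otimes>\<^bsub>B\<^esub> y)) b = f (eps b \<odot>\<^bsub>B\<^esub> \<one>\<^bsub>B\<^esub>)"
proof -
  have bal: "kbalanced k B B (add_monoid B) (\<lambda>y z. S y \<otimes>\<^bsub>B\<^esub> z)"
    by (rule balancedI) (auto simp: S_lin BB.l_distr BB.r_distr BP.Ma.smult_mult_left BP.Ma.smult_mult_right)
  have "f (eps b \<odot>\<^bsub>B\<^esub> \<one>\<^bsub>B\<^esub>) = f (sw (add_monoid B) (\<lambda>y z. S y \<otimes>\<^bsub>B\<^esub> z) b)"
    using antipode_left[OF b] klift_comult[OF BB.M.a_comm_group bal b] by simp
  also have "\<dots> = sw G (\<lambda>x y. f (S x \<otimes>\<^bsub>B\<^esub> y)) b"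
    by (rule hom_sw[OF BB.M.a_comm_group G f b]) (simp add: S_lin)
  finally show ?thesis ..
qed

lemma sw_antipode_right:
  assumes G: "group G" and f: "f \<in> hom (add_monoid B) G" and b: "b \<in> carrier B"
  shows "sw G (\<lambda>x y. f (x \<otimes>\<^bsub>B\<^esub> S y)) b = f (eps b \<odot>\<^bsub>B\<^esub> \<one>\<^bsub>B\<^esub>)"
proof -
  have bal: "kbalanced k B B (add_monoid B) (\<lambda>y z. y \<otimes>\<^bsub>B\<^esub> S z)"
    by (rule balancedI) (auto simp: S_lin BB.l_distr BB.r_distr BP.Ma.smult_mult_left BP.Ma.smult_mult_right)
  have "f (eps b \<odot>\<^bsub>B\<^esub> \<one>\<^bsub>B\<^esub>) = f (sw (add_monoid B) (\<lambda>y z. y \<otimes>\<^bsub>B\<^esub> S z) b)"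
    using antipode_right[OF b] klift_comult[OF BB.M.a_comm_group bal b] by simp
  also have "\<dots> = sw G (\<lambda>x y. f (x \<otimes>\<^bsub>B\<^esub> S y)) b"
    by (rule hom_sw[OF BB.M.a_comm_group G f b]) (simp add: S_lin)
  finally show ?thesis ..
qed

lemma comult_sw: "b \<in> carrier B \<Longrightarrow> comult B b = sw (add_monoid BT) (kpure k B B) b"
  unfolding sw_def by (rule cop(2))

lemma sw_pure_klift:
  assumes G: "comm_group G" and f: "kbalanced k B B G f" and b: "b \<in> carrier B"
    and g: "\<And>x y. \<lbrakk>x \<in> carrier B; y \<in> carrier B\<rbrakk> \<Longrightarrow> g x y \<in> carrier BT"
  shows "klift k B B G f (sw (add_monoid BT) g b) = sw G (\<lambda>x y. klift k B B G f (g x y)) b"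
  by (rule hom_sw[OF BP.TA_a_comm_group _ BP.klift_hom[OF G f] b])
    (use G g in \<open>auto simp: comm_group_def\<close>)

text \<open>Multiplicativity of the comultiplication: both coproducts are expanded, multiplied out
  as pure tensors, and the lift of \<open>f\<close> is moved through the two sums.\<close>

lemma sw_prod:
  assumes G: "comm_group G" and f: "kbalanced k B B G f" and x: "x \<in> carrier B" and y: "y \<in> carrier B"
  shows "sw G f (x \<otimes>\<^bsub>B\<^esub> y) =
    sw G (\<lambda>x1 x2. sw G (\<lambda>y1 y2. f (x1 \<otimes>\<^bsub>B\<^esub> y1) (x2 \<otimes>\<^bsub>B\<^esub> y2)) y) x"
proof -
  let ?A = "add_monoid BT"
  note c = BP.kpure_closed
  have "sw G f (x \<otimes>\<^bsub>B\<^esub> y) = klift k B B G f (sw ?A (kpure k B B) x \<otimes>\<^bsub>BT\<^esub> sw ?A (kpure k B B) y)"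
    using x y by (simp only: klift_comult[OF G f, symmetric] comultD(3) BB.m_closed comult_sw[symmetric])
  also have "sw ?A (kpure k B B) x \<otimes>\<^bsub>BT\<^esub> sw ?A (kpure k B B) y =
      sw ?A (\<lambda>x1 x2. sw ?A (\<lambda>y1 y2. kpure k B B x1 x2 \<otimes>\<^bsub>BT\<^esub> kpure k B B y1 y2) y) x"
    using x y c sw_closed[OF BP.TA_a_comm_group y, of "kpure k B B"]
    by (subst sw_ldistr[OF BP.TA_ring], simp_all del: BP.TA_simps, intro sw_cong x sw_rdistr[OF BP.TA_ring])
       (auto simp del: BP.TA_simps)
  also have "\<dots> = sw ?A (\<lambda>x1 x2. sw ?A (\<lambda>y1 y2. kpure k B B (x1 \<otimes>\<^bsub>B\<^esub> y1) (x2 \<otimes>\<^bsub>B\<^esub> y2)) y) x"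
    by (intro sw_cong x y BP.kpure_mult)
  also have "klift k B B G f \<dots> =
      sw G (\<lambda>x1 x2. klift k B B G f (sw ?A (\<lambda>y1 y2. kpure k B B (x1 \<otimes>\<^bsub>B\<^esub> y1) (x2 \<otimes>\<^bsub>B\<^esub> y2)) y)) x"
    using sw_closed[OF BP.TA_a_comm_group y] c by (intro sw_pure_klift G f x) simp
  also have "\<dots> = sw G (\<lambda>x1 x2. sw G (\<lambda>y1 y2. klift k B B G f (kpure k B B (x1 \<otimes>\<^bsub>B\<^esub> y1) (x2 \<otimes>\<^bsub>B\<^esub> y2))) y) x"
    by (intro sw_cong x sw_pure_klift G f y c BB.m_closed)
  also have "\<dots> = sw G (\<lambda>x1 x2. sw G (\<lambda>y1 y2. f (x1 \<otimes>\<^bsub>B\<^esub> y1) (x2 \<otimes>\<^bsub>B\<^esub> y2)) y) x"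
    by (intro sw_cong x y BP.klift_pure G f BB.m_closed)
  finally show ?thesis .
qed

text \<open>Compatibility of the comultiplication with the bracket, unfolded: the coproduct of {x,y}
  is x1 y1 \<otimes> {x2,y2} + {x1,y1} \<otimes> x2 y2. The work lies in showing that the two nested
  lifts inside \<open>tensor_bracket\<close> are lifts of balanced maps.\<close>

lemma sw_bracket:
  assumes G: "comm_group G" and f: "kbalanced k B B G f" and x: "x \<in> carrier B" and y: "y \<in> carrier B"
  shows "sw G f (bracket B x y) =
    sw G (\<lambda>x1 x2. sw G (\<lambda>y1 y2. f (x1 \<otimes>\<^bsub>B\<^esub> y1) (bracket B x2 y2) \<otimes>\<^bsub>G\<^esub>
      f (bracket B x1 y1) (x2 \<otimes>\<^bsub>B\<^esub> y2)) y) x"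
proof -
  let ?A = "add_monoid BT"
  note A = BP.TA_a_comm_group and c = BP.kpure_closed
  define q where "q a b c d = kpure k B B (a \<otimes>\<^bsub>B\<^esub> c) (bracket B b d) \<oplus>\<^bsub>BT\<^esub>
      kpure k B B (bracket B a c) (b \<otimes>\<^bsub>B\<^esub> d)" for a b c d
  have qc: "q a b c d \<in> carrier BT" if "a \<in> carrier B" "b \<in> carrier B" "c \<in> carrier B" "d \<in> carrier B" for a b c d
    unfolding q_def using that by (intro BP.TA.a_closed c BB.m_closed bracket_closed)
  note simps = BP.kpure_add_left BP.kpure_add_right bracket_add_left bracket_add_right bracket_closed
    BB.m_closed BB.l_distr BB.r_distr BB.M.a_closed BP.TA.a_ac BP.TA.a_closed c
  have middle: "kpure k B B (r \<odot>\<^bsub>B\<^esub> u) v = kpure k B B u (r \<odot>\<^bsub>B\<^esub> v)"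
    if "r \<in> carrier k" "u \<in> carrier B" "v \<in> carrier B" for r u v
    by (rule BP.kpure_middle) (use that in auto)
  have inner: "kbalanced k B B ?A (\<lambda>c d. q a b c d)" if "a \<in> carrier B" "b \<in> carrier B" for a b
  proof
    fix c c' d assume "c \<in> carrier B" "c' \<in> carrier B" "d \<in> carrier B"
    with that show "q a b (c \<oplus>\<^bsub>B\<^esub> c') d = q a b c d \<otimes>\<^bsub>?A\<^esub> q a b c' d"
      unfolding q_def monoid.simps by (simp only: simps)
  next
    fix c d d' assume "c \<in> carrier B" "d \<in> carrier B" "d' \<in> carrier B"
    with that show "q a b c (d \<oplus>\<^bsub>B\<^esub> d') = q a b c d \<otimes>\<^bsub>?A\<^esub> q a b c d'"
      unfolding q_def monoid.simps by (simp only: simps)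
  next
    fix c r d assume "c \<in> carrier B" "r \<in> carrier k" "d \<in> carrier B"
    with that show "q a b (r \<odot>\<^bsub>B\<^esub> c) d = q a b c (r \<odot>\<^bsub>B\<^esub> d)"
      unfolding q_def
      by (simp only: BP.Ma.smult_mult_right bracket_smult_right middle BB.m_closed bracket_closed)
  qed (use that qc in simp)
  have qy: "klift k B B ?A (\<lambda>c d. q a b c d) (comult B y) = sw ?A (q a b) y"
    if "a \<in> carrier B" "b \<in> carrier B" for a b
    by (rule klift_comult[OF A inner[OF that] y])
  have qy_closed: "sw ?A (q a b) y \<in> carrier ?A" if "a \<in> carrier B" "b \<in> carrier B" for a b
    by (rule sw_closed[OF A y]) (use qc that in simp)
  \<comment> \<open>The inner lift is only evaluated at the coproduct of \<open>y\<close>, where it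
    is a Sweedler sum; bilinearity in (a, b) can therefore be checked summand by summand.\<close>
  have outer: "kbalanced k B B ?A (\<lambda>a b. klift k B B ?A (\<lambda>c d. q a b c d) (comult B y))"
  proof
    fix a a' b assume h: "a \<in> carrier B" "a' \<in> carrier B" "b \<in> carrier B"
    have "sw ?A (q (a \<oplus>\<^bsub>B\<^esub> a') b) y = sw ?A (\<lambda>c d. q a b c d \<otimes>\<^bsub>?A\<^esub> q a' b c d) y"
      unfolding q_def monoid.simps by (rule sw_cong[OF y]) (use h in \<open>simp only: simps\<close>)
    also have "\<dots> = sw ?A (q a b) y \<otimes>\<^bsub>?A\<^esub> sw ?A (q a' b) y"
      by (rule sw_mult_dist[OF A y]) (use h qc in simp_all)
    finally show "klift k B B ?A (\<lambda>c d. q (a \<oplus>\<^bsub>B\<^esub> a') b c d) (comult B y) =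
        klift k B B ?A (\<lambda>c d. q a b c d) (comult B y) \<otimes>\<^bsub>?A\<^esub> klift k B B ?A (\<lambda>c d. q a' b c d) (comult B y)"
      using h by (simp only: qy BB.M.a_closed)
  next
    fix a b b' assume h: "a \<in> carrier B" "b \<in> carrier B" "b' \<in> carrier B"
    have "sw ?A (q a (b \<oplus>\<^bsub>B\<^esub> b')) y = sw ?A (\<lambda>c d. q a b c d \<otimes>\<^bsub>?A\<^esub> q a b' c d) y"
      unfolding q_def monoid.simps by (rule sw_cong[OF y]) (use h in \<open>simp only: simps\<close>)
    also have "\<dots> = sw ?A (q a b) y \<otimes>\<^bsub>?A\<^esub> sw ?A (q a b') y"
      by (rule sw_mult_dist[OF A y]) (use h qc in simp_all)
    finally show "klift k B B ?A (\<lambda>c d. q a (b \<oplus>\<^bsub>B\<^esub> b') c d) (comult B y) =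
        klift k B B ?A (\<lambda>c d. q a b c d) (comult B y) \<otimes>\<^bsub>?A\<^esub> klift k B B ?A (\<lambda>c d. q a b' c d) (comult B y)"
      using h by (simp only: qy BB.M.a_closed)
  next
    fix a r b assume h: "a \<in> carrier B" "r \<in> carrier k" "b \<in> carrier B"
    have "sw ?A (q (r \<odot>\<^bsub>B\<^esub> a) b) y = sw ?A (q a (r \<odot>\<^bsub>B\<^esub> b)) y"
      unfolding q_def
      by (rule sw_cong[OF y])
        (use h in \<open>simp only: BP.Ma.smult_mult_left bracket_smult_left middle BB.m_closed bracket_closed\<close>)
    then show "klift k B B ?A (\<lambda>c d. q (r \<odot>\<^bsub>B\<^esub> a) b c d) (comult B y) =
        klift k B B ?A (\<lambda>c d. q a (r \<odot>\<^bsub>B\<^esub> b) c d) (comult B y)"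
      using h by (simp only: qy BB.smult_closed)
  qed (use qy qy_closed in simp)
  have "comult B (bracket B x y) = klift k B B ?A (\<lambda>a b. klift k B B ?A (\<lambda>c d. q a b c d) (comult B y)) (comult B x)"
    using comult_bracket[OF x y] unfolding tensor_bracket_def q_def BP.klift_KT .
  also have "\<dots> = sw ?A (\<lambda>a b. klift k B B ?A (\<lambda>c d. q a b c d) (comult B y)) x"
    by (rule klift_comult[OF A outer x])
  also have "\<dots> = sw ?A (\<lambda>a b. sw ?A (q a b) y) x"
    by (rule sw_cong[OF x qy])
  finally have "sw G f (bracket B x y) = klift k B B G f (sw ?A (\<lambda>a b. sw ?A (q a b) y) x)"
    using klift_comult[OF G f bracket_closed[OF x y]] by simp
  also have "\<dots> = sw G (\<lambda>a b. klift k B B G f (sw ?A (q a b) y)) x"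
    using qy_closed by (intro sw_pure_klift G f x) simp
  also have "\<dots> = sw G (\<lambda>a b. sw G (\<lambda>c d. klift k B B G f (q a b c d)) y) x"
    by (intro sw_cong x sw_pure_klift G f y qc)
  also have "\<dots> = sw G (\<lambda>a b. sw G (\<lambda>c d. f (a \<otimes>\<^bsub>B\<^esub> c) (bracket B b d) \<otimes>\<^bsub>G\<^esub>
      f (bracket B a c) (b \<otimes>\<^bsub>B\<^esub> d)) y) x"
    unfolding q_def
    by (intro sw_cong x y)
      (simp only: BP.klift_add[OF G f] BP.klift_pure[OF G f] c BB.m_closed bracket_closed)
  finally show ?thesis .
qed

text \<open>A trilinear \<open>g\<close> factors through B \<otimes> (B \<otimes> B) as the lift of
  \<open>\<psi>\<close>. Applied to the two sides of the coassociativity axiom, this factor produces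
  the two nested sums.\<close>

lemma sw_coassoc:
  assumes G: "comm_group G"
    and b1: "\<And>z. z \<in> carrier B \<Longrightarrow> kbalanced k B B G (\<lambda>x y. g x y z)"
    and b2: "\<And>x. x \<in> carrier B \<Longrightarrow> kbalanced k B B G (\<lambda>y z. g x y z)"
    and b: "b \<in> carrier B"
  shows "sw G (\<lambda>x z. sw G (\<lambda>x1 x2. g x1 x2 z) x) b = sw G (\<lambda>x w. sw G (\<lambda>y z. g x y z) w) b"
proof -
  interpret L: module_pair k BT B
    by (intro module_pair.intro BP.TA_module BB.module)
  interpret R: module_pair k B BT
    by (intro module_pair.intro BP.TA_module BB.module)
  let ?R = "add_monoid R.TA"
  note GR = R.TA_a_comm_group
  define \<psi> where "\<psi> x t = klift k B B G (\<lambda>y z. g x y z) t" for x t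
  have \<psi>: "kbalanced k B BT G \<psi>"
    unfolding \<psi>_def by (rule BP.balanced_klift_right[OF G BB.module b1 b2])
  \<comment> \<open>The universal trilinear map into B \<otimes> (B \<otimes> B).\<close>
  define \<alpha> where "\<alpha> x y z = kpure k B BT x (kpure k B B y z)" for x y z
  have \<alpha>c: "\<alpha> x y z \<in> carrier R.TA" if "x \<in> carrier B" "y \<in> carrier B" "z \<in> carrier B" for x y z
    unfolding \<alpha>_def using that by (intro R.kpure_closed BP.kpure_closed)
  have \<alpha>1: "kbalanced k B B ?R (\<lambda>x y. \<alpha> x y z)" if z: "z \<in> carrier B" for z
    unfolding \<alpha>_def
  proof
    fix x r y assume "x \<in> carrier B" "r \<in> carrier k" "y \<in> carrier B"
    then show "kpure k B BT (r \<odot>\<^bsub>B\<^esub> x) (kpure k B B y z) = kpure k B BT x (kpure k B B (r \<odot>\<^bsub>B\<^esub> y) z)"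
      using z by (simp only: R.kpure_middle BP.kpure_closed BP.TA_smult_pure)
  qed (unfold partial_object.simps monoid.simps, insert z,
      (simp only: R.kpure_closed R.kpure_add_left R.kpure_add_right BP.kpure_closed BP.kpure_add_left)+)
  have \<alpha>2: "kbalanced k B B ?R (\<lambda>y z. \<alpha> x y z)" if x: "x \<in> carrier B" for x
    unfolding \<alpha>_def
  proof
    fix y r z assume "y \<in> carrier B" "r \<in> carrier k" "z \<in> carrier B"
    then show "kpure k B BT x (kpure k B B (r \<odot>\<^bsub>B\<^esub> y) z) = kpure k B BT x (kpure k B B y (r \<odot>\<^bsub>B\<^esub> z))"
      by (simp only: BP.kpure_middle)
  qed (unfold partial_object.simps monoid.simps, insert x,
      (simp only: R.kpure_closed R.kpure_add_right BP.kpure_closed BP.kpure_add_left BP.kpure_add_right)+)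
  \<comment> \<open>The associativity isomorphism before its last lift, as a bilinear map of a
    tensor and a third element.\<close>
  define A where "A t z = klift k B B ?R (\<lambda>x y. \<alpha> x y z) t" for t z
  have A: "kbalanced k BT B ?R A"
    unfolding A_def by (rule BP.balanced_klift_left[OF GR BB.module \<alpha>1 \<alpha>2])
  have \<alpha>\<psi>: "klift k B BT G \<psi> (\<alpha> x y z) = g x y z"
    if "x \<in> carrier B" "y \<in> carrier B" "z \<in> carrier B" for x y z
    unfolding \<alpha>_def using that
    by (simp only: R.klift_pure[OF G \<psi>] BP.kpure_closed) (simp only: \<psi>_def BP.klift_pure[OF G b2])
  have \<psi>_hom: "klift k B BT G \<psi> \<in> hom ?R G"
    by (rule R.klift_hom[OF G \<psi>])
  have gG: "group G" by (rule comm_group.axioms(2)[OF G])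
  have id: "(\<lambda>y. y) \<in> lin_map k B B" by (rule lin_mapI) simp_all
  have "tensor_map k B B BT B (comult B) (\<lambda>y. y) (comult B b)
      = sw (add_monoid L.TA) (\<lambda>x z. kpure k BT B (comult B x) z) b"
  proof -
    have t: "tensor_map k B B BT B (comult B) (\<lambda>y. y) \<in> hom (add_monoid BT) (add_monoid L.TA)"
      using tensor_map_lin(1)[OF BP.module_pair_axioms L.module_pair_axioms comultD(2) id]
      by (simp add: lin_map_def)
    have "tensor_map k B B BT B (comult B) (\<lambda>y. y) (sw (add_monoid BT) (kpure k B B) b)
      = sw (add_monoid L.TA) (\<lambda>x z. tensor_map k B B BT B (comult B) (\<lambda>y. y) (kpure k B B x z)) b"
      by (rule hom_sw[OF BP.TA_a_comm_group L.TA.a_group t b]) (use BP.kpure_closed in simp)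
    also have "\<dots> = sw (add_monoid L.TA) (\<lambda>x z. kpure k BT B (comult B x) z) b"
      by (intro sw_cong b tensor_map_lin(2)[OF BP.module_pair_axioms L.module_pair_axioms comultD(2) id])
    finally show ?thesis by (simp only: comult_sw[OF b])
  qed
  then have "tensor_assoc k B B B (tensor_map k B B BT B (comult B) (\<lambda>y. y) (comult B b))
      = klift k BT B ?R A (sw (add_monoid L.TA) (\<lambda>x z. kpure k BT B (comult B x) z) b)"
    unfolding tensor_assoc_def A_def \<alpha>_def by (simp only: R.klift_KT) (simp add: klift_def tensor_lift_def hom_def)
  also have "\<dots> = sw ?R (\<lambda>x z. klift k BT B ?R A (kpure k BT B (comult B x) z)) b"
    by (rule hom_sw[OF L.TA_a_comm_group R.TA.a_group L.klift_hom[OF GR A] b])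
      (use L.kpure_closed comult_lin(1) in simp)
  also have "\<dots> = sw ?R (\<lambda>x z. A (comult B x) z) b"
    by (intro sw_cong b L.klift_pure[OF GR A] comult_lin(1))
  also have "\<dots> = sw ?R (\<lambda>x z. sw ?R (\<lambda>x1 x2. \<alpha> x1 x2 z) x) b"
    unfolding A_def by (intro sw_cong b klift_comult[OF GR \<alpha>1])
  finally have left: "klift k B BT G \<psi> (tensor_assoc k B B B (tensor_map k B B BT B (comult B) (\<lambda>y. y) (comult B b)))
      = sw G (\<lambda>x z. sw G (\<lambda>x1 x2. g x1 x2 z) x) b"
  proof (simp only:)
    have "klift k B BT G \<psi> (sw ?R (\<lambda>x z. sw ?R (\<lambda>x1 x2. \<alpha> x1 x2 z) x) b)
        = sw G (\<lambda>x z. klift k B BT G \<psi> (sw ?R (\<lambda>x1 x2. \<alpha> x1 x2 z) x)) b"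
      by (rule hom_sw[OF GR gG \<psi>_hom b], rule sw_closed[OF GR]) (use \<alpha>c in simp_all)
    also have "\<dots> = sw G (\<lambda>x z. sw G (\<lambda>x1 x2. klift k B BT G \<psi> (\<alpha> x1 x2 z)) x) b"
      by (rule sw_cong[OF b], rule hom_sw[OF GR gG \<psi>_hom]) (use \<alpha>c in simp_all)
    also have "\<dots> = sw G (\<lambda>x z. sw G (\<lambda>x1 x2. g x1 x2 z) x) b"
      by (intro sw_cong b \<alpha>\<psi>)
    finally show "klift k B BT G \<psi> (sw ?R (\<lambda>x z. sw ?R (\<lambda>x1 x2. \<alpha> x1 x2 z) x) b)
        = sw G (\<lambda>x z. sw G (\<lambda>x1 x2. g x1 x2 z) x) b" .
  qed
  have "tensor_map k B B B BT (\<lambda>y. y) (comult B) (comult B b)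
      = sw ?R (\<lambda>x w. kpure k B BT x (comult B w)) b"
  proof -
    have t: "tensor_map k B B B BT (\<lambda>y. y) (comult B) \<in> hom (add_monoid BT) ?R"
      using tensor_map_lin(1)[OF BP.module_pair_axioms R.module_pair_axioms id comultD(2)]
      by (simp add: lin_map_def)
    have "tensor_map k B B B BT (\<lambda>y. y) (comult B) (sw (add_monoid BT) (kpure k B B) b)
      = sw ?R (\<lambda>x z. tensor_map k B B B BT (\<lambda>y. y) (comult B) (kpure k B B x z)) b"
      by (rule hom_sw[OF BP.TA_a_comm_group R.TA.a_group t b]) (use BP.kpure_closed in simp)
    also have "\<dots> = sw ?R (\<lambda>x w. kpure k B BT x (comult B w)) b"
      by (intro sw_cong b tensor_map_lin(2)[OF BP.module_pair_axioms R.module_pair_axioms id comultD(2)])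
    finally show ?thesis by (simp only: comult_sw[OF b])
  qed
  then have "klift k B BT G \<psi> (tensor_map k B B B BT (\<lambda>y. y) (comult B) (comult B b))
      = sw G (\<lambda>x w. klift k B BT G \<psi> (kpure k B BT x (comult B w))) b"
    by (simp only:) (rule hom_sw[OF GR gG \<psi>_hom b], use R.kpure_closed comult_lin(1) in simp)
  also have "\<dots> = sw G (\<lambda>x w. \<psi> x (comult B w)) b"
    by (intro sw_cong b R.klift_pure[OF G \<psi>] comult_lin(1))
  also have "\<dots> = sw G (\<lambda>x w. sw G (\<lambda>y z. g x y z) w) b"
    unfolding \<psi>_def by (intro sw_cong b klift_comult[OF G b2])
  finally show ?thesis
    using left coassoc[OF b] by simp
qed

section \<open>A complement to the copy of \<open>B\<close>\<close>

lemma balanced_mult: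
  assumes "nc_algebra k A" and F: "F \<in> lin_map k B A" and G: "G \<in> lin_map k B A"
  shows "kbalanced k B B (add_monoid A) (\<lambda>x y. F x \<otimes>\<^bsub>A\<^esub> G y)"
proof -
  interpret A: nc_algebra k A by fact
  show ?thesis
    by (rule balancedI)
      (simp_all add: lin_mapD[OF F] lin_mapD[OF G] A.l_distr A.r_distr A.smult_mult_left A.smult_mult_right)
qed

lemma sw_lin_map:
  assumes "nc_algebra k A" and f: "kbalanced k B B (add_monoid A) f"
    and sm: "\<And>r x y. \<lbrakk>r \<in> carrier k; x \<in> carrier B; y \<in> carrier B\<rbrakk> \<Longrightarrow> f (r \<odot>\<^bsub>B\<^esub> x) y = r \<odot>\<^bsub>A\<^esub> f x y"
  shows "sw (add_monoid A) f \<in> lin_map k B A"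
proof -
  interpret A: nc_algebra k A by fact
  have G: "comm_group (add_monoid A)" using A.abelian_group_axioms abelian_group_iff by blast
  have fc: "f x y \<in> carrier A" if "x \<in> carrier B" "y \<in> carrier B" for x y
    using balancedD(1)[OF f that] by simp
  show ?thesis
  proof (rule lin_mapI)
    fix r b assume r: "r \<in> carrier k" and b: "b \<in> carrier B"
    have hom: "(\<lambda>a. r \<odot>\<^bsub>A\<^esub> a) \<in> hom (add_monoid A) (add_monoid A)"
      using r by (intro homI) (simp_all add: A.smult_r_distr)
    have "sw (add_monoid A) f (r \<odot>\<^bsub>B\<^esub> b) = sw (add_monoid A) (\<lambda>x y. r \<odot>\<^bsub>A\<^esub> f x y) b"
      unfolding sw_smult[OF G f r b] by (rule sw_cong[OF b sm[OF r]])
    also have "\<dots> = r \<odot>\<^bsub>A\<^esub> sw (add_monoid A) f b"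
      by (rule hom_sw[OF G comm_group.axioms(2)[OF G] hom b, symmetric]) (simp add: fc)
    finally show "sw (add_monoid A) f (r \<odot>\<^bsub>B\<^esub> b) = r \<odot>\<^bsub>A\<^esub> sw (add_monoid A) f b" .
  qed (use add_homD[OF sw_hom[OF G f]] in simp_all)
qed

lemma hom_of_bal:
  "kbalanced k B B G f \<Longrightarrow> comm_group G \<Longrightarrow> z \<in> carrier B \<Longrightarrow> (\<lambda>c. f c z) \<in> hom (add_monoid B) G"
  by (intro homI) (simp_all add: balancedD)

text \<open>Coassociativity brings the first two legs together, the antipode axiom turns them into a
  counit, balancedness moves this scalar to the other slot, and the counit axiom absorbs it there.
  In short, b1 S(b2) \<otimes> b3 = 1 \<otimes> b.\<close>

lemma sw_antipode_cancel_right: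
  assumes G: "comm_group G" and f: "kbalanced k B B G f" and b: "b \<in> carrier B"
  shows "sw G (\<lambda>x w. sw G (\<lambda>y z. f (x \<otimes>\<^bsub>B\<^esub> S y) z) w) b = f \<one>\<^bsub>B\<^esub> b"
proof -
  note gG = comm_group.axioms(2)[OF G] and fD = balancedD[OF f]
  note alg = BP.Ma.smult_mult_left BP.Ma.smult_mult_right
  have "sw G (\<lambda>x w. sw G (\<lambda>y z. f (x \<otimes>\<^bsub>B\<^esub> S y) z) w) b = sw G (\<lambda>x z. sw G (\<lambda>x1 x2. f (x1 \<otimes>\<^bsub>B\<^esub> S x2) z) x) b"
  proof (rule sw_coassoc[OF G _ _ b, symmetric])
    fix z assume z: "z \<in> carrier B"
    show "kbalanced k B B G (\<lambda>x y. f (x \<otimes>\<^bsub>B\<^esub> S y) z)"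
      by (rule balancedI) (use z in \<open>simp_all add: fD S_lin BB.l_distr BB.r_distr alg\<close>)
  next
    fix x assume x: "x \<in> carrier B"
    show "kbalanced k B B G (\<lambda>y z. f (x \<otimes>\<^bsub>B\<^esub> S y) z)"
      by (rule balancedI) (use x in \<open>simp_all add: fD S_lin BB.l_distr BB.r_distr alg\<close>)
  qed
  also have "\<dots> = sw G (\<lambda>x z. f (eps x \<odot>\<^bsub>B\<^esub> \<one>\<^bsub>B\<^esub>) z) b"
    by (intro sw_cong b sw_antipode_right[OF gG hom_of_bal[OF f G]])
  also have "\<dots> = sw G (\<lambda>x z. f \<one>\<^bsub>B\<^esub> (eps x \<odot>\<^bsub>B\<^esub> z)) b"
    by (intro sw_cong b) (simp add: fD eps_closed)
  also have "\<dots> = f \<one>\<^bsub>B\<^esub> b"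
    by (rule sw_counit_left[OF gG _ b]) (intro homI; simp add: fD)
  finally show ?thesis .
qed

lemma sw_antipode_cancel_left:
  assumes G: "comm_group G" and f: "kbalanced k B B G f" and b: "b \<in> carrier B"
  shows "sw G (\<lambda>x w. sw G (\<lambda>y z. f (S x \<otimes>\<^bsub>B\<^esub> y) z) w) b = f \<one>\<^bsub>B\<^esub> b"
proof -
  note gG = comm_group.axioms(2)[OF G] and fD = balancedD[OF f]
  note alg = BP.Ma.smult_mult_left BP.Ma.smult_mult_right
  have "sw G (\<lambda>x w. sw G (\<lambda>y z. f (S x \<otimes>\<^bsub>B\<^esub> y) z) w) b = sw G (\<lambda>x z. sw G (\<lambda>x1 x2. f (S x1 \<otimes>\<^bsub>B\<^esub> x2) z) x) b"
  proof (rule sw_coassoc[OF G _ _ b, symmetric])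
    fix z assume z: "z \<in> carrier B"
    show "kbalanced k B B G (\<lambda>x y. f (S x \<otimes>\<^bsub>B\<^esub> y) z)"
      by (rule balancedI) (use z in \<open>simp_all add: fD S_lin BB.l_distr BB.r_distr alg\<close>)
  next
    fix x assume x: "x \<in> carrier B"
    show "kbalanced k B B G (\<lambda>y z. f (S x \<otimes>\<^bsub>B\<^esub> y) z)"
      by (rule balancedI) (use x in \<open>simp_all add: fD S_lin BB.l_distr BB.r_distr alg\<close>)
  qed
  also have "\<dots> = sw G (\<lambda>x z. f (eps x \<odot>\<^bsub>B\<^esub> \<one>\<^bsub>B\<^esub>) z) b"
    by (intro sw_cong b sw_antipode_left[OF gG hom_of_bal[OF f G]])
  also have "\<dots> = sw G (\<lambda>x z. f \<one>\<^bsub>B\<^esub> (eps x \<odot>\<^bsub>B\<^esub> z)) b"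
    by (intro sw_cong b) (simp add: fD eps_closed)
  also have "\<dots> = f \<one>\<^bsub>B\<^esub> b"
    by (rule sw_counit_left[OF gG _ b]) (intro homI; simp add: fD)
  finally show ?thesis .
qed

lemma UG: "comm_group (add_monoid U)"
  using nc_algebra.axioms(2)[OF U_nc_algebra] ring.is_abelian_group abelian_group_iff by blast

lemma U_ring: "ring U"
  by (rule nc_algebra.axioms(2)[OF U_nc_algebra])

abbreviation swU where "swU \<equiv> sw (add_monoid U)"

lemma swU_closed:
  "\<lbrakk>b \<in> carrier B; \<And>x y. \<lbrakk>x \<in> carrier B; y \<in> carrier B\<rbrakk> \<Longrightarrow> f x y \<in> carrier U\<rbrakk> \<Longrightarrow> swU f b \<in> carrier U"
  using sw_closed[OF UG, of b f] by simp

lemma swU_add: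
  "\<lbrakk>b \<in> carrier B; \<And>x y. \<lbrakk>x \<in> carrier B; y \<in> carrier B\<rbrakk> \<Longrightarrow> f x y \<in> carrier U;
    \<And>x y. \<lbrakk>x \<in> carrier B; y \<in> carrier B\<rbrakk> \<Longrightarrow> g x y \<in> carrier U\<rbrakk> \<Longrightarrow>
    swU (\<lambda>x y. f x y \<oplus>\<^bsub>U\<^esub> g x y) b = swU f b \<oplus>\<^bsub>U\<^esub> swU g b"
  using sw_mult_dist[OF UG, of b f g] by simp

lemma swU_minus:
  assumes b: "b \<in> carrier B" and f: "\<And>x y. \<lbrakk>x \<in> carrier B; y \<in> carrier B\<rbrakk> \<Longrightarrow> f x y \<in> carrier U"
    and g: "\<And>x y. \<lbrakk>x \<in> carrier B; y \<in> carrier B\<rbrakk> \<Longrightarrow> g x y \<in> carrier U"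
  shows "swU (\<lambda>x y. f x y \<ominus>\<^bsub>U\<^esub> g x y) b = swU f b \<ominus>\<^bsub>U\<^esub> swU g b"
proof -
  have "swU f b = swU (\<lambda>x y. (f x y \<ominus>\<^bsub>U\<^esub> g x y) \<oplus>\<^bsub>U\<^esub> g x y) b"
    by (rule sw_cong[OF b]) (simp add: f g a_minus_def U.M.a_assoc U.M.l_neg)
  also have "\<dots> = swU (\<lambda>x y. f x y \<ominus>\<^bsub>U\<^esub> g x y) b \<oplus>\<^bsub>U\<^esub> swU g b"
    by (rule swU_add[OF b]) (simp_all add: f g)
  finally show ?thesis
    using swU_closed[OF b, of "\<lambda>x y. f x y \<ominus>\<^bsub>U\<^esub> g x y"] swU_closed[OF b, of g] f g
    by (simp add: a_minus_def U.M.a_assoc U.M.r_neg)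
qed

lemmas swU_ldistr = sw_ldistr[OF U_ring] and swU_rdistr = sw_rdistr[OF U_ring]

lemma mS_lin: "(\<lambda>b. m (S b)) \<in> lin_map k B U"
  by (rule lin_mapI) (simp_all add: m_closed S_lin m_add m_smult)

section \<open>The elements \<open>p b\<close> and their relations\<close>

text \<open>The convolution product of \<open>m\<close> after \<open>S\<close> with
  \<open>h\<close>. As \<open>m\<close> after \<open>S\<close> is the convolution inverse of
  \<open>m\<close>, this is the only linear choice for which \<open>m\<close> convolved with
  \<open>p\<close> gives \<open>h\<close>.\<close>

definition p where "p = swU (\<lambda>y z. m (S y) \<cdot> h z)"

lemma p_lin: "p \<in> lin_map k B U"
  unfolding p_def
  by (rule sw_lin_map[OF U_nc_algebra balanced_mult[OF U_nc_algebra mS_lin h_lin]])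
    (simp add: m_closed S_lin m_smult h_closed U.smult_mult_left)

lemmas p_linD = lin_mapD[OF p_lin]
lemmas p_closed = p_linD(1)

lemma sw_m_p:
  assumes b: "b \<in> carrier B"
  shows "swU (\<lambda>x w. m x \<cdot> p w) b = h b"
proof -
  have "swU (\<lambda>x w. m x \<cdot> p w) b = swU (\<lambda>x w. swU (\<lambda>y z. m (x \<otimes>\<^bsub>B\<^esub> S y) \<cdot> h z) w) b"
    unfolding p_def
    by (rule sw_cong[OF b], subst swU_rdistr)
      (auto simp: m_closed h_closed S_lin m_mult U.m_assoc intro!: sw_cong)
  also have "\<dots> = m \<one>\<^bsub>B\<^esub> \<cdot> h b"
    by (rule sw_antipode_cancel_right[OF UG balanced_mult[OF U_nc_algebra m_lin h_lin] b])
  finally show ?thesis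
    using b by (simp add: m_one h_closed)
qed

text \<open>Convolving on the left with \<open>m\<close> after \<open>S\<close>, the convolution
  inverse of \<open>m\<close>, recovers \<open>F\<close> and \<open>G\<close> from the two equal
  sums.\<close>

lemma sw_m_cancel:
  assumes b: "b \<in> carrier B" and F: "F \<in> lin_map k B U" and G: "G \<in> lin_map k B U"
    and eq: "\<And>x. x \<in> carrier B \<Longrightarrow>
      swU (\<lambda>y z. m y \<cdot> F z) x = swU (\<lambda>y z. m y \<cdot> G z) x"
  shows "F b = G b"
proof -
  have *: "F b = swU (\<lambda>x w. m (S x) \<cdot> swU (\<lambda>y z. m y \<cdot> F z) w) b" if F: "F \<in> lin_map k B U" for F
  proof -
    have "swU (\<lambda>x w. m (S x) \<cdot> swU (\<lambda>y z. m y \<cdot> F z) w) b =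
        swU (\<lambda>x w. swU (\<lambda>y z. m (S x \<otimes>\<^bsub>B\<^esub> y) \<cdot> F z) w) b"
      by (rule sw_cong[OF b], subst swU_rdistr)
        (auto simp: m_closed lin_mapD[OF F] S_lin m_mult U.m_assoc intro!: sw_cong)
    also have "\<dots> = m \<one>\<^bsub>B\<^esub> \<cdot> F b"
      by (rule sw_antipode_cancel_left[OF UG balanced_mult[OF U_nc_algebra m_lin F] b])
    finally show ?thesis
      using b by (simp add: m_one lin_mapD[OF F])
  qed
  show ?thesis
    unfolding *[OF F] *[OF G] by (rule sw_cong[OF b]) (simp add: eq)
qed

text \<open>The cancellation is applied in \<open>x\<close> for fixed \<open>y\<close> and then in
  \<open>y\<close>. It is the device that transfers the relations of \<open>h\<close> to
  \<open>p\<close>.\<close>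

lemma sw_m_cancel2:
  assumes x: "x \<in> carrier B" and y: "y \<in> carrier B"
    and E1: "\<And>y. y \<in> carrier B \<Longrightarrow> (\<lambda>x. E x y) \<in> lin_map k B U" and E2: "\<And>x. x \<in> carrier B \<Longrightarrow> E x \<in> lin_map k B U"
    and D1: "\<And>y. y \<in> carrier B \<Longrightarrow> (\<lambda>x. D x y) \<in> lin_map k B U" and D2: "\<And>x. x \<in> carrier B \<Longrightarrow> D x \<in> lin_map k B U"
    and eq: "\<And>x y. \<lbrakk>x \<in> carrier B; y \<in> carrier B\<rbrakk> \<Longrightarrow>
      swU (\<lambda>x1 x2. swU (\<lambda>y1 y2. m x1 \<cdot> (m y1 \<cdot> E x2 y2)) y) x =
      swU (\<lambda>x1 x2. swU (\<lambda>y1 y2. m x1 \<cdot> (m y1 \<cdot> D x2 y2)) y) x"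
  shows "E x y = D x y"
proof -
  \<comment> \<open>The first cancellation treats the whole inner sum over \<open>y\<close> as a
    function of \<open>x\<close>, so that sum has to be linear in \<open>x\<close>.\<close>
  have lin: "(\<lambda>x. swU (\<lambda>y1 y2. m y1 \<cdot> E x y2) y) \<in> lin_map k B U"
    if y: "y \<in> carrier B" and E1: "\<And>y. y \<in> carrier B \<Longrightarrow> (\<lambda>x. E x y) \<in> lin_map k B U"
    for E y
  proof (rule lin_mapI)
    fix x assume "x \<in> carrier B"
    then show "swU (\<lambda>y1 y2. m y1 \<cdot> E x y2) y \<in> carrier U"
      using lin_mapD(1)[OF E1] by (intro swU_closed y) (simp add: m_closed)
  next
    fix x x' assume x: "x \<in> carrier B" "x' \<in> carrier B"
    have "swU (\<lambda>y1 y2. m y1 \<cdot> E (x \<oplus>\<^bsub>B\<^esub> x') y2) y =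
        swU (\<lambda>y1 y2. m y1 \<cdot> E x y2 \<oplus>\<^bsub>U\<^esub> m y1 \<cdot> E x' y2) y"
      by (rule sw_cong[OF y]) (use x in \<open>simp add: m_closed lin_mapD[OF E1] U.r_distr\<close>)
    also have "\<dots> = swU (\<lambda>y1 y2. m y1 \<cdot> E x y2) y \<oplus>\<^bsub>U\<^esub> swU (\<lambda>y1 y2. m y1 \<cdot> E x' y2) y"
      by (rule swU_add[OF y]) (use x in \<open>simp_all add: m_closed lin_mapD[OF E1]\<close>)
    finally show "swU (\<lambda>y1 y2. m y1 \<cdot> E (x \<oplus>\<^bsub>B\<^esub> x') y2) y =
        swU (\<lambda>y1 y2. m y1 \<cdot> E x y2) y \<oplus>\<^bsub>U\<^esub> swU (\<lambda>y1 y2. m y1 \<cdot> E x' y2) y" .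
  next
    fix r x assume r: "r \<in> carrier k" and x: "x \<in> carrier B"
    have "swU (\<lambda>y1 y2. m y1 \<cdot> E (r \<odot>\<^bsub>B\<^esub> x) y2) y =
        swU (\<lambda>y1 y2. (r \<odot>\<^bsub>U\<^esub> \<one>\<^bsub>U\<^esub>) \<cdot> (m y1 \<cdot> E x y2)) y"
      by (rule sw_cong[OF y])
        (use r x in \<open>simp add: m_closed lin_mapD[OF E1] U.smult_mult_left U.smult_mult_right\<close>)
    also have "\<dots> = (r \<odot>\<^bsub>U\<^esub> \<one>\<^bsub>U\<^esub>) \<cdot> swU (\<lambda>y1 y2. m y1 \<cdot> E x y2) y"
      by (rule swU_rdistr[symmetric]) (use r x y in \<open>simp_all add: m_closed lin_mapD[OF E1]\<close>)
    also have "\<dots> = r \<odot>\<^bsub>U\<^esub> swU (\<lambda>y1 y2. m y1 \<cdot> E x y2) y"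
      using lin_mapD(1)[OF E1] r x y swU_closed[OF y, of "\<lambda>y1 y2. m y1 \<cdot> E x y2"]
      by (simp add: m_closed U.smult_mult_left)
    finally show "swU (\<lambda>y1 y2. m y1 \<cdot> E (r \<odot>\<^bsub>B\<^esub> x) y2) y =
        r \<odot>\<^bsub>U\<^esub> swU (\<lambda>y1 y2. m y1 \<cdot> E x y2) y" .
  qed
  have dist: "swU (\<lambda>x1 x2. m x1 \<cdot> swU (\<lambda>y1 y2. m y1 \<cdot> E x2 y2) y) x =
      swU (\<lambda>x1 x2. swU (\<lambda>y1 y2. m x1 \<cdot> (m y1 \<cdot> E x2 y2)) y) x"
    if y: "y \<in> carrier B" and x: "x \<in> carrier B"
      and E1: "\<And>y. y \<in> carrier B \<Longrightarrow> (\<lambda>x. E x y) \<in> lin_map k B U"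
    for E x y
    by (rule sw_cong[OF x], rule swU_rdistr) (use y in \<open>simp_all add: m_closed lin_mapD(1)[OF E1]\<close>)
  have inner: "swU (\<lambda>y1 y2. m y1 \<cdot> E x y2) y = swU (\<lambda>y1 y2. m y1 \<cdot> D x y2) y"
    if y: "y \<in> carrier B" for y
    by (rule sw_m_cancel[OF x lin[OF y E1] lin[OF y D1]]) (simp_all only: dist E1 D1 y eq)
  show ?thesis
    by (rule sw_m_cancel[OF y E2[OF x] D2[OF x] inner])
qed

text \<open>Since \<open>m c\<close> commutes with every \<open>m x1\<close>, the factor
  \<open>m x1\<close> can be drawn into the commutator. The sum becomes the commutator of
  \<open>m c\<close> with m_x1 p_x2 summed, that is with \<open>h x\<close>.\<close>

lemma sw_m_p_comm:
  assumes x: "x \<in> carrier B" and c: "c \<in> carrier B"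
  shows "swU (\<lambda>x1 x2. m x1 \<cdot> (p x2 \<cdot> m c \<ominus>\<^bsub>U\<^esub> m c \<cdot> p x2)) x = m (bracket B x c)"
proof -
  have mm: "m a \<cdot> m c = m c \<cdot> m a" if "a \<in> carrier B" for a
    using that c by (simp add: BB.m_comm flip: m_mult)
  have "m a \<cdot> (p b \<cdot> m c \<ominus>\<^bsub>U\<^esub> m c \<cdot> p b) =
      m a \<cdot> p b \<cdot> m c \<ominus>\<^bsub>U\<^esub> m c \<cdot> (m a \<cdot> p b)"
    if "a \<in> carrier B" "b \<in> carrier B" for a b
    using that c mm[of a] by (simp add: m_closed p_closed U.r_distr a_minus_def U.r_minus U.m_assoc flip: U.m_assoc[of "m a" "m c"])
  then have "swU (\<lambda>x1 x2. m x1 \<cdot> (p x2 \<cdot> m c \<ominus>\<^bsub>U\<^esub> m c \<cdot> p x2)) x =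
      swU (\<lambda>a b. m a \<cdot> p b \<cdot> m c \<ominus>\<^bsub>U\<^esub> m c \<cdot> (m a \<cdot> p b)) x"
    by (intro sw_cong x)
  also have "\<dots> = h x \<cdot> m c \<ominus>\<^bsub>U\<^esub> m c \<cdot> h x"
    using x c by (subst swU_minus) (simp_all add: m_closed p_closed sw_m_p flip: swU_ldistr swU_rdistr)
  finally show ?thesis
    using x c by (simp add: m_bracket)
qed

text \<open>Moving \<open>m c\<close> to the left past each h_z costs m_{z,c}. The corrections
  m_S(y) m_{z,c} all lie in the image of \<open>m\<close>, and the witness is d = S(b1){b2,c}. This
  is exactly what will make \<open>T b\<close> well defined over \<open>B\<close>.\<close>

lemma p_comm_m:
  assumes b: "b \<in> carrier B" and c: "c \<in> carrier B"
  shows "\<exists>d\<in>carrier B. p b \<cdot> m c = m c \<cdot> p b \<oplus>\<^bsub>U\<^esub> m d"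
proof -
  let ?d = "sw (add_monoid B) (\<lambda>y z. S y \<otimes>\<^bsub>B\<^esub> bracket B z c) b"
  have BG: "comm_group (add_monoid B)" by (rule BB.M.a_comm_group)
  have d: "?d \<in> carrier B"
    using sw_closed[OF BG b, of "\<lambda>y z. S y \<otimes>\<^bsub>B\<^esub> bracket B z c"] c by (simp add: S_lin bracket_closed)
  have mm: "m a \<cdot> m c = m c \<cdot> m a" if "a \<in> carrier B" for a
    using that c by (simp add: BB.m_comm flip: m_mult)
  have hm: "h z \<cdot> m c = m c \<cdot> h z \<oplus>\<^bsub>U\<^esub> m (bracket B z c)" if "z \<in> carrier B" for z
    using that c m_bracket[OF that c] m_closed h_closed bracket_closed
    by (simp add: a_minus_def U.M.a_ac U.M.r_neg U.M.r_neg1)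
  have "p b \<cdot> m c = swU (\<lambda>y z. m (S y) \<cdot> h z \<cdot> m c) b"
    unfolding p_def by (rule swU_ldistr) (simp_all add: b c m_closed h_closed S_lin)
  also have "\<dots> = swU (\<lambda>y z. m c \<cdot> (m (S y) \<cdot> h z) \<oplus>\<^bsub>U\<^esub> m (S y \<otimes>\<^bsub>B\<^esub> bracket B z c)) b"
  proof (rule sw_cong[OF b])
    fix y z assume yz: "y \<in> carrier B" "z \<in> carrier B"
    have "m (S y) \<cdot> h z \<cdot> m c = m (S y) \<cdot> (m c \<cdot> h z \<oplus>\<^bsub>U\<^esub> m (bracket B z c))"
      using yz c by (simp add: U.m_assoc m_closed h_closed S_lin hm)
    also have "\<dots> = m (S y) \<cdot> m c \<cdot> h z \<oplus>\<^bsub>U\<^esub> m (S y) \<cdot> m (bracket B z c)"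
      using yz c by (simp add: U.m_assoc m_closed h_closed S_lin U.r_distr bracket_closed)
    finally show "m (S y) \<cdot> h z \<cdot> m c =
        m c \<cdot> (m (S y) \<cdot> h z) \<oplus>\<^bsub>U\<^esub> m (S y \<otimes>\<^bsub>B\<^esub> bracket B z c)"
      using yz c by (simp add: mm S_lin m_mult bracket_closed) (simp add: U.m_assoc m_closed h_closed S_lin)
  qed
  also have "\<dots> = m c \<cdot> p b \<oplus>\<^bsub>U\<^esub> swU (\<lambda>y z. m (S y \<otimes>\<^bsub>B\<^esub> bracket B z c)) b"
    unfolding p_def using b c
    by (subst swU_add) (simp_all add: m_closed h_closed S_lin bracket_closed flip: swU_rdistr)
  also have "swU (\<lambda>y z. m (S y \<otimes>\<^bsub>B\<^esub> bracket B z c)) b = m ?d"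
    by (rule hom_sw[OF BG comm_group.axioms(2)[OF UG] _ b, symmetric])
      (use c m_lin in \<open>auto simp: lin_map_def S_lin bracket_closed\<close>)
  finally show ?thesis using d by blast
qed

text \<open>Applying the counit to both legs of the coproduct of {x,y} returns its counit e.
  Computed from the bracket rule instead, the two summands give e each, so e = e + e.\<close>

lemma eps_bracket:
  assumes x: "x \<in> carrier B" and y: "y \<in> carrier B"
  shows "eps (bracket B x y) = \<zero>"
proof -
  let ?K = "add_monoid k"
  have K: "comm_group ?K" by (rule kk.a_comm_group)
  note gK = comm_group.axioms(2)[OF K]
  note e = ring_hom_add[OF counit_ring_hom] ring_hom_mult[OF counit_ring_hom] eps_closed counit_smult bracket_closed
  have bal: "kbalanced k B B ?K (\<lambda>a b. eps a \<otimes> eps b)"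
    by (rule balancedI) (simp_all add: e kk.l_distr kk.r_distr kk.m_ac)
  have eps_hom: "eps \<in> hom (add_monoid B) ?K"
    by (rule homI) (simp_all add: e)
  have one: "sw ?K (\<lambda>a b. eps a \<otimes> eps b) z = eps z" if z: "z \<in> carrier B" for z
  proof -
    have "sw ?K (\<lambda>a b. eps a \<otimes> eps b) z = sw ?K (\<lambda>a b. eps (eps a \<odot>\<^bsub>B\<^esub> b)) z"
      by (rule sw_cong[OF z]) (simp add: e)
    then show ?thesis
      using sw_counit_left[OF gK eps_hom z] by simp
  qed
  have "eps (bracket B x y) = sw ?K (\<lambda>a b. eps a \<otimes> eps b) (bracket B x y)"
    using x y by (simp add: one bracket_closed)
  also have "\<dots> = sw ?K (\<lambda>x1 x2. sw ?K (\<lambda>y1 y2. eps x1 \<otimes> eps y1 \<otimes> eps (bracket B x2 y2) \<otimes>\<^bsub>?K\<^esub>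
      (eps (bracket B x1 y1) \<otimes> (eps x2 \<otimes> eps y2))) y) x"
    unfolding sw_bracket[OF K bal x y] by (intro sw_cong x y) (simp add: e)
  \<comment> \<open>The counit values are absorbed into the brackets as scalars, so that every sum
    becomes a contraction by the counit axiom.\<close>
  also have "\<dots> = sw ?K (\<lambda>x1 x2. sw ?K (\<lambda>y1 y2. eps (bracket B (eps x1 \<odot>\<^bsub>B\<^esub> x2) (eps y1 \<odot>\<^bsub>B\<^esub> y2)) \<otimes>\<^bsub>?K\<^esub>
      eps (bracket B (eps x2 \<odot>\<^bsub>B\<^esub> x1) (eps y2 \<odot>\<^bsub>B\<^esub> y1))) y) x"
    by (intro sw_cong x y) (simp add: e bracket_smult_left bracket_smult_right kk.m_ac)
  also have "\<dots> = sw ?K (\<lambda>x1 x2. sw ?K (\<lambda>y1 y2. eps (bracket B (eps x1 \<odot>\<^bsub>B\<^esub> x2) (eps y1 \<odot>\<^bsub>B\<^esub> y2))) y \<otimes>\<^bsub>?K\<^esub>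
      sw ?K (\<lambda>y1 y2. eps (bracket B (eps x2 \<odot>\<^bsub>B\<^esub> x1) (eps y2 \<odot>\<^bsub>B\<^esub> y1))) y) x"
    by (intro sw_cong x sw_mult_dist[OF K y]) (simp_all add: e)
  also have "\<dots> = sw ?K (\<lambda>x1 x2. eps (bracket B (eps x1 \<odot>\<^bsub>B\<^esub> x2) y) \<otimes>\<^bsub>?K\<^esub> eps (bracket B (eps x2 \<odot>\<^bsub>B\<^esub> x1) y)) x"
  proof (rule sw_cong[OF x])
    fix a b assume a: "a \<in> carrier B" and b: "b \<in> carrier B"
    have hom: "(\<lambda>z. eps (bracket B u z)) \<in> hom (add_monoid B) ?K" if "u \<in> carrier B" for u
      by (rule homI) (simp_all add: e that bracket_add_right)
    show "sw ?K (\<lambda>y1 y2. eps (bracket B (eps a \<odot>\<^bsub>B\<^esub> b) (eps y1 \<odot>\<^bsub>B\<^esub> y2))) y \<otimes>\<^bsub>?K\<^esub>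
      sw ?K (\<lambda>y1 y2. eps (bracket B (eps b \<odot>\<^bsub>B\<^esub> a) (eps y2 \<odot>\<^bsub>B\<^esub> y1))) y =
      eps (bracket B (eps a \<odot>\<^bsub>B\<^esub> b) y) \<otimes>\<^bsub>?K\<^esub> eps (bracket B (eps b \<odot>\<^bsub>B\<^esub> a) y)"
      using a b by (subst sw_counit_left[OF gK hom y], simp add: e, subst sw_counit_right[OF gK hom y]) (simp_all add: e)
  qed
  also have "\<dots> = sw ?K (\<lambda>x1 x2. eps (bracket B (eps x1 \<odot>\<^bsub>B\<^esub> x2) y)) x \<otimes>\<^bsub>?K\<^esub>
      sw ?K (\<lambda>x1 x2. eps (bracket B (eps x2 \<odot>\<^bsub>B\<^esub> x1) y)) x"
    by (rule sw_mult_dist[OF K x]) (simp_all add: e y)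
  also have "\<dots> = eps (bracket B x y) \<otimes>\<^bsub>?K\<^esub> eps (bracket B x y)"
  proof -
    have hom: "(\<lambda>z. eps (bracket B z y)) \<in> hom (add_monoid B) ?K"
      by (rule homI) (simp_all add: e y bracket_add_left)
    show ?thesis
      by (simp only: sw_counit_left[OF gK hom x] sw_counit_right[OF gK hom x])
  qed
  finally show ?thesis
    using x y by (simp add: e)
qed

lemma m_comm_m: "\<lbrakk>a \<in> carrier B; c \<in> carrier B\<rbrakk> \<Longrightarrow> m a \<cdot> m c = m c \<cdot> m a"
  by (simp add: BB.m_comm flip: m_mult)

lemma lin_map_add:
  "F \<in> lin_map k B U \<Longrightarrow> G \<in> lin_map k B U \<Longrightarrow> (\<lambda>x. F x \<oplus>\<^bsub>U\<^esub> G x) \<in> lin_map k B U"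
  by (rule lin_mapI) (simp_all add: lin_mapD U.smult_r_distr U.M.a_ac)

lemma lin_map_smult:
  assumes "r \<in> carrier k" and F: "F \<in> lin_map k B U"
  shows "(\<lambda>x. r \<odot>\<^bsub>U\<^esub> F x) \<in> lin_map k B U"
proof (rule lin_mapI)
  fix s x assume "s \<in> carrier k" "x \<in> carrier B"
  then show "r \<odot>\<^bsub>U\<^esub> F (s \<odot>\<^bsub>B\<^esub> x) = s \<odot>\<^bsub>U\<^esub> (r \<odot>\<^bsub>U\<^esub> F x)"
    using assms(1) kk.m_comm[of r s] by (simp add: lin_mapD[OF F] flip: U.smult_assoc1)
qed (use assms(1) in \<open>simp_all add: lin_mapD[OF F] U.smult_r_distr\<close>)

lemma lin_map_eps: "u \<in> carrier U \<Longrightarrow> (\<lambda>x. eps x \<odot>\<^bsub>U\<^esub> u) \<in> lin_map k B U"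
  by (rule lin_mapI)
    (simp_all add: eps_closed ring_hom_add[OF counit_ring_hom] counit_smult U.smult_l_distr U.smult_assoc1)

text \<open>After convolution with \<open>m\<close> in both variables the left side becomes h_xy, by
  the product rule for coproducts, and the right side becomes m_x h_y + m_y h_x, by the counit
  axiom. The defining relation for h_xy identifies the two.\<close>

lemma p_mult:
  assumes x: "x \<in> carrier B" and y: "y \<in> carrier B"
  shows "p (x \<otimes>\<^bsub>B\<^esub> y) = eps x \<odot>\<^bsub>U\<^esub> p y \<oplus>\<^bsub>U\<^esub> eps y \<odot>\<^bsub>U\<^esub> p x"
proof (rule sw_m_cancel2[OF x y, of "\<lambda>x y. p (x \<otimes>\<^bsub>B\<^esub> y)" "\<lambda>x y. eps x \<odot>\<^bsub>U\<^esub> p y \<oplus>\<^bsub>U\<^esub> eps y \<odot>\<^bsub>U\<^esub> p x"])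
  fix x y assume x: "x \<in> carrier B" and y: "y \<in> carrier B"
  note c = m_closed p_closed h_closed eps_closed
  have "swU (\<lambda>x1 x2. swU (\<lambda>y1 y2. m x1 \<cdot> (m y1 \<cdot> p (x2 \<otimes>\<^bsub>B\<^esub> y2))) y) x =
      swU (\<lambda>x1 x2. swU (\<lambda>y1 y2. m (x1 \<otimes>\<^bsub>B\<^esub> y1) \<cdot> p (x2 \<otimes>\<^bsub>B\<^esub> y2)) y) x"
    by (intro sw_cong x y) (simp add: c m_mult U.m_assoc)
  also have "\<dots> = h (x \<otimes>\<^bsub>B\<^esub> y)"
    using sw_prod[OF UG balanced_mult[OF U_nc_algebra m_lin p_lin] x y] x y by (simp add: sw_m_p)
  finally have L: "swU (\<lambda>x1 x2. swU (\<lambda>y1 y2. m x1 \<cdot> (m y1 \<cdot> p (x2 \<otimes>\<^bsub>B\<^esub> y2))) y) x =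
      m y \<cdot> h x \<oplus>\<^bsub>U\<^esub> m x \<cdot> h y"
    using x y by (simp add: h_mult)
  have m_hom: "m \<in> hom (add_monoid B) (add_monoid U)"
    using m_lin by (simp add: lin_map_def)
  note gU = comm_group.axioms(2)[OF UG]
  have cr: "swU (\<lambda>x1 x2. eps x2 \<odot>\<^bsub>U\<^esub> m x1) x = m x" if x: "x \<in> carrier B" for x
  proof -
    have "swU (\<lambda>x1 x2. eps x2 \<odot>\<^bsub>U\<^esub> m x1) x = swU (\<lambda>x1 x2. m (eps x2 \<odot>\<^bsub>B\<^esub> x1)) x"
      by (rule sw_cong[OF x]) (simp add: m_smult c)
    then show ?thesis using sw_counit_right[OF gU m_hom x] by simp
  qed
  have "swU (\<lambda>x1 x2. swU (\<lambda>y1 y2. m x1 \<cdot> (m y1 \<cdot> (eps x2 \<odot>\<^bsub>U\<^esub> p y2 \<oplus>\<^bsub>U\<^esub> eps y2 \<odot>\<^bsub>U\<^esub> p x2))) y) x =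
      swU (\<lambda>x1 x2. swU (\<lambda>y1 y2. (eps x2 \<odot>\<^bsub>U\<^esub> m x1) \<cdot> (m y1 \<cdot> p y2) \<oplus>\<^bsub>U\<^esub>
        (eps y2 \<odot>\<^bsub>U\<^esub> m y1) \<cdot> (m x1 \<cdot> p x2)) y) x"
  proof (intro sw_cong x y)
    fix a b a' b' assume ab: "a \<in> carrier B" "b \<in> carrier B" "a' \<in> carrier B" "b' \<in> carrier B"
    have "m a \<cdot> (m a' \<cdot> p b) = m a' \<cdot> (m a \<cdot> p b)"
      using ab m_comm_m[of a a'] by (simp add: c flip: U.m_assoc)
    then show "m a \<cdot> (m a' \<cdot> (eps b \<odot>\<^bsub>U\<^esub> p b' \<oplus>\<^bsub>U\<^esub> eps b' \<odot>\<^bsub>U\<^esub> p b)) =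
        (eps b \<odot>\<^bsub>U\<^esub> m a) \<cdot> (m a' \<cdot> p b') \<oplus>\<^bsub>U\<^esub> (eps b' \<odot>\<^bsub>U\<^esub> m a') \<cdot> (m a \<cdot> p b)"
      using ab by (simp add: c U.r_distr U.smult_mult_left U.smult_mult_right)
  qed
  also have "\<dots> = swU (\<lambda>x1 x2. (eps x2 \<odot>\<^bsub>U\<^esub> m x1) \<cdot> h y \<oplus>\<^bsub>U\<^esub> m y \<cdot> (m x1 \<cdot> p x2)) x"
  proof (rule sw_cong[OF x])
    fix a b assume ab: "a \<in> carrier B" "b \<in> carrier B"
    have "swU (\<lambda>y1 y2. (eps b \<odot>\<^bsub>U\<^esub> m a) \<cdot> (m y1 \<cdot> p y2) \<oplus>\<^bsub>U\<^esub>
        (eps y2 \<odot>\<^bsub>U\<^esub> m y1) \<cdot> (m a \<cdot> p b)) y =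
        (eps b \<odot>\<^bsub>U\<^esub> m a) \<cdot> swU (\<lambda>y1 y2. m y1 \<cdot> p y2) y \<oplus>\<^bsub>U\<^esub>
        swU (\<lambda>y1 y2. eps y2 \<odot>\<^bsub>U\<^esub> m y1) y \<cdot> (m a \<cdot> p b)"
      using ab y by (subst swU_add) (simp_all add: c swU_ldistr swU_rdistr)
    then show "swU (\<lambda>y1 y2. (eps b \<odot>\<^bsub>U\<^esub> m a) \<cdot> (m y1 \<cdot> p y2) \<oplus>\<^bsub>U\<^esub>
        (eps y2 \<odot>\<^bsub>U\<^esub> m y1) \<cdot> (m a \<cdot> p b)) y =
        (eps b \<odot>\<^bsub>U\<^esub> m a) \<cdot> h y \<oplus>\<^bsub>U\<^esub> m y \<cdot> (m a \<cdot> p b)"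
      by (simp only: sw_m_p[OF y] cr[OF y])
  qed
  also have "\<dots> = swU (\<lambda>x1 x2. eps x2 \<odot>\<^bsub>U\<^esub> m x1) x \<cdot> h y \<oplus>\<^bsub>U\<^esub>
      m y \<cdot> swU (\<lambda>x1 x2. m x1 \<cdot> p x2) x"
    using x y by (subst swU_add) (simp_all add: c swU_ldistr swU_rdistr)
  also have "\<dots> = m x \<cdot> h y \<oplus>\<^bsub>U\<^esub> m y \<cdot> h x"
    by (simp only: sw_m_p[OF x] cr[OF x])
  finally show "swU (\<lambda>x1 x2. swU (\<lambda>y1 y2. m x1 \<cdot> (m y1 \<cdot> p (x2 \<otimes>\<^bsub>B\<^esub> y2))) y) x =
      swU (\<lambda>x1 x2. swU (\<lambda>y1 y2. m x1 \<cdot> (m y1 \<cdot> (eps x2 \<odot>\<^bsub>U\<^esub> p y2 \<oplus>\<^bsub>U\<^esub> eps y2 \<odot>\<^bsub>U\<^esub> p x2))) y) x"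
    using L x y by (simp add: U.M.a_comm c)
next
  fix y assume y: "y \<in> carrier B"
  show "(\<lambda>x. p (x \<otimes>\<^bsub>B\<^esub> y)) \<in> lin_map k B U"
    by (rule lin_mapI) (use y in \<open>simp_all add: p_linD BB.l_distr BP.Ma.smult_mult_left\<close>)
  show "(\<lambda>x. eps x \<odot>\<^bsub>U\<^esub> p y \<oplus>\<^bsub>U\<^esub> eps y \<odot>\<^bsub>U\<^esub> p x) \<in> lin_map k B U"
    by (intro lin_map_add lin_map_eps lin_map_smult p_lin p_closed eps_closed y)
next
  fix x assume x: "x \<in> carrier B"
  show "(\<lambda>y. p (x \<otimes>\<^bsub>B\<^esub> y)) \<in> lin_map k B U"
    by (rule lin_mapI) (use x in \<open>simp_all add: p_linD BB.r_distr BP.Ma.smult_mult_right\<close>)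
  show "(\<lambda>y. eps x \<odot>\<^bsub>U\<^esub> p y \<oplus>\<^bsub>U\<^esub> eps y \<odot>\<^bsub>U\<^esub> p x) \<in> lin_map k B U"
    by (intro lin_map_add lin_map_eps lin_map_smult p_lin p_closed eps_closed x)
qed

lemma bracket_anti:
  assumes x: "x \<in> carrier B" and y: "y \<in> carrier B"
  shows "bracket B y x = \<ominus>\<^bsub>B\<^esub> bracket B x y"
proof -
  note c = bracket_closed
  have "bracket B (x \<oplus>\<^bsub>B\<^esub> y) (x \<oplus>\<^bsub>B\<^esub> y) =
      (bracket B x x \<oplus>\<^bsub>B\<^esub> bracket B y x) \<oplus>\<^bsub>B\<^esub> (bracket B x y \<oplus>\<^bsub>B\<^esub> bracket B y y)"
    by (simp only: bracket_add_left bracket_add_right BB.M.a_closed x y)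
  then have "bracket B y x \<oplus>\<^bsub>B\<^esub> bracket B x y = \<zero>\<^bsub>B\<^esub>"
    using x y by (simp add: bracket_alternating BB.M.a_comm c)
  then show ?thesis
    using x y by (simp add: BB.M.minus_equality c)
qed

text \<open>Both sides are convolved with \<open>m\<close> in both variables and compared through
  h_{x,y} = h_x h_y - h_y h_x. Every correction produced by moving some p past some m reappears in
  the expansion of h_{x,y}.\<close>

lemma p_bracket:
  assumes x: "x \<in> carrier B" and y: "y \<in> carrier B"
  shows "p (bracket B x y) = p x \<cdot> p y \<ominus>\<^bsub>U\<^esub> p y \<cdot> p x"
proof (rule sw_m_cancel2[OF x y, of "\<lambda>x y. p (bracket B x y)" "\<lambda>x y. p x \<cdot> p y \<ominus>\<^bsub>U\<^esub> p y \<cdot> p x"])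
  fix x y assume x: "x \<in> carrier B" and y: "y \<in> carrier B"
  note c = m_closed p_closed h_closed eps_closed bracket_closed
  \<comment> \<open>\<open>A\<close> is the left side after convolution, and \<open>X\<close> and
    \<open>Y\<close> are the two products on the right after convolution. \<open>C\<close> and
    \<open>D\<close> are the corrections: h_{x,y} = A + C + D, h_x h_y = X + C and h_y h_x = Y -
    D.\<close>
  define A where "A = swU (\<lambda>x1 x2. swU (\<lambda>y1 y2. m x1 \<cdot> (m y1 \<cdot> p (bracket B x2 y2))) y) x"
  define C where "C = swU (\<lambda>y1 y2. m (bracket B x y1) \<cdot> p y2) y"
  define D where "D = swU (\<lambda>x1 x2. m (bracket B x1 y) \<cdot> p x2) x"
  define X where "X = swU (\<lambda>x1 x2. swU (\<lambda>y1 y2. m x1 \<cdot> (m y1 \<cdot> (p x2 \<cdot> p y2))) y) x"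
  define Y where "Y = swU (\<lambda>x1 x2. swU (\<lambda>y1 y2. m x1 \<cdot> (m y1 \<cdot> (p y2 \<cdot> p x2))) y) x"
  have cl: "A \<in> carrier U" "C \<in> carrier U" "D \<in> carrier U" "X \<in> carrier U" "Y \<in> carrier U"
    unfolding A_def C_def D_def X_def Y_def using x y by (auto intro!: swU_closed simp: c)
  have br: "swU (\<lambda>y1 y2. m (bracket B a y1) \<cdot> (eps b \<odot>\<^bsub>U\<^esub> p y2 \<oplus>\<^bsub>U\<^esub> eps y2 \<odot>\<^bsub>U\<^esub> p b)) y =
      swU (\<lambda>y1 y2. m (bracket B (eps b \<odot>\<^bsub>B\<^esub> a) y1) \<cdot> p y2) y \<oplus>\<^bsub>U\<^esub> m (bracket B a y) \<cdot> p b"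
    if ab: "a \<in> carrier B" "b \<in> carrier B" for a b
  proof -
    have hom: "(\<lambda>z. m (bracket B a z)) \<in> hom (add_monoid B) (add_monoid U)"
      by (rule homI) (use ab in \<open>simp_all add: c bracket_add_right m_add\<close>)
    have "swU (\<lambda>y1 y2. m (bracket B a y1) \<cdot> (eps b \<odot>\<^bsub>U\<^esub> p y2 \<oplus>\<^bsub>U\<^esub> eps y2 \<odot>\<^bsub>U\<^esub> p b)) y =
        swU (\<lambda>y1 y2. m (bracket B (eps b \<odot>\<^bsub>B\<^esub> a) y1) \<cdot> p y2 \<oplus>\<^bsub>U\<^esub> m (bracket B a (eps y2 \<odot>\<^bsub>B\<^esub> y1)) \<cdot> p b) y"
      by (rule sw_cong[OF y])
        (use ab in \<open>simp add: c U.r_distr bracket_smult_left bracket_smult_right m_smult U.smult_mult_left U.smult_mult_right\<close>)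
    also have "\<dots> = swU (\<lambda>y1 y2. m (bracket B (eps b \<odot>\<^bsub>B\<^esub> a) y1) \<cdot> p y2) y \<oplus>\<^bsub>U\<^esub>
        swU (\<lambda>y1 y2. m (bracket B a (eps y2 \<odot>\<^bsub>B\<^esub> y1))) y \<cdot> p b"
      using ab y by (subst swU_add) (simp_all add: c swU_ldistr)
    finally show ?thesis
      by (simp only: sw_counit_right[OF comm_group.axioms(2)[OF UG] hom y])
  qed
  have h1: "h (bracket B x y) = A \<oplus>\<^bsub>U\<^esub> (C \<oplus>\<^bsub>U\<^esub> D)"
  proof -
    have "h (bracket B x y) = swU (\<lambda>a b. m a \<cdot> p b) (bracket B x y)"
      using x y by (simp add: sw_m_p c)
    also have "\<dots> = swU (\<lambda>x1 x2. swU (\<lambda>y1 y2. m (x1 \<otimes>\<^bsub>B\<^esub> y1) \<cdot> p (bracket B x2 y2) \<oplus>\<^bsub>U\<^esub>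
        m (bracket B x1 y1) \<cdot> p (x2 \<otimes>\<^bsub>B\<^esub> y2)) y) x"
      using sw_bracket[OF UG balanced_mult[OF U_nc_algebra m_lin p_lin] x y] by simp
    also have "\<dots> = swU (\<lambda>x1 x2. swU (\<lambda>y1 y2. m x1 \<cdot> (m y1 \<cdot> p (bracket B x2 y2)) \<oplus>\<^bsub>U\<^esub>
        m (bracket B x1 y1) \<cdot> (eps x2 \<odot>\<^bsub>U\<^esub> p y2 \<oplus>\<^bsub>U\<^esub> eps y2 \<odot>\<^bsub>U\<^esub> p x2)) y) x"
      by (intro sw_cong x y) (simp add: c m_mult p_mult U.m_assoc)
    also have "\<dots> = swU (\<lambda>x1 x2. swU (\<lambda>y1 y2. m x1 \<cdot> (m y1 \<cdot> p (bracket B x2 y2))) y \<oplus>\<^bsub>U\<^esub>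
        (swU (\<lambda>y1 y2. m (bracket B (eps x2 \<odot>\<^bsub>B\<^esub> x1) y1) \<cdot> p y2) y \<oplus>\<^bsub>U\<^esub> m (bracket B x1 y) \<cdot> p x2)) x"
      by (rule sw_cong[OF x], subst swU_add) (use y in \<open>simp_all add: c br\<close>)
    also have "\<dots> = A \<oplus>\<^bsub>U\<^esub> (swU (\<lambda>x1 x2. swU (\<lambda>y1 y2. m (bracket B (eps x2 \<odot>\<^bsub>B\<^esub> x1) y1) \<cdot> p y2) y) x \<oplus>\<^bsub>U\<^esub> D)"
      unfolding A_def D_def using x y
      by (subst swU_add, simp_all add: c swU_closed) (subst swU_add, simp_all add: c swU_closed)
    also have "swU (\<lambda>x1 x2. swU (\<lambda>y1 y2. m (bracket B (eps x2 \<odot>\<^bsub>B\<^esub> x1) y1) \<cdot> p y2) y) x = C"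
    proof -
      have hom: "(\<lambda>z. swU (\<lambda>y1 y2. m (bracket B z y1) \<cdot> p y2) y) \<in> hom (add_monoid B) (add_monoid U)"
      proof (rule homI; simp)
        fix z z' assume z: "z \<in> carrier B" "z' \<in> carrier B"
        have "swU (\<lambda>y1 y2. m (bracket B (z \<oplus>\<^bsub>B\<^esub> z') y1) \<cdot> p y2) y =
            swU (\<lambda>y1 y2. m (bracket B z y1) \<cdot> p y2 \<oplus>\<^bsub>U\<^esub> m (bracket B z' y1) \<cdot> p y2) y"
          by (rule sw_cong[OF y]) (use z in \<open>simp add: c bracket_add_left m_add U.l_distr\<close>)
        also have "\<dots> = swU (\<lambda>y1 y2. m (bracket B z y1) \<cdot> p y2) y \<oplus>\<^bsub>U\<^esub> swU (\<lambda>y1 y2. m (bracket B z' y1) \<cdot> p y2) y"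
          by (rule swU_add[OF y]) (use z in \<open>simp_all add: c\<close>)
        finally show "swU (\<lambda>y1 y2. m (bracket B (z \<oplus>\<^bsub>B\<^esub> z') y1) \<cdot> p y2) y =
            swU (\<lambda>y1 y2. m (bracket B z y1) \<cdot> p y2) y \<oplus>\<^bsub>U\<^esub> swU (\<lambda>y1 y2. m (bracket B z' y1) \<cdot> p y2) y" .
      qed (use y in \<open>simp add: swU_closed c\<close>)
      show ?thesis
        unfolding C_def by (rule sw_counit_right[OF comm_group.axioms(2)[OF UG] hom x])
    qed
    finally show ?thesis .
  qed
  \<comment> \<open>In the summand m_x1 p_x2 m_y1 p_y2 the middle factors are interchanged. The
    commutator that is left over is summed over the legs of \<open>x\<close> first, where
    \<open>sw_m_p_comm\<close> evaluates it.\<close>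
  have prod: "h x \<cdot> h y = swU (\<lambda>x1 x2. swU (\<lambda>y1 y2. m x1 \<cdot> (m y1 \<cdot> (p x2 \<cdot> p y2))) y) x \<oplus>\<^bsub>U\<^esub>
      swU (\<lambda>y1 y2. m (bracket B x y1) \<cdot> p y2) y"
    if x: "x \<in> carrier B" and y: "y \<in> carrier B" for x y
  proof -
    have "h x \<cdot> h y = swU (\<lambda>x1 x2. m x1 \<cdot> p x2) x \<cdot> swU (\<lambda>y1 y2. m y1 \<cdot> p y2) y"
      using x y by (simp add: sw_m_p)
    also have "\<dots> = swU (\<lambda>x1 x2. (m x1 \<cdot> p x2) \<cdot> swU (\<lambda>y1 y2. m y1 \<cdot> p y2) y) x"
      by (rule swU_ldistr) (simp_all add: c swU_closed x y)
    also have "\<dots> = swU (\<lambda>x1 x2. swU (\<lambda>y1 y2. (m x1 \<cdot> p x2) \<cdot> (m y1 \<cdot> p y2)) y) x"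
      by (rule sw_cong[OF x], rule swU_rdistr) (simp_all add: c y)
    also have "\<dots> = swU (\<lambda>x1 x2. swU (\<lambda>y1 y2. m x1 \<cdot> (m y1 \<cdot> (p x2 \<cdot> p y2)) \<oplus>\<^bsub>U\<^esub>
        m x1 \<cdot> (p x2 \<cdot> m y1 \<ominus>\<^bsub>U\<^esub> m y1 \<cdot> p x2) \<cdot> p y2) y) x"
    proof (intro sw_cong x y)
      fix a b a' b' assume ab: "a \<in> carrier B" "b \<in> carrier B" "a' \<in> carrier B" "b' \<in> carrier B"
      have "p b \<cdot> m a' = m a' \<cdot> p b \<oplus>\<^bsub>U\<^esub> (p b \<cdot> m a' \<ominus>\<^bsub>U\<^esub> m a' \<cdot> p b)"
        using ab by (simp add: c a_minus_def U.M.r_neg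
            U.M.a_lcomm[of "m a' \<cdot> p b" "p b \<cdot> m a'" "\<ominus>\<^bsub>U\<^esub> (m a' \<cdot> p b)"])
      then have "m a \<cdot> (p b \<cdot> m a') \<cdot> p b' =
          m a \<cdot> (m a' \<cdot> p b \<oplus>\<^bsub>U\<^esub> (p b \<cdot> m a' \<ominus>\<^bsub>U\<^esub> m a' \<cdot> p b)) \<cdot> p b'"
        by simp
      also have "\<dots> = m a \<cdot> (m a' \<cdot> p b) \<cdot> p b' \<oplus>\<^bsub>U\<^esub>
          m a \<cdot> (p b \<cdot> m a' \<ominus>\<^bsub>U\<^esub> m a' \<cdot> p b) \<cdot> p b'"
        using ab by (subst U.r_distr) (simp_all add: c U.l_distr)
      finally show "(m a \<cdot> p b) \<cdot> (m a' \<cdot> p b') =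
          m a \<cdot> (m a' \<cdot> (p b \<cdot> p b')) \<oplus>\<^bsub>U\<^esub>
          m a \<cdot> (p b \<cdot> m a' \<ominus>\<^bsub>U\<^esub> m a' \<cdot> p b) \<cdot> p b'"
        using ab by (simp add: c U.m_assoc)
    qed
    also have "\<dots> = swU (\<lambda>x1 x2. swU (\<lambda>y1 y2. m x1 \<cdot> (m y1 \<cdot> (p x2 \<cdot> p y2))) y \<oplus>\<^bsub>U\<^esub>
        swU (\<lambda>y1 y2. m x1 \<cdot> (p x2 \<cdot> m y1 \<ominus>\<^bsub>U\<^esub> m y1 \<cdot> p x2) \<cdot> p y2) y) x"
      by (intro sw_cong x swU_add y) (simp_all add: c)
    also have "\<dots> = swU (\<lambda>x1 x2. swU (\<lambda>y1 y2. m x1 \<cdot> (m y1 \<cdot> (p x2 \<cdot> p y2))) y) x \<oplus>\<^bsub>U\<^esub>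
        swU (\<lambda>x1 x2. swU (\<lambda>y1 y2. m x1 \<cdot> (p x2 \<cdot> m y1 \<ominus>\<^bsub>U\<^esub> m y1 \<cdot> p x2) \<cdot> p y2) y) x"
      by (intro swU_add x swU_closed y) (simp_all add: c)
    also have "swU (\<lambda>x1 x2. swU (\<lambda>y1 y2. m x1 \<cdot> (p x2 \<cdot> m y1 \<ominus>\<^bsub>U\<^esub> m y1 \<cdot> p x2) \<cdot> p y2) y) x =
        swU (\<lambda>y1 y2. swU (\<lambda>x1 x2. m x1 \<cdot> (p x2 \<cdot> m y1 \<ominus>\<^bsub>U\<^esub> m y1 \<cdot> p x2) \<cdot> p y2) x) y"
      by (rule sw_swap[OF UG x y]) (simp add: c)
    also have "\<dots> = swU (\<lambda>y1 y2. m (bracket B x y1) \<cdot> p y2) y"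
      by (rule sw_cong[OF y], subst sw_m_p_comm[OF x, symmetric], assumption, rule swU_ldistr[symmetric])
        (simp_all add: c x)
    finally show ?thesis .
  qed
  have h2: "h x \<cdot> h y = X \<oplus>\<^bsub>U\<^esub> C"
    unfolding X_def C_def by (rule prod[OF x y])
  \<comment> \<open>The product formula with x and y exchanged; antisymmetry of the bracket turns
    its correction into the negative of \<open>D\<close>.\<close>
  have h3: "h y \<cdot> h x = Y \<ominus>\<^bsub>U\<^esub> D"
  proof -
    have "swU (\<lambda>y1 y2. swU (\<lambda>x1 x2. m y1 \<cdot> (m x1 \<cdot> (p y2 \<cdot> p x2))) x) y =
        swU (\<lambda>x1 x2. swU (\<lambda>y1 y2. m y1 \<cdot> (m x1 \<cdot> (p y2 \<cdot> p x2))) y) x"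
      by (rule sw_swap[OF UG y x]) (simp add: c)
    also have "\<dots> = Y"
      unfolding Y_def
    proof (intro sw_cong x y)
      fix a b a' b' assume ab: "a \<in> carrier B" "b \<in> carrier B" "a' \<in> carrier B" "b' \<in> carrier B"
      show "m a' \<cdot> (m a \<cdot> (p b' \<cdot> p b)) = m a \<cdot> (m a' \<cdot> (p b' \<cdot> p b))"
        using ab m_comm_m[of a a'] by (simp add: c flip: U.m_assoc)
    qed
    finally have 1: "h y \<cdot> h x = Y \<oplus>\<^bsub>U\<^esub> swU (\<lambda>x1 x2. m (bracket B y x1) \<cdot> p x2) x"
      using prod[OF y x] by simp
    have m_inv: "m (\<ominus>\<^bsub>B\<^esub> b) = \<ominus>\<^bsub>U\<^esub> m b" if "b \<in> carrier B" for b
    proof -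
      have "m (\<ominus>\<^bsub>B\<^esub> b) \<oplus>\<^bsub>U\<^esub> m b = \<zero>\<^bsub>U\<^esub>"
        using that m_smult[of \<zero> b] by (simp add: m_closed BB.M.l_neg flip: m_add)
      then show ?thesis using that by (simp add: U.M.minus_equality m_closed)
    qed
    have "swU (\<lambda>x1 x2. m (bracket B y x1) \<cdot> p x2) x \<oplus>\<^bsub>U\<^esub> D =
        swU (\<lambda>x1 x2. m (bracket B y x1) \<cdot> p x2 \<oplus>\<^bsub>U\<^esub> m (bracket B x1 y) \<cdot> p x2) x"
      unfolding D_def by (rule swU_add[OF x, symmetric]) (simp_all add: c y)
    also have "\<dots> = swU (\<lambda>x1 x2. \<zero>\<^bsub>U\<^esub>) x"
      by (rule sw_cong[OF x])
        (simp add: bracket_anti[OF _ y] c y m_inv U.l_minus U.M.l_neg)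
    also have "\<dots> = \<zero>\<^bsub>U\<^esub>"
      using comm_monoid.psum_one[OF comm_group.axioms(1)[OF UG]] by (simp add: sw_def)
    finally have "swU (\<lambda>x1 x2. m (bracket B y x1) \<cdot> p x2) x = \<ominus>\<^bsub>U\<^esub> D"
      using cl swU_closed[OF x, of "\<lambda>x1 x2. m (bracket B y x1) \<cdot> p x2"] y
      by (simp add: U.M.minus_equality c)
    then show ?thesis
      using 1 by (simp add: a_minus_def)
  qed
  have "A \<oplus>\<^bsub>U\<^esub> (C \<oplus>\<^bsub>U\<^esub> D) = (X \<ominus>\<^bsub>U\<^esub> Y) \<oplus>\<^bsub>U\<^esub> (C \<oplus>\<^bsub>U\<^esub> D)"
    using h1 h2 h3 h_bracket[OF x y] cl by (simp add: a_minus_def U.M.a_ac U.M.minus_add)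
  then have "A = X \<ominus>\<^bsub>U\<^esub> Y"
    using cl by simp
  also have "\<dots> = swU (\<lambda>x1 x2. swU (\<lambda>y1 y2. m x1 \<cdot> (m y1 \<cdot> (p x2 \<cdot> p y2))) y \<ominus>\<^bsub>U\<^esub>
      swU (\<lambda>y1 y2. m x1 \<cdot> (m y1 \<cdot> (p y2 \<cdot> p x2))) y) x"
    unfolding X_def Y_def by (rule swU_minus[OF x, symmetric]) (simp_all add: swU_closed y c)
  also have "\<dots> = swU (\<lambda>x1 x2. swU (\<lambda>y1 y2. m x1 \<cdot> (m y1 \<cdot> (p x2 \<cdot> p y2)) \<ominus>\<^bsub>U\<^esub>
      m x1 \<cdot> (m y1 \<cdot> (p y2 \<cdot> p x2))) y) x"
    by (intro sw_cong x swU_minus[symmetric] y) (simp_all add: c)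
  also have "\<dots> = swU (\<lambda>x1 x2. swU (\<lambda>y1 y2. m x1 \<cdot> (m y1 \<cdot> (p x2 \<cdot> p y2 \<ominus>\<^bsub>U\<^esub> p y2 \<cdot> p x2))) y) x"
    by (intro sw_cong x y) (simp add: c a_minus_def U.r_distr U.r_minus)
  finally show "swU (\<lambda>x1 x2. swU (\<lambda>y1 y2. m x1 \<cdot> (m y1 \<cdot> p (bracket B x2 y2))) y) x =
      swU (\<lambda>x1 x2. swU (\<lambda>y1 y2. m x1 \<cdot> (m y1 \<cdot> (p x2 \<cdot> p y2 \<ominus>\<^bsub>U\<^esub> p y2 \<cdot> p x2))) y) x"
    by (simp only: A_def)
next
  note simps = p_linD bracket_closed bracket_add_left bracket_add_right bracket_smult_left bracket_smult_right
    U.l_distr U.r_distr U.smult_mult_left U.smult_mult_right a_minus_def U.M.minus_add U.M.a_ac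
    U.smult_r_distr
  fix y assume y: "y \<in> carrier B"
  show "(\<lambda>x. p (bracket B x y)) \<in> lin_map k B U"
    by (rule lin_mapI) (use y in \<open>simp_all add: simps\<close>)
  show "(\<lambda>x. p x \<cdot> p y \<ominus>\<^bsub>U\<^esub> p y \<cdot> p x) \<in> lin_map k B U"
    by (rule lin_mapI) (use y in \<open>simp_all add: simps U.smult_r_minus\<close>)
next
  note simps = p_linD bracket_closed bracket_add_left bracket_add_right bracket_smult_left bracket_smult_right
    U.l_distr U.r_distr U.smult_mult_left U.smult_mult_right a_minus_def U.M.minus_add U.M.a_ac
    U.smult_r_distr
  fix x assume x: "x \<in> carrier B"
  show "(\<lambda>y. p (bracket B x y)) \<in> lin_map k B U"
    by (rule lin_mapI) (use x in \<open>simp_all add: simps\<close>)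
  show "(\<lambda>y. p x \<cdot> p y \<ominus>\<^bsub>U\<^esub> p y \<cdot> p x) \<in> lin_map k B U"
    by (rule lin_mapI) (use x in \<open>simp_all add: simps U.smult_r_minus\<close>)
qed

section \<open>The comultiplication of the enveloping algebra\<close>

sublocale UU: nc_algebra_pair k U U
  by (intro nc_algebra_pair.intro U_nc_algebra)

declare UU.TA_simps [simp del]

abbreviation UT where "UT \<equiv> tensor_algebra k U U"
abbreviation swT where "swT \<equiv> sw (add_monoid UT)"

text \<open>In the second formula the factors are exchanged but the order of summation is kept. Both
  products of a commutator thus become double sums over the same indices and can be compared summand
  by summand.\<close>

lemma sw_times:
  assumes R: "ring R" and x: "x \<in> carrier B" and y: "y \<in> carrier B"
    and f: "\<And>x y. \<lbrakk>x \<in> carrier B; y \<in> carrier B\<rbrakk> \<Longrightarrow> f x y \<in> carrier R"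
    and g: "\<And>x y. \<lbrakk>x \<in> carrier B; y \<in> carrier B\<rbrakk> \<Longrightarrow> g x y \<in> carrier R"
  shows "sw (add_monoid R) f x \<otimes>\<^bsub>R\<^esub> sw (add_monoid R) g y =
      sw (add_monoid R) (\<lambda>x1 x2. sw (add_monoid R) (\<lambda>y1 y2. f x1 x2 \<otimes>\<^bsub>R\<^esub> g y1 y2) y) x"
    and "sw (add_monoid R) g y \<otimes>\<^bsub>R\<^esub> sw (add_monoid R) f x =
      sw (add_monoid R) (\<lambda>x1 x2. sw (add_monoid R) (\<lambda>y1 y2. g y1 y2 \<otimes>\<^bsub>R\<^esub> f x1 x2) y) x"
proof -
  interpret R: ring R by (rule R)
  have G: "comm_group (add_monoid R)" by (rule R.a_comm_group)
  have gy: "sw (add_monoid R) g y \<in> carrier R"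
    using sw_closed[OF G y, of g] g by simp
  have "sw (add_monoid R) f x \<otimes>\<^bsub>R\<^esub> sw (add_monoid R) g y =
      sw (add_monoid R) (\<lambda>x1 x2. f x1 x2 \<otimes>\<^bsub>R\<^esub> sw (add_monoid R) g y) x"
    by (rule sw_ldistr[OF R gy x f])
  also have "\<dots> = sw (add_monoid R) (\<lambda>x1 x2. sw (add_monoid R) (\<lambda>y1 y2. f x1 x2 \<otimes>\<^bsub>R\<^esub> g y1 y2) y) x"
    by (intro sw_cong[OF x] sw_rdistr[OF R _ y] f g)
  finally show "sw (add_monoid R) f x \<otimes>\<^bsub>R\<^esub> sw (add_monoid R) g y =
      sw (add_monoid R) (\<lambda>x1 x2. sw (add_monoid R) (\<lambda>y1 y2. f x1 x2 \<otimes>\<^bsub>R\<^esub> g y1 y2) y) x" .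
  have "sw (add_monoid R) g y \<otimes>\<^bsub>R\<^esub> sw (add_monoid R) f x =
      sw (add_monoid R) (\<lambda>x1 x2. sw (add_monoid R) g y \<otimes>\<^bsub>R\<^esub> f x1 x2) x"
    by (rule sw_rdistr[OF R gy x f])
  also have "\<dots> = sw (add_monoid R) (\<lambda>x1 x2. sw (add_monoid R) (\<lambda>y1 y2. g y1 y2 \<otimes>\<^bsub>R\<^esub> f x1 x2) y) x"
    by (intro sw_cong[OF x] sw_ldistr[OF R _ y] f g)
  finally show "sw (add_monoid R) g y \<otimes>\<^bsub>R\<^esub> sw (add_monoid R) f x =
      sw (add_monoid R) (\<lambda>x1 x2. sw (add_monoid R) (\<lambda>y1 y2. g y1 y2 \<otimes>\<^bsub>R\<^esub> f x1 x2) y) x" .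
qed

lemma balanced_pure:
  assumes "module_pair k M N" and F: "F \<in> lin_map k B M" and G: "G \<in> lin_map k B N"
  shows "kbalanced k B B (add_monoid (tensor_algebra k M N)) (\<lambda>x y. kpure k M N (F x) (G y))"
proof -
  interpret module_pair k M N by fact
  show ?thesis
    by (rule balancedI, unfold partial_object.simps monoid.simps)
      (simp_all only: lin_mapD[OF F] lin_mapD[OF G] kpure_closed kpure_add_left kpure_add_right kpure_middle)
qed

lemma tensor_map_comult:
  assumes MN: "module_pair k M N" and F: "F \<in> lin_map k B M" and G: "G \<in> lin_map k B N" and b: "b \<in> carrier B"
  shows "tensor_map k B B M N F G (comult B b) = sw (add_monoid (tensor_algebra k M N)) (\<lambda>x y. kpure k M N (F x) (G y)) b"
proof -
  interpret module_pair k M N by (rule MN)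
  note t = tensor_map_lin[OF BP.module_pair_axioms MN F G]
  have "tensor_map k B B M N F G (sw (add_monoid BT) (kpure k B B) b) =
      sw (add_monoid TA) (\<lambda>x y. tensor_map k B B M N F G (kpure k B B x y)) b"
    by (rule hom_sw[OF BP.TA_a_comm_group TA.a_group _ b])
      (use t(1) BP.kpure_closed in \<open>simp_all add: lin_map_def\<close>)
  also have "\<dots> = sw (add_monoid TA) (\<lambda>x y. kpure k M N (F x) (G y)) b"
    by (intro sw_cong b t(2))
  finally show ?thesis
    by (simp only: comult_sw[OF b])
qed

abbreviation kp where "kp \<equiv> kpure k U U"

text \<open>\<open>ca\<close> and \<open>ce\<close> give the Sweedler summands of \<open>\<Delta>(m\<^sub>b)\<close> and \<open>\<Delta>(h\<^sub>b)\<close>.\<close>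

definition ca where "ca x y = kp (m x) (m y)"
definition ce where "ce x y = kp (m x) (h y) \<oplus>\<^bsub>UT\<^esub> kp (h x) (m y)"

lemma ca_closed: "\<lbrakk>x \<in> carrier B; y \<in> carrier B\<rbrakk> \<Longrightarrow> ca x y \<in> carrier UT"
  unfolding ca_def by (intro UU.kpure_closed m_closed)

lemma ce_closed: "\<lbrakk>x \<in> carrier B; y \<in> carrier B\<rbrakk> \<Longrightarrow> ce x y \<in> carrier UT"
  unfolding ce_def by (intro UU.TA.a_closed UU.kpure_closed m_closed h_closed)

lemma ca_bal: "kbalanced k B B (add_monoid UT) ca"
  unfolding ca_def by (rule balanced_pure[OF UU.module_pair_axioms m_lin m_lin])

lemma ce_bal: "kbalanced k B B (add_monoid UT) ce"
proof -
  note b1 = balancedD[OF balanced_pure[OF UU.module_pair_axioms m_lin h_lin], unfolded partial_object.simps monoid.simps]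
    and b2 = balancedD[OF balanced_pure[OF UU.module_pair_axioms h_lin m_lin], unfolded partial_object.simps monoid.simps]
  show ?thesis
    unfolding ce_def
    by (rule balancedI, unfold partial_object.simps monoid.simps)
      (simp_all only: b1 b2 UU.TA.a_closed UU.TA.a_ac)
qed

lemma hm: "\<lbrakk>x \<in> carrier B; y \<in> carrier B\<rbrakk> \<Longrightarrow> h x \<cdot> m y = m y \<cdot> h x \<oplus>\<^bsub>U\<^esub> m (bracket B x y)"
  using minus_eq_iff[OF U_ring, of "h x \<cdot> m y" "m y \<cdot> h x" "m (bracket B x y)"]
  by (simp add: m_bracket[symmetric] m_closed h_closed bracket_closed U.M.a_comm)

lemma hh: "\<lbrakk>x \<in> carrier B; y \<in> carrier B\<rbrakk> \<Longrightarrow> h x \<cdot> h y = h y \<cdot> h x \<oplus>\<^bsub>U\<^esub> h (bracket B x y)"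
  using minus_eq_iff[OF U_ring, of "h x \<cdot> h y" "h y \<cdot> h x" "h (bracket B x y)"]
  by (simp add: h_bracket[symmetric] h_closed bracket_closed U.M.a_comm)

lemma m_minus: "b \<in> carrier B \<Longrightarrow> m (\<ominus>\<^bsub>B\<^esub> b) = \<ominus>\<^bsub>U\<^esub> m b"
proof -
  assume b: "b \<in> carrier B"
  have "m (\<ominus>\<^bsub>B\<^esub> b) \<oplus>\<^bsub>U\<^esub> m b = \<zero>\<^bsub>U\<^esub>"
    using b m_smult[of \<zero> b] by (simp add: m_closed BB.M.l_neg flip: m_add)
  then show ?thesis using b by (simp add: U.M.minus_equality m_closed)
qed

lemma mh:
  assumes "x \<in> carrier B" "y \<in> carrier B"
  shows "m x \<cdot> h y = h y \<cdot> m x \<oplus>\<^bsub>U\<^esub> m (bracket B x y)"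
proof -
  have "m (bracket B y x) = \<ominus>\<^bsub>U\<^esub> m (bracket B x y)"
    using assms by (simp add: bracket_anti[of x y] m_minus bracket_closed)
  then show ?thesis
    using hm[OF assms(2,1)] assms
    by (simp add: m_closed h_closed bracket_closed U.M.a_assoc U.M.l_neg)
qed

text \<open>Here and in the next three lemmas the relations of the enveloping algebra are verified
  for fixed Sweedler legs. Summing with \<open>sw_prod\<close>, \<open>sw_bracket\<close> and
  \<open>sw_times\<close> turns them into relations between coproducts.\<close>

lemma ca_mult:
  assumes "x1 \<in> carrier B" "x2 \<in> carrier B" "y1 \<in> carrier B" "y2 \<in> carrier B"
  shows "ca (x1 \<otimes>\<^bsub>B\<^esub> y1) (x2 \<otimes>\<^bsub>B\<^esub> y2) = ca x1 x2 \<otimes>\<^bsub>UT\<^esub> ca y1 y2"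
  unfolding ca_def using assms by (simp add: UU.kpure_mult m_closed m_mult)

lemma ce_mult:
  assumes "x1 \<in> carrier B" "x2 \<in> carrier B" "y1 \<in> carrier B" "y2 \<in> carrier B"
  shows "ce (x1 \<otimes>\<^bsub>B\<^esub> y1) (x2 \<otimes>\<^bsub>B\<^esub> y2) = ca y1 y2 \<otimes>\<^bsub>UT\<^esub> ce x1 x2 \<oplus>\<^bsub>UT\<^esub> ca x1 x2 \<otimes>\<^bsub>UT\<^esub> ce y1 y2"
proof -
  note c = m_closed h_closed U.m_closed assms UU.kpure_closed
  have "m (x1 \<otimes>\<^bsub>B\<^esub> y1) = m y1 \<cdot> m x1" "m (x2 \<otimes>\<^bsub>B\<^esub> y2) = m y2 \<cdot> m x2"
    "m (x1 \<otimes>\<^bsub>B\<^esub> y1) = m x1 \<cdot> m y1" "m (x2 \<otimes>\<^bsub>B\<^esub> y2) = m x2 \<cdot> m y2"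
    using assms m_comm_m by (simp_all add: m_mult)
  then have "kp (m (x1 \<otimes>\<^bsub>B\<^esub> y1)) (h (x2 \<otimes>\<^bsub>B\<^esub> y2)) = kp (m y1 \<cdot> m x1) (m y2 \<cdot> h x2) \<oplus>\<^bsub>UT\<^esub> kp (m x1 \<cdot> m y1) (m x2 \<cdot> h y2)"
    "kp (h (x1 \<otimes>\<^bsub>B\<^esub> y1)) (m (x2 \<otimes>\<^bsub>B\<^esub> y2)) = kp (m y1 \<cdot> h x1) (m y2 \<cdot> m x2) \<oplus>\<^bsub>UT\<^esub> kp (m x1 \<cdot> h y1) (m x2 \<cdot> m y2)"
    using assms by (simp_all add: h_mult UU.kpure_add_right UU.kpure_add_left c)
  then show ?thesis
    unfolding ca_def ce_def
    by (simp add: UU.TA_r_distr UU.kpure_mult c UU.TA.a_ac)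
qed

lemma ca_bracket:
  assumes "x1 \<in> carrier B" "x2 \<in> carrier B" "y1 \<in> carrier B" "y2 \<in> carrier B"
  shows "ce x1 x2 \<otimes>\<^bsub>UT\<^esub> ca y1 y2 = ca y1 y2 \<otimes>\<^bsub>UT\<^esub> ce x1 x2 \<oplus>\<^bsub>UT\<^esub>
    (ca (x1 \<otimes>\<^bsub>B\<^esub> y1) (bracket B x2 y2) \<oplus>\<^bsub>UT\<^esub> ca (bracket B x1 y1) (x2 \<otimes>\<^bsub>B\<^esub> y2))"
proof -
  note c = m_closed h_closed U.m_closed assms UU.kpure_closed bracket_closed
  have 1: "kp (m x1 \<cdot> m y1) (h x2 \<cdot> m y2) =
      kp (m y1 \<cdot> m x1) (m y2 \<cdot> h x2) \<oplus>\<^bsub>UT\<^esub> kp (m (x1 \<otimes>\<^bsub>B\<^esub> y1)) (m (bracket B x2 y2))"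
    using assms by (simp add: hm m_mult m_comm_m[of x1 y1] UU.kpure_add_right c)
  have 2: "kp (h x1 \<cdot> m y1) (m x2 \<cdot> m y2) =
      kp (m y1 \<cdot> h x1) (m y2 \<cdot> m x2) \<oplus>\<^bsub>UT\<^esub> kp (m (bracket B x1 y1)) (m (x2 \<otimes>\<^bsub>B\<^esub> y2))"
    using assms by (simp add: hm m_mult m_comm_m[of x2 y2] UU.kpure_add_left c)
  show ?thesis
    unfolding ca_def ce_def
    by (simp add: UU.TA_r_distr UU.TA_l_distr UU.kpure_mult c 1 2 UU.TA.a_ac)
qed

text \<open>The mixed products, with one h in each leg, have to be reordered in both legs. Their
  leftovers m_{x1,y1} \<otimes> (..) and (..) \<otimes> m_{x2,y2} combine, by the relation for h of
  a product, into m_{x1,y1} \<otimes> h_(x2 y2) and h_(x1 y1) \<otimes> m_{x2,y2}.\<close>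

lemma ce_bracket:
  assumes "x1 \<in> carrier B" "x2 \<in> carrier B" "y1 \<in> carrier B" "y2 \<in> carrier B"
  shows "ce x1 x2 \<otimes>\<^bsub>UT\<^esub> ce y1 y2 = ce y1 y2 \<otimes>\<^bsub>UT\<^esub> ce x1 x2 \<oplus>\<^bsub>UT\<^esub>
    (ce (x1 \<otimes>\<^bsub>B\<^esub> y1) (bracket B x2 y2) \<oplus>\<^bsub>UT\<^esub> ce (bracket B x1 y1) (x2 \<otimes>\<^bsub>B\<^esub> y2))"
proof -
  note c = m_closed h_closed U.m_closed assms UU.kpure_closed bracket_closed BB.m_closed
  have 1: "kp (m x1 \<cdot> m y1) (h x2 \<cdot> h y2) =
      kp (m y1 \<cdot> m x1) (h y2 \<cdot> h x2) \<oplus>\<^bsub>UT\<^esub> kp (m (x1 \<otimes>\<^bsub>B\<^esub> y1)) (h (bracket B x2 y2))"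
    using assms by (simp add: hh[of x2 y2] m_mult m_comm_m[of x1 y1] UU.kpure_add_right c)
  have 2: "kp (h x1 \<cdot> h y1) (m x2 \<cdot> m y2) =
      kp (h y1 \<cdot> h x1) (m y2 \<cdot> m x2) \<oplus>\<^bsub>UT\<^esub> kp (h (bracket B x1 y1)) (m (x2 \<otimes>\<^bsub>B\<^esub> y2))"
    using assms by (simp add: hh[of x1 y1] m_mult m_comm_m[of x2 y2] UU.kpure_add_left c)
  have "kp (m x1 \<cdot> h y1) (h x2 \<cdot> m y2) =
      kp (m x1 \<cdot> h y1) (m y2 \<cdot> h x2) \<oplus>\<^bsub>UT\<^esub> kp (m x1 \<cdot> h y1) (m (bracket B x2 y2))"
    using assms by (simp add: hm UU.kpure_add_right c)
  also have "kp (m x1 \<cdot> h y1) (m y2 \<cdot> h x2) =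
      kp (h y1 \<cdot> m x1) (m y2 \<cdot> h x2) \<oplus>\<^bsub>UT\<^esub> kp (m (bracket B x1 y1)) (m y2 \<cdot> h x2)"
    unfolding mh[OF assms(1,3)] by (rule UU.kpure_add_left) (simp_all add: c)
  finally have 3: "kp (m x1 \<cdot> h y1) (h x2 \<cdot> m y2) =
      kp (h y1 \<cdot> m x1) (m y2 \<cdot> h x2) \<oplus>\<^bsub>UT\<^esub> kp (m (bracket B x1 y1)) (m y2 \<cdot> h x2) \<oplus>\<^bsub>UT\<^esub>
      kp (m x1 \<cdot> h y1) (m (bracket B x2 y2))" .
  have "kp (h x1 \<cdot> m y1) (m x2 \<cdot> h y2) =
      kp (m y1 \<cdot> h x1) (m x2 \<cdot> h y2) \<oplus>\<^bsub>UT\<^esub> kp (m (bracket B x1 y1)) (m x2 \<cdot> h y2)"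
    using assms by (simp add: hm UU.kpure_add_left c)
  also have "kp (m y1 \<cdot> h x1) (m x2 \<cdot> h y2) =
      kp (m y1 \<cdot> h x1) (h y2 \<cdot> m x2) \<oplus>\<^bsub>UT\<^esub> kp (m y1 \<cdot> h x1) (m (bracket B x2 y2))"
    unfolding mh[OF assms(2,4)] by (rule UU.kpure_add_right) (simp_all add: c)
  finally have 4: "kp (h x1 \<cdot> m y1) (m x2 \<cdot> h y2) =
      kp (m y1 \<cdot> h x1) (h y2 \<cdot> m x2) \<oplus>\<^bsub>UT\<^esub> kp (m y1 \<cdot> h x1) (m (bracket B x2 y2)) \<oplus>\<^bsub>UT\<^esub>
      kp (m (bracket B x1 y1)) (m x2 \<cdot> h y2)" .
  have 5: "kp (h (x1 \<otimes>\<^bsub>B\<^esub> y1)) (m (bracket B x2 y2)) =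
      kp (m y1 \<cdot> h x1) (m (bracket B x2 y2)) \<oplus>\<^bsub>UT\<^esub> kp (m x1 \<cdot> h y1) (m (bracket B x2 y2))"
    using assms by (simp add: h_mult UU.kpure_add_left c)
  have 6: "kp (m (bracket B x1 y1)) (h (x2 \<otimes>\<^bsub>B\<^esub> y2)) =
      kp (m (bracket B x1 y1)) (m y2 \<cdot> h x2) \<oplus>\<^bsub>UT\<^esub> kp (m (bracket B x1 y1)) (m x2 \<cdot> h y2)"
    using assms by (simp add: h_mult UU.kpure_add_right c)
  have L: "ce x1 x2 \<otimes>\<^bsub>UT\<^esub> ce y1 y2 =
      kp (m x1 \<cdot> m y1) (h x2 \<cdot> h y2) \<oplus>\<^bsub>UT\<^esub> kp (h x1 \<cdot> m y1) (m x2 \<cdot> h y2) \<oplus>\<^bsub>UT\<^esub>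
      (kp (m x1 \<cdot> h y1) (h x2 \<cdot> m y2) \<oplus>\<^bsub>UT\<^esub> kp (h x1 \<cdot> h y1) (m x2 \<cdot> m y2))"
    if "x1 \<in> carrier B" "x2 \<in> carrier B" "y1 \<in> carrier B" "y2 \<in> carrier B" for x1 x2 y1 y2
    unfolding ce_def using that
    by (simp only: UU.TA_r_distr UU.TA_l_distr UU.kpure_mult c UU.TA.a_closed)
  show ?thesis
    unfolding L[OF assms] L[OF assms(3,4,1,2)] 1 2 3 4
    unfolding ce_def 5 6
    by (simp only: UU.TA.a_ac UU.TA.a_closed c)
qed

definition dm where "dm = swT ca"
definition dh where "dh = swT ce"

lemma UTG: "comm_group (add_monoid UT)"
  by (rule UU.TA_a_comm_group)

lemma swT_closed:
  "\<lbrakk>b \<in> carrier B; \<And>x y. \<lbrakk>x \<in> carrier B; y \<in> carrier B\<rbrakk> \<Longrightarrow> f x y \<in> carrier UT\<rbrakk> \<Longrightarrow> swT f b \<in> carrier UT"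
  using sw_closed[OF UTG, of b f] by simp

lemma swT_add:
  "\<lbrakk>b \<in> carrier B; \<And>x y. \<lbrakk>x \<in> carrier B; y \<in> carrier B\<rbrakk> \<Longrightarrow> f x y \<in> carrier UT;
    \<And>x y. \<lbrakk>x \<in> carrier B; y \<in> carrier B\<rbrakk> \<Longrightarrow> g x y \<in> carrier UT\<rbrakk> \<Longrightarrow>
    swT (\<lambda>x y. f x y \<oplus>\<^bsub>UT\<^esub> g x y) b = swT f b \<oplus>\<^bsub>UT\<^esub> swT g b"
  using sw_mult_dist[OF UTG, of b f g] by simp

lemma swT_add2:
  assumes x: "x \<in> carrier B" and y: "y \<in> carrier B"
    and f: "\<And>x1 x2 y1 y2. \<lbrakk>x1 \<in> carrier B; x2 \<in> carrier B; y1 \<in> carrier B; y2 \<in> carrier B\<rbrakk> \<Longrightarrow> f x1 x2 y1 y2 \<in> carrier UT"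
    and g: "\<And>x1 x2 y1 y2. \<lbrakk>x1 \<in> carrier B; x2 \<in> carrier B; y1 \<in> carrier B; y2 \<in> carrier B\<rbrakk> \<Longrightarrow> g x1 x2 y1 y2 \<in> carrier UT"
  shows "swT (\<lambda>x1 x2. swT (\<lambda>y1 y2. f x1 x2 y1 y2 \<oplus>\<^bsub>UT\<^esub> g x1 x2 y1 y2) y) x =
    swT (\<lambda>x1 x2. swT (f x1 x2) y) x \<oplus>\<^bsub>UT\<^esub> swT (\<lambda>x1 x2. swT (g x1 x2) y) x"
proof -
  have "swT (\<lambda>x1 x2. swT (\<lambda>y1 y2. f x1 x2 y1 y2 \<oplus>\<^bsub>UT\<^esub> g x1 x2 y1 y2) y) x =
      swT (\<lambda>x1 x2. swT (f x1 x2) y \<oplus>\<^bsub>UT\<^esub> swT (g x1 x2) y) x"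
    by (intro sw_cong x swT_add y f g)
  also have "\<dots> = swT (\<lambda>x1 x2. swT (f x1 x2) y) x \<oplus>\<^bsub>UT\<^esub> swT (\<lambda>x1 x2. swT (g x1 x2) y) x"
    by (intro swT_add x swT_closed y f g)
  finally show ?thesis .
qed

lemma kp_smult: "\<lbrakk>r \<in> carrier k; u \<in> carrier U; v \<in> carrier U\<rbrakk> \<Longrightarrow> kp (r \<odot>\<^bsub>U\<^esub> u) v = r \<odot>\<^bsub>UT\<^esub> kp u v"
  by (simp add: UU.TA_smult_pure)

lemma dm_lin: "dm \<in> lin_map k B UT"
  unfolding dm_def
  by (rule sw_lin_map[OF UU.TA_nc_algebra ca_bal]) (simp add: ca_def kp_smult m_smult m_closed)

lemma dh_lin: "dh \<in> lin_map k B UT"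
  unfolding dh_def
  by (rule sw_lin_map[OF UU.TA_nc_algebra ce_bal])
    (simp add: ce_def kp_smult m_smult h_smult m_closed h_closed UU.TA_smult_add UU.kpure_closed)

lemma dm_tensor_map: "b \<in> carrier B \<Longrightarrow> tensor_map k B B U U m m (comult B b) = dm b"
  unfolding dm_def ca_def by (rule tensor_map_comult[OF UU.module_pair_axioms m_lin m_lin])

lemma dh_tensor_map: "b \<in> carrier B \<Longrightarrow>
    tensor_map k B B U U m h (comult B b) \<oplus>\<^bsub>UT\<^esub> tensor_map k B B U U h m (comult B b) = dh b"
  unfolding dh_def ce_def
  by (simp only: tensor_map_comult[OF UU.module_pair_axioms m_lin h_lin]
      tensor_map_comult[OF UU.module_pair_axioms h_lin m_lin] swT_add UU.kpure_closed m_closed h_closed)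

lemma U_alg_hom_unique:
  assumes D: "D \<in> alg_hom k U A" and E: "E \<in> alg_hom k U A"
    and m: "\<And>b. b \<in> carrier B \<Longrightarrow> D (m b) = E (m b)" and h: "\<And>b. b \<in> carrier B \<Longrightarrow> D (h b) = E (h b)"
    and u: "u \<in> carrier U"
  shows "D u = E u"
  using u
proof (induction rule: U_induct)
  case (add u v)
  then show ?case using lin_mapD(2)[OF alg_homD(2)[OF D], of u v] lin_mapD(2)[OF alg_homD(2)[OF E], of u v] by simp
next
  case (mult u v)
  then show ?case using alg_homD(3)[OF D, of u v] alg_homD(3)[OF E, of u v] by simp
qed (auto simp: m h)

text \<open>\<open>env_comult\<close> is a definite description, so a homomorphism with the
  prescribed values has to be produced first; the universal property supplies it once
  \<open>dm\<close> and \<open>dh\<close> satisfy the relations.\<close>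

lemma env_comult_exists:
  "\<exists>D\<in>alg_hom k U UT. \<forall>b\<in>carrier B. D (m b) = dm b \<and> D (h b) = dh b"
proof -
  note dmD = lin_mapD[OF dm_lin] and dhD = lin_mapD[OF dh_lin]
  note R = UU.TA_ring
  have "\<exists>\<phi>\<in>ring_hom U UT. (\<forall>b\<in>carrier B. \<phi> (m b) = dm b \<and> \<phi> (h b) = dh b) \<and>
    (\<forall>r\<in>carrier k. \<forall>u\<in>carrier U. \<phi> (r \<odot>\<^bsub>U\<^esub> u) = (r \<odot>\<^bsub>UT\<^esub> \<one>\<^bsub>UT\<^esub>) \<otimes>\<^bsub>UT\<^esub> \<phi> u)"
  proof (rule U_universal[OF R UU.TA.smult_one_ring_hom])
    fix x y assume x: "x \<in> carrier B" and y: "y \<in> carrier B"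
    note times = sw_times[OF R x y]
    show "dm (x \<otimes>\<^bsub>B\<^esub> y) = dm x \<otimes>\<^bsub>UT\<^esub> dm y"
    proof -
      have "dm (x \<otimes>\<^bsub>B\<^esub> y) = swT (\<lambda>x1 x2. swT (\<lambda>y1 y2. ca x1 x2 \<otimes>\<^bsub>UT\<^esub> ca y1 y2) y) x"
        unfolding dm_def sw_prod[OF UTG ca_bal x y] by (intro sw_cong x y ca_mult)
      also have "\<dots> = dm x \<otimes>\<^bsub>UT\<^esub> dm y"
        unfolding dm_def by (rule times(1)[symmetric]) (simp_all add: ca_closed)
      finally show ?thesis .
    qed
    show "dh (x \<otimes>\<^bsub>B\<^esub> y) = dm y \<otimes>\<^bsub>UT\<^esub> dh x \<oplus>\<^bsub>UT\<^esub> dm x \<otimes>\<^bsub>UT\<^esub> dh y"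
    proof -
      have "dh (x \<otimes>\<^bsub>B\<^esub> y) = swT (\<lambda>x1 x2. swT (\<lambda>y1 y2. ca y1 y2 \<otimes>\<^bsub>UT\<^esub> ce x1 x2 \<oplus>\<^bsub>UT\<^esub> ca x1 x2 \<otimes>\<^bsub>UT\<^esub> ce y1 y2) y) x"
        unfolding dh_def sw_prod[OF UTG ce_bal x y] by (intro sw_cong x y ce_mult)
      also have "\<dots> = dm y \<otimes>\<^bsub>UT\<^esub> dh x \<oplus>\<^bsub>UT\<^esub> dm x \<otimes>\<^bsub>UT\<^esub> dh y"
        unfolding dm_def dh_def
        by (subst times(1), (simp_all add: ca_closed ce_closed)[2], subst times(2), (simp_all add: ca_closed ce_closed)[2],
            rule swT_add2[OF x y]) (simp_all add: UU.TA_mult_closed ca_closed ce_closed)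
      finally show ?thesis .
    qed
    show "dm (bracket B x y) = dh x \<otimes>\<^bsub>UT\<^esub> dm y \<ominus>\<^bsub>UT\<^esub> dm y \<otimes>\<^bsub>UT\<^esub> dh x"
    proof -
      have "dh x \<otimes>\<^bsub>UT\<^esub> dm y = swT (\<lambda>x1 x2. swT (\<lambda>y1 y2. ca y1 y2 \<otimes>\<^bsub>UT\<^esub> ce x1 x2 \<oplus>\<^bsub>UT\<^esub>
          (ca (x1 \<otimes>\<^bsub>B\<^esub> y1) (bracket B x2 y2) \<oplus>\<^bsub>UT\<^esub> ca (bracket B x1 y1) (x2 \<otimes>\<^bsub>B\<^esub> y2))) y) x"
        unfolding dm_def dh_def by (subst times(1), (simp_all add: ca_closed ce_closed)[2], intro sw_cong x y ca_bracket)
      also have "\<dots> = dm y \<otimes>\<^bsub>UT\<^esub> dh x \<oplus>\<^bsub>UT\<^esub> dm (bracket B x y)"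
        unfolding dm_def dh_def sw_bracket[OF UTG ca_bal x y] monoid.simps
        by (subst times(2), (simp_all add: ca_closed ce_closed)[2], rule swT_add2[OF x y])
          (simp_all add: UU.TA_mult_closed ca_closed ce_closed bracket_closed)
      finally show ?thesis
        using minus_eq_iff[OF R, of "dh x \<otimes>\<^bsub>UT\<^esub> dm y" "dm y \<otimes>\<^bsub>UT\<^esub> dh x" "dm (bracket B x y)"] x y
        by (simp add: dmD dhD UU.TA_mult_closed bracket_closed UU.TA.a_comm)
    qed
    show "dh (bracket B x y) = dh x \<otimes>\<^bsub>UT\<^esub> dh y \<ominus>\<^bsub>UT\<^esub> dh y \<otimes>\<^bsub>UT\<^esub> dh x"
    proof -
      have "dh x \<otimes>\<^bsub>UT\<^esub> dh y = swT (\<lambda>x1 x2. swT (\<lambda>y1 y2. ce y1 y2 \<otimes>\<^bsub>UT\<^esub> ce x1 x2 \<oplus>\<^bsub>UT\<^esub>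
          (ce (x1 \<otimes>\<^bsub>B\<^esub> y1) (bracket B x2 y2) \<oplus>\<^bsub>UT\<^esub> ce (bracket B x1 y1) (x2 \<otimes>\<^bsub>B\<^esub> y2))) y) x"
        unfolding dh_def by (subst times(1), (simp_all add: ca_closed ce_closed)[2], intro sw_cong x y ce_bracket)
      also have "\<dots> = dh y \<otimes>\<^bsub>UT\<^esub> dh x \<oplus>\<^bsub>UT\<^esub> dh (bracket B x y)"
        unfolding dh_def sw_bracket[OF UTG ce_bal x y] monoid.simps
        by (subst times(2), (simp_all add: ca_closed ce_closed)[2], rule swT_add2[OF x y])
          (simp_all add: UU.TA_mult_closed ce_closed bracket_closed)
      finally show ?thesis
        using minus_eq_iff[OF R, of "dh x \<otimes>\<^bsub>UT\<^esub> dh y" "dh y \<otimes>\<^bsub>UT\<^esub> dh x" "dh (bracket B x y)"] x y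
        by (simp add: dhD UU.TA_mult_closed bracket_closed UU.TA.a_comm)
    qed
  next
    have "dm \<one>\<^bsub>B\<^esub> = tensor_map k B B U U m m (kpure k B B \<one>\<^bsub>B\<^esub> \<one>\<^bsub>B\<^esub>)"
      using dm_tensor_map[of "\<one>\<^bsub>B\<^esub>"] by (simp add: comultD(4))
    also have "\<dots> = kp (m \<one>\<^bsub>B\<^esub>) (m \<one>\<^bsub>B\<^esub>)"
      by (rule tensor_map_lin(2)[OF BP.module_pair_axioms UU.module_pair_axioms m_lin m_lin]) simp_all
    finally show "dm \<one>\<^bsub>B\<^esub> = \<one>\<^bsub>UT\<^esub>"
      by (simp add: m_one UU.TA_simps)
  next
    fix r x assume r: "r \<in> carrier k" and x: "x \<in> carrier B"
    show "(r \<odot>\<^bsub>UT\<^esub> \<one>\<^bsub>UT\<^esub>) \<otimes>\<^bsub>UT\<^esub> dm x = dm x \<otimes>\<^bsub>UT\<^esub> (r \<odot>\<^bsub>UT\<^esub> \<one>\<^bsub>UT\<^esub>)"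
      "(r \<odot>\<^bsub>UT\<^esub> \<one>\<^bsub>UT\<^esub>) \<otimes>\<^bsub>UT\<^esub> dh x = dh x \<otimes>\<^bsub>UT\<^esub> (r \<odot>\<^bsub>UT\<^esub> \<one>\<^bsub>UT\<^esub>)"
      by (rule UU.TA.smult_one_central[OF r], rule dmD dhD, rule x)+
    show "dm (r \<odot>\<^bsub>B\<^esub> x) = (r \<odot>\<^bsub>UT\<^esub> \<one>\<^bsub>UT\<^esub>) \<otimes>\<^bsub>UT\<^esub> dm x" "dh (r \<odot>\<^bsub>B\<^esub> x) = (r \<odot>\<^bsub>UT\<^esub> \<one>\<^bsub>UT\<^esub>) \<otimes>\<^bsub>UT\<^esub> dh x"
      using UU.TA.smult_eq_mult[OF r dmD(1)[OF x]] UU.TA.smult_eq_mult[OF r dhD(1)[OF x]]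
      by (simp_all only: dmD dhD r x)
  qed (auto simp: dmD dhD)
  then obtain \<phi> where \<phi>: "\<phi> \<in> ring_hom U UT" and v: "\<forall>b\<in>carrier B. \<phi> (m b) = dm b \<and> \<phi> (h b) = dh b"
    and sm: "\<And>r u. \<lbrakk>r \<in> carrier k; u \<in> carrier U\<rbrakk> \<Longrightarrow> \<phi> (r \<odot>\<^bsub>U\<^esub> u) = (r \<odot>\<^bsub>UT\<^esub> \<one>\<^bsub>UT\<^esub>) \<otimes>\<^bsub>UT\<^esub> \<phi> u"
    by blast
  have "\<phi> (r \<odot>\<^bsub>U\<^esub> u) = r \<odot>\<^bsub>UT\<^esub> \<phi> u" if "r \<in> carrier k" "u \<in> carrier U" for r u
    unfolding sm[OF that] by (rule UU.TA.smult_eq_mult[symmetric, OF that(1) ring_hom_closed[OF \<phi> that(2)]])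
  with \<phi> have "\<phi> \<in> alg_hom k U UT"
    by (simp add: alg_hom_def)
  with v show ?thesis by blast
qed

abbreviation dd where "dd \<equiv> env_comult k B"

text \<open>Uniqueness holds because \<open>m\<close> and \<open>h\<close> generate. The
  homomorphism is restricted to the carrier, as the description ranges over extensional
  maps.\<close>

lemma env_comult:
  shows "dd \<in> alg_hom k U UT" and "b \<in> carrier B \<Longrightarrow> dd (m b) = dm b" and "b \<in> carrier B \<Longrightarrow> dd (h b) = dh b"
proof -
  let ?P = "\<lambda>D. D \<in> extensional (carrier U) \<and> D \<in> alg_hom k U UT \<and>
       (\<forall>b\<in>carrier B.
          D (m b) = tensor_map k B B U U m m (comult B b) \<and>
          D (h b) = tensor_map k B B U U m h (comult B b) \<oplus>\<^bsub>UT\<^esub>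
                    tensor_map k B B U U h m (comult B b))"
  obtain D where D: "D \<in> alg_hom k U UT" "\<forall>b\<in>carrier B. D (m b) = dm b \<and> D (h b) = dh b"
    using env_comult_exists by blast
  note DD = alg_homD[OF D(1)]
  have r: "restrict D (carrier U) \<in> alg_hom k U UT"
    by (intro alg_homI lin_mapI) (simp_all add: lin_mapD[OF DD(2)] DD)
  have "?P (THE D. ?P D)"
  proof (rule theI[where P = ?P and a = "restrict D (carrier U)"])
    show "?P (restrict D (carrier U))"
      using r D by (simp add: m_closed h_closed dm_tensor_map dh_tensor_map)
  next
    fix E assume E: "?P E"
    show "E = restrict D (carrier U)"
    proof (rule extensionalityI)
      fix u assume u: "u \<in> carrier U"
      show "E u = restrict D (carrier U) u"
        by (rule U_alg_hom_unique[OF _ r _ _ u])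
          (use E D in \<open>simp_all add: m_closed h_closed dm_tensor_map dh_tensor_map\<close>)
    qed (use E in auto)
  qed
  then have "?P dd"
    unfolding env_comult_def Let_def .
  then show "dd \<in> alg_hom k U UT" and "b \<in> carrier B \<Longrightarrow> dd (m b) = dm b" and "b \<in> carrier B \<Longrightarrow> dd (h b) = dh b"
    by (simp_all add: dm_tensor_map dh_tensor_map)
qed

section \<open>The quotient Hopf algebra and its coaction\<close>

abbreviation Bplus where "Bplus \<equiv> augmentation_ideal k B"
abbreviation I where "I \<equiv> env_aug k B"
abbreviation gens where "gens \<equiv> {x \<cdot> m b | x b. x \<in> carrier U \<and> b \<in> Bplus}"

lemma Bplus: "b \<in> Bplus \<Longrightarrow> b \<in> carrier B" "b \<in> Bplus \<Longrightarrow> eps b = \<zero>"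
  by (simp_all add: augmentation_ideal_def)

lemma gens_closed: "gens \<subseteq> carrier (add_monoid U)"
  using Bplus(1) by (auto simp: m_closed)

lemma I_subgroup: "subgroup I (add_monoid U)"
  unfolding env_aug_def by (rule group.generate_is_subgroup[OF comm_group.axioms(2)[OF UG] gens_closed])

lemma I_gen: "\<lbrakk>x \<in> carrier U; b \<in> Bplus\<rbrakk> \<Longrightarrow> x \<cdot> m b \<in> I"
  unfolding env_aug_def by (rule generate.incl) blast

lemma I_closed: "i \<in> I \<Longrightarrow> i \<in> carrier U"
  using subgroup.subset[OF I_subgroup] by auto

lemma I_add: "i \<in> I \<Longrightarrow> j \<in> I \<Longrightarrow> i \<oplus>\<^bsub>U\<^esub> j \<in> I"
  using subgroup.m_closed[OF I_subgroup] by simp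

lemma I_hom:
  assumes "f \<in> hom (add_monoid U) (add_monoid U)"
    and "\<And>x b. \<lbrakk>x \<in> carrier U; b \<in> Bplus\<rbrakk> \<Longrightarrow> f (x \<cdot> m b) \<in> I" and "i \<in> I"
  shows "f i \<in> I"
  using group.generate_hom_closed[OF comm_group.axioms(2)[OF UG] gens_closed assms(1), of i] assms(2,3)
  unfolding env_aug_def[symmetric] by blast

lemma bracket_Bplus: "\<lbrakk>x \<in> carrier B; y \<in> carrier B\<rbrakk> \<Longrightarrow> bracket B x y \<in> Bplus"
  by (simp add: augmentation_ideal_def bracket_closed eps_bracket)

lemma I_left:
  assumes u: "u \<in> carrier U" and i: "i \<in> I"
  shows "u \<cdot> i \<in> I"
proof (rule I_hom[where f = "\<lambda>i. u \<cdot> i", OF _ _ i])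
  show "(\<lambda>i. u \<cdot> i) \<in> hom (add_monoid U) (add_monoid U)"
    using u by (intro homI) (simp_all add: U.r_distr)
  fix x b assume "x \<in> carrier U" "b \<in> Bplus"
  then show "u \<cdot> (x \<cdot> m b) \<in> I"
    using u I_gen[of "u \<cdot> x" b] Bplus by (simp add: U.m_assoc m_closed)
qed

text \<open>It suffices to multiply by generators. \<open>m c\<close> commutes past m_b; for
  \<open>h c\<close> one has m_b h_c = h_c m_b + m_{b,c}, and the counit of {b,c} vanishes, so the
  extra term again comes from the augmentation ideal.\<close>

lemma I_right:
  assumes u: "u \<in> carrier U" and i: "i \<in> I"
  shows "i \<cdot> u \<in> I"
proof -
  have gen: "i \<cdot> u \<in> I"
    if u: "u \<in> carrier U" and i: "i \<in> I"
      and g: "\<And>x b. \<lbrakk>x \<in> carrier U; b \<in> Bplus\<rbrakk> \<Longrightarrow> x \<cdot> m b \<cdot> u \<in> I" for u i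
  proof (rule I_hom[where f = "\<lambda>i. i \<cdot> u", OF _ g i])
    show "(\<lambda>i. i \<cdot> u) \<in> hom (add_monoid U) (add_monoid U)"
      using u by (intro homI) (simp_all add: U.l_distr)
  qed
  have "\<forall>i\<in>I. i \<cdot> u \<in> I"
    using u
  proof (induction rule: U_induct)
    case (m c)
    show ?case
    proof (rule ballI, rule gen)
      fix x b assume x: "x \<in> carrier U" and b: "b \<in> Bplus"
      have "x \<cdot> m b \<cdot> m c = x \<cdot> m c \<cdot> m b"
        using x m Bplus[OF b] m_comm_m[of b c] by (simp add: U.m_assoc m_closed)
      then show "x \<cdot> m b \<cdot> m c \<in> I"
        using I_gen[of "x \<cdot> m c" b] x m b by (simp add: m_closed)
    qed (use m m_closed in auto)
  next
    case (h c)
    show ?case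
    proof (rule ballI, rule gen)
      fix x b assume x: "x \<in> carrier U" and b: "b \<in> Bplus"
      note b' = Bplus[OF b]
      have "x \<cdot> m b \<cdot> h c = x \<cdot> h c \<cdot> m b \<oplus>\<^bsub>U\<^esub> x \<cdot> m (bracket B b c)"
        using x h b' by (simp add: U.m_assoc m_closed h_closed mh U.r_distr bracket_closed)
      then show "x \<cdot> m b \<cdot> h c \<in> I"
        using I_gen[of "x \<cdot> h c" b] I_gen[OF x bracket_Bplus[OF b'(1) h]] x h b
        by (simp add: h_closed I_add)
    qed (use h h_closed in auto)
  next
    case (add u v)
    then show ?case by (simp add: U.r_distr I_closed I_add)
  next
    case (mult u v)
    then show ?case by (simp add: I_closed flip: U.m_assoc)
  qed
  then show ?thesis using i by blast
qed

lemma I_ideal: "ideal I U"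
  by (rule idealI[OF U_ring I_subgroup I_left I_right])

sublocale HI: algebra_ideal k U I
  by (intro algebra_ideal.intro U_nc_algebra I_ideal)

abbreviation H where "H \<equiv> env_quot k B"
abbreviation prj where "prj \<equiv> env_proj k B"

lemma H_eq: "H = HI.Q" and prj_eq: "prj = HI.proj"
  by (simp_all add: env_quot_def env_proj_def fun_eq_iff)

lemma H_nc_algebra: "nc_algebra k H"
  unfolding H_eq by (rule HI.Q_nc_algebra)

sublocale H: nc_algebra k H
  by (rule H_nc_algebra)

lemma prj_alg_hom: "prj \<in> alg_hom k U H"
  unfolding H_eq prj_eq by (rule HI.proj_alg_hom)

lemmas prjD = lin_mapD[OF alg_homD(2)[OF prj_alg_hom]] alg_homD(3,4)[OF prj_alg_hom]

lemma H_carrierE: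
  assumes "c \<in> carrier H" obtains u where "u \<in> carrier U" "c = prj u"
  using assms unfolding H_eq prj_eq by (rule HI.Q_carrierE)

text \<open>The difference of b and its counit times the unit lies in the augmentation ideal, so its
  image under \<open>m\<close> dies in the quotient.\<close>

lemma prj_m:
  assumes b: "b \<in> carrier B"
  shows "prj (m b) = eps b \<odot>\<^bsub>H\<^esub> \<one>\<^bsub>H\<^esub>"
proof -
  let ?c = "b \<ominus>\<^bsub>B\<^esub> eps b \<odot>\<^bsub>B\<^esub> \<one>\<^bsub>B\<^esub>"
  have e: "eps b \<in> carrier k" using b by (rule eps_closed)
  have c: "?c \<in> carrier B" using b e by simp
  have bc: "b = ?c \<oplus>\<^bsub>B\<^esub> eps b \<odot>\<^bsub>B\<^esub> \<one>\<^bsub>B\<^esub>"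
    using b e by (simp add: a_minus_def BB.M.a_assoc BB.M.l_neg)
  have "eps b = eps ?c \<oplus> eps (eps b \<odot>\<^bsub>B\<^esub> \<one>\<^bsub>B\<^esub>)"
    using arg_cong[OF bc, of eps] c e ring_hom_add[OF counit_ring_hom, of ?c "eps b \<odot>\<^bsub>B\<^esub> \<one>\<^bsub>B\<^esub>"] by simp
  then have "eps b = eps ?c \<oplus> eps b"
    using e by (simp add: counit_smult ring_hom_one[OF counit_ring_hom])
  then have "eps ?c = \<zero>"
    using kk.add.r_cancel_one'[OF e eps_closed[OF c]] by simp
  then have "?c \<in> Bplus"
    using c by (simp add: augmentation_ideal_def)
  then have "m ?c \<in> I"
    using I_gen[of "\<one>\<^bsub>U\<^esub>" ?c] m_closed[OF c] by simp
  moreover have "m b = m ?c \<oplus>\<^bsub>U\<^esub> eps b \<odot>\<^bsub>U\<^esub> \<one>\<^bsub>U\<^esub>"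
    using arg_cong[OF bc, of m] c e by (simp add: m_add m_smult m_one)
  then have "m b \<ominus>\<^bsub>U\<^esub> eps b \<odot>\<^bsub>U\<^esub> \<one>\<^bsub>U\<^esub> = m ?c"
    using minus_eq_iff[OF U_ring, of "m b" "eps b \<odot>\<^bsub>U\<^esub> \<one>\<^bsub>U\<^esub>" "m ?c"] b c e by (simp add: m_closed)
  ultimately have "prj (m b) = prj (eps b \<odot>\<^bsub>U\<^esub> \<one>\<^bsub>U\<^esub>)"
    unfolding prj_eq using b e by (intro HI.proj_eqI) (simp_all add: m_closed)
  then show ?thesis
    using e by (simp add: prjD)
qed

sublocale UH: nc_algebra_pair k U H
  by (intro nc_algebra_pair.intro U_nc_algebra H_nc_algebra)

declare UH.TA_simps [simp del]

section \<open>The coaction on generators\<close>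

abbreviation UHT where "UHT \<equiv> tensor_algebra k U H"
abbreviation ku where "ku \<equiv> kpure k U H"
abbreviation swH where "swH \<equiv> sw (add_monoid UHT)"
abbreviation lam where "lam \<equiv> env_coaction k B"

lemma UHG: "comm_group (add_monoid UHT)"
  by (rule UH.TA_a_comm_group)

lemma id_alg_hom: "(\<lambda>y. y) \<in> alg_hom k U U"
  by (intro alg_homI lin_mapI) simp_all

lemma lam_alg_hom: "lam \<in> alg_hom k U UHT"
proof -
  have t: "tensor_map k U U U H (\<lambda>y. y) prj \<in> alg_hom k UT UHT"
    by (rule tensor_map_alg_hom[OF UU.nc_algebra_pair_axioms UH.nc_algebra_pair_axioms id_alg_hom prj_alg_hom])
  note tD = lin_mapD[OF alg_homD(2)[OF t]] alg_homD(3,4)[OF t]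
    and dD = lin_mapD[OF alg_homD(2)[OF env_comult(1)]] alg_homD(3,4)[OF env_comult(1)]
  show ?thesis
    by (intro alg_homI lin_mapI) (simp_all add: env_coaction_def tD dD)
qed

lemmas lamD = lin_mapD[OF alg_homD(2)[OF lam_alg_hom]] alg_homD(3,4)[OF lam_alg_hom]

lemma coact_sw:
  assumes b: "b \<in> carrier B" and f: "\<And>x y. \<lbrakk>x \<in> carrier B; y \<in> carrier B\<rbrakk> \<Longrightarrow> f x y \<in> carrier UT"
  shows "tensor_map k U U U H (\<lambda>y. y) prj (swT f b) = swH (\<lambda>x y. tensor_map k U U U H (\<lambda>y. y) prj (f x y)) b"
proof -
  have "tensor_map k U U U H (\<lambda>y. y) prj \<in> hom (add_monoid UT) (add_monoid UHT)"
    using alg_homD(2)[OF tensor_map_alg_hom[OF UU.nc_algebra_pair_axioms UH.nc_algebra_pair_axioms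
          id_alg_hom prj_alg_hom]] by (simp add: lin_map_def)
  then show ?thesis
    by (intro hom_sw[OF UTG comm_group.axioms(2)[OF UHG] _ b]) (simp_all add: f)
qed

lemmas coact_pure = tensor_map_lin(2)[OF UU.module_pair_axioms UH.module_pair_axioms
    alg_homD(2)[OF id_alg_hom] alg_homD(2)[OF prj_alg_hom]]

lemmas coact_lin = lin_mapD[OF tensor_map_lin(1)[OF UU.module_pair_axioms UH.module_pair_axioms
    alg_homD(2)[OF id_alg_hom] alg_homD(2)[OF prj_alg_hom]]]

text \<open>In the quotient m_y is the scalar given by the counit of y. It moves across the tensor
  sign into the first leg, where the counit axiom removes it.\<close>

lemma sw_eps_right:
  assumes F: "F \<in> lin_map k B U" and b: "b \<in> carrier B"
  shows "swH (\<lambda>x y. ku (F x) (prj (m y))) b = ku (F b) \<one>\<^bsub>H\<^esub>"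
proof -
  have "swH (\<lambda>x y. ku (F x) (prj (m y))) b = swH (\<lambda>x y. ku (F (eps y \<odot>\<^bsub>B\<^esub> x)) \<one>\<^bsub>H\<^esub>) b"
    by (rule sw_cong[OF b]) (simp add: prj_m lin_mapD[OF F] UH.kpure_middle eps_closed)
  also have "\<dots> = ku (F b) \<one>\<^bsub>H\<^esub>"
    by (rule sw_counit_right[OF comm_group.axioms(2)[OF UHG] _ b], rule homI)
      (simp_all add: UH.kpure_closed UH.kpure_add_left lin_mapD[OF F])
  finally show ?thesis .
qed

text \<open>The copy of \<open>B\<close> is coinvariant; this is what makes the Galois map balanced
  over \<open>B\<close>.\<close>

lemma lam_m: "b \<in> carrier B \<Longrightarrow> lam (m b) = ku (m b) \<one>\<^bsub>H\<^esub>"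
proof -
  assume b: "b \<in> carrier B"
  have "lam (m b) = swH (\<lambda>x y. tensor_map k U U U H (\<lambda>y. y) prj (ca x y)) b"
    unfolding env_coaction_def env_comult(2)[OF b] dm_def by (rule coact_sw[OF b ca_closed])
  also have "\<dots> = swH (\<lambda>x y. ku (m x) (prj (m y))) b"
    unfolding ca_def by (intro sw_cong b coact_pure m_closed)
  also have "\<dots> = ku (m b) \<one>\<^bsub>H\<^esub>"
    by (rule sw_eps_right[OF m_lin b])
  finally show ?thesis .
qed

lemma swH_closed:
  "\<lbrakk>b \<in> carrier B; \<And>x y. \<lbrakk>x \<in> carrier B; y \<in> carrier B\<rbrakk> \<Longrightarrow> f x y \<in> carrier UHT\<rbrakk> \<Longrightarrow> swH f b \<in> carrier UHT"
  using sw_closed[OF UHG, of b f] by simp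

lemma swH_add:
  "\<lbrakk>b \<in> carrier B; \<And>x y. \<lbrakk>x \<in> carrier B; y \<in> carrier B\<rbrakk> \<Longrightarrow> f x y \<in> carrier UHT;
    \<And>x y. \<lbrakk>x \<in> carrier B; y \<in> carrier B\<rbrakk> \<Longrightarrow> g x y \<in> carrier UHT\<rbrakk> \<Longrightarrow>
    swH (\<lambda>x y. f x y \<oplus>\<^bsub>UHT\<^esub> g x y) b = swH f b \<oplus>\<^bsub>UHT\<^esub> swH g b"
  using sw_mult_dist[OF UHG, of b f g] by simp

lemma lam_h: "b \<in> carrier B \<Longrightarrow> lam (h b) = swH (\<lambda>x y. ku (m x) (prj (h y))) b \<oplus>\<^bsub>UHT\<^esub> ku (h b) \<one>\<^bsub>H\<^esub>"
proof -
  assume b: "b \<in> carrier B"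
  have "lam (h b) = swH (\<lambda>x y. tensor_map k U U U H (\<lambda>y. y) prj (ce x y)) b"
    unfolding env_coaction_def env_comult(3)[OF b] dh_def by (rule coact_sw[OF b ce_closed])
  also have "\<dots> = swH (\<lambda>x y. ku (m x) (prj (h y)) \<oplus>\<^bsub>UHT\<^esub> ku (h x) (prj (m y))) b"
    unfolding ce_def by (intro sw_cong b) (simp add: coact_lin coact_pure m_closed h_closed UU.kpure_closed)
  also have "\<dots> = swH (\<lambda>x y. ku (m x) (prj (h y))) b \<oplus>\<^bsub>UHT\<^esub> ku (h b) \<one>\<^bsub>H\<^esub>"
    unfolding sw_eps_right[OF h_lin b, symmetric]
    by (rule swH_add[OF b]) (simp_all add: UH.kpure_closed m_closed h_closed prjD)
  finally show ?thesis .
qed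

text \<open>The coaction is multiplicative and the factor m_S(x) is coinvariant, so it only
  multiplies first legs. There m_(S(b1) b2) \<otimes> \<pi>(h_b3) collapses by antipode
  cancellation, which leaves \<open>p b\<close> primitive relative to the coaction.\<close>

lemma lam_p:
  assumes b: "b \<in> carrier B"
  shows "lam (p b) = ku \<one>\<^bsub>U\<^esub> (prj (h b)) \<oplus>\<^bsub>UHT\<^esub> ku (p b) \<one>\<^bsub>H\<^esub>"
proof -
  note c = m_closed h_closed S_lin(1) prjD(1) UH.kpure_closed UH.TA_mult_closed
  have lam_hom: "lam \<in> hom (add_monoid U) (add_monoid UHT)"
    using alg_homD(2)[OF lam_alg_hom] by (simp add: lin_map_def)
  have "lam (p b) = swH (\<lambda>x w. lam (m (S x) \<cdot> h w)) b"
    unfolding p_def by (rule hom_sw[OF UG comm_group.axioms(2)[OF UHG] lam_hom b]) (simp add: c)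
  also have "\<dots> = swH (\<lambda>x w. swH (\<lambda>y z. ku (m (S x \<otimes>\<^bsub>B\<^esub> y)) (prj (h z))) w \<oplus>\<^bsub>UHT\<^esub> ku (m (S x) \<cdot> h w) \<one>\<^bsub>H\<^esub>) b"
  proof (rule sw_cong[OF b])
    fix x w assume x: "x \<in> carrier B" and w: "w \<in> carrier B"
    have k1: "ku (m (S x)) \<one>\<^bsub>H\<^esub> \<in> carrier UHT" using x by (simp add: c)
    have "lam (m (S x) \<cdot> h w) =
        ku (m (S x)) \<one>\<^bsub>H\<^esub> \<otimes>\<^bsub>UHT\<^esub> (swH (\<lambda>x y. ku (m x) (prj (h y))) w \<oplus>\<^bsub>UHT\<^esub> ku (h w) \<one>\<^bsub>H\<^esub>)"
      using x w by (simp add: lamD c lam_m lam_h)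
    also have "\<dots> = ku (m (S x)) \<one>\<^bsub>H\<^esub> \<otimes>\<^bsub>UHT\<^esub> swH (\<lambda>x y. ku (m x) (prj (h y))) w \<oplus>\<^bsub>UHT\<^esub>
        ku (m (S x)) \<one>\<^bsub>H\<^esub> \<otimes>\<^bsub>UHT\<^esub> ku (h w) \<one>\<^bsub>H\<^esub>"
      using x w by (intro UH.TA_r_distr k1 swH_closed) (simp_all add: c)
    also have "ku (m (S x)) \<one>\<^bsub>H\<^esub> \<otimes>\<^bsub>UHT\<^esub> swH (\<lambda>x y. ku (m x) (prj (h y))) w =
        swH (\<lambda>y z. ku (m (S x)) \<one>\<^bsub>H\<^esub> \<otimes>\<^bsub>UHT\<^esub> ku (m y) (prj (h z))) w"
      by (rule sw_rdistr[OF UH.TA_ring k1 w]) (simp add: c)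
    also have "\<dots> = swH (\<lambda>y z. ku (m (S x \<otimes>\<^bsub>B\<^esub> y)) (prj (h z))) w"
      by (rule sw_cong[OF w]) (use x in \<open>simp add: UH.kpure_mult c m_mult\<close>)
    finally show "lam (m (S x) \<cdot> h w) =
        swH (\<lambda>y z. ku (m (S x \<otimes>\<^bsub>B\<^esub> y)) (prj (h z))) w \<oplus>\<^bsub>UHT\<^esub> ku (m (S x) \<cdot> h w) \<one>\<^bsub>H\<^esub>"
      using x w by (simp add: UH.kpure_mult c)
  qed
  also have "\<dots> = swH (\<lambda>x w. swH (\<lambda>y z. ku (m (S x \<otimes>\<^bsub>B\<^esub> y)) (prj (h z))) w) b \<oplus>\<^bsub>UHT\<^esub>
      swH (\<lambda>x w. ku (m (S x) \<cdot> h w) \<one>\<^bsub>H\<^esub>) b"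
    by (rule swH_add[OF b]) (simp_all add: swH_closed c)
  also have "swH (\<lambda>x w. swH (\<lambda>y z. ku (m (S x \<otimes>\<^bsub>B\<^esub> y)) (prj (h z))) w) b = ku (m \<one>\<^bsub>B\<^esub>) (prj (h b))"
  proof (rule sw_antipode_cancel_left[OF UHG _ b])
    have "(\<lambda>z. prj (h z)) \<in> lin_map k B H"
      by (rule lin_mapI) (simp_all add: h_closed h_add h_smult prjD)
    then show "kbalanced k B B (add_monoid UHT) (\<lambda>c z. ku (m c) (prj (h z)))"
      by (rule balanced_pure[OF UH.module_pair_axioms m_lin])
  qed
  also have "swH (\<lambda>x w. ku (m (S x) \<cdot> h w) \<one>\<^bsub>H\<^esub>) b = ku (p b) \<one>\<^bsub>H\<^esub>"
    unfolding p_def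
    by (rule hom_sw[OF UG comm_group.axioms(2)[OF UHG] _ b, symmetric], rule homI)
      (simp_all add: UH.kpure_closed UH.kpure_add_left c)
  finally show ?thesis by (simp add: m_one)
qed

section \<open>Bijectivity of the Galois map\<close>

sublocale W: tensor_product "carrier B" "\<lambda>x b. x \<cdot> m b" "\<lambda>b y. m b \<cdot> y" U U
proof -
  have "abelian_group U" by (rule ring.is_abelian_group[OF U_ring])
  then show "tensor_product (carrier B) (\<lambda>x b. x \<cdot> m b) (\<lambda>b y. m b \<cdot> y) U U"
    by (intro tensor_product.intro) (simp_all add: m_closed)
qed

abbreviation E where "E \<equiv> end_ring W.T"
abbreviation wl where "wl \<equiv> tensor_lift (carrier B) (\<lambda>x b. x \<cdot> m b) (\<lambda>b y. m b \<cdot> y) U U"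
abbreviation wbal where "wbal \<equiv> balanced (carrier B) (\<lambda>x b. x \<cdot> m b) (\<lambda>b y. m b \<cdot> y) U U"

sublocale WG: comm_group W.T
  by (rule W.comm_group_T)

sublocale E: ring E
  by (rule WG.ring_end_ring)

text \<open>Elements of \<open>E\<close> are extensional and additive, so their values on pure
  tensors decide equality.\<close>

lemma E_eqI:
  assumes f: "f \<in> carrier E" and g: "g \<in> carrier E"
    and eq: "\<And>x y. \<lbrakk>x \<in> carrier U; y \<in> carrier U\<rbrakk> \<Longrightarrow> f (W.P x y) = g (W.P x y)"
  shows "f = g"
  by (rule WG.end_ring_eqI[OF f g], rule W.hom_eqI[OF WG.is_group WG.end_ring_hom[OF f] WG.end_ring_hom[OF g] eq])

lemma restrict_lift:
  assumes f: "wbal W.T f"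
  shows "restrict (wl W.T f) (carrier W.T) \<in> carrier E"
    and "\<lbrakk>x \<in> carrier U; y \<in> carrier U\<rbrakk> \<Longrightarrow> restrict (wl W.T f) (carrier W.T) (W.P x y) = f x y"
  by (rule WG.end_ring_restrict[OF W.lift_hom[OF W.comm_group_T f]])
    (simp add: W.pure_closed W.lift_pure[OF W.comm_group_T f])

section \<open>Left multiplications on the tensor product over \<open>B\<close>\<close>

definition L where "L u = restrict (wl W.T (\<lambda>x y. W.P (u \<cdot> x) y)) (carrier W.T)"

lemma L_bal: "u \<in> carrier U \<Longrightarrow> wbal W.T (\<lambda>x y. W.P (u \<cdot> x) y)"
  by (rule balancedI)
    (simp_all add: W.pure_closed U.r_distr W.pure_add_left W.pure_add_right W.pure_middle[symmetric] m_closed U.m_assoc)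

lemma L_closed: "u \<in> carrier U \<Longrightarrow> L u \<in> carrier E"
  unfolding L_def by (rule restrict_lift(1)[OF L_bal])

lemma L_pure: "\<lbrakk>u \<in> carrier U; x \<in> carrier U; y \<in> carrier U\<rbrakk> \<Longrightarrow> L u (W.P x y) = W.P (u \<cdot> x) y"
  unfolding L_def by (rule restrict_lift(2)[OF L_bal])

lemma L_ring_hom: "L \<in> ring_hom U E"
proof (rule ring_hom_memI)
  fix u v assume u: "u \<in> carrier U" and v: "v \<in> carrier U"
  show "L (u \<cdot> v) = L u \<otimes>\<^bsub>E\<^esub> L v"
    by (rule E_eqI)
      (use u v in \<open>simp_all add: L_closed WG.end_ring_simps(2) W.pure_closed L_pure U.m_assoc\<close>)
  show "L (u \<oplus>\<^bsub>U\<^esub> v) = L u \<oplus>\<^bsub>E\<^esub> L v"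
    by (rule E_eqI)
      (use u v in \<open>simp_all add: L_closed WG.end_ring_simps(3) W.pure_closed L_pure U.l_distr W.pure_add_left\<close>)
next
  show "L \<one>\<^bsub>U\<^esub> = \<one>\<^bsub>E\<^esub>"
    by (rule E_eqI) (simp_all add: L_closed WG.end_ring_simps(5) W.pure_closed L_pure)
qed (rule L_closed)

section \<open>The operators \<open>T b\<close>\<close>

text \<open>The element 1 \<otimes> q - q \<otimes> 1 inserted between x and y; the group is written
  multiplicatively, so the inverse is the minus sign. Keeping it as a function of x and y for every
  \<open>q\<close> allows additivity in \<open>q\<close> to be used before anything descends to the
  tensor product.\<close>

definition der where "der q x y = W.P x (q \<cdot> y) \<otimes>\<^bsub>W.T\<^esub> inv\<^bsub>W.T\<^esub> W.P (x \<cdot> q) y"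

lemma der_closed: "\<lbrakk>q \<in> carrier U; x \<in> carrier U; y \<in> carrier U\<rbrakk> \<Longrightarrow> der q x y \<in> carrier W.T"
  unfolding der_def by (simp add: W.pure_closed)

lemma der_add: "\<lbrakk>q \<in> carrier U; r \<in> carrier U; x \<in> carrier U; y \<in> carrier U\<rbrakk> \<Longrightarrow>
    der (q \<oplus>\<^bsub>U\<^esub> r) x y = der q x y \<otimes>\<^bsub>W.T\<^esub> der r x y"
  unfolding der_def
  by (simp add: U.l_distr U.r_distr W.pure_add_left W.pure_add_right W.pure_closed WG.inv_mult WG.m_ac)

lemma pure_smult: "\<lbrakk>r \<in> carrier k; x \<in> carrier U; y \<in> carrier U\<rbrakk> \<Longrightarrow> W.P x (r \<odot>\<^bsub>U\<^esub> y) = W.P (r \<odot>\<^bsub>U\<^esub> x) y"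
  using W.pure_middle[of x "r \<odot>\<^bsub>B\<^esub> \<one>\<^bsub>B\<^esub>" y]
  by (simp add: m_smult m_one U.smult_mult_left U.smult_mult_right)

lemma der_smult: "\<lbrakk>r \<in> carrier k; q \<in> carrier U; x \<in> carrier U; y \<in> carrier U\<rbrakk> \<Longrightarrow>
    der (r \<odot>\<^bsub>U\<^esub> q) x y = der q (r \<odot>\<^bsub>U\<^esub> x) y"
  unfolding der_def by (simp add: U.smult_mult_left U.smult_mult_right pure_smult)

text \<open>Moving \<open>m c\<close> to the left of q costs \<open>m d\<close> in both terms. Since
  m_d comes from \<open>B\<close>, it passes through the tensor sign, and x m_d \<otimes> y occurs
  once with each sign.\<close>

lemma der_bal:
  assumes q: "q \<in> carrier U" and comm: "\<And>c. c \<in> carrier B \<Longrightarrow> \<exists>d\<in>carrier B. q \<cdot> m c = m c \<cdot> q \<oplus>\<^bsub>U\<^esub> m d"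
  shows "wbal W.T (der q)"
proof
  fix x c y assume x: "x \<in> carrier U" and c: "c \<in> carrier B" and y: "y \<in> carrier U"
  obtain d where d: "d \<in> carrier B" and qc: "q \<cdot> m c = m c \<cdot> q \<oplus>\<^bsub>U\<^esub> m d"
    using comm[OF c] by blast
  note cl = x y q m_closed[OF c] m_closed[OF d]
  have "q \<cdot> (m c \<cdot> y) = m c \<cdot> (q \<cdot> y) \<oplus>\<^bsub>U\<^esub> m d \<cdot> y"
    using cl by (simp add: qc U.l_distr U.m_assoc flip: U.m_assoc[of q])
  then have 1: "W.P x (q \<cdot> (m c \<cdot> y)) = W.P (x \<cdot> m c) (q \<cdot> y) \<otimes>\<^bsub>W.T\<^esub> W.P (x \<cdot> m d) y"
    using cl c d by (simp add: W.pure_add_right W.pure_middle)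
  have "W.P (x \<cdot> q) (m c \<cdot> y) = W.P (x \<cdot> (q \<cdot> m c)) y"
    using cl c by (simp add: U.m_assoc flip: W.pure_middle)
  also have "\<dots> = W.P (x \<cdot> m c \<cdot> q) y \<otimes>\<^bsub>W.T\<^esub> W.P (x \<cdot> m d) y"
    using cl by (simp add: qc U.r_distr U.m_assoc W.pure_add_left)
  finally show "der q (x \<cdot> m c) y = der q x (m c \<cdot> y)"
    using cl unfolding der_def 1
    by (simp add: W.pure_closed WG.inv_mult WG.m_assoc)
      (simp add: W.pure_closed WG.m_lcomm[of "W.P (x \<cdot> m d) y"])
qed (use q in \<open>simp_all add: der_def W.pure_closed U.l_distr U.r_distr W.pure_add_left W.pure_add_right WG.inv_mult WG.m_ac\<close>)

definition T where "T b = restrict (wl W.T (der (p b))) (carrier W.T)"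

lemma p_der_bal: "b \<in> carrier B \<Longrightarrow> wbal W.T (der (p b))"
  by (intro der_bal p_closed p_comm_m)

lemma T_closed: "b \<in> carrier B \<Longrightarrow> T b \<in> carrier E"
  unfolding T_def by (rule restrict_lift(1)[OF p_der_bal])

lemma T_pure: "\<lbrakk>b \<in> carrier B; x \<in> carrier U; y \<in> carrier U\<rbrakk> \<Longrightarrow> T b (W.P x y) = der (p b) x y"
  unfolding T_def by (rule restrict_lift(2)[OF p_der_bal])

lemma E_hom:
  assumes "f \<in> carrier E"
  shows "\<lbrakk>x \<in> carrier W.T; y \<in> carrier W.T\<rbrakk> \<Longrightarrow> f (x \<otimes>\<^bsub>W.T\<^esub> y) = f x \<otimes>\<^bsub>W.T\<^esub> f y"
    and "x \<in> carrier W.T \<Longrightarrow> f (inv\<^bsub>W.T\<^esub> x) = inv\<^bsub>W.T\<^esub> f x"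
proof -
  interpret group_hom W.T W.T f
    by (intro group_hom.intro group_hom_axioms.intro WG.is_group WG.end_ring_hom[OF assms])
  show "\<lbrakk>x \<in> carrier W.T; y \<in> carrier W.T\<rbrakk> \<Longrightarrow> f (x \<otimes>\<^bsub>W.T\<^esub> y) = f x \<otimes>\<^bsub>W.T\<^esub> f y"
    and "x \<in> carrier W.T \<Longrightarrow> f (inv\<^bsub>W.T\<^esub> x) = inv\<^bsub>W.T\<^esub> f x"
    by simp_all
qed

lemma L_der: "\<lbrakk>u \<in> carrier U; q \<in> carrier U; x \<in> carrier U; y \<in> carrier U\<rbrakk> \<Longrightarrow>
    L u (der q x y) = der q (u \<cdot> x) y"
  by (simp add: der_def E_hom[OF L_closed] W.pure_closed L_pure U.m_assoc)

text \<open>\<open>L u\<close> multiplies at the far left of the first factor, while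
  \<open>T b\<close> acts between the two factors.\<close>

lemma L_T_comm: "\<lbrakk>u \<in> carrier U; b \<in> carrier B\<rbrakk> \<Longrightarrow> L u \<otimes>\<^bsub>E\<^esub> T b = T b \<otimes>\<^bsub>E\<^esub> L u"
  by (rule E_eqI)
    (simp_all add: L_closed T_closed WG.end_ring_simps(2) W.pure_closed T_pure L_pure L_der p_closed)

lemma T_der:
  assumes "b \<in> carrier B" "q \<in> carrier U" "x \<in> carrier U" "y \<in> carrier U"
  shows "T b (der q x y) = W.P x (p b \<cdot> q \<cdot> y) \<otimes>\<^bsub>W.T\<^esub> inv\<^bsub>W.T\<^esub> W.P (x \<cdot> p b) (q \<cdot> y) \<otimes>\<^bsub>W.T\<^esub>
    (inv\<^bsub>W.T\<^esub> W.P (x \<cdot> q) (p b \<cdot> y) \<otimes>\<^bsub>W.T\<^esub> W.P (x \<cdot> (q \<cdot> p b)) y)"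
  using assms
  by (simp add: der_def[of q] E_hom[OF T_closed] W.pure_closed T_pure p_closed)
    (simp add: der_def W.pure_closed p_closed U.m_assoc WG.inv_mult)

text \<open>Of the four terms of a composite, the two with one p on either side of the tensor sign
  are interchanged by swapping x and y. What survives in the commutator is p_x p_y - p_y p_x on the
  right factor minus the same on the left factor, and this difference of products is
  p_{x,y}.\<close>

lemma T_bracket:
  assumes x: "x \<in> carrier B" and y: "y \<in> carrier B"
  shows "T x \<otimes>\<^bsub>E\<^esub> T y = T y \<otimes>\<^bsub>E\<^esub> T x \<oplus>\<^bsub>E\<^esub> T (bracket B x y)"
proof (rule E_eqI)
  fix u v assume u: "u \<in> carrier U" and v: "v \<in> carrier U"
  let ?b = "p (bracket B x y)"
  note c = p_closed[OF x] p_closed[OF y] p_closed[OF bracket_closed[OF x y]] u v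
  have pp: "p x \<cdot> p y = p y \<cdot> p x \<oplus>\<^bsub>U\<^esub> ?b"
    using minus_eq_iff[OF U_ring, of "p x \<cdot> p y" "p y \<cdot> p x" ?b] c
    by (simp add: p_bracket[OF x y, symmetric] U.M.a_comm)
  have 1: "W.P u (p x \<cdot> p y \<cdot> v) = W.P u (p y \<cdot> p x \<cdot> v) \<otimes>\<^bsub>W.T\<^esub> W.P u (?b \<cdot> v)"
    using c by (simp add: pp U.l_distr W.pure_add_right)
  have 2: "W.P (u \<cdot> (p x \<cdot> p y)) v = W.P (u \<cdot> (p y \<cdot> p x)) v \<otimes>\<^bsub>W.T\<^esub> W.P (u \<cdot> ?b) v"
    using c by (simp add: pp U.r_distr W.pure_add_left)
  \<comment> \<open>Here e stands for u p_{x,y} \<otimes> v, which enters once through the reordered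
    product on the left factor and once, inverted, through \<open>T (bracket B x y)\<close>.\<close>
  have 3: "a \<otimes>\<^bsub>W.T\<^esub> b' \<otimes>\<^bsub>W.T\<^esub> i \<otimes>\<^bsub>W.T\<^esub> (j \<otimes>\<^bsub>W.T\<^esub> d) =
      a \<otimes>\<^bsub>W.T\<^esub> j \<otimes>\<^bsub>W.T\<^esub> (i \<otimes>\<^bsub>W.T\<^esub> (d \<otimes>\<^bsub>W.T\<^esub> e)) \<otimes>\<^bsub>W.T\<^esub> (b' \<otimes>\<^bsub>W.T\<^esub> inv\<^bsub>W.T\<^esub> e)"
    if "a \<in> carrier W.T" "b' \<in> carrier W.T" "i \<in> carrier W.T" "j \<in> carrier W.T" "d \<in> carrier W.T" "e \<in> carrier W.T"
    for a b' i j d e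
  proof -
    have "a \<otimes>\<^bsub>W.T\<^esub> j \<otimes>\<^bsub>W.T\<^esub> (i \<otimes>\<^bsub>W.T\<^esub> (d \<otimes>\<^bsub>W.T\<^esub> e)) \<otimes>\<^bsub>W.T\<^esub> (b' \<otimes>\<^bsub>W.T\<^esub> inv\<^bsub>W.T\<^esub> e) =
        (a \<otimes>\<^bsub>W.T\<^esub> b' \<otimes>\<^bsub>W.T\<^esub> i \<otimes>\<^bsub>W.T\<^esub> (j \<otimes>\<^bsub>W.T\<^esub> d)) \<otimes>\<^bsub>W.T\<^esub> (e \<otimes>\<^bsub>W.T\<^esub> inv\<^bsub>W.T\<^esub> e)"
      using that by (simp only: WG.m_ac WG.m_closed WG.inv_closed)
    then show ?thesis using that by simp
  qed
  show "(T x \<otimes>\<^bsub>E\<^esub> T y) (W.P u v) = (T y \<otimes>\<^bsub>E\<^esub> T x \<oplus>\<^bsub>E\<^esub> T (bracket B x y)) (W.P u v)"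
    using c x y
    by (simp add: WG.end_ring_simps(2,3) W.pure_closed T_pure T_der bracket_closed)
      (simp add: 1 2 der_def W.pure_closed 3)
qed (use x y in \<open>simp_all add: T_closed bracket_closed\<close>)

section \<open>The action of the enveloping algebra on the tensor product over
  \<open>B\<close>\<close>

text \<open>\<open>E\<close> has no scalar multiplication; its scalars are the left multiplications
  by multiples of the unit, which commute with all \<open>L u\<close> and all
  \<open>T b\<close>.\<close>

definition \<iota> where "\<iota> r = L (r \<odot>\<^bsub>U\<^esub> \<one>\<^bsub>U\<^esub>)"

lemma \<iota>_ring_hom: "\<iota> \<in> ring_hom k E"
proof -
  have "\<iota> = L \<circ> (\<lambda>r. r \<odot>\<^bsub>U\<^esub> \<one>\<^bsub>U\<^esub>)"
    by (simp add: fun_eq_iff \<iota>_def)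
  then show ?thesis
    using ring_hom_trans[OF U.smult_one_ring_hom L_ring_hom] by simp
qed

lemmas LD = ring_hom_mult[OF L_ring_hom] ring_hom_add[OF L_ring_hom] ring_hom_one[OF L_ring_hom]
lemmas \<iota>D = ring_hom_closed[OF \<iota>_ring_hom] ring_hom_mult[OF \<iota>_ring_hom] ring_hom_add[OF \<iota>_ring_hom]
  ring_hom_one[OF \<iota>_ring_hom]

lemma \<iota>_L_comm: "\<lbrakk>r \<in> carrier k; u \<in> carrier U\<rbrakk> \<Longrightarrow> \<iota> r \<otimes>\<^bsub>E\<^esub> L u = L u \<otimes>\<^bsub>E\<^esub> \<iota> r"
  unfolding \<iota>_def by (simp add: U.smult_one_central flip: LD)

lemma T_smult: "\<lbrakk>r \<in> carrier k; b \<in> carrier B\<rbrakk> \<Longrightarrow> T (r \<odot>\<^bsub>B\<^esub> b) = \<iota> r \<otimes>\<^bsub>E\<^esub> T b"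
  by (rule E_eqI)
    (simp_all add: T_closed \<iota>D \<iota>_def L_closed WG.end_ring_simps(2) W.pure_closed T_pure p_closed L_der p_linD
      der_smult U.smult_mult_left)

lemma T_mult:
  assumes x: "x \<in> carrier B" and y: "y \<in> carrier B"
  shows "T (x \<otimes>\<^bsub>B\<^esub> y) = \<iota> (eps y) \<otimes>\<^bsub>E\<^esub> T x \<oplus>\<^bsub>E\<^esub> \<iota> (eps x) \<otimes>\<^bsub>E\<^esub> T y"
  by (rule E_eqI)
    (use x y in \<open>simp_all add: T_closed \<iota>D \<iota>_def L_closed WG.end_ring_simps(2,3) W.pure_closed T_pure p_closed L_der
      p_mult eps_closed der_add der_smult U.smult_mult_left WG.m_comm der_closed\<close>)

text \<open>The relations for h are those already found for \<open>T\<close>. The relation for m of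
  a bracket becomes 0 = 0: the counit kills brackets, and scalars commute with
  \<open>T\<close>.\<close>

lemma Theta_exists:
  "\<exists>\<phi>\<in>ring_hom U E. (\<forall>b\<in>carrier B. \<phi> (m b) = \<iota> (eps b) \<and> \<phi> (h b) = T b) \<and>
    (\<forall>r\<in>carrier k. \<forall>u\<in>carrier U. \<phi> (r \<odot>\<^bsub>U\<^esub> u) = \<iota> r \<otimes>\<^bsub>E\<^esub> \<phi> u)"
proof (rule U_universal[OF WG.ring_end_ring \<iota>_ring_hom])
  fix x y assume x: "x \<in> carrier B" and y: "y \<in> carrier B"
  show "T (x \<oplus>\<^bsub>B\<^esub> y) = T x \<oplus>\<^bsub>E\<^esub> T y"
    by (rule E_eqI)
      (use x y in \<open>simp_all add: T_closed WG.end_ring_simps(3) W.pure_closed T_pure p_linD der_add\<close>)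
  show "T (bracket B x y) = T x \<otimes>\<^bsub>E\<^esub> T y \<ominus>\<^bsub>E\<^esub> T y \<otimes>\<^bsub>E\<^esub> T x"
    using minus_eq_iff[OF WG.ring_end_ring, of "T x \<otimes>\<^bsub>E\<^esub> T y" "T y \<otimes>\<^bsub>E\<^esub> T x" "T (bracket B x y)"]
      T_bracket[OF x y] x y by (simp add: T_closed bracket_closed E.a_comm)
  have "\<iota> (eps y) \<otimes>\<^bsub>E\<^esub> T x = T x \<otimes>\<^bsub>E\<^esub> \<iota> (eps y)"
    unfolding \<iota>_def using x y by (intro L_T_comm) (simp_all add: eps_closed)
  then show "\<iota> (eps (bracket B x y)) = T x \<otimes>\<^bsub>E\<^esub> \<iota> (eps y) \<ominus>\<^bsub>E\<^esub> \<iota> (eps y) \<otimes>\<^bsub>E\<^esub> T x"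
    using x y ring_hom_zero[OF \<iota>_ring_hom kk.ring_axioms WG.ring_end_ring]
    by (simp add: eps_bracket a_minus_def E.r_neg T_closed \<iota>D eps_closed)
next
  fix r x assume r: "r \<in> carrier k" and x: "x \<in> carrier B"
  have "\<iota> r \<otimes>\<^bsub>E\<^esub> \<iota> s = \<iota> s \<otimes>\<^bsub>E\<^esub> \<iota> r" if "s \<in> carrier k" for s
    using \<iota>_L_comm[OF r, of "s \<odot>\<^bsub>U\<^esub> \<one>\<^bsub>U\<^esub>"] that by (simp add: \<iota>_def)
  then show "\<iota> r \<otimes>\<^bsub>E\<^esub> \<iota> (eps x) = \<iota> (eps x) \<otimes>\<^bsub>E\<^esub> \<iota> r"
    using x by (simp add: eps_closed)
  show "\<iota> r \<otimes>\<^bsub>E\<^esub> T x = T x \<otimes>\<^bsub>E\<^esub> \<iota> r"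
    unfolding \<iota>_def using r x by (intro L_T_comm) simp_all
qed (simp_all add: \<iota>D eps_closed T_closed T_smult T_mult ring_hom_add[OF counit_ring_hom]
    ring_hom_mult[OF counit_ring_hom] ring_hom_one[OF counit_ring_hom] counit_smult)

definition \<Theta> where "\<Theta> = (SOME \<phi>. \<phi> \<in> ring_hom U E \<and> (\<forall>b\<in>carrier B. \<phi> (m b) = \<iota> (eps b) \<and> \<phi> (h b) = T b) \<and>
    (\<forall>r\<in>carrier k. \<forall>u\<in>carrier U. \<phi> (r \<odot>\<^bsub>U\<^esub> u) = \<iota> r \<otimes>\<^bsub>E\<^esub> \<phi> u))"

lemma \<Theta>:
  shows "\<Theta> \<in> ring_hom U E" and "b \<in> carrier B \<Longrightarrow> \<Theta> (m b) = \<iota> (eps b)" and "b \<in> carrier B \<Longrightarrow> \<Theta> (h b) = T b"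
    and "\<lbrakk>r \<in> carrier k; u \<in> carrier U\<rbrakk> \<Longrightarrow> \<Theta> (r \<odot>\<^bsub>U\<^esub> u) = \<iota> r \<otimes>\<^bsub>E\<^esub> \<Theta> u"
  using someI_ex[OF Theta_exists[unfolded Bex_def], folded \<Theta>_def] by blast+

lemmas \<Theta>D = ring_hom_closed[OF \<Theta>(1)] ring_hom_mult[OF \<Theta>(1)] ring_hom_add[OF \<Theta>(1)] ring_hom_one[OF \<Theta>(1)]

text \<open>Commutation is stable under sums and products, so the generators decide. It is the
  reason why \<open>\<Psi>\<close> will be multiplicative.\<close>

lemma L_\<Theta>_comm:
  assumes u: "u \<in> carrier U" and v: "v \<in> carrier U"
  shows "L u \<otimes>\<^bsub>E\<^esub> \<Theta> v = \<Theta> v \<otimes>\<^bsub>E\<^esub> L u"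
  using v
proof (induction rule: U_induct)
  case (m b)
  then show ?case using u \<iota>_L_comm[of "eps b" u] by (simp add: \<Theta>(2) eps_closed)
next
  case (h b)
  then show ?case using u by (simp add: \<Theta>(3) L_T_comm)
next
  case (add v w)
  then show ?case using u by (simp add: \<Theta>D L_closed E.l_distr E.r_distr)
next
  case (mult v w)
  note c = \<Theta>D(1)[OF mult.hyps(1)] \<Theta>D(1)[OF mult.hyps(2)] L_closed[OF u]
  have "L u \<otimes>\<^bsub>E\<^esub> (\<Theta> v \<otimes>\<^bsub>E\<^esub> \<Theta> w) = \<Theta> v \<otimes>\<^bsub>E\<^esub> L u \<otimes>\<^bsub>E\<^esub> \<Theta> w"
    using c by (simp only: E.m_assoc[symmetric] mult.IH)
  also have "\<dots> = \<Theta> v \<otimes>\<^bsub>E\<^esub> \<Theta> w \<otimes>\<^bsub>E\<^esub> L u"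
    using c by (simp only: E.m_assoc mult.IH)
  finally show ?case using mult.hyps by (simp add: \<Theta>D)
qed

text \<open>On a generator x m_b of the ideal the last factor acts as the scalar given by the counit
  of b, which is zero.\<close>

lemma \<Theta>_null:
  assumes "i \<in> I"
  shows "\<Theta> i = \<zero>\<^bsub>E\<^esub>"
proof -
  interpret \<Theta>: ring_hom_ring U E \<Theta>
    by (rule ring_hom_ringI2[OF U_ring WG.ring_end_ring \<Theta>(1)])
  have "subgroup (a_kernel U E \<Theta>) (add_monoid U)"
    by (rule additive_subgroup.a_subgroup[OF ideal.axioms(1)[OF \<Theta>.kernel_is_ideal]])
  moreover have "gens \<subseteq> a_kernel U E \<Theta>"
  proof
    fix g assume "g \<in> gens"
    then obtain x b where g: "g = x \<cdot> m b" "x \<in> carrier U" "b \<in> Bplus" by blast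
    then have "\<Theta> g = \<Theta> x \<otimes>\<^bsub>E\<^esub> \<iota> \<zero>"
      using Bplus[of b] by (simp add: \<Theta>D \<Theta>(2) m_closed)
    also have "\<dots> = \<zero>\<^bsub>E\<^esub>"
      using ring_hom_zero[OF \<iota>_ring_hom kk.ring_axioms WG.ring_end_ring] g by (simp add: \<Theta>D)
    finally show "g \<in> a_kernel U E \<Theta>"
      using g Bplus(1)[of b] unfolding a_kernel_def' by (simp add: m_closed)
  qed
  ultimately have "I \<subseteq> a_kernel U E \<Theta>"
    unfolding env_aug_def
    by (intro group.generate_subgroup_incl[OF comm_group.axioms(2)[OF UG]])
  then show ?thesis
    using assms unfolding a_kernel_def' by blast
qed

section \<open>The induced action of U \<otimes> H\<close>

definition \<theta> where "\<theta> = quot_fun \<Theta>"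

lemma \<theta>_ring_hom: "\<theta> \<in> ring_hom H E"
  and \<theta>_prj: "u \<in> carrier U \<Longrightarrow> \<theta> (prj u) = \<Theta> u"
  using HI.quot_fun_ring_hom[OF WG.ring_end_ring \<Theta>(1) \<Theta>_null] by (simp_all add: \<theta>_def H_eq prj_eq)

lemmas \<theta>D = ring_hom_closed[OF \<theta>_ring_hom] ring_hom_mult[OF \<theta>_ring_hom] ring_hom_add[OF \<theta>_ring_hom]
  ring_hom_one[OF \<theta>_ring_hom]

lemma EG: "comm_group (add_monoid E)"
  by (rule E.a_comm_group)

lemma \<Psi>_bal: "kbalanced k U H (add_monoid E) (\<lambda>u c. L u \<otimes>\<^bsub>E\<^esub> \<theta> c)"
proof
  fix u r c assume u: "u \<in> carrier U" and r: "r \<in> carrier k" and c: "c \<in> carrier H"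
  obtain v where v: "v \<in> carrier U" "c = prj v" using c by (rule H_carrierE)
  have "r \<odot>\<^bsub>U\<^esub> u = u \<cdot> (r \<odot>\<^bsub>U\<^esub> \<one>\<^bsub>U\<^esub>)"
    using u r by (simp add: U.smult_mult_right)
  then have "L (r \<odot>\<^bsub>U\<^esub> u) = L u \<otimes>\<^bsub>E\<^esub> \<iota> r"
    using u r by (simp add: LD \<iota>_def)
  moreover have "\<theta> (r \<odot>\<^bsub>H\<^esub> c) = \<iota> r \<otimes>\<^bsub>E\<^esub> \<theta> c"
    using v r by (simp add: \<theta>_prj \<Theta>(4) flip: prjD(3))
  ultimately show "L (r \<odot>\<^bsub>U\<^esub> u) \<otimes>\<^bsub>E\<^esub> \<theta> c = L u \<otimes>\<^bsub>E\<^esub> \<theta> (r \<odot>\<^bsub>H\<^esub> c)"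
    using u r c by (simp add: E.m_assoc L_closed \<iota>D \<theta>D)
qed (simp_all add: L_closed \<theta>D LD E.l_distr E.r_distr)

definition \<Psi> where "\<Psi> = klift k U H (add_monoid E) (\<lambda>u c. L u \<otimes>\<^bsub>E\<^esub> \<theta> c)"

lemma \<Psi>_hom: "\<Psi> \<in> hom (add_monoid UHT) (add_monoid E)"
  unfolding \<Psi>_def by (rule UH.klift_hom[OF EG \<Psi>_bal])

lemma \<Psi>_pure: "\<lbrakk>u \<in> carrier U; c \<in> carrier H\<rbrakk> \<Longrightarrow> \<Psi> (ku u c) = L u \<otimes>\<^bsub>E\<^esub> \<theta> c"
  unfolding \<Psi>_def by (rule UH.klift_pure[OF EG \<Psi>_bal])

lemma \<Psi>_closed: "t \<in> carrier UHT \<Longrightarrow> \<Psi> t \<in> carrier E"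
  using add_homD(1)[OF \<Psi>_hom] by simp

lemma \<Psi>_add: "\<lbrakk>s \<in> carrier UHT; t \<in> carrier UHT\<rbrakk> \<Longrightarrow> \<Psi> (s \<oplus>\<^bsub>UHT\<^esub> t) = \<Psi> s \<oplus>\<^bsub>E\<^esub> \<Psi> t"
  using add_homD(2)[OF \<Psi>_hom] by simp

lemma \<Psi>_zero: "\<Psi> \<zero>\<^bsub>UHT\<^esub> = \<zero>\<^bsub>E\<^esub>"
  by (rule add_hom_zero[OF UH.TA_abelian_group E.is_abelian_group \<Psi>_hom])

lemma L_\<theta>_comm:
  assumes "u \<in> carrier U" "c \<in> carrier H" shows "L u \<otimes>\<^bsub>E\<^esub> \<theta> c = \<theta> c \<otimes>\<^bsub>E\<^esub> L u"
  using H_carrierE[OF assms(2)] by (metis L_\<Theta>_comm \<theta>_prj assms(1))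

text \<open>On pure tensors the inner factors \<open>\<theta> c\<close> and \<open>L v\<close> have
  to change places, which \<open>L_\<theta>_comm\<close> allows.\<close>

lemma \<Psi>_mult:
  assumes s: "s \<in> carrier UHT" and t: "t \<in> carrier UHT"
  shows "\<Psi> (s \<otimes>\<^bsub>UHT\<^esub> t) = \<Psi> s \<otimes>\<^bsub>E\<^esub> \<Psi> t"
  using s
proof (induction rule: UH.kpure_induct)
  case zero
  show ?case using t by (simp only: UH.TA_l_null \<Psi>_zero E.l_null \<Psi>_closed)
next
  case (add a b)
  then show ?case using t by (simp only: UH.TA_l_distr \<Psi>_add UH.TA_mult_closed E.l_distr \<Psi>_closed)
next
  case uc: (pure u c)
  note uc' = UH.kpure_closed[OF this]
  show ?case
    using t
  proof (induction rule: UH.kpure_induct)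
    case zero
    show ?case using uc' by (simp only: UH.TA_r_null \<Psi>_zero E.r_null \<Psi>_closed)
  next
    case (add a b)
    then show ?case using uc' by (simp only: UH.TA_r_distr \<Psi>_add UH.TA_mult_closed E.r_distr \<Psi>_closed)
  next
    case vd: (pure v d)
    have "L u \<otimes>\<^bsub>E\<^esub> (L v \<otimes>\<^bsub>E\<^esub> \<theta> c) \<otimes>\<^bsub>E\<^esub> \<theta> d = L u \<otimes>\<^bsub>E\<^esub> (\<theta> c \<otimes>\<^bsub>E\<^esub> L v) \<otimes>\<^bsub>E\<^esub> \<theta> d"
      using uc vd by (simp only: L_\<theta>_comm)
    then show ?case
      using uc vd by (simp add: UH.kpure_mult \<Psi>_pure LD \<theta>D L_closed E.m_assoc)
  qed
qed

lemma \<Psi>_left: "x \<in> carrier U \<Longrightarrow> \<Psi> (ku x \<one>\<^bsub>H\<^esub>) = L x"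
  by (simp add: \<Psi>_pure \<theta>D L_closed)

section \<open>The Galois map and its inverse\<close>

abbreviation gal where "gal \<equiv> galois_map k B"

text \<open>The coaction is multiplicative and \<lambda>(m_b) = m_b \<otimes> 1, so m_b may be
  attached to either side.\<close>

lemma gal_bal: "wbal (add_monoid UHT) (\<lambda>x y. ku x \<one>\<^bsub>H\<^esub> \<otimes>\<^bsub>UHT\<^esub> lam y)"
proof
  fix x b y assume x: "x \<in> carrier U" and b: "b \<in> carrier B" and y: "y \<in> carrier U"
  have "ku (x \<cdot> m b) \<one>\<^bsub>H\<^esub> = ku x \<one>\<^bsub>H\<^esub> \<otimes>\<^bsub>UHT\<^esub> ku (m b) \<one>\<^bsub>H\<^esub>"
    using x b by (simp add: UH.kpure_mult m_closed)
  then show "ku (x \<cdot> m b) \<one>\<^bsub>H\<^esub> \<otimes>\<^bsub>UHT\<^esub> lam y = ku x \<one>\<^bsub>H\<^esub> \<otimes>\<^bsub>UHT\<^esub> lam (m b \<cdot> y)"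
    using x b y by (simp add: lamD m_closed lam_m UH.TA_assoc UH.kpure_closed)
qed (simp_all add: UH.TA_mult_closed UH.kpure_closed lamD UH.kpure_add_left UH.TA_l_distr UH.TA_r_distr)

lemma gal_eq: "gal = wl (add_monoid UHT) (\<lambda>x y. ku x \<one>\<^bsub>H\<^esub> \<otimes>\<^bsub>UHT\<^esub> lam y)"
  by (simp add: galois_map_def Let_def)

lemma gal_hom: "gal \<in> hom W.T (add_monoid UHT)"
  unfolding gal_eq by (rule W.lift_hom[OF UHG gal_bal])

lemma gal_pure: "\<lbrakk>x \<in> carrier U; y \<in> carrier U\<rbrakk> \<Longrightarrow> gal (W.P x y) = ku x \<one>\<^bsub>H\<^esub> \<otimes>\<^bsub>UHT\<^esub> lam y"
  unfolding gal_eq by (rule W.lift_pure[OF UHG gal_bal])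

lemma gal_closed: "w \<in> carrier W.T \<Longrightarrow> gal w \<in> carrier UHT"
  using hom_in_carrier[OF gal_hom] by simp

lemma gal_mult: "\<lbrakk>v \<in> carrier W.T; w \<in> carrier W.T\<rbrakk> \<Longrightarrow> gal (v \<otimes>\<^bsub>W.T\<^esub> w) = gal v \<oplus>\<^bsub>UHT\<^esub> gal w"
  using hom_mult[OF gal_hom] by simp

lemma sw_der_p:
  assumes b: "b \<in> carrier B" and z: "z \<in> carrier U"
  shows "sw W.T (\<lambda>x y. der (m x \<cdot> p y) \<one>\<^bsub>U\<^esub> z) b = der (h b) \<one>\<^bsub>U\<^esub> z"
proof -
  have "(\<lambda>q. der q \<one>\<^bsub>U\<^esub> z) \<in> hom (add_monoid U) W.T"
    by (rule homI) (simp_all add: der_closed der_add z)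
  from hom_sw[OF UG WG.is_group this b, of "\<lambda>x y. m x \<cdot> p y"]
  show ?thesis by (simp add: sw_m_p b m_closed p_closed)
qed

text \<open>Formally y1 S(y2) \<otimes> y3 = 1 \<otimes> y. The statement is quantified over all z
  because, for a product uv, the identity for \<open>u\<close> is needed at vz. It yields
  injectivity of the Galois map.\<close>

lemma \<Psi>_lam:
  assumes "y \<in> carrier U"
  shows "\<forall>z\<in>carrier U. \<Psi> (lam y) (W.P \<one>\<^bsub>U\<^esub> z) = W.P \<one>\<^bsub>U\<^esub> (y \<cdot> z)"
  using assms
proof (induction rule: U_induct)
  case (m b)
  show ?case
  proof
    fix z assume z: "z \<in> carrier U"
    show "\<Psi> (lam (m b)) (W.P \<one>\<^bsub>U\<^esub> z) = W.P \<one>\<^bsub>U\<^esub> (m b \<cdot> z)"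
      using m z W.pure_middle[of "\<one>\<^bsub>U\<^esub>" b z] by (simp add: lam_m \<Psi>_left m_closed L_pure)
  qed
next
  case (h b)
  show ?case
  proof
    fix z assume z: "z \<in> carrier U"
    note c = m_closed h_closed prjD(1) UH.kpure_closed L_closed \<Theta>D(1)
    let ?w = "W.P \<one>\<^bsub>U\<^esub> z"
    have w: "?w \<in> carrier W.T" using z by (simp add: W.pure_closed)
    have ev: "(\<lambda>f. f ?w) \<in> hom (add_monoid E) W.T"
      by (rule homI) (simp_all add: WG.end_ring_closed w WG.end_ring_simps(3))
    have "\<Psi> (swH (\<lambda>x y. ku (m x) (prj (h y))) b) = sw (add_monoid E) (\<lambda>x y. \<Psi> (ku (m x) (prj (h y)))) b"
      by (rule hom_sw[OF UHG comm_group.axioms(2)[OF EG] \<Psi>_hom h]) (simp add: c)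
    also have "\<dots> = sw (add_monoid E) (\<lambda>x y. L (m x) \<otimes>\<^bsub>E\<^esub> T y) b"
      by (rule sw_cong[OF h]) (simp add: \<Psi>_pure c \<theta>_prj \<Theta>(3))
    finally have "\<Psi> (swH (\<lambda>x y. ku (m x) (prj (h y))) b) ?w = sw (add_monoid E) (\<lambda>x y. L (m x) \<otimes>\<^bsub>E\<^esub> T y) b ?w"
      by (rule arg_cong)
    also have "\<dots> = sw W.T (\<lambda>x y. (L (m x) \<otimes>\<^bsub>E\<^esub> T y) ?w) b"
      by (rule hom_sw[OF EG WG.is_group ev h]) (simp add: c T_closed)
    also have "\<dots> = sw W.T (\<lambda>x y. der (m x \<cdot> p y) \<one>\<^bsub>U\<^esub> z) b"
    proof (rule sw_cong[OF h])
      fix x y assume x: "x \<in> carrier B" and y: "y \<in> carrier B"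
      \<comment> \<open>With first factor 1, the term m_x \<otimes> p_y z equals 1 \<otimes> m_x p_y
        z, so m_x can be joined to p_y in both terms of \<open>der\<close>; afterwards the sum over
        m_x p_y is h_b.\<close>
      show "(L (m x) \<otimes>\<^bsub>E\<^esub> T y) ?w = der (m x \<cdot> p y) \<one>\<^bsub>U\<^esub> z"
        using x y z W.pure_middle[of "\<one>\<^bsub>U\<^esub>" x "p y \<cdot> z"]
        by (simp add: WG.end_ring_simps(2) w T_pure L_der c p_closed) (simp add: der_def c p_closed U.m_assoc)
    qed
    also have "\<dots> = der (h b) \<one>\<^bsub>U\<^esub> z"
      by (rule sw_der_p[OF h z])
    finally have 1: "\<Psi> (swH (\<lambda>x y. ku (m x) (prj (h y))) b) ?w = der (h b) \<one>\<^bsub>U\<^esub> z" .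
    \<comment> \<open>The remaining summand h_b \<otimes> 1 of the coaction restores exactly the
      term h_b \<otimes> z that \<open>der\<close> subtracts.\<close>
    have "\<Psi> (lam (h b)) ?w = der (h b) \<one>\<^bsub>U\<^esub> z \<otimes>\<^bsub>W.T\<^esub> W.P (h b) z"
      using h z w 1
      by (simp add: lam_h \<Psi>_add swH_closed c \<Psi>_left WG.end_ring_simps(3) L_pure)
    also have "\<dots> = W.P \<one>\<^bsub>U\<^esub> (h b \<cdot> z)"
      using h z by (simp add: der_def c W.pure_closed WG.m_assoc)
    finally show "\<Psi> (lam (h b)) ?w = W.P \<one>\<^bsub>U\<^esub> (h b \<cdot> z)" .
  qed
next
  case (add u v)
  then show ?case
    by (simp add: lamD \<Psi>_add WG.end_ring_simps(3) W.pure_closed U.l_distr W.pure_add_right)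
next
  case (mult u v)
  then show ?case
    by (simp add: lamD \<Psi>_mult WG.end_ring_simps(2) W.pure_closed U.m_assoc)
qed

definition \<kappa> where "\<kappa> t = \<Psi> t (W.P \<one>\<^bsub>U\<^esub> \<one>\<^bsub>U\<^esub>)"

lemma \<kappa>_hom: "\<kappa> \<in> hom (add_monoid UHT) W.T"
  unfolding \<kappa>_def
  by (rule homI) (simp_all add: WG.end_ring_closed \<Psi>_closed \<Psi>_add W.pure_closed WG.end_ring_simps(3))

lemma \<kappa>_closed: "t \<in> carrier UHT \<Longrightarrow> \<kappa> t \<in> carrier W.T"
  using add_homD(1)[OF \<kappa>_hom] .

text \<open>By multiplicativity of \<open>\<Psi>\<close>, the image of x \<otimes> y acts as
  \<open>L x\<close> after the operator of \<lambda>(y). On 1 \<otimes> 1 the latter gives 1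
  \<otimes> y and the former then x \<otimes> y.\<close>

lemma \<kappa>_gal:
  assumes w: "w \<in> carrier W.T"
  shows "\<kappa> (gal w) = w"
proof -
  have "(\<kappa> \<circ> gal) w = id w"
  proof (rule W.hom_eqI[OF WG.is_group hom_compose[OF gal_hom \<kappa>_hom] _ _ w])
    fix x y assume x: "x \<in> carrier U" and y: "y \<in> carrier U"
    show "(\<kappa> \<circ> gal) (W.P x y) = id (W.P x y)"
      using x y \<Psi>_lam[OF y]
      by (simp add: \<kappa>_def gal_pure \<Psi>_mult UH.kpure_closed lamD \<Psi>_left WG.end_ring_simps(2) W.pure_closed L_pure)
  qed (simp add: hom_def)
  then show ?thesis by simp
qed

lemma mult_left_hom: "s \<in> carrier UHT \<Longrightarrow> (\<lambda>t. s \<otimes>\<^bsub>UHT\<^esub> t) \<in> hom (add_monoid UHT) (add_monoid UHT)"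
  by (rule homI) (simp_all add: UH.TA_mult_closed UH.TA_r_distr)

lemma UHT_group: "group (add_monoid UHT)"
  by (rule comm_group.axioms(2)[OF UHG])

text \<open>Left linearity of the Galois map over \<open>U\<close>; with \<open>\<iota>\<close> in
  place of \<open>L\<close> it also handles the scalars in \<open>gal_\<Theta>\<close>.\<close>

lemma gal_L:
  assumes x: "x \<in> carrier U" and w: "w \<in> carrier W.T"
  shows "gal (L x w) = ku x \<one>\<^bsub>H\<^esub> \<otimes>\<^bsub>UHT\<^esub> gal w"
proof -
  have s: "ku x \<one>\<^bsub>H\<^esub> \<in> carrier UHT" using x by (simp add: UH.kpure_closed)
  have "(gal \<circ> L x) w = ((\<lambda>t. ku x \<one>\<^bsub>H\<^esub> \<otimes>\<^bsub>UHT\<^esub> t) \<circ> gal) w"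
  proof (rule W.hom_eqI[OF UHT_group hom_compose[OF WG.end_ring_hom[OF L_closed[OF x]] gal_hom]
        hom_compose[OF gal_hom mult_left_hom[OF s]] _ w])
    fix u v assume u: "u \<in> carrier U" and v: "v \<in> carrier U"
    have "ku (x \<cdot> u) \<one>\<^bsub>H\<^esub> = ku x \<one>\<^bsub>H\<^esub> \<otimes>\<^bsub>UHT\<^esub> ku u \<one>\<^bsub>H\<^esub>"
      using x u by (simp add: UH.kpure_mult)
    then show "(gal \<circ> L x) (W.P u v) = ((\<lambda>t. ku x \<one>\<^bsub>H\<^esub> \<otimes>\<^bsub>UHT\<^esub> t) \<circ> gal) (W.P u v)"
      using x u v by (simp add: L_pure gal_pure UH.TA_assoc UH.kpure_closed lamD)
  qed
  then show ?thesis by simp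
qed

text \<open>The coaction of p_b v is (1 \<otimes> \<pi>(h_b) + p_b \<otimes> 1) times \<lambda>(v).
  The subtracted term u p_b \<otimes> v of \<open>T b\<close> removes the second summand, so only
  multiplication by 1 \<otimes> \<pi>(h_b) is left.\<close>

lemma gal_T:
  assumes b: "b \<in> carrier B" and w: "w \<in> carrier W.T"
  shows "gal (T b w) = ku \<one>\<^bsub>U\<^esub> (prj (h b)) \<otimes>\<^bsub>UHT\<^esub> gal w"
proof -
  let ?s = "ku \<one>\<^bsub>U\<^esub> (prj (h b))"
  note c = b p_closed h_closed prjD(1) UH.kpure_closed UH.TA_mult_closed lamD(1)
  have s: "?s \<in> carrier UHT" by (simp add: c)
  interpret g: group_hom W.T "add_monoid UHT" gal
    by (intro group_hom.intro group_hom_axioms.intro WG.is_group UHT_group gal_hom)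
  have "(gal \<circ> T b) w = ((\<lambda>t. ?s \<otimes>\<^bsub>UHT\<^esub> t) \<circ> gal) w"
  proof (rule W.hom_eqI[OF UHT_group hom_compose[OF WG.end_ring_hom[OF T_closed[OF b]] gal_hom]
        hom_compose[OF gal_hom mult_left_hom[OF s]] _ w])
    fix u v assume u: "u \<in> carrier U" and v: "v \<in> carrier U"
    have cl: "ku u \<one>\<^bsub>H\<^esub> \<in> carrier UHT" "ku (p b) \<one>\<^bsub>H\<^esub> \<in> carrier UHT" "lam v \<in> carrier UHT"
      "ku (u \<cdot> p b) \<one>\<^bsub>H\<^esub> \<in> carrier UHT" "ku u (prj (h b)) \<in> carrier UHT"
      using u v by (simp_all add: c)
    have "gal (W.P u (p b \<cdot> v)) = ku u \<one>\<^bsub>H\<^esub> \<otimes>\<^bsub>UHT\<^esub> (?s \<oplus>\<^bsub>UHT\<^esub> ku (p b) \<one>\<^bsub>H\<^esub>) \<otimes>\<^bsub>UHT\<^esub> lam v"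
      using u v cl s by (simp add: gal_pure c lamD lam_p UH.TA_assoc)
    also have "\<dots> = ku u (prj (h b)) \<otimes>\<^bsub>UHT\<^esub> lam v \<oplus>\<^bsub>UHT\<^esub> ku (u \<cdot> p b) \<one>\<^bsub>H\<^esub> \<otimes>\<^bsub>UHT\<^esub> lam v"
      using u cl s by (simp add: UH.TA_r_distr UH.TA_l_distr UH.kpure_mult c)
    finally have 1: "gal (W.P u (p b \<cdot> v)) =
        ku u (prj (h b)) \<otimes>\<^bsub>UHT\<^esub> lam v \<oplus>\<^bsub>UHT\<^esub> ku (u \<cdot> p b) \<one>\<^bsub>H\<^esub> \<otimes>\<^bsub>UHT\<^esub> lam v" .
    have "gal (der (p b) u v) = gal (W.P u (p b \<cdot> v)) \<oplus>\<^bsub>UHT\<^esub> inv\<^bsub>add_monoid UHT\<^esub> gal (W.P (u \<cdot> p b) v)"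
      unfolding der_def using u v by (simp add: c gal_mult W.pure_closed)
    also have "\<dots> = ku u (prj (h b)) \<otimes>\<^bsub>UHT\<^esub> lam v"
      using u v cl UH.TA.r_neg[of "ku (u \<cdot> p b) \<one>\<^bsub>H\<^esub> \<otimes>\<^bsub>UHT\<^esub> lam v"]
      by (simp add: 1 gal_pure c UH.TA.a_assoc flip: a_inv_def)
    \<comment> \<open>Elements u \<otimes> 1 and 1 \<otimes> c commute, so the new factor can be
      pulled out to the far left.\<close>
    also have "ku u (prj (h b)) = ?s \<otimes>\<^bsub>UHT\<^esub> ku u \<one>\<^bsub>H\<^esub>"
      using u by (simp add: UH.kpure_mult c)
    finally show "(gal \<circ> T b) (W.P u v) = ((\<lambda>t. ?s \<otimes>\<^bsub>UHT\<^esub> t) \<circ> gal) (W.P u v)"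
      using u v cl s b by (simp add: T_pure gal_pure UH.TA_assoc)
  qed
  then show ?thesis by simp
qed

text \<open>The intertwining property passes from generators to sums and products. For m_b both
  sides are multiplication by the counit of b, by \<open>prj_m\<close>.\<close>

lemma gal_\<Theta>:
  assumes "u \<in> carrier U"
  shows "\<forall>w\<in>carrier W.T. gal (\<Theta> u w) = ku \<one>\<^bsub>U\<^esub> (prj u) \<otimes>\<^bsub>UHT\<^esub> gal w"
  using assms
proof (induction rule: U_induct)
  case (m b)
  then show ?case
    by (simp add: \<Theta>(2) \<iota>_def gal_L eps_closed prj_m UH.kpure_middle)
next
  case (h b)
  then show ?case by (simp add: \<Theta>(3) gal_T)
next
  case (add u v)
  then show ?case
    by (simp add: \<Theta>D WG.end_ring_simps(3) gal_mult WG.end_ring_closed prjD UH.kpure_add_right UH.TA_l_distr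
        UH.kpure_closed gal_closed)
next
  case (mult u v)
  have "ku \<one>\<^bsub>U\<^esub> (prj u \<otimes>\<^bsub>H\<^esub> prj v) = ku \<one>\<^bsub>U\<^esub> (prj u) \<otimes>\<^bsub>UHT\<^esub> ku \<one>\<^bsub>U\<^esub> (prj v)"
    using mult by (simp add: UH.kpure_mult prjD)
  then show ?case
    using mult by (simp add: \<Theta>D WG.end_ring_simps(2) WG.end_ring_closed prjD UH.TA_assoc UH.kpure_closed gal_closed)
qed

text \<open>The Galois map fixes the unit 1 \<otimes> 1 and carries \<open>L u\<close> and
  \<open>\<Theta> v\<close> to left multiplication by u \<otimes> 1 and 1 \<otimes> \<pi>(v), whose
  product is the given pure tensor.\<close>

lemma gal_\<kappa>:
  assumes t: "t \<in> carrier UHT"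
  shows "gal (\<kappa> t) = t"
proof -
  have "(gal \<circ> \<kappa>) t = id t"
  proof (rule UH.tensor_hom_eqI[OF UHT_group hom_compose[OF \<kappa>_hom gal_hom] _ _ t])
    fix u c assume u: "u \<in> carrier U" and c: "c \<in> carrier H"
    obtain v where v: "v \<in> carrier U" "c = prj v" using c by (rule H_carrierE)
    let ?w = "W.P \<one>\<^bsub>U\<^esub> \<one>\<^bsub>U\<^esub>"
    have w: "?w \<in> carrier W.T" by (simp add: W.pure_closed)
    have "gal ?w = ku \<one>\<^bsub>U\<^esub> \<one>\<^bsub>H\<^esub> \<otimes>\<^bsub>UHT\<^esub> ku \<one>\<^bsub>U\<^esub> \<one>\<^bsub>H\<^esub>"
      by (simp add: gal_pure lamD UH.TA_simps(4))
    then have "gal ?w = ku \<one>\<^bsub>U\<^esub> \<one>\<^bsub>H\<^esub>"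
      by (simp add: UH.kpure_mult)
    then have "gal (\<kappa> (ku u c)) = ku u \<one>\<^bsub>H\<^esub> \<otimes>\<^bsub>UHT\<^esub> (ku \<one>\<^bsub>U\<^esub> (prj v) \<otimes>\<^bsub>UHT\<^esub> ku \<one>\<^bsub>U\<^esub> \<one>\<^bsub>H\<^esub>)"
      using u v w
      by (simp add: \<kappa>_def \<Psi>_pure prjD \<theta>_prj WG.end_ring_simps(2) gal_L WG.end_ring_closed \<Theta>D gal_\<Theta>)
    then show "(gal \<circ> \<kappa>) (ku u c) = id (ku u c)"
      using u v by (simp add: UH.kpure_mult prjD)
  qed (simp add: hom_def)
  then show ?thesis by simp
qed

lemma gal_bij: "bij_betw gal (carrier W.T) (carrier UHT)"
  by (rule bij_betw_byWitness[where f' = \<kappa>]) (auto simp: \<kappa>_gal gal_\<kappa> gal_closed \<kappa>_closed)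

end

theorem proposition6p23:
  fixes k :: "('k, 'w) ring_scheme" and B :: "('k, 'b, 'x) poisson_hopf_scheme"
  assumes "poisson_hopf_algebra k B" and "pointed k B"
  shows "galois_map k B \<in>
           hom (env_tensor_B k B) (add_monoid (tensor_algebra k (env_algebra k B) (env_quot k B)))
       \<and> (\<forall>x\<in>carrier (env_algebra k B). \<forall>y\<in>carrier (env_algebra k B).
            galois_map k B (env_pure_B k B x y) =
              kpure k (env_algebra k B) (env_quot k B) x \<one>\<^bsub>env_quot k B\<^esub>
                \<otimes>\<^bsub>tensor_algebra k (env_algebra k B) (env_quot k B)\<^esub> env_coaction k B y)
       \<and> bij_betw (galois_map k B) (carrier (env_tensor_B k B))
           (carrier (tensor_algebra k (env_algebra k B) (env_quot k B)))"
proof -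
  interpret poisson_hopf_algebra k B by fact
  interpret hopf_env k B by unfold_locales
  show ?thesis
    unfolding env_tensor_B_def env_pure_B_def using gal_hom gal_pure gal_bij by blast
qed

end
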